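(* Let $T>0$, $I=[-T,T]$, $|I|=2T\ge 1$, $N\ge 1$, and let $G\colon\mathbb{R}^N\to[0,\infty)$ be a continuously differentiable G-function satisfying the $\Delta_2$ and $\nabla_2$ conditions at infinity. Let $F\colon I\times\mathbb{R}^N\times\mathbb{R}^N\to\mathbb{R}$ be of class $C^1$, $V\in C^1(I\times\mathbb{R}^N,\mathbb{R})$ and $f\in \mathbf{L}^{G^\ast}(I,\mathbb{R}^N)$. Assume the following. Assumptions on $F$: (F1) $F(t,x,\cdot)$ is convex for all $(t,x)\in I\times\mathbb{R}^N$. (F2) There exist $a\in C(\mathbb{R}_+,\mathbb{R}_+)$ and $\beta\in L^1(I,\mathbb{R}_+)$ such that for all $(t,x,v)\in I\times\mathbb{R}^N\times\mathbb{R}^N$: $|F(t,x,v)|\le a(|x|)(\beta(t)+G(v))$, $|F_x(t,x,v)|\le a(|x|)(\beta(t)+G(v))$, and $G^\ast(F_v(t,x,v))\le a(|x|)\big(\beta(t)+G^\ast(\nabla G(v))\big)$. (F3) There exists $\theta_F>0$ such that $\langle F_x(t,x,v),x\rangle+\langle F_v(t,x,v),v\rangle\le\theta_F F(t,x,v)$ for all $(t,x,v)\in I\times\mathbb{R}^N\times\mathbb{R}^N$. (F4) There exists $\Lambda>0$ such that $F(t,x,v)\ge\Lambda G(v)$ for all $(t,x,v)\in I\times\mathbb{R}^N\times\mathbb{R}^N$. (F5) $F(t,x,0)=0$ and $F_v(t,x,0)=0$ for all $(t,x)\in I\times\mathbb{R}^N$. Assumptions on $V$: (V1) $V(t,x)=K(t,x)-W(t,x)$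 for $x\in\mathbb{R}^N$, $t\in I$, where $K,W\colon I\times\mathbb{R}^N\to\mathbb{R}$. (V2) There exist $M>0$, $\varepsilon_V>0$, $\theta_V>\theta_F$ and $1<p_K\le\theta_V-\varepsilon_V$ such that for $|x|>M$, $t\in I$: $\langle V_x(t,x),x\rangle\le(\theta_V-\varepsilon_V)K(t,x)-\theta_V W(t,x)$ and $W(t,x)>K(t,x)>|x|^{p_K}$. (V3) There exist $\rho>0$, $b>1$ and $g\in L^1(I,\mathbb{R})$ such that $V(t,x)\ge b\,G(x)-g(t)$ for all $t\in I$ and all $x\in\mathbb{R}^N$ with $G\left(\frac{x}{2|I|}\right)\le\frac{\rho}{2}$. (V4) $\int_I V(t,0)\,dt=0$. Assumption on $f$ (with $\Lambda$ from (F4) and $\rho,b,g$ from (V3)): (f) $\int_I \big(G^\ast(f(t))+g(t)\big)\,dt<\min\{\Lambda,b-1\}\,\rho$. Let $\mathcal{L}(t,x,v)=F(t,x,v)+V(t,x)+\langle f(t),x\rangle$. Then the problem $$\frac{d}{dt}\mathcal{L}_v(t,u(t),\dot u(t))=\mathcal{L}_x(t,u(t),\dot u(t))\ \text{ for a.e. } t\in I,\qquad u(-T)=u(T),$$ has at least one nontrivial periodic solution.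
   Context: $\langle\cdot,\cdot\rangle$ and $|\cdot|$ are the Euclidean inner product and norm on $\mathbb{R}^N$; $\mathbb{R}_+=[0,\infty)$; subscripts $x,v$ denote gradients in these variables. A G-function is a function $G\colon\mathbb{R}^N\to[0,\infty)$ that is convex, even, with $G(0)=0$ and $G(x)/|x|\to\infty$ as $|x|\to\infty$. $\Delta_2$ at infinity: there are $C>0$, $R>0$ with $G(2x)\le C\,G(x)$ for $|x|\ge R$. $\nabla_2$ at infinity: there are $C>1$, $R>0$ with $G(x)\le\frac{1}{2C}G(Cx)$ for $|x|\ge R$. The Fenchel conjugate is $G^\ast(y)=\sup_{x\in\mathbb{R}^N}\{\langle x,y\rangle-G(x)\}$. The Orlicz space is $\mathbf{L}^G=\mathbf{L}^G(I,\mathbb{R}^N)=\{u\colon I\to\mathbb{R}^N \text{ measurable}:\int_I G(u)\,dt<\infty\}$ with the Luxemburg norm $\|u\|_{\mathbf{L}^G}=\inf\{\lambda>0:\int_I G(u/\lambda)\,dt\le1\}$; $\mathbf{L}^{G^\ast}$ is defined in the same way with $G^\ast$. The anisotropic Orlicz-Sobolev space is $\mathbf{W}^1\mathbf{L}^G=\{u\in\mathbf{L}^G:\dot u\in\mathbf{L}^G\}$ with norm $\|u\|_{\mathbf{L}^G}+\|\dot u\|_{\mathbf{L}^G}$ (its elements are absolutely continuous), and $\mathbf{W}^1_T\mathbf{L}^G=\{u\in\mathbf{W}^1\mathbf{L}^G:u(-T)=u(T)\}$. A periodic solution of the problem is a function $u\in\mathbf{W}^1_T\mathbf{L}^G$ satisfying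 the equation for a.e. $t\in I$ (where $t\mapsto\mathcal{L}_v(t,u(t),\dot u(t))$, defined a.e., is understood to have an absolutely continuous representative). Nontrivial means $u\not\equiv0$. *)

theory Defs
  imports "HOL-Analysis.Analysis"
begin

text \<open>On a set that is not open (such as \<open>{-T..T} \<times> UNIV\<close>), derivatives are taken within the set,
  i.e. they are one-sided at the end points of the time interval.\<close>

definition C1_on :: "('a::real_normed_vector \<Rightarrow> real) \<Rightarrow> 'a set \<Rightarrow> bool" where
  "C1_on h S \<longleftrightarrow>
     (\<exists>h'. continuous_on S h' \<and>
       (\<forall>z\<in>S. (h has_derivative blinfun_apply (h' z)) (at z within S)))"

text \<open>Meaningful only at points of differentiability.\<close>

definition grad :: "('a::real_inner \<Rightarrow> real) \<Rightarrow> 'a \<Rightarrow> 'a" where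
  "grad h x = (THE D. GDERIV h x :> D)"

definition G_function :: "('a::euclidean_space \<Rightarrow> real) \<Rightarrow> bool" where
  "G_function G \<longleftrightarrow>
     (\<forall>x. 0 \<le> G x) \<and> convex_on UNIV G \<and> (\<forall>x. G (- x) = G x) \<and> G 0 = 0 \<and>
     filterlim (\<lambda>x. G x / norm x) at_top at_infinity"

definition Delta2_at_infinity :: "('a::euclidean_space \<Rightarrow> real) \<Rightarrow> bool" where
  "Delta2_at_infinity G \<longleftrightarrow>
     (\<exists>C>0. \<exists>R>0. \<forall>x. norm x \<ge> R \<longrightarrow> G (2 *\<^sub>R x) \<le> C * G x)"

definition Nabla2_at_infinity :: "('a::euclidean_space \<Rightarrow> real) \<Rightarrow> bool" where
  "Nabla2_at_infinity G \<longleftrightarrow>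
     (\<exists>C>1. \<exists>R>0. \<forall>x. norm x \<ge> R \<longrightarrow> G x \<le> 1 / (2 * C) * G (C *\<^sub>R x))"

text \<open>For a G-function the superlinear growth makes the supremum finite, so it may be taken in
  the reals.\<close>

definition fenchel_conjugate :: "('a::euclidean_space \<Rightarrow> real) \<Rightarrow> 'a \<Rightarrow> real" where
  "fenchel_conjugate G y = (SUP x. x \<bullet> y - G x)"

text \<open>Functions are defined on all of \<open>real\<close>, but only their values on \<open>S\<close> matter. As \<open>G \<ge> 0\<close>,
  integrability of \<open>G \<circ> u\<close> says that its integral is finite.\<close>

definition orlicz :: "('a::euclidean_space \<Rightarrow> real) \<Rightarrow> real set \<Rightarrow> (real \<Rightarrow> 'a) set" where
  "orlicz G S = {u. u \<in> borel_measurable (lebesgue_on S) \<and>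
                    integrable (lebesgue_on S) (\<lambda>t. G (u t))}"

definition abs_continuous_on :: "real set \<Rightarrow> (real \<Rightarrow> 'a::real_normed_vector) \<Rightarrow> bool" where
  "abs_continuous_on S u \<longleftrightarrow>
     (\<forall>\<epsilon>>0. \<exists>\<delta>>0. \<forall>(n::nat) l r.
        (\<forall>i<n. l i \<le> r i \<and> {l i..r i} \<subseteq> S) \<and>
        (\<forall>i<n. \<forall>j<n. i \<noteq> j \<longrightarrow> {l i<..<r i} \<inter> {l j<..<r j} = {}) \<and>
        (\<Sum>i<n. r i - l i) < \<delta>
        \<longrightarrow> (\<Sum>i<n. norm (u (r i) - u (l i))) < \<epsilon>)"

text \<open>Elements are given by their absolutely continuous representative, whose weak derivative is
  its classical derivative; the latter exists almost everywhere, and \<open>vector_derivative\<close> is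
  unspecified on the remaining null set.\<close>

definition orlicz_sobolev :: "('a::euclidean_space \<Rightarrow> real) \<Rightarrow> real set \<Rightarrow> (real \<Rightarrow> 'a) set" where
  "orlicz_sobolev G S =
     {u. abs_continuous_on S u \<and> u \<in> orlicz G S \<and>
         (\<lambda>t. vector_derivative u (at t)) \<in> orlicz G S}"

definition orlicz_sobolev_periodic ::
  "('a::euclidean_space \<Rightarrow> real) \<Rightarrow> real \<Rightarrow> (real \<Rightarrow> 'a) set" where
  "orlicz_sobolev_periodic G T = {u \<in> orlicz_sobolev G {-T..T}. u (- T) = u T}"

text \<open>\<open>p\<close> is the absolutely continuous representative of the momentum \<open>L\<^sub>v(t, u, u')\<close>.\<close>

definition periodic_solution ::
  "('a::euclidean_space \<Rightarrow> real) \<Rightarrow> real \<Rightarrow> (real \<Rightarrow> 'a \<Rightarrow> 'a \<Rightarrow> real) \<Rightarrow> (real \<Rightarrow> 'a) \<Rightarrow> bool" where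
  "periodic_solution G T L u \<longleftrightarrow>
     u \<in> orlicz_sobolev_periodic G T \<and>
     (\<exists>p. abs_continuous_on {-T..T} p \<and>
        (AE t in lebesgue_on {-T..T}.
           p t = grad (\<lambda>v. L t (u t) v) (vector_derivative u (at t))) \<and>
        (AE t in lebesgue_on {-T..T}.
           (p has_vector_derivative
              grad (\<lambda>x. L t x (vector_derivative u (at t))) (u t)) (at t)))"

end

theory Submission
  imports Defs "HOL-Complex_Analysis.Great_Picard"
begin

text \<open>
  The solution is a critical point of mountain pass type of the action
  \<open>J u = (LINT t|M. F t (u t) (u' t) + V t (u t) + f t \<bullet> u t)\<close> on periodic curves \<open>u\<close>.

  The geometry is that of a mountain pass. On the set of curves for which the integrals of \<open>G (u t)\<close> and
  \<open>G (u' t)\<close> add up to \<open>\<rho>\<close>, Jensen's inequality keeps \<open>u t\<close> in the region where the lower bound of the potential holds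
  (\<open>pointwise_G_bound\<close>), and with the Fenchel-Young inequality \<open>J\<close> is at least a constant \<open>\<alpha> > 0\<close> there
  (\<open>J_on_sphere\<close>). The zero curve and a large constant curve lie on either side of this set, with
  \<open>J \<le> 0\<close> at both (\<open>far_point\<close>).

  The variational principle is carried out on the Banach space of pairs of a starting value and a bounded continuous
  slope, on which \<open>J\<close> is continuously differentiable for elementary reasons (\<open>J_C1\<close>). This norm is too
  strong for any compactness of almost critical sequences, but compactness is not asked for in it: being almost critical
  for smooth variations is a weak condition, which passes to limits of low regularity. Two
  further facts are required of the sequence. Its derivative in its own direction has to tend to zero although no bound
  in the strong norm is available; this is achieved by applying the minimax argument to
  \<open>J (exp r *\<^sub>R z)\<close> in the variables \<open>(r, z)\<close> (\<open>mountain_pass_cerami\<close>). And the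
  integrals of \<open>G (u' t)\<close> have to be bounded, which follows from the inequalities of Ambrosetti-Rabinowitz type for \<open>F\<close>
  and \<open>V\<close> (\<open>ambrosetti_rabinowitz_bound\<close>). A subsequence then converges uniformly to a curve whose derivative
  has finite modular (\<open>weak_compactness\<close>).

  The main difficulty is that \<open>F\<close> is only convex in the velocity, so the velocities need not converge strongly. Testing
  with the difference of the sequence and its limit shows that the energies do not exceed the energy of the
  limit asymptotically (\<open>energy_limsup\<close>); convexity gives lower semicontinuity, also of energies shifted in a fixed
  direction (\<open>shifted_energy_liminf\<close>), and equi-integrability of the integrands (\<open>equi_integrable\<close>). Comparing
  difference quotients of the energies, uniformly along the sequence, identifies the limit of the derivatives with the
  derivative at the limit (\<open>euler_equation\<close>).

  The limit is nontrivial since otherwise \<open>J\<close> would fall below \<open>\<alpha>\<close> along the sequence (\<open>weak_solution\<close>), and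
  du Bois-Reymond's lemma turns the weak equation into the differential equation
  (\<open>weak_solution_is_periodic_solution\<close>).
\<close>

section \<open>Ekeland's variational principle\<close>

text \<open>Repeatedly pass to an almost minimal point of the set \<open>A x\<close> of points \<open>y\<close> with \<open>\<Phi> y + \<delta> *
  dist y x \<le> \<Phi> x\<close>. These sets shrink along the way and the drop of \<open>\<Phi>\<close> controls the distance
  travelled, so the points converge; a point that violated the last inequality at the limit would
  lie in every one of the sets, with a value strictly below the limit of the almost minimal
  values.\<close>

theorem ekeland_variational_principle:
  fixes \<Phi> :: "'a::complete_space \<Rightarrow> real"
  assumes S: "x0 \<in> S" and lsc: "\<And>r. closed {x \<in> S. \<Phi> x \<le> r}"
    and almost_min: "\<And>x. x \<in> S \<Longrightarrow> \<Phi> x0 \<le> \<Phi> x + \<epsilon>" and del: "\<delta> > 0"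
  obtains x where "x \<in> S" "\<Phi> x \<le> \<Phi> x0" "\<delta> * dist x x0 \<le> \<epsilon>"
    "\<And>y. y \<in> S \<Longrightarrow> \<Phi> x \<le> \<Phi> y + \<delta> * dist x y"
proof -
  define A where "A x = {y \<in> S. \<Phi> y + \<delta> * dist y x \<le> \<Phi> x}" for x
  have A_refl: "x \<in> A x" if "x \<in> S" for x using that by (simp add: A_def)
  have A_trans: "z \<in> A x" if "y \<in> A x" "z \<in> A y" for x y z
  proof -
    have "\<delta> * dist z x \<le> \<delta> * (dist z y + dist y x)"
      using del dist_triangle[of z x y] by (intro mult_left_mono) auto
    then show ?thesis using that by (auto simp: A_def algebra_simps)
  qed
  have low: "\<Phi> x0 - \<epsilon> \<le> \<Phi> x" if "x \<in> S" for x using almost_min[OF that] by simp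
  have step: "\<exists>y. y \<in> A x \<and> (\<forall>z\<in>A x. \<Phi> y \<le> \<Phi> z + (1/2)^n)" if "x \<in> S" for x and n::nat
  proof -
    have bdd: "bdd_below (\<Phi> ` A x)" using low by (auto simp: A_def intro!: bdd_belowI)
    have ne: "\<Phi> ` A x \<noteq> {}" using A_refl[OF that] by auto
    have "Inf (\<Phi> ` A x) < Inf (\<Phi> ` A x) + (1/2)^n" by simp
    then obtain y where y: "y \<in> A x" "\<Phi> y < Inf (\<Phi> ` A x) + (1/2)^n"
      using cInf_lessD[OF ne] by fastforce
    have "\<Phi> y \<le> \<Phi> z + (1/2)^n" if "z \<in> A x" for z
    proof -
      have "Inf (\<Phi> ` A x) \<le> \<Phi> z" using bdd that by (intro cInf_lower) auto
      then show ?thesis using y(2) by linarith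
    qed
    then show ?thesis using y(1) by blast
  qed
  obtain X where X0: "X 0 = x0" and XS: "\<And>n. X n \<in> S"
    and XA: "\<And>n. X (Suc n) \<in> A (X n)" and Xmin: "\<And>n z. z \<in> A (X n) \<Longrightarrow> \<Phi> (X (Suc n)) \<le> \<Phi> z + (1/2)^n"
  proof -
    have "\<exists>X. X 0 = x0 \<and> (\<forall>n. X n \<in> S \<and> (X (Suc n) \<in> A (X n) \<and> (\<forall>z\<in>A (X n). \<Phi> (X (Suc n)) \<le> \<Phi> z + (1/2)^n)))"
    proof -
      have "\<exists>X. \<forall>n. (X n \<in> S \<and> (n = 0 \<longrightarrow> X n = x0)) \<and>
          (X (Suc n) \<in> A (X n) \<and> (\<forall>z\<in>A (X n). \<Phi> (X (Suc n)) \<le> \<Phi> z + (1/2)^n))"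
      proof (rule dependent_nat_choice)
        show "\<exists>x. x \<in> S \<and> ((0::nat) = 0 \<longrightarrow> x = x0)" using S by auto
      next
        fix x and n :: nat assume "x \<in> S \<and> (n = 0 \<longrightarrow> x = x0)"
        then show "\<exists>y. (y \<in> S \<and> (Suc n = 0 \<longrightarrow> y = x0)) \<and> y \<in> A x \<and> (\<forall>z\<in>A x. \<Phi> y \<le> \<Phi> z + (1 / 2) ^ n)"
          using step[of x n] by (auto simp: A_def)
      qed
      then show ?thesis by blast
    qed
    then show ?thesis using that by blast
  qed
  have XA': "X m \<in> A (X n)" if "n \<le> m" for n m
    using that
  proof (induction m rule: dec_induct)
    case base then show ?case using A_refl XS by blast
  next
    case (step m) then show ?case using A_trans XA by blast
  qed
  have dec: "\<Phi> (X m) + \<delta> * dist (X m) (X n) \<le> \<Phi> (X n)" if "n \<le> m" for n m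
    using XA'[OF that] by (simp add: A_def)
  have "decseq (\<lambda>n. \<Phi> (X n))"
    unfolding decseq_def using dec del by (smt (verit) mult_nonneg_nonneg zero_le_dist)
  then obtain L where L: "(\<lambda>n. \<Phi> (X n)) \<longlonglongrightarrow> L" and Lle: "\<And>n. L \<le> \<Phi> (X n)"
    using decseq_convergent[of "\<lambda>n. \<Phi> (X n)" "\<Phi> x0 - \<epsilon>"] low XS by metis
  have "Cauchy X"
    unfolding Cauchy_altdef
  proof (intro allI impI)
    fix e :: real assume e: "e > 0"
    then have "\<delta> * e > 0" using del by simp
    then obtain N where N: "\<And>n. n \<ge> N \<Longrightarrow> \<bar>\<Phi> (X n) - L\<bar> < \<delta> * e"
      using L unfolding LIMSEQ_iff by (metis real_norm_def)
    have "dist (X m) (X n) < e" if "m \<ge> N" "n > m" for m n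
    proof -
      have "\<delta> * dist (X n) (X m) < \<delta> * e" using dec[of m n] that N[of m] Lle[of n] by (smt (verit) less_imp_le)
      then show ?thesis using del by (simp add: dist_commute)
    qed
    then show "\<exists>M. \<forall>m\<ge>M. \<forall>n>m. dist (X m) (X n) < e" by blast
  qed
  then obtain x where x: "X \<longlonglongrightarrow> x" using Cauchy_convergent_iff convergent_def by blast
  have xle: "x \<in> S \<and> \<Phi> x \<le> \<Phi> (X n)" for n
  proof -
    have "\<forall>\<^sub>F m in sequentially. X m \<in> {x \<in> S. \<Phi> x \<le> \<Phi> (X n)}"
      using eventually_ge_at_top[of n]
    proof eventually_elim
      case (elim m) then show ?case using dec[OF elim] XS del by (smt (verit) mem_Collect_eq mult_nonneg_nonneg zero_le_dist)
    qed
    then have "x \<in> {x \<in> S. \<Phi> x \<le> \<Phi> (X n)}" by (rule Lim_in_closed_set[OF lsc _ _ x]) simp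
    then show ?thesis by simp
  qed
  have "\<Phi> x \<le> L" using xle by (intro LIMSEQ_le_const[OF L]) auto
  have xA: "x \<in> A (X n)" for n
  proof -
    have lim: "(\<lambda>m. \<Phi> (X m) + \<delta> * dist (X m) (X n)) \<longlonglongrightarrow> L + \<delta> * dist x (X n)"
      by (intro tendsto_intros L x)
    have "L + \<delta> * dist x (X n) \<le> \<Phi> (X n)"
      by (rule LIMSEQ_le_const2[OF lim]) (use dec in auto)
    then show ?thesis using \<open>\<Phi> x \<le> L\<close> xle by (auto simp: A_def)
  qed
  show thesis
  proof
    show "x \<in> S" "\<Phi> x \<le> \<Phi> x0" using xle[of 0] X0 by auto
    show "\<delta> * dist x x0 \<le> \<epsilon>" using xA[of 0] X0 almost_min[of x] by (auto simp: A_def)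
    fix y assume y: "y \<in> S"
    show "\<Phi> x \<le> \<Phi> y + \<delta> * dist x y"
    proof (rule ccontr)
      assume "\<not> ?thesis"
      then have yA: "y \<in> A x" and less: "\<Phi> y + \<delta> * dist x y < \<Phi> x" using y by (auto simp: A_def dist_commute)
      have "\<Phi> x \<le> \<Phi> y + (1/2)^n" for n
        using Xmin[OF A_trans[OF xA yA], of n] xle[of "Suc n"] by linarith
      moreover have "(\<lambda>n. \<Phi> y + (1/2)^n) \<longlonglongrightarrow> \<Phi> y + 0" by (intro tendsto_intros) auto
      ultimately have "\<Phi> x \<le> \<Phi> y + 0" by (intro LIMSEQ_le_const) auto
      then show False using less del by (smt (verit) mult_nonneg_nonneg zero_le_dist)
    qed
  qed
qed

section \<open>Mountain passes of continuously differentiable functionals\<close>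

text \<open>The derivative is encoded as a function of the point and the direction, continuous in both
  together; the dual space of \<open>'x\<close> then never has to be formed.\<close>

locale C1_functional =
  fixes J :: "'x::real_normed_vector \<Rightarrow> real" and DJ :: "'x \<Rightarrow> 'x \<Rightarrow> real"
  assumes DJ_linear: "\<And>x. linear (DJ x)"
    and DJ_line: "\<And>x b. ((\<lambda>s. J (x + s *\<^sub>R b)) has_real_derivative DJ x b) (at 0)"
    and DJ_cont: "continuous_on UNIV (\<lambda>p. DJ (fst p) (snd p))"
begin

lemma DJ_tendsto: "((\<lambda>s. DJ (f s) (g s)) \<longlongrightarrow> DJ x b) Z" if "(f \<longlongrightarrow> x) Z" "(g \<longlongrightarrow> b) Z"
  using continuous_on_tendsto_compose[OF DJ_cont tendsto_Pair[OF that]] by simp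

lemma DJ_line_at: "((\<lambda>s. J (x + s *\<^sub>R b)) has_real_derivative DJ (x + r *\<^sub>R b) b) (at r)"
proof -
  have "((\<lambda>s. J ((x + r *\<^sub>R b) + s *\<^sub>R b)) has_real_derivative DJ (x + r *\<^sub>R b) b) (at (r - r))"
    using DJ_line[of "x + r *\<^sub>R b" b] by simp
  then have "((\<lambda>s. J ((x + r *\<^sub>R b) + (s - r) *\<^sub>R b)) has_real_derivative DJ (x + r *\<^sub>R b) b) (at r)"
    using DERIV_shift[of "\<lambda>s. J ((x + r *\<^sub>R b) + s *\<^sub>R b)" "DJ (x + r *\<^sub>R b) b" r "- r"] by simp
  then show ?thesis by (simp add: algebra_simps)
qed

lemma mean_value: "\<exists>\<theta>. 0 < \<theta> \<and> \<theta> < 1 \<and> J (x + b) - J x = DJ (x + \<theta> *\<^sub>R b) b"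
proof -
  have "\<exists>\<theta>::real. \<theta> > 0 \<and> \<theta> < 1 \<and> J (x + 1 *\<^sub>R b) - J (x + 0 *\<^sub>R b) = (1 - 0) * DJ (x + \<theta> *\<^sub>R b) b"
    by (rule MVT2) (use DJ_line_at in auto)
  then show ?thesis by simp
qed

text \<open>By the mean value theorem an increment of \<open>J\<close> equals \<open>DJ\<close> at a nearby point in a short
  direction, and joint continuity sends this to \<open>DJ x 0 = 0\<close>.\<close>

lemma cont: "continuous_on UNIV J"
proof -
  have "J \<midarrow>x\<rightarrow> J x" for x
  proof -
    have "\<forall>y. \<exists>\<theta>. 0 < \<theta> \<and> \<theta> < 1 \<and> J y - J x = DJ (x + \<theta> *\<^sub>R (y - x)) (y - x)"
      using mean_value[of x "y - x" for y] by simp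
    then obtain \<theta> where \<theta>: "\<And>y. 0 < \<theta> y \<and> \<theta> y < 1 \<and> J y - J x = DJ (x + \<theta> y *\<^sub>R (y - x)) (y - x)" by metis
    have lim: "((\<lambda>y. y - x) \<longlongrightarrow> 0) (at x)" by (rule LIM_zero) (rule tendsto_ident_at)
    have z0: "((\<lambda>y. \<theta> y *\<^sub>R (y - x)) \<longlongrightarrow> 0) (at x)"
    proof (rule Lim_null_comparison[OF _ tendsto_norm_zero[OF lim]])
      show "\<forall>\<^sub>F y in at x. norm (\<theta> y *\<^sub>R (y - x)) \<le> norm (y - x)"
        by (rule always_eventually) (use \<theta> in \<open>auto intro!: mult_left_le_one_le simp: less_imp_le\<close>)
    qed
    have l0: "((\<lambda>y. x + \<theta> y *\<^sub>R (y - x)) \<longlongrightarrow> x) (at x)" using tendsto_add[OF tendsto_const z0, of x] by simp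
    have "((\<lambda>y. DJ (x + \<theta> y *\<^sub>R (y - x)) (y - x)) \<longlongrightarrow> DJ x 0) (at x)"
      by (rule DJ_tendsto[OF l0 lim])
    then have "((\<lambda>y. J y - J x) \<longlongrightarrow> 0) (at x)"
      using \<theta> linear_0[OF DJ_linear, of x] by simp
    then show ?thesis by (rule LIM_zero_cancel)
  qed
  then show ?thesis by (simp add: continuous_at_imp_continuous_on isCont_def)
qed

text \<open>The mean value theorem on the chord from \<open>c s\<close> to \<open>c (s + h)\<close> turns the difference quotient
  of \<open>J \<circ> c\<close> into \<open>DJ\<close> at a nearby point in the direction of the difference quotient of \<open>c\<close>.\<close>

lemma chain:
  assumes c: "(c has_vector_derivative c') (at s)"
  shows "((\<lambda>s. J (c s)) has_real_derivative DJ (c s) c') (at s)"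
proof -
  have "\<forall>h. \<exists>\<theta>. 0 < \<theta> \<and> \<theta> < 1 \<and> J (c (s + h)) - J (c s) = DJ (c s + \<theta> *\<^sub>R (c (s + h) - c s)) (c (s + h) - c s)"
    using mean_value[of "c s" "c (s + h) - c s" for h] by simp
  then obtain \<theta> where \<theta>: "\<And>h. 0 < \<theta> h \<and> \<theta> h < 1 \<and> J (c (s + h)) - J (c s) = DJ (c s + \<theta> h *\<^sub>R (c (s + h) - c s)) (c (s + h) - c s)"
    by metis
  have "isCont c s" using c has_vector_derivative_continuous by blast
  then have "(\<lambda>h. c (s + h)) \<midarrow>0\<rightarrow> c s" by (simp add: LIM_offset_zero_iff isCont_def)
  then have lim: "(\<lambda>h. c (s + h) - c s) \<midarrow>0\<rightarrow> 0" by (rule LIM_zero)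
  have z0: "((\<lambda>h. \<theta> h *\<^sub>R (c (s + h) - c s)) \<longlongrightarrow> 0) (at 0)"
  proof (rule Lim_null_comparison[OF _ tendsto_norm_zero[OF lim]])
    show "\<forall>\<^sub>F h in at 0. norm (\<theta> h *\<^sub>R (c (s + h) - c s)) \<le> norm (c (s + h) - c s)"
      by (rule always_eventually) (use \<theta> in \<open>auto intro!: mult_left_le_one_le simp: less_imp_le\<close>)
  qed
  have l0: "((\<lambda>h. c s + \<theta> h *\<^sub>R (c (s + h) - c s)) \<longlongrightarrow> c s) (at 0)" using tendsto_add[OF tendsto_const z0, of "c s"] by simp
  have q: "((\<lambda>h. (c (s + h) - c s) /\<^sub>R h) \<longlongrightarrow> c') (at 0)"
  proof (rule LIM_zero_cancel, rule tendsto_norm_zero_cancel)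
    have "((\<lambda>h. norm (c (s + h) - c s - h *\<^sub>R c') / norm h) \<longlongrightarrow> 0) (at 0)"
      using c unfolding has_vector_derivative_def has_derivative_at by blast
    moreover have "norm ((c (s + h) - c s) /\<^sub>R h - c') = norm (c (s + h) - c s - h *\<^sub>R c') / norm h" if "h \<noteq> 0" for h
    proof -
      have "(c (s + h) - c s) /\<^sub>R h - c' = (c (s + h) - c s - h *\<^sub>R c') /\<^sub>R h"
        using that by (simp add: scaleR_diff_right)
      then show ?thesis by (simp add: divide_inverse)
    qed
    ultimately show "((\<lambda>h. norm ((c (s + h) - c s) /\<^sub>R h - c')) \<longlongrightarrow> 0) (at 0)"
      by (auto elim!: Lim_transform_eventually simp: eventually_at_filter)
  qed
  have "((\<lambda>h. DJ (c s + \<theta> h *\<^sub>R (c (s + h) - c s)) ((c (s + h) - c s) /\<^sub>R h)) \<longlongrightarrow> DJ (c s) c') (at 0)"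
    by (rule DJ_tendsto[OF l0 q])
  then have "((\<lambda>h. (J (c (s + h)) - J (c s)) / h) \<longlongrightarrow> DJ (c s) c') (at 0)"
    using \<theta> linear_scale[OF DJ_linear] by (simp add: divide_inverse mult.commute)
  then show ?thesis by (simp add: DERIV_def)
qed

end

text \<open>Bounded continuous functions on the whole line form a complete metric space; of a path only
  the values on \<open>{0..1}\<close> enter the \<open>peak\<close> below.\<close>

definition paths :: "'z \<Rightarrow> 'z \<Rightarrow> (real \<Rightarrow>\<^sub>C 'z::metric_space) set" where
  "paths a b = {\<gamma>. apply_bcontfun \<gamma> 0 = a \<and> apply_bcontfun \<gamma> 1 = b}"

lemma isCont_eval_bcontfun: "continuous_on UNIV (\<lambda>\<gamma>::'a::topological_space \<Rightarrow>\<^sub>C 'b::metric_space. \<gamma> t)"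
  unfolding continuous_on_iff using dist_fun_lt_imp_dist_val_lt by blast

lemma closed_paths: "closed (paths a b)"
  unfolding paths_def
  by (intro closed_Collect_conj closed_Collect_eq isCont_eval_bcontfun continuous_on_const)

context C1_functional
begin

lemma cont_path: "continuous_on S (\<lambda>t. J (apply_bcontfun \<gamma> t))"
  by (rule continuous_on_compose2[OF cont]) (auto intro: continuous_intros)

definition peak :: "(real \<Rightarrow>\<^sub>C 'x) \<Rightarrow> real" where
  "peak \<gamma> = (SUP t\<in>{0..1}. J (\<gamma> t))"

lemma
  fixes \<gamma> :: "real \<Rightarrow>\<^sub>C 'x"
  shows peak_attained: "\<exists>t\<in>{0..1}. J (\<gamma> t) = peak \<gamma>"
  and le_peak: "t \<in> {0..1} \<Longrightarrow> J (\<gamma> t) \<le> peak \<gamma>"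
proof -
  obtain t where t: "t \<in> {0..1}" "\<And>s. s \<in> {0..1} \<Longrightarrow> J (\<gamma> s) \<le> J (\<gamma> t)"
    using continuous_attains_sup[of "{0..1::real}", OF _ _ cont_path[of _ \<gamma>]] by auto
  have "peak \<gamma> = J (\<gamma> t)"
    unfolding peak_def using t by (intro cSup_eq_maximum) auto
  then show "\<exists>t\<in>{0..1}. J (\<gamma> t) = peak \<gamma>" "t \<in> {0..1} \<Longrightarrow> J (\<gamma> t) \<le> peak \<gamma>" for t
    using t by auto
qed

text \<open>Lower semicontinuity of the peak, a supremum of continuous functions, in the form in which
  the variational principle asks for it.\<close>

lemma closed_peak_sublevel: "closed {\<gamma> \<in> paths a b. peak \<gamma> \<le> r}"
proof -
  have "{\<gamma> \<in> paths a b. peak \<gamma> \<le> r} = paths a b \<inter> (\<Inter>t\<in>{0..1}. {\<gamma>. J (apply_bcontfun \<gamma> t) \<le> r})"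
  proof (intro equalityI subsetI)
    fix \<gamma> assume "\<gamma> \<in> {\<gamma> \<in> paths a b. peak \<gamma> \<le> r}"
    then show "\<gamma> \<in> paths a b \<inter> (\<Inter>t\<in>{0..1}. {\<gamma>. J (apply_bcontfun \<gamma> t) \<le> r})"
      using order_trans[OF le_peak] by blast
  next
    fix \<gamma> assume *: "\<gamma> \<in> paths a b \<inter> (\<Inter>t\<in>{0..1}. {\<gamma>. J (apply_bcontfun \<gamma> t) \<le> r})"
    obtain t where "t \<in> {0..1}" "J (\<gamma> t) = peak \<gamma>" using peak_attained by blast
    then show "\<gamma> \<in> {\<gamma> \<in> paths a b. peak \<gamma> \<le> r}" using * by force
  qed
  moreover have "closed {\<gamma>. J (apply_bcontfun \<gamma> t) \<le> r}" for t
    by (intro closed_Collect_le continuous_on_compose2[OF cont isCont_eval_bcontfun]) auto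
  ultimately show ?thesis by (auto intro!: closed_Int closed_paths closed_INT)
qed

text \<open>If every point at which the path reaches its peak had a direction of descent steeper than
  \<open>\<epsilon>\<close>, finitely many such directions could be blended along the path into a continuous field \<open>v\<close>
  of norm at most 1 that vanishes at the end points. Pushing the path along \<open>v\<close> would lower the
  peak by more than \<open>\<epsilon>\<close> times the distance travelled.\<close>

lemma critical_peak:
  fixes \<gamma> :: "real \<Rightarrow>\<^sub>C 'x"
  assumes min: "\<And>\<gamma>'. \<gamma>' \<in> paths a b \<Longrightarrow> peak \<gamma> \<le> peak \<gamma>' + \<epsilon> * dist \<gamma> \<gamma>'" and \<gamma>: "\<gamma> \<in> paths a b"
    and ends: "J a < peak \<gamma>" "J b < peak \<gamma>" and \<epsilon>: "\<epsilon> > 0"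
  shows "\<exists>t\<in>{0..1}. J (\<gamma> t) = peak \<gamma> \<and> (\<forall>h. \<bar>DJ (\<gamma> t) h\<bar> \<le> \<epsilon> * norm h)"
proof (rule ccontr)
  assume contra: "\<not> ?thesis"
  define m where "m = peak \<gamma>"
  define M where "M = {t\<in>{0..1}. J (\<gamma> t) = m}"
  have g0: "\<gamma> 0 = a" "\<gamma> 1 = b" using \<gamma> by (auto simp: paths_def)
  have "closed ({0..1} \<inter> {t. J (apply_bcontfun \<gamma> t) = m})"
    by (intro closed_Int closed_Collect_eq continuous_on_const cont_path) auto
  then have "compact ({0..1} \<inter> {t. J (apply_bcontfun \<gamma> t) = m})"
    using compact_Int_closed[OF compact_Icc[of 0 "1::real"]] by (metis Int_left_absorb)
  moreover have "{0..1} \<inter> {t. J (apply_bcontfun \<gamma> t) = m} = M" by (auto simp: M_def)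
  ultimately have "compact M" by simp
  have dcont: "continuous_on S (\<lambda>t. DJ (\<gamma> t) h)" for h S
  proof -
    have "continuous_on S (\<lambda>t. (\<gamma> t, h))" by (intro continuous_intros) auto
    then show ?thesis using continuous_on_compose2[OF DJ_cont, of S "\<lambda>t. (\<gamma> t, h)"] by simp
  qed
  have desc: "\<exists>h. norm h = 1 \<and> DJ (\<gamma> t) h < - \<epsilon>" if "t \<in> M" for t
  proof -
    have "\<exists>h. \<epsilon> * norm h < \<bar>DJ (\<gamma> t) h\<bar>"
      using contra that unfolding M_def m_def by (auto simp: not_le)
    then obtain h where h: "\<epsilon> * norm h < \<bar>DJ (\<gamma> t) h\<bar>" by blast
    then have hn: "norm h > 0" using linear_0[OF DJ_linear] by (cases "h = 0") auto
    define c where "c = (if DJ (\<gamma> t) h < 0 then inverse (norm h) else - inverse (norm h))"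
    have "DJ (\<gamma> t) (c *\<^sub>R h) = - (\<bar>DJ (\<gamma> t) h\<bar> / norm h)"
      using linear_scale[OF DJ_linear] by (auto simp: c_def field_simps)
    also have "\<dots> < - \<epsilon>" using h hn by (simp add: field_simps)
    finally show ?thesis using hn by (intro exI[of _ "c *\<^sub>R h"]) (auto simp: c_def)
  qed
  define O' where "O' h = {t. DJ (apply_bcontfun \<gamma> t) h < - \<epsilon>}" for h
  have "open (O' h)" for h unfolding O'_def by (intro open_Collect_less dcont continuous_on_const)
  moreover have "M \<subseteq> (\<Union>h\<in>{h. norm h = 1}. O' h)" using desc by (auto simp: O'_def)
  ultimately obtain B where B: "B \<subseteq> {h. norm h = 1}" "finite B" "M \<subseteq> (\<Union>h\<in>B. O' h)"
    using compactE_image[OF \<open>compact M\<close>, of "{h. norm h = 1}" O'] by blast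
  \<comment> \<open>\<open>\<eta> h\<close> is positive exactly where \<open>h\<close> descends faster than \<open>\<epsilon>\<close>; the term \<open>m - J (\<gamma> t)\<close> keeps
    the denominator positive off the peak set; \<open>cut\<close> is 1 on the peak set and vanishes at the end
    points, which lie lower\<close>
  define \<eta> where "\<eta> h t = max 0 (- \<epsilon> - DJ (apply_bcontfun \<gamma> t) h)" for h t
  define den where "den t = (\<Sum>h\<in>B. \<eta> h t) + (m - J (apply_bcontfun \<gamma> t))" for t
  define \<kappa> where "\<kappa> = min (m - J a) (m - J b)"
  define cut where "cut t = max 0 (1 - (m - J (apply_bcontfun \<gamma> t)) / \<kappa>)" for t
  define v where "v t = (\<Sum>h\<in>B. (cut t * \<eta> h t / den t) *\<^sub>R h)" for t
  have \<kappa>: "\<kappa> > 0" using ends by (simp add: \<kappa>_def m_def)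
  have \<eta>0: "\<eta> h t \<ge> 0" for h t by (simp add: \<eta>_def)
  have s0: "(\<Sum>h\<in>B. \<eta> h t) \<ge> 0" for t by (intro sum_nonneg \<eta>0)
  have Jm: "J (\<gamma> t) \<le> m" if "t \<in> {0..1}" for t using le_peak that by (simp add: m_def)
  have sM: "(\<Sum>h\<in>B. \<eta> h t) > 0" if t: "t \<in> M" for t
  proof -
    obtain h where "h \<in> B" "t \<in> O' h" using B t by auto
    then show ?thesis using B \<eta>0 by (intro sum_pos2[of B h]) (auto simp: O'_def \<eta>_def)
  qed
  have den: "den t > 0" if "t \<in> {0..1}" for t
  proof (cases "t \<in> M")
    case True then show ?thesis using sM Jm[OF that] by (smt (verit) den_def)
  next
    case False then show ?thesis using s0[of t] Jm[OF that] that by (simp add: den_def M_def)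
  qed
  have cut01: "0 \<le> cut t" "cut t \<le> 1" if "t \<in> {0..1}" for t using \<kappa> Jm[OF that] by (auto simp: cut_def)
  have \<eta>_cont: "continuous_on S (\<eta> h)" for h S unfolding \<eta>_def by (intro continuous_intros dcont)
  have vcont: "continuous_on {0..1} v"
    unfolding v_def den_def cut_def
    by (intro continuous_intros \<eta>_cont cont_path) (use den \<kappa> in \<open>auto simp: den_def less_imp_neq[symmetric]\<close>)
  have vnorm: "norm (v t) \<le> 1" if t: "t \<in> {0..1}" for t
  proof -
    have "norm (v t) \<le> (\<Sum>h\<in>B. norm ((cut t * \<eta> h t / den t) *\<^sub>R h))" unfolding v_def by (rule norm_sum)
    also have "\<dots> = (\<Sum>h\<in>B. cut t * \<eta> h t / den t)"
      using B(1) cut01[OF t] \<eta>0 den[OF t] by (intro sum.cong) (auto simp: abs_mult)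
    also have "\<dots> = cut t * (\<Sum>h\<in>B. \<eta> h t) / den t" by (simp add: sum_distrib_left sum_divide_distrib)
    also have "\<dots> \<le> 1 * den t / den t"
      using cut01[OF t] s0[of t] Jm[OF t] den[OF t]
      by (intro divide_right_mono mult_mono) (auto simp: den_def)
    finally show ?thesis using den[OF t] by simp
  qed
  have DJv: "DJ (\<gamma> t) (v t) < - \<epsilon>" if t: "t \<in> M" for t
  proof -
    have t01: "t \<in> {0..1}" and Jt: "J (\<gamma> t) = m" using t by (auto simp: M_def)
    have le: "\<eta> h t * DJ (\<gamma> t) h \<le> \<eta> h t * (- \<epsilon>)" for h
    proof (cases "DJ (\<gamma> t) h \<le> - \<epsilon>")
      case True then show ?thesis by (intro mult_left_mono \<eta>0) auto
    next
      case False then show ?thesis by (simp add: \<eta>_def)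
    qed
    obtain h0 where h0: "h0 \<in> B" "t \<in> O' h0" using B t by auto
    have "\<eta> h0 t > 0" "DJ (\<gamma> t) h0 < - \<epsilon>" using h0 by (auto simp: O'_def \<eta>_def)
    then have "\<eta> h0 t * DJ (\<gamma> t) h0 < \<eta> h0 t * (- \<epsilon>)" by (intro mult_strict_left_mono)
    then have "(\<Sum>h\<in>B. \<eta> h t * DJ (\<gamma> t) h) < (\<Sum>h\<in>B. \<eta> h t * (- \<epsilon>))"
      using B(2) h0(1) le by (intro sum_strict_mono_ex1) blast+
    then have lt: "(\<Sum>h\<in>B. \<eta> h t * DJ (\<gamma> t) h) < - \<epsilon> * den t"
      using Jt by (simp add: den_def sum_distrib_left sum_negf mult.commute)
    have "DJ (\<gamma> t) (v t) = (\<Sum>h\<in>B. \<eta> h t / den t * DJ (\<gamma> t) h)"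
      unfolding v_def using Jt by (simp add: linear_sum[OF DJ_linear] linear_scale[OF DJ_linear] cut_def)
    also have "\<dots> = (\<Sum>h\<in>B. \<eta> h t * DJ (\<gamma> t) h) / den t" by (simp add: sum_divide_distrib)
    also have "\<dots> < - \<epsilon>" using lt den[OF t01] by (simp add: field_simps)
    finally show ?thesis .
  qed
  have v0: "v 0 = 0" "v 1 = 0" using \<kappa> g0 by (auto simp: v_def cut_def \<kappa>_def field_simps intro!: sum.neutral)
  obtain w where w01: "\<And>t. t \<in> {0..1} \<Longrightarrow> apply_bcontfun w t = v t" and wc: "\<And>t. apply_bcontfun w t = v (clamp 0 1 t)"
    by (rule continuous_on_cbox_bcontfunE[of 0 1 v]) (use vcont in auto)
  have "norm (apply_bcontfun w t) \<le> 1" for t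
    unfolding wc by (rule vnorm) (use clamp_in_interval[of 0 "1::real" t] in simp)
  then have wn: "norm w \<le> 1" by (rule norm_bound)
  \<comment> \<open>the shifted path attains its peak at a parameter where the old path is almost at its own peak
    and where the derivative along \<open>v\<close> is at least \<open>- \<epsilon>\<close>\<close>
  have "\<exists>t\<in>{0..1}. \<exists>\<theta>. 0 < \<theta> \<and> \<theta> < s \<and> J (\<gamma> t) \<ge> m - 2 * s * \<epsilon> - (s * \<bar>DJ (\<gamma> t + \<theta> *\<^sub>R v t) (v t)\<bar>) \<and> DJ (\<gamma> t + \<theta> *\<^sub>R v t) (v t) \<ge> - \<epsilon>"
    if s: "s > 0" for s
  proof -
    define \<gamma>' where "\<gamma>' = \<gamma> + s *\<^sub>R w"
    have "\<gamma>' \<in> paths a b" using g0 v0 w01 by (simp add: \<gamma>'_def paths_def)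
    moreover have "dist \<gamma> \<gamma>' \<le> s" using wn s by (simp add: \<gamma>'_def dist_norm)
    ultimately have ge: "m \<le> peak \<gamma>' + \<epsilon> * s" using min[of \<gamma>'] \<epsilon> m_def
      by (smt (verit) mult_left_mono)
    obtain t where t: "t \<in> {0..1}" "J (\<gamma>' t) = peak \<gamma>'" using peak_attained by blast
    obtain \<theta> where \<theta>: "0 < \<theta>" "\<theta> < 1" "J (\<gamma> t + s *\<^sub>R v t) - J (\<gamma> t) = DJ (\<gamma> t + \<theta> *\<^sub>R s *\<^sub>R v t) (s *\<^sub>R v t)"
      using mean_value[of "\<gamma> t" "s *\<^sub>R v t"] by blast
    define D where "D = DJ (\<gamma> t + (\<theta> * s) *\<^sub>R v t) (v t)"
    have eq: "peak \<gamma>' - J (\<gamma> t) = s * D" using \<theta>(3) t w01 by (simp add: \<gamma>'_def linear_scale[OF DJ_linear] D_def)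
    have "s * D \<ge> s * (- \<epsilon>)" using eq ge Jm[OF t(1)] by (simp add: mult.commute)
    then have "D \<ge> - \<epsilon>" using s by (metis mult_le_cancel_left_pos)
    moreover have "J (\<gamma> t) \<ge> m - 2 * s * \<epsilon> - s * \<bar>D\<bar>"
    proof -
      have "s * D \<le> s * \<bar>D\<bar>" using s by (intro mult_left_mono) auto
      moreover have "2 * s * \<epsilon> = \<epsilon> * s + \<epsilon> * s" "0 < \<epsilon> * s" using s \<epsilon> by auto
      ultimately show ?thesis using eq ge by linarith
    qed
    ultimately show ?thesis using t(1) \<theta> s unfolding D_def by (intro bexI[of _ t] exI[of _ "\<theta> * s"]) auto
  qed
  then have "\<forall>n::nat. \<exists>t\<in>{0..1}. \<exists>\<theta>. 0 < \<theta> \<and> \<theta> < inverse (real (Suc n)) \<and> J (\<gamma> t) \<ge> m - 2 * inverse (real (Suc n)) * \<epsilon> - (inverse (real (Suc n)) * \<bar>DJ (\<gamma> t + \<theta> *\<^sub>R v t) (v t)\<bar>) \<and> DJ (\<gamma> t + \<theta> *\<^sub>R v t) (v t) \<ge> - \<epsilon>"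
    by simp
  then obtain tn \<theta>n where tn: "\<And>n. tn n \<in> {0..1}" and \<theta>n: "\<And>n. 0 < \<theta>n n" "\<And>n. \<theta>n n < inverse (real (Suc n))"
    and Jn: "\<And>n. J (\<gamma> (tn n)) \<ge> m - 2 * inverse (real (Suc n)) * \<epsilon> - (inverse (real (Suc n)) * \<bar>DJ (\<gamma> (tn n) + \<theta>n n *\<^sub>R v (tn n)) (v (tn n))\<bar>)"
    and Dn: "\<And>n. DJ (\<gamma> (tn n) + \<theta>n n *\<^sub>R v (tn n)) (v (tn n)) \<ge> - \<epsilon>" by metis
  \<comment> \<open>as the shift tends to 0, these parameters accumulate at a point of the peak set\<close>
  obtain t r where t: "t \<in> {0..1}" and r: "strict_mono r" and lim: "(\<lambda>n. tn (r n)) \<longlonglongrightarrow> t"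
    using tn compact_Icc[of 0 "1::real"] unfolding compact_def o_def by metis
  have inv0: "(\<lambda>n. inverse (real (Suc (r n)))) \<longlonglongrightarrow> 0"
    using LIMSEQ_subseq_LIMSEQ[OF LIMSEQ_inverse_real_of_nat r] by (simp add: o_def)
  have \<theta>0: "(\<lambda>n. \<theta>n (r n)) \<longlonglongrightarrow> 0"
    by (rule tendsto_sandwich[OF _ _ tendsto_const inv0]) (use \<theta>n in \<open>auto intro!: always_eventually simp: less_imp_le\<close>)
  have vlim: "(\<lambda>n. v (tn (r n))) \<longlonglongrightarrow> v t"
    by (rule continuous_on_tendsto_compose[OF vcont lim]) (use t tn in auto)
  have glim: "(\<lambda>n. \<gamma> (tn (r n))) \<longlonglongrightarrow> \<gamma> t"
    by (rule continuous_on_tendsto_compose[OF continuous_on_apply_bcontfun[of UNIV \<gamma>] lim]) auto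
  have "(\<lambda>n. \<gamma> (tn (r n)) + \<theta>n (r n) *\<^sub>R v (tn (r n))) \<longlonglongrightarrow> \<gamma> t + 0 *\<^sub>R v t"
    by (intro tendsto_intros glim \<theta>0 vlim)
  then have Dlim: "(\<lambda>n. DJ (\<gamma> (tn (r n)) + \<theta>n (r n) *\<^sub>R v (tn (r n))) (v (tn (r n)))) \<longlonglongrightarrow> DJ (\<gamma> t) (v t)"
    by (intro DJ_tendsto vlim) simp
  have Dge: "DJ (\<gamma> t) (v t) \<ge> - \<epsilon>" by (rule LIMSEQ_le_const[OF Dlim]) (use Dn in auto)
  have "(\<lambda>n. m - 2 * inverse (real (Suc (r n))) * \<epsilon> - (inverse (real (Suc (r n))) * \<bar>DJ (\<gamma> (tn (r n)) + \<theta>n (r n) *\<^sub>R v (tn (r n))) (v (tn (r n)))\<bar>))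
      \<longlonglongrightarrow> m - 2 * 0 * \<epsilon> - 0 * \<bar>DJ (\<gamma> t) (v t)\<bar>"
    by (intro tendsto_intros inv0 Dlim)
  moreover have "(\<lambda>n. J (\<gamma> (tn (r n)))) \<longlonglongrightarrow> J (\<gamma> t)"
    by (rule continuous_on_tendsto_compose[OF cont glim]) auto
  ultimately have "m \<le> J (\<gamma> t)" using Jn by (intro LIMSEQ_le[of _ "m" "\<lambda>n. J (\<gamma> (tn (r n)))"]) auto
  then have "t \<in> M" using Jm[OF t] t by (simp add: M_def)
  then show False using DJv Dge by fastforce
qed

end

text \<open>The variational principle on the space of paths yields a path close to \<open>\<gamma>\<^sub>0\<close> to which
  \<open>critical_peak\<close> applies. The distance to \<open>\<gamma>\<^sub>0\<close> is recorded because in \<open>mountain_pass_cerami\<close> it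
  confines an auxiliary real variable.\<close>

lemma minimax_near_path:
  fixes J :: "'z::banach \<Rightarrow> real" and \<gamma>\<^sub>0 :: "real \<Rightarrow>\<^sub>C 'z"
  assumes "C1_functional J DJ" and \<epsilon>: "\<epsilon> > 0" and \<gamma>\<^sub>0: "\<gamma>\<^sub>0 \<in> paths a b"
    and ends: "\<And>\<gamma>. \<gamma> \<in> paths a b \<Longrightarrow> J a < C1_functional.peak J \<gamma> \<and> J b < C1_functional.peak J \<gamma>"
    and almost_min: "\<And>\<gamma>. \<gamma> \<in> paths a b \<Longrightarrow> C1_functional.peak J \<gamma>\<^sub>0 \<le> C1_functional.peak J \<gamma> + \<epsilon>\<^sup>2"
  obtains \<gamma> z t where "\<gamma> \<in> paths a b" "J z = C1_functional.peak J \<gamma>" "J z \<le> C1_functional.peak J \<gamma>\<^sub>0"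
    "dist z (\<gamma>\<^sub>0 t) \<le> \<epsilon>" "t \<in> {0..1}" "\<And>h. \<bar>DJ z h\<bar> \<le> \<epsilon> * norm h"
proof -
  interpret C1_functional J DJ by fact
  obtain \<gamma> where \<gamma>: "\<gamma> \<in> paths a b" "peak \<gamma> \<le> peak \<gamma>\<^sub>0" "\<epsilon> * dist \<gamma> \<gamma>\<^sub>0 \<le> \<epsilon>\<^sup>2"
    and min: "\<And>\<gamma>'. \<gamma>' \<in> paths a b \<Longrightarrow> peak \<gamma> \<le> peak \<gamma>' + \<epsilon> * dist \<gamma> \<gamma>'"
    using ekeland_variational_principle[OF \<gamma>\<^sub>0 closed_peak_sublevel almost_min \<epsilon>] by blast
  have d: "dist \<gamma> \<gamma>\<^sub>0 \<le> \<epsilon>" using \<gamma>(3) \<epsilon> by (simp add: power2_eq_square)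
  obtain t where t: "t \<in> {0..1}" "J (\<gamma> t) = peak \<gamma>" "\<And>h. \<bar>DJ (\<gamma> t) h\<bar> \<le> \<epsilon> * norm h"
    using critical_peak[OF min \<gamma>(1) _ _ \<epsilon>] ends[OF \<gamma>(1)] by blast
  show thesis
    by (rule that[of \<gamma> "\<gamma> t" t]) (use t \<gamma> d dist_bounded[of \<gamma> t \<gamma>\<^sub>0] in auto)
qed

lemma bcontfun_of_path:
  fixes \<gamma> :: "real \<Rightarrow> 'z::metric_space"
  assumes "continuous_on {a..b} \<gamma>"
  obtains g :: "real \<Rightarrow>\<^sub>C 'z" where "\<And>t. t \<in> {a..b} \<Longrightarrow> g t = \<gamma> t"
  by (rule continuous_on_cbox_bcontfunE[of a b \<gamma>, unfolded cbox_interval, OF assms]) (rule that; blast)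

text \<open>The minimax argument is applied to \<open>(r, z) \<mapsto> J (exp r *\<^sub>R z)\<close>, whose derivative in the
  direction of \<open>r\<close> is \<open>DJ x x\<close> at \<open>x = exp r *\<^sub>R z\<close>. Almost critical points of this function
  therefore have small derivative in their own direction, whatever their norm; this is Cerami's
  condition in the form needed for the a priori bound. The paths of both functions have the same
  peaks, so the minimax level does not change, and starting from a path with \<open>r = 0\<close> keeps \<open>exp r\<close>
  away from 0.\<close>

theorem mountain_pass_cerami:
  fixes J :: "'x::banach \<Rightarrow> real"
  assumes "C1_functional J DJ"
    and ends: "J 0 \<le> 0" "J e \<le> 0" and \<alpha>: "\<alpha> > 0"
    and pass: "\<And>\<gamma>. continuous_on {0..1} \<gamma> \<Longrightarrow> \<gamma> 0 = 0 \<Longrightarrow> \<gamma> 1 = e \<Longrightarrow> \<exists>t\<in>{0..1::real}. J (\<gamma> t) \<ge> \<alpha>"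
  shows "\<exists>C. \<forall>\<epsilon>>0. \<exists>x. \<alpha> \<le> J x \<and> J x \<le> C \<and> \<bar>DJ x x\<bar> \<le> \<epsilon> \<and> (\<forall>h. \<bar>DJ x h\<bar> \<le> \<epsilon> * norm h)"
proof -
  interpret J: C1_functional J DJ by fact
  define Q where "Q p = exp (fst p) *\<^sub>R snd p" for p :: "real \<times> 'x"
  define J' where "J' p = J (Q p)" for p
  define DJ' where "DJ' p h = DJ (Q p) (exp (fst p) *\<^sub>R (fst h *\<^sub>R snd p + snd h))" for p h :: "real \<times> 'x"
  have Qcont: "continuous_on S Q" for S unfolding Q_def by (intro continuous_intros)
  interpret J': C1_functional J' DJ'
  proof (rule C1_functional.intro)
    show "linear (DJ' p)" for p
    proof (rule linearI)
      show "DJ' p (h + k) = DJ' p h + DJ' p k" for h k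
        unfolding DJ'_def linear_add[OF J.DJ_linear, symmetric] by (simp add: algebra_simps)
      show "DJ' p (c *\<^sub>R h) = c *\<^sub>R DJ' p h" for c h
        unfolding DJ'_def linear_scale[OF J.DJ_linear, symmetric] by (simp add: algebra_simps)
    qed
    show "((\<lambda>s. J' (p + s *\<^sub>R h)) has_real_derivative DJ' p h) (at 0)" for p h
    proof -
      have "((\<lambda>s. Q (p + s *\<^sub>R h)) has_vector_derivative exp (fst p) *\<^sub>R (fst h *\<^sub>R snd p + snd h)) (at 0)"
        unfolding Q_def has_vector_derivative_def
        by (auto intro!: derivative_eq_intros simp: algebra_simps)
      from J.chain[OF this] show ?thesis by (simp add: J'_def DJ'_def)
    qed
    have "continuous_on UNIV (\<lambda>q. (Q (fst q), exp (fst (fst q)) *\<^sub>R (fst (snd q) *\<^sub>R snd (fst q) + snd (snd q))))"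
      by (intro continuous_intros continuous_on_compose2[OF Qcont[of UNIV]]) auto
    from continuous_on_compose2[OF J.DJ_cont this]
    show "continuous_on UNIV (\<lambda>q. DJ' (fst q) (snd q))" by (simp add: DJ'_def)
  qed
  have pos: "\<alpha> \<le> J.peak \<gamma>" if "\<gamma> \<in> paths 0 e" for \<gamma>
    using pass[of "apply_bcontfun \<gamma>"] J.le_peak[of _ \<gamma>] that by (fastforce simp: paths_def)
  have down: "\<exists>\<gamma>. \<gamma> \<in> paths 0 e \<and> J.peak \<gamma> = J'.peak \<delta>" if \<delta>: "\<delta> \<in> paths (0, 0) (0, e)" for \<delta>
  proof -
    have "continuous_on {0..1} (\<lambda>t. Q (apply_bcontfun \<delta> t))"
      by (rule continuous_on_compose2[OF Qcont[of UNIV]]) auto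
    then obtain \<gamma> where \<gamma>: "\<And>t::real. t \<in> {0..1} \<Longrightarrow> apply_bcontfun \<gamma> t = Q (\<delta> t)" by (rule bcontfun_of_path) blast
    have "\<gamma> \<in> paths 0 e" using \<delta> \<gamma>[of 0] \<gamma>[of 1] by (simp add: paths_def Q_def)
    moreover have "J.peak \<gamma> = J'.peak \<delta>"
      unfolding J.peak_def J'.peak_def J'_def using \<gamma> by (intro SUP_cong) auto
    ultimately show ?thesis by blast
  qed
  have up: "\<exists>\<delta>. \<delta> \<in> paths (0, 0) (0, e) \<and> J'.peak \<delta> = J.peak \<gamma> \<and> (\<forall>t\<in>{0..1}. fst (apply_bcontfun \<delta> t) = 0)" if \<gamma>: "\<gamma> \<in> paths 0 e" for \<gamma>
  proof -
    have "continuous_on {0..1} (\<lambda>t. (0::real, apply_bcontfun \<gamma> t))" by (intro continuous_intros) auto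
    then obtain \<delta> where \<delta>: "\<And>t::real. t \<in> {0..1} \<Longrightarrow> apply_bcontfun \<delta> t = (0::real, \<gamma> t)" by (rule bcontfun_of_path) blast
    have "\<delta> \<in> paths (0, 0) (0, e)" using \<gamma> \<delta>[of 0] \<delta>[of 1] by (simp add: paths_def)
    moreover have "J'.peak \<delta> = J.peak \<gamma>"
      unfolding J.peak_def J'.peak_def J'_def using \<delta> by (intro SUP_cong) (auto simp: Q_def)
    ultimately show ?thesis using \<delta> by auto
  qed
  have "continuous_on {0..1} (\<lambda>t::real. t *\<^sub>R e)" by (intro continuous_intros)
  then obtain \<gamma>\<^sub>1 where "\<And>t::real. t \<in> {0..1} \<Longrightarrow> apply_bcontfun \<gamma>\<^sub>1 t = t *\<^sub>R e" by (rule bcontfun_of_path) blast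
  then have \<gamma>\<^sub>1: "\<gamma>\<^sub>1 \<in> paths 0 e" by (simp add: paths_def)
  have bdd: "bdd_below (J.peak ` paths 0 e)" using pos by (auto intro!: bdd_belowI)
  show ?thesis
  proof (rule exI[of _ "J.peak \<gamma>\<^sub>1 + 1"], intro allI impI)
    fix \<epsilon>' :: real assume "\<epsilon>' > 0"
    \<comment> \<open>the factor 3 bounds \<open>exp (- fst z)\<close>, since \<open>\<bar>fst z\<bar> \<le> \<epsilon> \<le> 1\<close>\<close>
    define \<epsilon> where "\<epsilon> = min 1 (\<epsilon>' / 3)"
    have \<epsilon>: "0 < \<epsilon>" "\<epsilon> \<le> 1" "3 * \<epsilon> \<le> \<epsilon>'" using \<open>\<epsilon>' > 0\<close> by (auto simp: \<epsilon>_def)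
    have "Inf (J.peak ` paths 0 e) < Inf (J.peak ` paths 0 e) + \<epsilon>\<^sup>2" using \<epsilon> by simp
    then obtain \<gamma>\<^sub>0 where \<gamma>\<^sub>0: "\<gamma>\<^sub>0 \<in> paths 0 e" "J.peak \<gamma>\<^sub>0 < Inf (J.peak ` paths 0 e) + \<epsilon>\<^sup>2"
      using cInf_lessD[of "J.peak ` paths 0 e"] \<gamma>\<^sub>1 by fastforce
    have le: "J.peak \<gamma>\<^sub>0 \<le> J.peak \<gamma> + \<epsilon>\<^sup>2" if "\<gamma> \<in> paths 0 e" for \<gamma>
      using cInf_lower[OF imageI[OF that, of J.peak] bdd] \<gamma>\<^sub>0(2) by linarith
    obtain \<delta>\<^sub>0 where \<delta>\<^sub>0: "\<delta>\<^sub>0 \<in> paths (0, 0) (0, e)" "J'.peak \<delta>\<^sub>0 = J.peak \<gamma>\<^sub>0" "\<And>t. t \<in> {0..1} \<Longrightarrow> fst (apply_bcontfun \<delta>\<^sub>0 t) = 0"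
      using up[OF \<gamma>\<^sub>0(1)] by blast
    have J'ends: "J' (0, 0) \<le> 0" "J' (0, e) \<le> 0" using ends by (auto simp: J'_def Q_def)
    obtain \<delta> z t where \<delta>: "\<delta> \<in> paths (0, 0) (0, e)" "J' z = J'.peak \<delta>" "J' z \<le> J'.peak \<delta>\<^sub>0"
      and zt: "dist z (\<delta>\<^sub>0 t) \<le> \<epsilon>" "t \<in> {0..1}" and Dz: "\<And>h. \<bar>DJ' z h\<bar> \<le> \<epsilon> * norm h"
    proof (rule minimax_near_path[OF J'.C1_functional_axioms \<epsilon>(1) \<delta>\<^sub>0(1)])
      show "J' (0, 0) < J'.peak \<gamma> \<and> J' (0, e) < J'.peak \<gamma>" if "\<gamma> \<in> paths (0, 0) (0, e)" for \<gamma>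
        using down[OF that] pos J'ends \<alpha> by fastforce
      show "J'.peak \<delta>\<^sub>0 \<le> J'.peak \<gamma> + \<epsilon>\<^sup>2" if "\<gamma> \<in> paths (0, 0) (0, e)" for \<gamma>
        using down[OF that] le \<delta>\<^sub>0(2) by metis
    qed blast
    have "\<bar>fst z\<bar> \<le> \<epsilon>" using dist_fst_le[of z "\<delta>\<^sub>0 t"] zt \<delta>\<^sub>0(3) by (simp add: dist_real_def)
    then have "- fst z \<le> 1" using \<epsilon> by linarith
    then have ez: "inverse (exp (fst z)) \<le> 3"
      using exp_le order_trans[of "exp (- fst z)" "exp 1" 3] by (simp flip: exp_minus)
    have a: "\<alpha> \<le> J (Q z)" using down[OF \<delta>(1)] \<delta>(2) pos by (metis J'_def)
    have b: "J (Q z) \<le> J.peak \<gamma>\<^sub>1 + 1"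
      using \<delta>(3) \<delta>\<^sub>0(2) le[OF \<gamma>\<^sub>1] \<epsilon> power_le_one[of \<epsilon> 2] by (simp add: J'_def)
    have "DJ' z (1, 0) = DJ (Q z) (Q z)" by (simp add: DJ'_def Q_def)
    then have c: "\<bar>DJ (Q z) (Q z)\<bar> \<le> \<epsilon>'" using Dz[of "(1, 0)"] \<epsilon> by (simp add: norm_Pair)
    have d: "\<bar>DJ (Q z) h\<bar> \<le> \<epsilon>' * norm h" for h
    proof -
      have "DJ' z (0, inverse (exp (fst z)) *\<^sub>R h) = DJ (Q z) h" by (simp add: DJ'_def)
      then have "\<bar>DJ (Q z) h\<bar> \<le> \<epsilon> * (inverse (exp (fst z)) * norm h)"
        using Dz[of "(0, inverse (exp (fst z)) *\<^sub>R h)"] by (simp add: norm_Pair)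
      also have "\<dots> \<le> \<epsilon> * (3 * norm h)" using ez \<epsilon> by (intro mult_left_mono mult_right_mono) auto
      also have "\<dots> \<le> \<epsilon>' * norm h" using \<epsilon> mult_right_mono[OF \<epsilon>(3), of "norm h"] by simp
      finally show ?thesis .
    qed
    show "\<exists>x. \<alpha> \<le> J x \<and> J x \<le> J.peak \<gamma>\<^sub>1 + 1 \<and> \<bar>DJ x x\<bar> \<le> \<epsilon>' \<and> (\<forall>h. \<bar>DJ x h\<bar> \<le> \<epsilon>' * norm h)"
      using a b c d by blast
  qed
qed

section \<open>Primitives of integrable functions\<close>

locale time_interval =
  fixes T :: real assumes T_pos: "T > 0"
begin

abbreviation "I \<equiv> {-T..T}"
abbreviation "M \<equiv> lebesgue_on I"

definition prim :: "(real \<Rightarrow> 'a::euclidean_space) \<Rightarrow> real \<Rightarrow> 'a" where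
  "prim f t = integral {-T..t} f"

lemma measure_M: "measure M I = 2 * T" "finite_measure M" "emeasure M I = ennreal (2 * T)"
proof -
  show "emeasure M I = ennreal (2 * T)" using T_pos by (simp add: emeasure_restrict_space)
  then show "measure M I = 2 * T" using T_pos by (simp add: measure_def)
  show "finite_measure M" using \<open>emeasure M I = ennreal (2 * T)\<close> by (intro finite_measureI) (simp add: space_restrict_space)
qed

declare measure_M(1) [simp]

lemma space_M: "space M = I" by (simp add: space_restrict_space)

lemma integrable_const_M [simp, intro]: "integrable M (\<lambda>t. c :: 'a::{banach,second_countable_topology})"
  by (rule finite_measure.integrable_const[OF measure_M(2)])

lemma LINT_const [simp]: "(LINT t|M. c :: 'a::{banach,second_countable_topology}) = (2 * T) *\<^sub>R c"
  using measure_M(1) by (simp add: space_M)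

lemma measurable_cont: "continuous_on I f \<Longrightarrow> f \<in> borel_measurable M" for f :: "real \<Rightarrow> 'a::euclidean_space"
  by (rule continuous_imp_measurable_on_sets_lebesgue) auto

lemma bounded_cont:
  fixes f :: "real \<Rightarrow> 'a::euclidean_space"
  assumes "continuous_on I f"
  obtains C where "C \<ge> 0" "\<And>t. t \<in> I \<Longrightarrow> norm (f t) \<le> C"
proof -
  have "bounded (f ` I)" by (rule compact_imp_bounded[OF compact_continuous_image[OF assms compact_Icc]])
  then obtain C where "C > 0" "\<forall>x\<in>f ` I. norm x \<le> C" unfolding bounded_pos by blast
  then show thesis by (intro that[of C]) auto
qed

lemma integrable_bounded:
  fixes f :: "real \<Rightarrow> 'a::euclidean_space"
  assumes "f \<in> borel_measurable M" "\<And>t. t \<in> I \<Longrightarrow> norm (f t) \<le> C"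
  shows "integrable M f"
  by (rule finite_measure.integrable_const_bound[OF measure_M(2), of _ C])
    (use assms in \<open>auto intro!: AE_I2 simp: space_M\<close>)

lemma integrable_cont: "continuous_on I f \<Longrightarrow> integrable M f" for f :: "real \<Rightarrow> 'a::euclidean_space"
  using continuous_imp_integrable_real by blast

lemma integrable_inner_bounded:
  fixes r \<phi> :: "real \<Rightarrow> 'a::euclidean_space"
  assumes r: "integrable M r" and m: "\<phi> \<in> borel_measurable M" and b: "\<And>t. t \<in> I \<Longrightarrow> norm (\<phi> t) \<le> C"
  shows "integrable M (\<lambda>t. r t \<bullet> \<phi> t)" and "\<bar>LINT t|M. r t \<bullet> \<phi> t\<bar> \<le> C * (LINT t|M. norm (r t))"
proof -
  have rm: "r \<in> borel_measurable M" using r by simp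
  have le: "\<bar>r t \<bullet> \<phi> t\<bar> \<le> C * norm (r t)" if "t \<in> I" for t
    using Cauchy_Schwarz_ineq2[of "r t" "\<phi> t"] mult_left_mono[OF b[OF that], of "norm (r t)"] by (simp add: mult.commute)
  have ir: "integrable M (\<lambda>t. C * norm (r t))" using r by simp
  show i: "integrable M (\<lambda>t. r t \<bullet> \<phi> t)"
    by (rule Bochner_Integration.integrable_bound[OF ir]) (use rm m le in \<open>auto intro!: AE_I2 simp: space_M intro: order_trans[OF _ abs_ge_self]\<close>)
  have "\<bar>LINT t|M. r t \<bullet> \<phi> t\<bar> \<le> (LINT t|M. \<bar>r t \<bullet> \<phi> t\<bar>)" by (rule integral_abs_bound)
  also have "\<dots> \<le> (LINT t|M. C * norm (r t))"
    by (rule integral_mono) (use i ir le in \<open>auto simp: space_M\<close>)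
  finally show "\<bar>LINT t|M. r t \<bullet> \<phi> t\<bar> \<le> C * (LINT t|M. norm (r t))" by simp
qed

lemma indicator_measurable_M: "A \<in> sets borel \<Longrightarrow> indicat_real A \<in> borel_measurable M"
  by (intro measurable_restrict_space1 measurable_completion) simp

text \<open>Theorems on differentiation speak of Henstock-Kurzweil integrals over subintervals, limit
  theorems of Lebesgue integrals over \<open>M\<close>; this connects the two. With open intervals in the
  indicator, adjacent intervals become disjoint.\<close>

lemma integral_eq_LINT:
  fixes f :: "real \<Rightarrow> 'a::euclidean_space"
  assumes f: "integrable M f" and st: "-T \<le> s" "t \<le> T"
  shows "f integrable_on {s..t}" "integral {s..t} f = (LINT \<tau>|M. indicator {s..t} \<tau> *\<^sub>R f \<tau>)"
    "integrable M (\<lambda>\<tau>. indicator {s..t} \<tau> *\<^sub>R f \<tau>)"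
    "integral {s..t} f = (LINT \<tau>|M. indicator {s<..<t} \<tau> *\<^sub>R f \<tau>)"
proof -
  have "integrable (lebesgue_on {s..t}) f" using f integrable_subinterval[of "-T" T f s t] st by auto
  then show fi: "f integrable_on {s..t}" using integrable_on_lebesgue_on by (metis lmeasurable_interval(2) fmeasurableD interval_cbox lmeasurable_cbox)
  have ind: "integrable M (\<lambda>\<tau>. indicator A \<tau> *\<^sub>R f \<tau>)" if "A \<in> sets borel" for A
  proof (rule Bochner_Integration.integrable_bound[OF f])
    have "f \<in> borel_measurable M" using f by simp
    moreover have "indicat_real A \<in> borel_measurable M" using that by (rule indicator_measurable_M)
    ultimately show "(\<lambda>\<tau>. indicator A \<tau> *\<^sub>R f \<tau>) \<in> borel_measurable M" by measurable
  qed (auto intro!: AE_I2 simp: indicator_def)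
  show "integrable M (\<lambda>\<tau>. indicator {s..t} \<tau> *\<^sub>R f \<tau>)" using ind by simp
  have *: "integral A f = (LINT \<tau>|M. indicator A \<tau> *\<^sub>R f \<tau>)" if "A \<in> sets borel" "A \<subseteq> I" for A
  proof -
    have "(LINT \<tau>|M. indicator A \<tau> *\<^sub>R f \<tau>) = integral I (\<lambda>\<tau>. indicator A \<tau> *\<^sub>R f \<tau>)"
      by (rule lebesgue_integral_eq_integral[OF ind]) (use that in auto)
    also have "\<dots> = integral I (\<lambda>\<tau>. if \<tau> \<in> A then f \<tau> else 0)"
      by (intro integral_cong) (auto simp: indicator_def)
    also have "\<dots> = integral A f" using that by (simp add: Henstock_Kurzweil_Integration.integral_restrict_Int) (metis inf.absorb1)
    finally show ?thesis by simp
  qed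
  show "integral {s..t} f = (LINT \<tau>|M. indicator {s..t} \<tau> *\<^sub>R f \<tau>)" using st by (intro *) auto
  show "integral {s..t} f = (LINT \<tau>|M. indicator {s<..<t} \<tau> *\<^sub>R f \<tau>)"
    using st *[of "{s<..<t}"] integral_open_interval_real[of s t f] by (auto simp: subset_iff)
qed

lemma prim_diff:
  fixes f :: "real \<Rightarrow> 'a::euclidean_space"
  assumes f: "integrable M f" and st: "-T \<le> s" "s \<le> t" "t \<le> T"
  shows "prim f t - prim f s = integral {s..t} f"
  using Henstock_Kurzweil_Integration.integral_combine[of "-T" s t f] integral_eq_LINT(1)[OF f, of "-T" t] st
  unfolding prim_def by (simp add: algebra_simps)

lemma prim_start [simp]: "prim f (-T) = 0" by (simp add: prim_def)

lemma prim_end: "integrable M f \<Longrightarrow> prim f T = (LINT t|M. f t)"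
  unfolding prim_def by (subst lebesgue_integral_eq_integral) auto

lemma prim_linear:
  fixes f g :: "real \<Rightarrow> 'a::euclidean_space"
  assumes "integrable M f" "integrable M g" "t \<in> I"
  shows "prim (\<lambda>t. f t + g t) t = prim f t + prim g t" "prim (\<lambda>t. f t - g t) t = prim f t - prim g t"
    "prim (\<lambda>t. c *\<^sub>R f t) t = c *\<^sub>R prim f t"
  unfolding prim_def using integral_eq_LINT(1)[OF assms(1), of "-T" t] integral_eq_LINT(1)[OF assms(2), of "-T" t] assms(3)
  by (auto simp: integral_add integral_diff)

lemma prim_bound:
  fixes f :: "real \<Rightarrow> 'a::euclidean_space"
  assumes f: "integrable M f" and st: "-T \<le> s" "s \<le> t" "t \<le> T"
  shows "norm (prim f t - prim f s) \<le> (LINT \<tau>|M. indicator {s<..<t} \<tau> *\<^sub>R norm (f \<tau>))"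
proof -
  have "norm (prim f t - prim f s) \<le> (LINT \<tau>|M. norm (indicator {s<..<t} \<tau> *\<^sub>R f \<tau>))"
    unfolding prim_diff[OF assms] integral_eq_LINT(4)[OF f st(1,3)] by (rule integral_norm_bound)
  then show ?thesis by simp
qed

lemma prim_norm_le:
  fixes f :: "real \<Rightarrow> 'a::euclidean_space"
  assumes f: "integrable M f" and "s \<in> I" "t \<in> I"
  shows "norm (prim f t - prim f s) \<le> (LINT \<tau>|M. norm (f \<tau>))"
proof -
  have "norm (prim f t - prim f s) \<le> (LINT \<tau>|M. norm (f \<tau>))" if "s \<in> I" "t \<in> I" "s \<le> t" for s t
  proof -
    have "norm (prim f t - prim f s) \<le> (LINT \<tau>|M. indicator {s..t} \<tau> *\<^sub>R norm (f \<tau>))"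
      using prim_bound[OF f, of s t] that integral_eq_LINT(2,4)[of "\<lambda>t. norm (f t)" s t] f by auto
    also have "\<dots> \<le> (LINT \<tau>|M. norm (f \<tau>))"
      using that f integral_eq_LINT(3)[of "\<lambda>t. norm (f t)" s t]
      by (intro integral_mono) (auto simp: indicator_def)
    finally show ?thesis .
  qed
  then show ?thesis using assms by (metis linear norm_minus_commute)
qed

lemma prim_cont: "integrable M f \<Longrightarrow> continuous_on I (prim f)" for f :: "real \<Rightarrow> 'a::euclidean_space"
  unfolding prim_def using integral_eq_LINT(1)[of f "-T" T] indefinite_integral_continuous_1 by auto

text \<open>Dominated convergence. The part of \<open>f\<close> above a high level is small in the mean, which is the
  quantitative content of integrability behind absolute continuity of primitives and density of
  continuous functions.\<close>

lemma truncation_small: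
  fixes f :: "real \<Rightarrow> 'a::euclidean_space"
  assumes f: "integrable M f" and "\<epsilon> > 0"
  shows "\<exists>R>0. (LINT t|M. max 0 (norm (f t) - R)) < \<epsilon>"
proof -
  have fm: "f \<in> borel_measurable M" using f by simp
  have "(\<lambda>n::nat. LINT t|M. max 0 (norm (f t) - real (Suc n))) \<longlonglongrightarrow> (LINT t|M. 0)"
  proof (rule integral_dominated_convergence[where w = "\<lambda>t. norm (f t)"])
    show "AE t in M. (\<lambda>n::nat. max 0 (norm (f t) - real (Suc n))) \<longlonglongrightarrow> 0"
    proof (rule AE_I2, rule tendsto_eventually)
      fix t
      obtain N :: nat where N: "norm (f t) < real N" using reals_Archimedean2 by blast
      show "\<forall>\<^sub>F n in sequentially. max 0 (norm (f t) - real (Suc n)) = 0"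
        using eventually_ge_at_top[of N] by eventually_elim (use N in auto)
    qed
  qed (use f fm in auto)
  then have "\<forall>\<^sub>F n in sequentially. (LINT t|M. max 0 (norm (f t) - real (Suc n))) < \<epsilon>"
    using order_tendstoD(2)[of _ _ _ \<epsilon>] \<open>\<epsilon> > 0\<close> by auto
  then obtain n :: nat where "(LINT t|M. max 0 (norm (f t) - real (Suc n))) < \<epsilon>"
    by (auto simp: eventually_sequentially)
  then show ?thesis by (intro exI[of _ "real (Suc n)"]) auto
qed

text \<open>Below a level \<open>R\<close> the increments are at most \<open>R\<close> times the length of the intervals; what
  lies above \<open>R\<close> contributes less than \<open>\<epsilon> / 2\<close> over any family of disjoint intervals.\<close>

lemma prim_abs_continuous:
  fixes f :: "real \<Rightarrow> 'a::euclidean_space"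
  assumes f: "integrable M f" and u: "\<And>t. t \<in> I \<Longrightarrow> u t = c + prim f t"
  shows "abs_continuous_on I u"
  unfolding abs_continuous_on_def
proof (intro allI impI)
  fix \<epsilon> :: real assume "\<epsilon> > 0"
  then obtain R where R: "R > 0" and small: "(LINT t|M. max 0 (norm (f t) - R)) < \<epsilon> / 2"
    using truncation_small[OF f, of "\<epsilon> / 2"] by auto
  define h where "h t = max 0 (norm (f t) - R)" for t
  have fm: "f \<in> borel_measurable M" using f by simp
  have hm: "h \<in> borel_measurable M" unfolding h_def using fm by measurable
  have hi: "integrable M h"
    by (rule Bochner_Integration.integrable_bound[OF f]) (use hm R in \<open>auto simp: h_def intro!: AE_I2\<close>)
  have fn: "integrable M (\<lambda>t. norm (f t))" using f by simp
  have le: "norm (f t) \<le> R + h t" for t by (simp add: h_def)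
  show "\<exists>\<delta>>0. \<forall>(n::nat) l r. (\<forall>i<n. l i \<le> r i \<and> {l i..r i} \<subseteq> I) \<and>
          (\<forall>i<n. \<forall>j<n. i \<noteq> j \<longrightarrow> {l i<..<r i} \<inter> {l j<..<r j} = {}) \<and> (\<Sum>i<n. r i - l i) < \<delta> \<longrightarrow>
          (\<Sum>i<n. norm (u (r i) - u (l i))) < \<epsilon>"
  proof (intro exI[of _ "\<epsilon> / (2 * R)"] conjI allI impI)
    show "\<epsilon> / (2 * R) > 0" using \<open>\<epsilon> > 0\<close> R by simp
    fix n :: nat and l r :: "nat \<Rightarrow> real"
    assume *: "(\<forall>i<n. l i \<le> r i \<and> {l i..r i} \<subseteq> I) \<and>
          (\<forall>i<n. \<forall>j<n. i \<noteq> j \<longrightarrow> {l i<..<r i} \<inter> {l j<..<r j} = {}) \<and> (\<Sum>i<n. r i - l i) < \<epsilon> / (2 * R)"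
    have lr: "-T \<le> l i" "l i \<le> r i" "r i \<le> T" if "i < n" for i using * that by auto
    have disj: "{l i<..<r i} \<inter> {l j<..<r j} = {}" if "i < n" "j < n" "i \<noteq> j" for i j using * that by auto
    have hint: "integrable M (\<lambda>\<tau>. indicator {l i<..<r i} \<tau> *\<^sub>R h \<tau>)" for i
    proof (rule Bochner_Integration.integrable_bound[OF hi])
      show "(\<lambda>\<tau>. indicat_real {l i<..<r i} \<tau> *\<^sub>R h \<tau>) \<in> borel_measurable M"
        by (intro borel_measurable_scaleR indicator_measurable_M hm) auto
    qed (auto intro!: AE_I2 simp: indicator_def)
    have each: "norm (u (r i) - u (l i)) \<le> R * (r i - l i) + (LINT \<tau>|M. indicator {l i<..<r i} \<tau> *\<^sub>R h \<tau>)" if "i < n" for i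
    proof -
      have "norm (u (r i) - u (l i)) \<le> (LINT \<tau>|M. indicator {l i<..<r i} \<tau> *\<^sub>R norm (f \<tau>))"
        using prim_bound[OF f lr[OF that]] u lr[OF that] by simp
      also have "\<dots> = integral {l i..r i} (\<lambda>\<tau>. norm (f \<tau>))"
        using integral_eq_LINT(4)[OF fn, of "l i" "r i"] lr[OF that] by simp
      also have "\<dots> \<le> integral {l i..r i} (\<lambda>\<tau>. R + h \<tau>)"
        using integral_eq_LINT(1)[OF fn, of "l i" "r i"] integral_eq_LINT(1)[OF hi, of "l i" "r i"] lr[OF that]
        by (intro integral_le Henstock_Kurzweil_Integration.integrable_add le) auto
      also have "\<dots> = R * (r i - l i) + integral {l i..r i} h"
        using integral_eq_LINT(1)[OF hi, of "l i" "r i"] lr[OF that] by (subst integral_add) auto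
      finally show ?thesis using integral_eq_LINT(4)[OF hi, of "l i" "r i"] lr[OF that] by simp
    qed
    have "(\<Sum>i<n. norm (u (r i) - u (l i))) \<le> (\<Sum>i<n. R * (r i - l i) + (LINT \<tau>|M. indicator {l i<..<r i} \<tau> *\<^sub>R h \<tau>))"
      using each by (intro sum_mono) auto
    also have "\<dots> = R * (\<Sum>i<n. r i - l i) + (LINT \<tau>|M. (\<Sum>i<n. indicator {l i<..<r i} \<tau> *\<^sub>R h \<tau>))"
      using hint by (subst Bochner_Integration.integral_sum) (auto simp: sum.distrib sum_distrib_left)
    also have "(LINT \<tau>|M. (\<Sum>i<n. indicator {l i<..<r i} \<tau> *\<^sub>R h \<tau>)) \<le> (LINT \<tau>|M. h \<tau>)"
    proof (rule integral_mono)
      fix \<tau> assume "\<tau> \<in> space M"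
      have "(\<Sum>i<n. indicat_real {l i<..<r i} \<tau>) \<le> 1"
      proof (cases "\<exists>j<n. \<tau> \<in> {l j<..<r j}")
        case True
        then obtain j where j: "j < n" "\<tau> \<in> {l j<..<r j}" by blast
        have "(\<Sum>i<n. indicat_real {l i<..<r i} \<tau>) = (\<Sum>i<n. if i = j then 1 else 0)"
        proof (intro sum.cong refl)
          fix i assume "i \<in> {..<n}"
          then show "indicat_real {l i<..<r i} \<tau> = (if i = j then 1 else 0)"
          proof (cases "i = j")
            case False
            then have "{l i<..<r i} \<inter> {l j<..<r j} = {}" using disj j(1) \<open>i \<in> {..<n}\<close> by blast
            then have "\<tau> \<notin> {l i<..<r i}" using j(2) by blast
            then show ?thesis using False by simp
          qed (use j in simp)
        qed
        then show ?thesis using j by simp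
      next
        case False
        then have "(\<Sum>i<n. indicat_real {l i<..<r i} \<tau>) = 0" by (intro sum.neutral) (auto simp: indicator_def)
        then show ?thesis by linarith
      qed
      then have "(\<Sum>i<n. indicat_real {l i<..<r i} \<tau>) * h \<tau> \<le> 1 * h \<tau>" by (intro mult_right_mono) (auto simp: h_def)
      then show "(\<Sum>i<n. indicat_real {l i<..<r i} \<tau> *\<^sub>R h \<tau>) \<le> h \<tau>" by (simp add: sum_distrib_right)
    next
      show "integrable M (\<lambda>\<tau>. \<Sum>i<n. indicat_real {l i<..<r i} \<tau> *\<^sub>R h \<tau>)"
        by (intro Bochner_Integration.integrable_sum hint)
    qed (rule hi)
    also have "R * (\<Sum>i<n. r i - l i) + (LINT \<tau>|M. h \<tau>) < \<epsilon> / 2 + \<epsilon> / 2"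
    proof (rule add_strict_mono)
      show "R * (\<Sum>i<n. r i - l i) < \<epsilon> / 2" using * R by (simp add: field_simps)
      show "(LINT \<tau>|M. h \<tau>) < \<epsilon> / 2" using small by (simp add: h_def)
    qed
    finally show "(\<Sum>i<n. norm (u (r i) - u (l i))) < \<epsilon>" by simp
  qed
qed

lemma AE_M_negligible:
  assumes "negligible N" "\<And>t. t \<in> I \<Longrightarrow> t \<notin> N \<Longrightarrow> P t"
  shows "AE t in M. P t"
proof -
  have "AE t in lebesgue. t \<notin> N" using assms(1) by (simp add: AE_not_in negligible_iff_null_sets)
  then have "AE t in lebesgue. t \<in> I \<longrightarrow> P t" by eventually_elim (use assms(2) in auto)
  then show ?thesis by (subst AE_restrict_space_iff) auto
qed

text \<open>Lebesgue's differentiation theorem for right-hand intervals, applied to \<open>f\<close> and to its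
  reflection, gives the derivative from both sides off a negligible set.\<close>

lemma prim_derivative:
  fixes f :: "real \<Rightarrow> 'a::euclidean_space"
  assumes f: "integrable M f" and u: "\<And>t. t \<in> I \<Longrightarrow> u t = c + prim f t"
  shows "AE t in M. (u has_vector_derivative f t) (at t)"
proof -
  define f0 where "f0 t = (if t \<in> I then f t else 0)" for t
  have "f integrable_on I" using integral_eq_LINT(1)[OF f, of "-T" T] by simp
  then have "f0 integrable_on UNIV" unfolding f0_def using integrable_restrict_UNIV by blast
  then have f0: "f0 integrable_on cbox s t" for s t by (rule integrable_on_subcbox) simp
  have f0r: "(\<lambda>t. f0 (- t)) integrable_on cbox s t" for s t
    using Henstock_Kurzweil_Integration.integrable_reflect_real[of f0 "-s" "-t"] f0[of "-t" "-s"] by simp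
  obtain N1 where N1: "negligible N1" "\<And>x e. x \<notin> N1 \<Longrightarrow> 0 < e \<Longrightarrow>
      \<exists>d>0. \<forall>h. 0 < h \<and> h < d \<longrightarrow> norm (integral (cbox x (x + h *\<^sub>R One)) f0 /\<^sub>R h ^ DIM(real) - f0 x) < e"
    using integrable_ccontinuous_explicit[of f0, OF f0] by blast
  obtain N2 where N2: "negligible N2" "\<And>x e. x \<notin> N2 \<Longrightarrow> 0 < e \<Longrightarrow>
      \<exists>d>0. \<forall>h. 0 < h \<and> h < d \<longrightarrow> norm (integral (cbox x (x + h *\<^sub>R One)) (\<lambda>t. f0 (- t)) /\<^sub>R h ^ DIM(real) - f0 (- x)) < e"
    using integrable_ccontinuous_explicit[of "\<lambda>t. f0 (- t)", OF f0r] by blast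
  show ?thesis
  proof (rule AE_M_negligible)
    have "negligible ((\<lambda>x. - x) ` N2)"
      by (rule negligible_differentiable_image_negligible[OF _ N2(1)]) (auto intro!: derivative_intros)
    then show "negligible (N1 \<union> (\<lambda>x. - x) ` N2 \<union> {-T, T})" using N1(1) by simp
    fix x assume xI: "x \<in> I" and xN: "x \<notin> N1 \<union> (\<lambda>x. - x) ` N2 \<union> {-T, T}"
    have x: "-T < x" "x < T" using xI xN by auto
    have xN1: "x \<notin> N1" using xN by blast
    have xN2: "- x \<notin> N2" using xN by (metis UnI1 UnI2 image_eqI minus_minus)
    show "(u has_vector_derivative f x) (at x)"
      unfolding has_vector_derivative_def has_derivative_at_alt
    proof (intro conjI allI impI)
      show "bounded_linear (\<lambda>h. h *\<^sub>R f x)" by (rule bounded_linear_scaleR_left)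
      fix e :: real assume e: "0 < e"
      obtain d1 where d1: "d1 > 0" "\<And>h. 0 < h \<Longrightarrow> h < d1 \<Longrightarrow> norm (integral {x..x + h} f0 /\<^sub>R h - f0 x) < e"
        using N1(2)[OF xN1 e] by auto
      obtain d2 where d2: "d2 > 0" "\<And>h. 0 < h \<Longrightarrow> h < d2 \<Longrightarrow> norm (integral {-x..-x + h} (\<lambda>t. f0 (- t)) /\<^sub>R h - f0 x) < e"
        using N2(2)[OF xN2 e] by auto
      have scale: "norm (A - h *\<^sub>R v) \<le> e * h" if "norm (A /\<^sub>R h - v) < e" "h > 0" for A v :: 'a and h
      proof -
        have "A - h *\<^sub>R v = h *\<^sub>R (A /\<^sub>R h - v)" using that by (simp add: scaleR_diff_right)
        then have "norm (A - h *\<^sub>R v) = h * norm (A /\<^sub>R h - v)" using that by simp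
        then show ?thesis using that by (metis less_imp_le mult.commute mult_left_mono)
      qed
      have f0x: "f0 x = f x" using xI by (simp add: f0_def)
      show "\<exists>d>0. \<forall>y. norm (y - x) < d \<longrightarrow> norm (u y - u x - (y - x) *\<^sub>R f x) \<le> e * norm (y - x)"
      proof (intro exI[of _ "min (min d1 d2) (min (x + T) (T - x))"] conjI allI impI)
        show "0 < min (min d1 d2) (min (x + T) (T - x))" using d1 d2 x by auto
        fix y assume "norm (y - x) < min (min d1 d2) (min (x + T) (T - x))"
        then have y: "\<bar>y - x\<bar> < d1" "\<bar>y - x\<bar> < d2" "-T < y" "y < T" by auto
        consider "y = x" | "y > x" | "y < x" by linarith
        then show "norm (u y - u x - (y - x) *\<^sub>R f x) \<le> e * norm (y - x)"
        proof cases
          case 1 then show ?thesis by simp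
        next
          case 2
          have "u y - u x = integral {x..y} f" using prim_diff[OF f, of x y] u[of x] u[of y] x y 2 by simp
          also have "\<dots> = integral {x..x + (y - x)} f0"
            using x y by (auto intro!: integral_cong simp: f0_def)
          finally show ?thesis using scale[OF d1(2)[of "y - x"]] y 2 f0x by simp
        next
          case 3
          have "u x - u y = integral {y..x} f" using prim_diff[OF f, of y x] u[of x] u[of y] x y 3 by simp
          also have "\<dots> = integral {y..x} f0"
            using x y by (auto intro!: integral_cong simp: f0_def)
          also have "\<dots> = integral {-x..-x + (x - y)} (\<lambda>t. f0 (- t))"
            using Henstock_Kurzweil_Integration.integral_reflect_real[of x y f0] by simp
          finally have "norm (u x - u y - (x - y) *\<^sub>R f x) \<le> e * (x - y)" using scale[OF d2(2)[of "x - y"]] y 3 f0x by simp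
          moreover have "norm (u x - u y - (x - y) *\<^sub>R f x) = norm (u y - u x - (y - x) *\<^sub>R f x)"
            by (subst norm_minus_cancel[symmetric]) (simp add: algebra_simps)
          ultimately show ?thesis using 3 by simp
        qed
      qed
    qed
  qed
qed

text \<open>A measurable function is an almost everywhere limit of continuous ones. Composing these with
  the radial retraction onto the ball of radius \<open>R\<close> leaves the limit unchanged and supplies the
  bound that dominated convergence asks for.\<close>

lemma bounded_measurable_limit_continuous:
  fixes z :: "real \<Rightarrow> 'a::euclidean_space"
  assumes z: "z \<in> borel_measurable M" and R: "R > 0" "\<And>t. t \<in> I \<Longrightarrow> norm (z t) \<le> R"
  obtains g where "\<And>n::nat. continuous_on UNIV (g n)" "\<And>n t. norm (g n t) \<le> R" "AE t in M. (\<lambda>n. g n t) \<longlonglongrightarrow> z t"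
proof -
  have "z measurable_on I" using z by (subst measurable_on_iff_borel_measurable) auto
  then obtain N g where N: "negligible N" and g: "\<And>n. continuous_on UNIV (g n)"
    and lim: "\<And>x. x \<notin> N \<Longrightarrow> (\<lambda>n. g n x) \<longlonglongrightarrow> (if x \<in> I then z x else 0)"
    unfolding measurable_on_def by metis
  define k where "k x = (R / max R (norm x)) *\<^sub>R x" for x :: 'a
  have mR: "max R (norm x) > 0" for x :: 'a using R by (simp add: less_max_iff_disj)
  have kc: "continuous_on UNIV k"
    unfolding k_def by (intro continuous_intros) (use mR in \<open>auto simp: less_imp_neq[symmetric]\<close>)
  have kid: "k x = x" if "norm x \<le> R" for x using that R by (simp add: k_def max_absorb1)
  have kb: "norm (k x) \<le> R" for x
  proof -
    have "norm (k x) = R * norm x / max R (norm x)" using mR[of x] R by (simp add: k_def abs_of_pos)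
    also have "\<dots> \<le> R * max R (norm x) / max R (norm x)" using R mR[of x] by (intro divide_right_mono mult_left_mono) auto
    finally show ?thesis using mR[of x] by simp
  qed
  show thesis
  proof (rule that[of "\<lambda>n t. k (g n t)"])
    show "continuous_on UNIV (\<lambda>t. k (g n t))" for n
      by (rule continuous_on_compose2[OF kc g]) auto
    show "AE t in M. (\<lambda>n. k (g n t)) \<longlonglongrightarrow> z t"
    proof (rule AE_M_negligible[OF N])
      fix t assume t: "t \<in> I" "t \<notin> N"
      have "(\<lambda>n. k (g n t)) \<longlonglongrightarrow> k (z t)"
        by (rule continuous_on_tendsto_compose[OF kc]) (use lim[OF t(2)] t(1) in auto)
      then show "(\<lambda>n. k (g n t)) \<longlonglongrightarrow> z t" using kid R(2)[OF t(1)] by simp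
    qed
  qed (rule kb)
qed

lemma continuous_dense_L1:
  fixes f :: "real \<Rightarrow> 'a::euclidean_space"
  assumes f: "integrable M f" and "\<epsilon> > 0"
  obtains g where "continuous_on UNIV g" "(LINT t|M. norm (f t - g t)) < \<epsilon>"
proof -
  have fm: "f \<in> borel_measurable M" using f by simp
  obtain R where R: "R > 0" and small: "(LINT t|M. max 0 (norm (f t) - R)) < \<epsilon> / 2"
    using truncation_small[OF f, of "\<epsilon> / 2"] \<open>\<epsilon> > 0\<close> by auto
  define z where "z t = (R / max R (norm (f t))) *\<^sub>R f t" for t
  have mR: "max R (norm x) > 0" for x :: 'a using R by (simp add: less_max_iff_disj)
  have zm: "z \<in> borel_measurable M" unfolding z_def using fm by measurable
  have zb: "norm (z t) \<le> R" for t
  proof -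
    have "norm (z t) = R * norm (f t) / max R (norm (f t))" using mR[of "f t"] R by (simp add: z_def abs_of_pos)
    also have "\<dots> \<le> R * max R (norm (f t)) / max R (norm (f t))" using R mR[of "f t"] by (intro divide_right_mono mult_left_mono) auto
    finally show ?thesis using mR[of "f t"] by simp
  qed
  have zf: "norm (f t - z t) = max 0 (norm (f t) - R)" for t
  proof (cases "norm (f t) \<le> R")
    case True then show ?thesis using R by (simp add: z_def max_absorb1)
  next
    case False
    have "f t - z t = (1 - R / norm (f t)) *\<^sub>R f t" using False by (simp add: z_def algebra_simps max_def)
    then have "norm (f t - z t) = \<bar>1 - R / norm (f t)\<bar> * norm (f t)" by simp
    also have "\<bar>1 - R / norm (f t)\<bar> = 1 - R / norm (f t)" using False R by (intro abs_of_nonneg) (simp add: divide_le_eq)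
    finally have "norm (f t - z t) = (1 - R / norm (f t)) * norm (f t)" .
    moreover have "f t \<noteq> 0" using False R by auto
    ultimately have "norm (f t - z t) = norm (f t) - R" by (simp add: left_diff_distrib)
    then show ?thesis using False by simp
  qed
  obtain g where g: "\<And>n::nat. continuous_on UNIV (g n)" "\<And>n t. norm (g n t) \<le> R" "AE t in M. (\<lambda>n. g n t) \<longlonglongrightarrow> z t"
    using bounded_measurable_limit_continuous[OF zm R(1)] zb by blast
  have gm: "g n \<in> borel_measurable M" for n
    using g(1)[of n] continuous_on_subset by (intro measurable_cont) blast
  have "(\<lambda>n. LINT t|M. norm (z t - g n t)) \<longlonglongrightarrow> (LINT t|M. 0)"
  proof (rule integral_dominated_convergence[where w = "\<lambda>t. 2 * R"])
    show "AE t in M. (\<lambda>n. norm (z t - g n t)) \<longlonglongrightarrow> 0"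
      using g(3)
    proof eventually_elim
      case (elim t)
      have "(\<lambda>n. norm (z t - g n t)) \<longlonglongrightarrow> norm (z t - z t)" by (intro tendsto_intros elim)
      then show ?case by simp
    qed
    show "AE t in M. norm (norm (z t - g n t)) \<le> 2 * R" for n
    proof (rule AE_I2)
      fix t show "norm (norm (z t - g n t)) \<le> 2 * R"
        using norm_triangle_ineq4[of "z t" "g n t"] zb[of t] g(2)[of n t] by simp
    qed
    show "(\<lambda>t. norm (z t - g n t)) \<in> borel_measurable M" for n using zm gm by measurable
  qed auto
  then have lim0: "(\<lambda>n. LINT t|M. norm (z t - g n t)) \<longlonglongrightarrow> 0" by simp
  have "\<forall>\<^sub>F n in sequentially. (LINT t|M. norm (z t - g n t)) < \<epsilon> / 2"
    by (rule order_tendstoD(2)[OF lim0]) (use \<open>\<epsilon> > 0\<close> in simp)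
  then obtain n where n: "(LINT t|M. norm (z t - g n t)) < \<epsilon> / 2" by (auto simp: eventually_sequentially)
  have zi: "integrable M z" by (rule integrable_bounded[OF zm zb])
  have gi: "integrable M (g n)" by (rule integrable_bounded[OF gm g(2)])
  have "(LINT t|M. norm (f t - g n t)) \<le> (LINT t|M. norm (f t - z t) + norm (z t - g n t))"
  proof (rule integral_mono)
    show "norm (f t - g n t) \<le> norm (f t - z t) + norm (z t - g n t)" for t
      using norm_triangle_ineq[of "f t - z t" "z t - g n t"] by simp
  qed (use f zi gi in auto)
  also have "\<dots> = (LINT t|M. norm (f t - z t)) + (LINT t|M. norm (z t - g n t))"
    using f zi gi by (intro Bochner_Integration.integral_add) auto
  also have "\<dots> < \<epsilon> / 2 + \<epsilon> / 2" using n small zf by (intro add_strict_mono) auto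
  finally show thesis using that[OF g(1)] by simp
qed

text \<open>For continuous \<open>r\<close> this is the fundamental theorem of calculus. Both sides depend
  continuously on \<open>r\<close> in the mean, so density of the continuous functions gives the rest.\<close>

lemma integration_by_parts_L1:
  fixes r :: "real \<Rightarrow> 'a::euclidean_space"
  assumes r: "integrable M r" and \<eta>: "continuous_on I \<eta>"
    and \<phi>: "\<And>t. t \<in> I \<Longrightarrow> (\<phi> has_vector_derivative \<eta> t) (at t within I)"
  shows "(LINT t|M. r t \<bullet> \<phi> t) = prim r T \<bullet> \<phi> T - (LINT t|M. prim r t \<bullet> \<eta> t)"
proof -
  have \<phi>c: "continuous_on I \<phi>"
    unfolding continuous_on_eq_continuous_within by (intro ballI has_vector_derivative_continuous[OF \<phi>])
  obtain C\<^sub>1 where C1: "\<And>t. t \<in> I \<Longrightarrow> norm (\<phi> t) \<le> C\<^sub>1"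
    by (rule bounded_cont[OF \<phi>c]) blast
  obtain C\<^sub>2 where C2: "\<And>t. t \<in> I \<Longrightarrow> norm (\<eta> t) \<le> C\<^sub>2"
    by (rule bounded_cont[OF \<eta>]) blast
  have C0: "C\<^sub>1 \<ge> 0" "C\<^sub>2 \<ge> 0" using order_trans[OF norm_ge_zero C1[of T]] order_trans[OF norm_ge_zero C2[of T]] T_pos by auto
  define \<Delta> where "\<Delta> r = (LINT t|M. r t \<bullet> \<phi> t) - (prim r T \<bullet> \<phi> T - (LINT t|M. prim r t \<bullet> \<eta> t))" for r
  have cont0: "\<Delta> g = 0" if g: "continuous_on UNIV g" for g
  proof -
    have gI: "continuous_on I g" using g continuous_on_subset by blast
    have gi: "integrable M g" by (rule integrable_cont[OF gI])
    have pc: "continuous_on I (prim g)" by (rule prim_cont[OF gi])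
    have pd: "(prim g has_vector_derivative g t) (at t within I)" if "t \<in> I" for t
      unfolding prim_def using integral_has_vector_derivative[OF gI that] by simp
    have "((\<lambda>t. prim g t \<bullet> \<phi> t) has_vector_derivative prim g t \<bullet> \<eta> t + g t \<bullet> \<phi> t) (at t within I)" if "t \<in> I" for t
      by (rule bounded_bilinear.has_vector_derivative[OF bounded_bilinear_inner pd[OF that] \<phi>[OF that]])
    then have hi: "((\<lambda>t. prim g t \<bullet> \<eta> t + g t \<bullet> \<phi> t) has_integral prim g T \<bullet> \<phi> T - prim g (-T) \<bullet> \<phi> (-T)) I"
      using T_pos by (intro fundamental_theorem_of_calculus) auto
    have i1: "integrable M (\<lambda>t. prim g t \<bullet> \<eta> t)" by (intro integrable_cont continuous_intros pc \<eta>)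
    have i2: "integrable M (\<lambda>t. g t \<bullet> \<phi> t)" by (intro integrable_cont continuous_intros gI \<phi>c)
    have "(LINT t|M. prim g t \<bullet> \<eta> t + g t \<bullet> \<phi> t) = integral I (\<lambda>t. prim g t \<bullet> \<eta> t + g t \<bullet> \<phi> t)"
      using i1 i2 by (intro lebesgue_integral_eq_integral) auto
    also have "\<dots> = prim g T \<bullet> \<phi> T" using integral_unique[OF hi] by simp
    finally show ?thesis using i1 i2 by (simp add: \<Delta>_def)
  qed
  have "\<bar>\<Delta> r\<bar> \<le> (2 * C\<^sub>1 + 2 * T * C\<^sub>2) * \<epsilon>" if \<epsilon>: "\<epsilon> > 0" for \<epsilon>
  proof -
    obtain g where g: "continuous_on UNIV g" and close: "(LINT t|M. norm (r t - g t)) < \<epsilon>"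
      using continuous_dense_L1[OF r \<epsilon>] by blast
    have gI: "continuous_on I g" using g continuous_on_subset by blast
    have gi: "integrable M g" by (rule integrable_cont[OF gI])
    define d where "d t = r t - g t" for t
    have di: "integrable M d" unfolding d_def using r gi by simp
    have dpr: "prim d t = prim r t - prim g t" if "t \<in> I" for t
      unfolding d_def by (rule prim_linear(2)[OF r gi that])
    have dn: "(LINT t|M. norm (d t)) < \<epsilon>" using close by (simp add: d_def)
    have dp: "norm (prim d t) \<le> \<epsilon>" if "t \<in> I" for t
      using prim_norm_le[OF di, of "-T" t] that T_pos dn by auto
    have pm: "prim f \<in> borel_measurable M" if "integrable M f" for f :: "real \<Rightarrow> 'a"
      by (rule measurable_cont[OF prim_cont[OF that]])
    have pi: "integrable M (\<lambda>t. prim f t \<bullet> \<eta> t)" if "integrable M f" for f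
      by (intro integrable_cont continuous_intros prim_cont that \<eta>)
    have "\<Delta> d = \<Delta> r - \<Delta> g"
    proof -
      have "(LINT t|M. d t \<bullet> \<phi> t) = (LINT t|M. r t \<bullet> \<phi> t) - (LINT t|M. g t \<bullet> \<phi> t)"
        using integrable_inner_bounded(1)[OF r measurable_cont[OF \<phi>c] C1] integrable_inner_bounded(1)[OF gi measurable_cont[OF \<phi>c] C1]
        by (subst Bochner_Integration.integral_diff[symmetric]) (auto simp: d_def inner_diff_left)
      moreover have "(LINT t|M. prim d t \<bullet> \<eta> t) = (LINT t|M. prim r t \<bullet> \<eta> t) - (LINT t|M. prim g t \<bullet> \<eta> t)"
      proof -
        have "(LINT t|M. prim d t \<bullet> \<eta> t) = (LINT t|M. prim r t \<bullet> \<eta> t - prim g t \<bullet> \<eta> t)"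
          by (intro Bochner_Integration.integral_cong) (auto simp: dpr inner_diff_left space_M)
        then show ?thesis using pi[OF r] pi[OF gi] by simp
      qed
      ultimately show ?thesis using dpr[of T] T_pos by (simp add: \<Delta>_def inner_diff_left)
    qed
    then have "\<Delta> r = \<Delta> d" using cont0[OF g] by simp
    moreover have "\<bar>LINT t|M. d t \<bullet> \<phi> t\<bar> \<le> C\<^sub>1 * \<epsilon>"
      using integrable_inner_bounded(2)[OF di measurable_cont[OF \<phi>c] C1] mult_left_mono[OF less_imp_le[OF dn] C0(1)] by linarith
    moreover have "\<bar>prim d T \<bullet> \<phi> T\<bar> \<le> \<epsilon> * C\<^sub>1"
      using Cauchy_Schwarz_ineq2[of "prim d T" "\<phi> T"] mult_mono[OF dp[of T] C1[of T]] T_pos \<epsilon> C0 by fastforce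
    moreover have "\<bar>LINT t|M. prim d t \<bullet> \<eta> t\<bar> \<le> C\<^sub>2 * (2 * T * \<epsilon>)"
    proof -
      have pdi: "integrable M (prim d)" by (rule integrable_cont[OF prim_cont[OF di]])
      have "(LINT t|M. norm (prim d t)) \<le> (LINT t|M. \<epsilon>)"
        using pdi dp by (intro integral_mono) (auto simp: space_M)
      then show ?thesis
        using integrable_inner_bounded(2)[OF pdi measurable_cont[OF \<eta>] C2] C0(2) by (auto intro: order_trans mult_left_mono)
    qed
    ultimately have "\<bar>\<Delta> r\<bar> \<le> C\<^sub>1 * \<epsilon> + \<epsilon> * C\<^sub>1 + C\<^sub>2 * (2 * T * \<epsilon>)" unfolding \<Delta>_def by linarith
    then show ?thesis by (simp add: algebra_simps)
  qed
  note bound = this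
  have "\<Delta> r = 0"
  proof (rule ccontr)
    assume nz: "\<Delta> r \<noteq> 0"
    define K where "K = 2 * C\<^sub>1 + 2 * T * C\<^sub>2 + 1"
    have K: "K > 0" using C0 T_pos by (simp add: K_def add_nonneg_pos)
    have "\<bar>\<Delta> r\<bar> \<le> (K - 1) * (\<bar>\<Delta> r\<bar> / K)" using bound[of "\<bar>\<Delta> r\<bar> / K"] nz K by (simp add: K_def)
    also have "\<dots> < K * (\<bar>\<Delta> r\<bar> / K)" using nz K by (intro mult_strict_right_mono) auto
    finally show False using K by simp
  qed
  then show ?thesis by (simp add: \<Delta>_def)
qed

text \<open>Continuous functions of norm at most 1 approximate \<open>sgn (q t)\<close>, and \<open>q t \<bullet> sgn (q t) = norm
  (q t)\<close>.\<close>

lemma orthogonal_to_continuous_imp_zero: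
  fixes q :: "real \<Rightarrow> 'a::euclidean_space"
  assumes q: "integrable M q" and orth: "\<And>\<eta>. continuous_on UNIV \<eta> \<Longrightarrow> (LINT t|M. q t \<bullet> \<eta> t) = 0"
  shows "AE t in M. q t = 0"
proof -
  have qm: "q \<in> borel_measurable M" using q by simp
  define z where "z t = sgn (q t)" for t
  have zm: "z \<in> borel_measurable M" unfolding z_def sgn_div_norm using qm by measurable
  have zb: "norm (z t) \<le> 1" for t by (simp add: z_def norm_sgn)
  obtain g where g: "\<And>n::nat. continuous_on UNIV (g n)" "\<And>n t. norm (g n t) \<le> 1" "AE t in M. (\<lambda>n. g n t) \<longlonglongrightarrow> z t"
    using bounded_measurable_limit_continuous[OF zm zero_less_one] zb by blast
  have gm: "g n \<in> borel_measurable M" for n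
    using g(1)[of n] continuous_on_subset by (intro measurable_cont) blast
  have "(\<lambda>n. LINT t|M. q t \<bullet> g n t) \<longlonglongrightarrow> (LINT t|M. q t \<bullet> z t)"
  proof (rule integral_dominated_convergence[where w = "\<lambda>t. norm (q t)"])
    show "AE t in M. (\<lambda>n. q t \<bullet> g n t) \<longlonglongrightarrow> q t \<bullet> z t"
      using g(3) by eventually_elim (intro tendsto_intros)
    show "AE t in M. norm (q t \<bullet> g n t) \<le> norm (q t)" for n
    proof (rule AE_I2)
      fix t show "norm (q t \<bullet> g n t) \<le> norm (q t)"
        using Cauchy_Schwarz_ineq2[of "q t" "g n t"] mult_left_mono[OF g(2)[of n t], of "norm (q t)"] by simp
    qed
  qed (use qm zm gm q in auto)
  then have "(\<lambda>n::nat. 0::real) \<longlonglongrightarrow> (LINT t|M. q t \<bullet> z t)" by (simp only: orth[OF g(1)])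
  then have "(LINT t|M. q t \<bullet> z t) = 0" by (simp add: LIMSEQ_const_iff)
  moreover have "q t \<bullet> z t = norm (q t)" for t
    by (cases "q t = 0") (simp_all add: z_def sgn_div_norm dot_square_norm power2_eq_square)
  ultimately have "(LINT t|M. norm (q t)) = 0" by simp
  then have "AE t in M. norm (q t) = 0" using q by (subst (asm) integral_nonneg_eq_0_iff_AE) auto
  then show ?thesis by simp
qed

text \<open>An arbitrary continuous function becomes admissible when its mean is subtracted, and in the
  pairing with \<open>q\<close> the mean can be moved over to \<open>q\<close>. So \<open>q\<close> minus its mean is orthogonal to all
  continuous functions.\<close>

lemma du_bois_reymond:
  fixes q :: "real \<Rightarrow> 'a::euclidean_space"
  assumes q: "integrable M q"
    and orth: "\<And>\<eta>. continuous_on UNIV \<eta> \<Longrightarrow> (LINT t|M. \<eta> t) = 0 \<Longrightarrow> (LINT t|M. q t \<bullet> \<eta> t) = 0"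
  obtains c where "AE t in M. q t = c"
proof -
  define mean where "mean f = (1 / (2 * T)) *\<^sub>R (LINT t|M. f t)" for f :: "real \<Rightarrow> 'a"
  have mean0: "(LINT t|M. f t - mean f) = 0" if "integrable M f" for f
    using that T_pos by (simp add: mean_def)
  have "AE t in M. q t - mean q = 0"
  proof (rule orthogonal_to_continuous_imp_zero)
    show qi: "integrable M (\<lambda>t. q t - mean q)" using q by simp
    fix \<eta> :: "real \<Rightarrow> 'a" assume \<eta>: "continuous_on UNIV \<eta>"
    have \<eta>I: "continuous_on I \<eta>" using \<eta> continuous_on_subset by blast
    have \<eta>i: "integrable M \<eta>" by (rule integrable_cont[OF \<eta>I])
    obtain C where C: "\<And>t. t \<in> I \<Longrightarrow> norm (\<eta> t) \<le> C"
      by (rule bounded_cont[OF \<eta>I]) blast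
    note ib = integrable_inner_bounded(1)[OF _ measurable_cont[OF \<eta>I] C]
    have "(LINT t|M. q t \<bullet> (\<eta> t - mean \<eta>)) = 0"
      by (rule orth) (auto intro!: continuous_intros \<eta> mean0 \<eta>i)
    then have "(LINT t|M. q t \<bullet> \<eta> t) = (LINT t|M. q t) \<bullet> mean \<eta>"
      using ib[OF q] q by (simp add: inner_diff_right)
    moreover have "(LINT t|M. (q t - mean q) \<bullet> \<eta> t) = (LINT t|M. q t \<bullet> \<eta> t) - mean q \<bullet> (LINT t|M. \<eta> t)"
      using ib[OF q] \<eta>i by (simp add: inner_diff_left)
    ultimately show "(LINT t|M. (q t - mean q) \<bullet> \<eta> t) = 0" by (simp add: mean_def)
  qed
  then show thesis using that[of "mean q"] by simp
qed

end

section \<open>G-functions and their modulars\<close>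

locale orlicz_setting = time_interval T for T +
  fixes G :: "'a::euclidean_space \<Rightarrow> real"
  assumes GF: "G_function G" and D2: "Delta2_at_infinity G"
begin

lemma G_nonneg: "0 \<le> G x" and G_convex: "convex_on UNIV G" and G_even: "G (- x) = G x" and G_0: "G 0 = 0"
  using GF by (auto simp: G_function_def)

lemma G_cont: "continuous_on S G"
  using convex_on_continuous[OF open_UNIV G_convex] continuous_on_subset by blast

text \<open>Superlinearity in an additive form that can be integrated.\<close>

lemma G_superlinear:
  assumes "\<delta> > 0"
  obtains C where "C \<ge> 0" "\<And>v. norm v \<le> \<delta> * G v + C"
proof -
  have "\<forall>\<^sub>F x in at_infinity. 1 / \<delta> \<le> G x / norm x"
    using GF by (auto simp: G_function_def filterlim_at_top)
  then obtain B where B: "\<And>x. norm x \<ge> B \<Longrightarrow> 1 / \<delta> \<le> G x / norm x"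
    by (auto simp: eventually_at_infinity)
  show thesis
  proof (rule that[of "max B 0"])
    fix v :: 'a
    show "norm v \<le> \<delta> * G v + max B 0"
    proof (cases "norm v \<ge> max B 1")
      case True
      then have "1 / \<delta> \<le> G v / norm v" using B by simp
      moreover have "norm v > 0" using True by linarith
      ultimately have "norm v \<le> \<delta> * G v" using assms by (simp add: field_simps)
      then show ?thesis by simp
    next
      case False
      then show ?thesis
      proof (cases "norm v \<ge> B")
        case True
        show ?thesis
        proof (cases "v = 0")
          case True then show ?thesis using G_nonneg[of v] assms by simp
        next
          case False
          then have "norm v \<le> \<delta> * G v" using B[OF True] assms by (simp add: field_simps)
          then show ?thesis by simp
        qed
      next
        case False then show ?thesis using mult_nonneg_nonneg[OF less_imp_le[OF assms] G_nonneg[of v]] by linarith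
      qed
    qed
  qed simp
qed

text \<open>Half of \<open>G\<close> suffices for the bound of \<open>G_superlinear\<close>; the other half beats the additive
  constant at large distance.\<close>

lemma superlinear_outside:
  assumes "\<delta> > 0"
  obtains R' where "R' \<ge> 1" "\<And>v::'a. norm v > R' \<Longrightarrow> norm v \<le> \<delta> * G v"
proof -
  obtain C2 where C2: "C2 \<ge> 0" "\<And>v::'a. norm v \<le> \<delta> / 2 * G v + C2" using G_superlinear[of "\<delta> / 2"] assms by auto
  show thesis
  proof (rule that[of "2 * C2 + 1"])
    fix v :: 'a assume "norm v > 2 * C2 + 1"
    then show "norm v \<le> \<delta> * G v" using C2(2)[of v] by simp
  qed (use C2 in simp)
qed

lemma G_bounded: obtains B where "B \<ge> 0" "\<And>v. norm v \<le> r \<Longrightarrow> G v \<le> B"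
proof -
  have "compact (G ` cball 0 r)" by (intro compact_continuous_image G_cont compact_cball)
  then have "bounded (G ` cball 0 r)" by (rule compact_imp_bounded)
  then obtain B where B: "B > 0" "\<forall>x\<in>G ` cball 0 r. norm x \<le> B" unfolding bounded_pos by blast
  show thesis
  proof (rule that[of B])
    fix v :: 'a assume "norm v \<le> r"
    then have "norm (G v) \<le> B" using B(2) by auto
    then show "G v \<le> B" by simp
  qed (use B in simp)
qed

text \<open>Near the origin, where \<open>\<Delta>\<^sub>2\<close> is silent, \<open>G\<close> is bounded on bounded sets.\<close>

lemma G_double: obtains C where "C \<ge> 1" "\<And>v. G (2 *\<^sub>R v) \<le> C * (1 + G v)"
proof -
  obtain C R where C: "C > 0" "R > 0" "\<And>x. norm x \<ge> R \<Longrightarrow> G (2 *\<^sub>R x) \<le> C * G x"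
    using D2 by (auto simp: Delta2_at_infinity_def)
  obtain B where B: "B \<ge> 0" "\<And>v::'a. norm v \<le> 2 * R \<Longrightarrow> G v \<le> B" using G_bounded by blast
  show thesis
  proof (rule that[of "C + B + 1"])
    fix v :: 'a
    have p: "0 \<le> C * G v" "0 \<le> B * G v" using C(1) B(1) G_nonneg[of v] by simp_all
    show "G (2 *\<^sub>R v) \<le> (C + B + 1) * (1 + G v)"
    proof (cases "norm v \<ge> R")
      case True then show ?thesis using C(3)[OF True] C(1) B(1) p G_nonneg[of v] unfolding distrib_right distrib_left mult_1 mult_1_right by linarith
    next
      case False
      then have "G (2 *\<^sub>R v) \<le> B" by (intro B(2)) simp
      then show ?thesis using C(1) B(1) p G_nonneg[of v] unfolding distrib_right distrib_left mult_1 mult_1_right by linarith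
    qed
  qed (use C B in simp)
qed

text \<open>A constant for the \<open>\<Delta>\<^sub>2\<close> inequality of \<open>G_double\<close>, fixed once so that it can appear in
  estimates.\<close>

definition CD :: real where "CD = (SOME C. C \<ge> 1 \<and> (\<forall>v. G (2 *\<^sub>R v) \<le> C * (1 + G v)))"

lemma CD: "CD \<ge> 1" "G (2 *\<^sub>R v) \<le> CD * (1 + G v)"
proof -
  have "\<exists>C. C \<ge> 1 \<and> (\<forall>v. G (2 *\<^sub>R v) \<le> C * (1 + G v))" using G_double by blast
  from someI_ex[OF this] show "CD \<ge> 1" "G (2 *\<^sub>R v) \<le> CD * (1 + G v)" by (auto simp: CD_def)
qed

lemma G_half: "G ((1/2) *\<^sub>R (v + w)) \<le> (G v + G w) / 2"
  using convex_onD[OF G_convex, of "1/2" v w] by (simp add: scaleR_add_right)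

lemma G_add: "G (v + w) \<le> CD * (1 + G v + G w)"
proof -
  have "G (v + w) \<le> (G (2 *\<^sub>R v) + G (2 *\<^sub>R w)) / 2"
    using G_half[of "2 *\<^sub>R v" "2 *\<^sub>R w"] by (simp add: scaleR_add_right)
  also have "\<dots> \<le> (CD * (1 + G v) + CD * (1 + G w)) / 2" by (intro divide_right_mono add_mono CD) simp
  also have "\<dots> \<le> CD * (1 + G v + G w)"
    using CD(1) mult_nonneg_nonneg[of CD "G v"] mult_nonneg_nonneg[of CD "G w"] G_nonneg[of v] G_nonneg[of w] by (simp add: algebra_simps)
  finally show ?thesis .
qed

lemma G_scale_le: "0 \<le> c \<Longrightarrow> c \<le> 1 \<Longrightarrow> G (c *\<^sub>R v) \<le> c * G v"
  using convex_onD[OF G_convex, of c 0 v] G_0 by simp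

lemma measurable_G: "y \<in> borel_measurable M \<Longrightarrow> (\<lambda>t. G (y t)) \<in> borel_measurable M"
  by (rule borel_measurable_continuous_on[OF G_cont])

lemma integrable_of_G:
  fixes y :: "real \<Rightarrow> 'a"
  assumes "y \<in> borel_measurable M" "integrable M (\<lambda>t. G (y t))"
  shows "integrable M y"
proof -
  obtain C where C: "C \<ge> 0" "\<And>v. norm v \<le> 1 * G v + C" using G_superlinear[of 1] by auto
  have "integrable M (\<lambda>t. G (y t) + C)" using assms by simp
  then show ?thesis
    by (rule Bochner_Integration.integrable_bound) (use assms C in \<open>auto intro!: AE_I2 order_trans[OF C(2)]\<close>)
qed

lemma integrable_G_cont: "continuous_on I y \<Longrightarrow> integrable M (\<lambda>t. G (y t))"
  by (rule integrable_cont) (auto intro: continuous_on_compose2[OF G_cont[of UNIV]])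

end

section \<open>Limits of convex combinations and weak compactness\<close>

text \<open>Fatou's lemma for real integrands.\<close>

lemma fatou_bound:
  fixes f :: "nat \<Rightarrow> 'b \<Rightarrow> real"
  assumes f: "\<And>n. integrable N (f n)" "\<And>n t. 0 \<le> f n t" and C: "\<And>n. (LINT t|N. f n t) \<le> C"
    and lim: "AE t in N. (\<lambda>n. f n t) \<longlonglongrightarrow> F t" and F: "F \<in> borel_measurable N"
  shows "integrable N F" "(LINT t|N. F t) \<le> C" "AE t in N. 0 \<le> F t"
proof -
  have fm: "f n \<in> borel_measurable N" for n using f(1) by simp
  show nn: "AE t in N. 0 \<le> F t"
    using lim by eventually_elim (intro LIMSEQ_le_const, auto simp: f(2))
  have "0 \<le> (LINT t|N. f 0 t)" by (rule integral_nonneg_AE) (simp add: f(2))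
  then have "C \<ge> 0" using C[of 0] by linarith
  have "(\<integral>\<^sup>+t. ennreal (F t) \<partial>N) = (\<integral>\<^sup>+t. liminf (\<lambda>n. ennreal (f n t)) \<partial>N)"
  proof (rule nn_integral_cong_AE)
    show "AE t in N. ennreal (F t) = liminf (\<lambda>n. ennreal (f n t))"
      using lim
    proof eventually_elim
      case (elim t)
      then have "(\<lambda>n. ennreal (f n t)) \<longlonglongrightarrow> ennreal (F t)" by (rule tendsto_ennrealI)
      then show ?case using lim_imp_Liminf by (metis sequentially_bot)
    qed
  qed
  also have "\<dots> \<le> liminf (\<lambda>n. \<integral>\<^sup>+t. ennreal (f n t) \<partial>N)"
    by (rule nn_integral_liminf) (use fm in measurable)
  also have "\<dots> \<le> liminf (\<lambda>n. ennreal C)"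
    by (intro Liminf_mono always_eventually allI) (simp add: nn_integral_eq_integral f C ennreal_leI)
  also have "\<dots> = ennreal C" by (simp add: Liminf_const)
  finally have le: "(\<integral>\<^sup>+t. ennreal (F t) \<partial>N) \<le> ennreal C" .
  then have "(\<integral>\<^sup>+t. ennreal (F t) \<partial>N) < \<infinity>" using ennreal_less_top le_less_trans by (metis infinity_ennreal_def)
  then show FI: "integrable N F" by (rule integrableI_nonneg[OF F nn])
  show "(LINT t|N. F t) \<le> C"
    using le nn_integral_eq_integral[OF FI nn] \<open>C \<ge> 0\<close> by simp
qed

text \<open>Completeness of the space of integrable functions without its quotient: some subsequence
  converges almost everywhere, and Fatou's lemma passes the Cauchy estimates to its limit.\<close>

lemma L1_cauchy_limit:
  fixes z :: "nat \<Rightarrow> 'b \<Rightarrow> 'c::euclidean_space"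
  assumes z: "\<And>n. integrable N (z n)"
    and cauchy: "\<And>e. e > 0 \<Longrightarrow> \<exists>k. \<forall>i\<ge>k. \<forall>j\<ge>k. (LINT t|N. norm (z i t - z j t)) < e"
  obtains r y where "strict_mono r" "integrable N y" "AE t in N. (\<lambda>i. z (r i) t) \<longlonglongrightarrow> y t"
    "(\<lambda>i. LINT t|N. norm (z (r i) t - y t)) \<longlonglongrightarrow> 0"
proof -
  obtain r where r: "strict_mono r" and ae: "AE t in N. Cauchy (\<lambda>i. z (r i) t)"
    using cauchy_L1_AE_cauchy_subseq[OF z cauchy] by blast
  define y where "y t = lim (\<lambda>i. z (r i) t)" for t
  have zm: "z n \<in> borel_measurable N" for n using z by simp
  have ym: "y \<in> borel_measurable N" unfolding y_def by (intro borel_measurable_lim_metric zm)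
  have lim: "AE t in N. (\<lambda>i. z (r i) t) \<longlonglongrightarrow> y t"
    using ae by eventually_elim (simp add: y_def Cauchy_convergent_iff convergent_LIMSEQ_iff)
  have tail: "integrable N (\<lambda>t. norm (z i t - y t)) \<and> (LINT t|N. norm (z i t - y t)) \<le> e"
    if k: "\<forall>i\<ge>k. \<forall>j\<ge>k. (LINT t|N. norm (z i t - z j t)) < e" and i: "i \<ge> k" for i k e
  proof -
    have ge: "r (j + k) \<ge> k" for j using seq_suble[OF r, of "j + k"] by simp
    have "AE t in N. (\<lambda>j. norm (z i t - z (r (j + k)) t)) \<longlonglongrightarrow> norm (z i t - y t)"
      using lim
    proof eventually_elim
      case (elim t)
      have "(\<lambda>j. z (r (j + k)) t) \<longlonglongrightarrow> y t" using LIMSEQ_ignore_initial_segment[OF elim] .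
      then show ?case by (intro tendsto_intros)
    qed
    note limd = this
    have d: "integrable N (\<lambda>t. norm (z i t - z (r (j + k)) t))" for j using z by simp
    have le: "(LINT t|N. norm (z i t - z (r (j + k)) t)) \<le> e" for j using k i ge less_imp_le by blast
    have m: "(\<lambda>t. norm (z i t - y t)) \<in> borel_measurable N" using zm ym by measurable
    show ?thesis using fatou_bound(1,2)[OF d norm_ge_zero le limd m] by blast
  qed
  have yi: "integrable N y"
  proof -
    obtain k where k: "\<forall>i\<ge>k. \<forall>j\<ge>k. (LINT t|N. norm (z i t - z j t)) < 1" using cauchy[of 1] by auto
    have "integrable N (\<lambda>t. z k t - y t)" using tail[OF k order_refl] zm ym by (subst integrable_norm_iff[symmetric]) auto
    from Bochner_Integration.integrable_diff[OF z[of k] this] show ?thesis by (simp add: algebra_simps)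
  qed
  have "(\<lambda>i. LINT t|N. norm (z i t - y t)) \<longlonglongrightarrow> 0"
  proof (rule LIMSEQ_I)
    fix e :: real assume "e > 0"
    then obtain k where k: "\<forall>i\<ge>k. \<forall>j\<ge>k. (LINT t|N. norm (z i t - z j t)) < e / 2" using cauchy[of "e/2"] by auto
    have "norm ((LINT t|N. norm (z i t - y t)) - 0) < e" if "i \<ge> k" for i
      using tail[OF k that] \<open>e > 0\<close> by simp
    then show "\<exists>k. \<forall>i\<ge>k. norm ((LINT t|N. norm (z i t - y t)) - 0) < e" by blast
  qed
  then have "(\<lambda>i. LINT t|N. norm (z (r i) t - y t)) \<longlonglongrightarrow> 0"
    using LIMSEQ_subseq_LIMSEQ[OF _ r] by (force simp: o_def)
  then show thesis by (rule that[OF r yi lim])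
qed

text \<open>The function \<open>v \<mapsto> norm (1, v)\<close>, that is \<open>sqrt (1 + (norm v)\<^sup>2)\<close>, has linear growth but is
  uniformly convex on bounded sets. In terms of the norms \<open>P\<close>, \<open>Q\<close> of the two lifted vectors, the
  norm \<open>S\<close> of their sum and their inner product \<open>p\<close>, one has \<open>(P + Q - S) * (P + Q + S) = 2 * (P *
  Q - p)\<close>, while the Cauchy-Schwarz inequality for \<open>v\<close> and \<open>w\<close> bounds \<open>(norm (v - w))\<^sup>2\<close> by \<open>P\<^sup>2 *
  Q\<^sup>2 - p\<^sup>2\<close>.\<close>

lemma lifted_norm_uniformly_convex:
  fixes v w :: "'c::real_inner"
  assumes "norm v \<le> R" "norm w \<le> R"
  shows "(norm (v - w))\<^sup>2 \<le> 4 * (1 + R) ^ 3 * (norm (1::real, v) + norm (1::real, w) - norm ((1::real, v) + (1, w)))"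
proof -
  define P Q S p where "P = norm (1::real, v)" and "Q = norm (1::real, w)" and "S = norm ((1::real, v) + (1, w))" and "p = 1 + v \<bullet> w"
  have R: "R \<ge> 0" using assms(1) norm_ge_zero order_trans by blast
  have P2: "P\<^sup>2 = 1 + v \<bullet> v" and Q2: "Q\<^sup>2 = 1 + w \<bullet> w" and S2: "S\<^sup>2 = P\<^sup>2 + Q\<^sup>2 + 2 * p"
    by (auto simp: P_def Q_def S_def p_def power2_norm_eq_inner inner_Pair inner_add_left inner_add_right inner_commute)
  have nn: "P \<ge> 0" "Q \<ge> 0" "S \<ge> 0" by (auto simp: P_def Q_def S_def)
  have P: "P \<le> 1 + R" using norm_Pair_le[of "1::real" v] assms by (simp add: P_def)
  have Q: "Q \<le> 1 + R" using norm_Pair_le[of "1::real" w] assms by (simp add: Q_def)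
  have S: "S \<le> P + Q" unfolding S_def P_def Q_def by (rule norm_triangle_ineq)
  have fac: "(P + Q - S) * (P + Q + S) = 2 * (P * Q - p)"
    using S2 by (simp add: power2_eq_square algebra_simps)
  have cs: "(v \<bullet> w)\<^sup>2 \<le> (v \<bullet> v) * (w \<bullet> w)" by (rule Cauchy_Schwarz_ineq)
  have "(norm (v - w))\<^sup>2 = v \<bullet> v + w \<bullet> w - 2 * (v \<bullet> w)"
    by (simp add: power2_norm_eq_inner inner_diff_left inner_diff_right inner_commute)
  also have "\<dots> \<le> P\<^sup>2 * Q\<^sup>2 - p\<^sup>2" using cs unfolding P2 Q2 p_def by (simp add: power2_eq_square algebra_simps)
  also have "\<dots> = (P * Q - p) * (P * Q + p)" by (simp add: power2_eq_square algebra_simps)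
  also have "\<dots> \<le> (P * Q - p) * (2 * (1 + R)\<^sup>2)"
  proof (rule mult_left_mono)
    have "0 \<le> (P + Q - S) * (P + Q + S)" using S nn by (intro mult_nonneg_nonneg) auto
    then show pq: "0 \<le> P * Q - p" using fac by simp
    have "P * Q \<le> (1 + R) * (1 + R)" using P Q nn R by (intro mult_mono) auto
    then show "P * Q + p \<le> 2 * (1 + R)\<^sup>2" using pq by (simp add: power2_eq_square)
  qed
  also have "\<dots> = (1 + R)\<^sup>2 * (2 * (P * Q - p))" by simp
  also have "\<dots> = (1 + R)\<^sup>2 * (P + Q - S) * (P + Q + S)" by (simp only: fac[symmetric] mult.assoc)
  also have "\<dots> \<le> (1 + R)\<^sup>2 * (P + Q - S) * (4 * (1 + R))"
    using S P Q R nn by (intro mult_left_mono mult_nonneg_nonneg) auto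
  also have "\<dots> = 4 * (1 + R) ^ 3 * (P + Q - S)" by (simp add: power2_eq_square power3_eq_cube algebra_simps)
  finally show ?thesis by (simp add: P_def Q_def S_def)
qed

context orlicz_setting
begin

lemma LINT_indicator_interval:
  assumes "-T \<le> s" "s \<le> t" "t \<le> T"
  shows "(LINT \<tau>|M. indicat_real {s<..<t} \<tau>) = t - s" "integrable M (indicat_real {s<..<t})"
proof -
  show "(LINT \<tau>|M. indicat_real {s<..<t} \<tau>) = t - s"
    using integral_eq_LINT(4)[of "\<lambda>_. 1::real" s t] assms by simp
  show "integrable M (indicat_real {s<..<t})"
    by (rule integrable_bounded[of _ 1]) (auto intro!: indicator_measurable_M simp: indicator_def)
qed

lemma LINT_norm_le_G:
  assumes y: "y \<in> borel_measurable M" "integrable M (\<lambda>t. G (y t))" and C: "\<And>v::'a. norm v \<le> \<delta> * G v + C\<^sub>0"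
  shows "(LINT t|M. norm (y t)) \<le> \<delta> * (LINT t|M. G (y t)) + 2 * T * C\<^sub>0"
proof -
  have "(LINT t|M. norm (y t)) \<le> (LINT t|M. \<delta> * G (y t) + C\<^sub>0)"
    using integrable_of_G[OF y] y by (intro integral_mono C) auto
  then show ?thesis using y by simp
qed

lemma prim_equicontinuous:
  assumes C: "\<And>v::'a. norm v \<le> \<delta> * G v + C\<^sub>0" and "\<delta> \<ge> 0"
    and y: "y \<in> borel_measurable M" "integrable M (\<lambda>t. G (y t))" and st: "s \<in> I" "t \<in> I"
  shows "norm (prim y s - prim y t) \<le> \<delta> * (LINT t|M. G (y t)) + C\<^sub>0 * \<bar>s - t\<bar>"
proof -
  have yi: "integrable M y" by (rule integrable_of_G[OF y])
  have *: "norm (prim y t - prim y s) \<le> \<delta> * (LINT t|M. G (y t)) + C\<^sub>0 * (t - s)" if st: "-T \<le> s" "s \<le> t" "t \<le> T" for s t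
  proof -
    have "norm (prim y t - prim y s) \<le> (LINT \<tau>|M. indicator {s<..<t} \<tau> *\<^sub>R norm (y \<tau>))"
      by (rule prim_bound[OF yi st])
    also have "\<dots> \<le> (LINT \<tau>|M. \<delta> * G (y \<tau>) + C\<^sub>0 * indicat_real {s<..<t} \<tau>)"
    proof (rule integral_mono_AE)
      have "indicat_real {s<..<t} \<tau> *\<^sub>R norm (y \<tau>) \<le> \<delta> * G (y \<tau>) + C\<^sub>0 * indicat_real {s<..<t} \<tau>" for \<tau>
        using C[of "y \<tau>"] mult_nonneg_nonneg[OF \<open>\<delta> \<ge> 0\<close> G_nonneg[of "y \<tau>"]] by (simp add: indicator_def)
      then show "AE \<tau> in M. indicat_real {s<..<t} \<tau> *\<^sub>R norm (y \<tau>) \<le> \<delta> * G (y \<tau>) + C\<^sub>0 * indicat_real {s<..<t} \<tau>" by simp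
      show "integrable M (\<lambda>\<tau>. indicat_real {s<..<t} \<tau> *\<^sub>R norm (y \<tau>))"
        by (rule Bochner_Integration.integrable_bound[OF yi])
          (use yi in \<open>auto intro!: borel_measurable_scaleR indicator_measurable_M simp del: real_scaleR_def\<close>, auto simp: indicator_def)
      show "integrable M (\<lambda>\<tau>. \<delta> * G (y \<tau>) + C\<^sub>0 * indicat_real {s<..<t} \<tau>)"
        using y LINT_indicator_interval(2)[OF st] by simp
    qed
    also have "\<dots> = \<delta> * (LINT t|M. G (y t)) + C\<^sub>0 * (t - s)"
      using y LINT_indicator_interval[OF st] by simp
    finally show ?thesis .
  qed
  show ?thesis
  proof (cases "s \<le> t")
    case True then show ?thesis using *[of s t] st by (simp add: norm_minus_commute)
  next
    case False then show ?thesis using *[of t s] st by simp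
  qed
qed

text \<open>In \<open>norm y \<le> \<delta> * G y + C0\<close> the first summand is small in the mean and the second contributes
  a multiple of the length of the interval. The modulus depends on \<open>C\<close> only, so primitives of
  functions with a common bound on their modulars are equicontinuous.\<close>

lemma small_oscillation:
  assumes "e > 0" "C \<ge> 0"
  obtains d where "d > 0" "\<And>y s t. y \<in> borel_measurable M \<Longrightarrow> integrable M (\<lambda>t. G (y t)) \<Longrightarrow> (LINT t|M. G (y t)) \<le> C \<Longrightarrow>
     s \<in> I \<Longrightarrow> t \<in> I \<Longrightarrow> \<bar>s - t\<bar> < d \<Longrightarrow> norm (prim y s - prim y t) < e"
proof -
  define \<delta> where "\<delta> = e / (2 * (C + 1))"
  have \<delta>: "\<delta> > 0" using assms by (simp add: \<delta>_def)
  obtain C0 where C0: "C0 \<ge> 0" "\<And>v::'a. norm v \<le> \<delta> * G v + C0" using G_superlinear[OF \<delta>] by blast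
  show thesis
  proof (rule that[of "e / (2 * (C0 + 1))"])
    show "e / (2 * (C0 + 1)) > 0" using assms C0 by simp
    fix y s t assume y: "y \<in> borel_measurable M" "integrable M (\<lambda>t. G (y t))" "(LINT t|M. G (y t)) \<le> C"
      and st: "s \<in> I" "t \<in> I" "\<bar>s - t\<bar> < e / (2 * (C0 + 1))"
    have "\<delta> * (LINT t|M. G (y t)) \<le> \<delta> * C" using y \<delta> by (intro mult_left_mono) auto
    also have "\<dots> < e / 2" using assms by (simp add: \<delta>_def field_simps)
    finally have 1: "\<delta> * (LINT t|M. G (y t)) < e / 2" .
    have "C0 * \<bar>s - t\<bar> \<le> C0 * (e / (2 * (C0 + 1)))" using st C0 by (intro mult_left_mono) auto
    also have "\<dots> \<le> e / 2" using C0 assms by (simp add: field_simps)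
    finally show "norm (prim y s - prim y t) < e"
      using prim_equicontinuous[OF C0(2) less_imp_le[OF \<delta>] y(1,2) st(1,2)] 1 by linarith
  qed
qed

lemma integrable_bcontfun: "integrable M (apply_bcontfun (z :: real \<Rightarrow>\<^sub>C 'a))"
  and integrable_G_bcontfun: "integrable M (\<lambda>t. G (apply_bcontfun z t))"
  and measurable_bcontfun: "apply_bcontfun z \<in> borel_measurable M"
  by (rule integrable_cont integrable_G_cont measurable_cont, simp)+

lemma prim_lincomb:
  fixes z w :: "real \<Rightarrow>\<^sub>C 'a"
  assumes "t \<in> I"
  shows "prim (apply_bcontfun (a *\<^sub>R z + b *\<^sub>R w)) t = a *\<^sub>R prim z t + b *\<^sub>R prim w t"
proof -
  have "apply_bcontfun (a *\<^sub>R z + b *\<^sub>R w) = (\<lambda>t. a *\<^sub>R z t + b *\<^sub>R w t)" by auto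
  then show ?thesis using integrable_bcontfun[of z] integrable_bcontfun[of w] assms
    by (simp add: prim_linear(1)[of "\<lambda>t. a *\<^sub>R z t" "\<lambda>t. b *\<^sub>R w t"] prim_linear(3)[of z z] prim_linear(3)[of w w])
qed

lemma convex_G_sublevel: "convex {z :: real \<Rightarrow>\<^sub>C 'a. (LINT t|M. G (z t)) \<le> C}"
proof (rule convexI)
  fix z w :: "real \<Rightarrow>\<^sub>C 'a" and a b :: real
  assume zw: "z \<in> {z :: real \<Rightarrow>\<^sub>C 'a. (LINT t|M. G (z t)) \<le> C}" "w \<in> {z :: real \<Rightarrow>\<^sub>C 'a. (LINT t|M. G (z t)) \<le> C}" and ab: "0 \<le> a" "0 \<le> b" "a + b = 1"
  have "(LINT t|M. G ((a *\<^sub>R z + b *\<^sub>R w) t)) \<le> (LINT t|M. a * G (z t) + b * G (w t))"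
  proof (rule integral_mono)
    fix t
    have "G (a *\<^sub>R z t + b *\<^sub>R w t) \<le> a * G (z t) + b * G (w t)"
      using convex_onD[OF G_convex, of b "z t" "w t"] ab by (simp add: eq_diff_eq[symmetric])
    then show "G ((a *\<^sub>R z + b *\<^sub>R w) t) \<le> a * G (z t) + b * G (w t)" by simp
  next
    show "integrable M (\<lambda>t. G ((a *\<^sub>R z + b *\<^sub>R w) t))" by (rule integrable_G_bcontfun)
  qed (use integrable_G_bcontfun in simp)
  also have "\<dots> = a * (LINT t|M. G (z t)) + b * (LINT t|M. G (w t))" using integrable_G_bcontfun by simp
  also have "\<dots> \<le> a * C + b * C" using zw ab by (intro add_mono mult_left_mono) auto
  also have "\<dots> = C" using ab by (simp flip: distrib_right)
  finally show "a *\<^sub>R z + b *\<^sub>R w \<in> {z :: real \<Rightarrow>\<^sub>C 'a. (LINT t|M. G (z t)) \<le> C}" by simp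
qed

lemma convex_prim_near: "convex {z :: real \<Rightarrow>\<^sub>C 'a. norm (prim z t - A) \<le> e}" if "t \<in> I"
proof (rule convexI)
  fix z w :: "real \<Rightarrow>\<^sub>C 'a" and a b :: real
  assume zw: "z \<in> {z :: real \<Rightarrow>\<^sub>C 'a. norm (prim z t - A) \<le> e}" "w \<in> {z :: real \<Rightarrow>\<^sub>C 'a. norm (prim z t - A) \<le> e}" and ab: "0 \<le> a" "0 \<le> b" "a + b = 1"
  have "prim (a *\<^sub>R z + b *\<^sub>R w) t - A = a *\<^sub>R (prim z t - A) + b *\<^sub>R (prim w t - A) + ((a + b) *\<^sub>R A - A)"
    unfolding prim_lincomb[OF that] by (simp add: algebra_simps)
  also have "norm \<dots> \<le> a * norm (prim z t - A) + b * norm (prim w t - A)"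
    using ab norm_triangle_ineq[of "a *\<^sub>R (prim z t - A)" "b *\<^sub>R (prim w t - A)"] by simp
  also have "\<dots> \<le> a * e + b * e" using zw ab by (intro add_mono mult_left_mono) auto
  also have "\<dots> = e" using ab by (simp flip: distrib_right)
  finally show "a *\<^sub>R z + b *\<^sub>R w \<in> {z :: real \<Rightarrow>\<^sub>C 'a. norm (prim z t - A) \<le> e}" by simp
qed

text \<open>A substitute for weak compactness followed by Mazur's lemma. The strictly convex functional
  \<open>\<Gamma> z = (LINT t|M. norm (1, z t))\<close> is minimised approximately over the convex hulls of the tails
  of the sequence. The midpoint of two almost minimisers has almost the same value, so uniform
  convexity of the lifted norm brings them close together where both are bounded; elsewhere
  superlinearity of \<open>G\<close> makes them small in the mean. Thus the almost minimisers are a Cauchy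
  sequence in the mean.\<close>

lemma convex_combinations_L1_limit:
  fixes h :: "nat \<Rightarrow> (real \<Rightarrow>\<^sub>C 'a)"
  assumes hG: "\<And>k. (LINT t|M. G (h k t)) \<le> C"
  obtains z Y where "\<And>n::nat. (z n :: real \<Rightarrow>\<^sub>C 'a) \<in> convex hull (h ` {n..})" "integrable M Y" "AE t in M. (\<lambda>n. apply_bcontfun (z n) t) \<longlonglongrightarrow> Y t"
    "(\<lambda>n. LINT t|M. norm (z n t - Y t)) \<longlonglongrightarrow> 0"
proof -
  define K where "K n = convex hull (h ` {n..})" for n
  define \<Gamma> where "\<Gamma> z = (LINT t|M. norm (1::real, apply_bcontfun z t))" for z :: "real \<Rightarrow>\<^sub>C 'a"
  have C0: "C \<ge> 0" using order_trans[OF integral_nonneg_AE hG[of 0]] G_nonneg by simp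
  have KG: "(LINT t|M. G (z t)) \<le> C" if "z \<in> K n" for z :: "real \<Rightarrow>\<^sub>C 'a" and n
  proof -
    have "K n \<subseteq> {z :: real \<Rightarrow>\<^sub>C 'a. (LINT t|M. G (z t)) \<le> C}" unfolding K_def
      by (rule hull_minimal) (use hG convex_G_sublevel in auto)
    then show ?thesis using that by blast
  qed
  have hK: "h n \<in> K n" for n unfolding K_def by (rule hull_inc) simp
  have Kmono: "K m \<subseteq> K n" if "n \<le> m" for n m unfolding K_def by (rule hull_mono) (use that in auto)
  have int1: "integrable M (\<lambda>t. norm (1::real, apply_bcontfun z t))" for z :: "real \<Rightarrow>\<^sub>C 'a"
    by (intro integrable_cont continuous_intros) simp
  have \<Gamma>0: "\<Gamma> z \<ge> 0" for z unfolding \<Gamma>_def by (rule integral_nonneg_AE) simp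
  obtain C1 where C1: "C1 \<ge> 0" "\<And>v::'a. norm v \<le> 1 * G v + C1" using G_superlinear[of 1] by auto
  have \<Gamma>h: "\<Gamma> (h n) \<le> 2 * T + (C + 2 * T * C1)" for n
  proof -
    have "\<Gamma> (h n) \<le> (LINT t|M. 1 + norm (h n t))"
      unfolding \<Gamma>_def using int1 integrable_bcontfun norm_Pair_le[of "1::real"] by (intro integral_mono) auto
    also have "\<dots> = 2 * T + (LINT t|M. norm (h n t))" using integrable_bcontfun by simp
    finally show ?thesis using LINT_norm_le_G[OF measurable_bcontfun integrable_G_bcontfun C1(2), of "h n"] hG[of n] by simp
  qed
  \<comment> \<open>the infima over the shrinking hulls increase to a limit, so an almost minimiser over a late
    hull is almost minimal for all earlier ones\<close>
  define d where "d n = Inf (\<Gamma> ` K n)" for n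
  have bdd: "bdd_below (\<Gamma> ` K n)" for n using \<Gamma>0 by (auto intro!: bdd_belowI)
  have d_le: "d n \<le> \<Gamma> z" if "z \<in> K n" for n and z :: "real \<Rightarrow>\<^sub>C 'a" unfolding d_def using bdd that by (intro cInf_lower) auto
  have "incseq d"
    unfolding incseq_def
  proof (intro allI impI)
    fix m n :: nat assume "m \<le> n"
    then show "d m \<le> d n"
      unfolding d_def using bdd hK[of n] Kmono[of m n] by (intro cInf_superset_mono image_mono) auto
  qed
  moreover have "d n \<le> 2 * T + (C + 2 * T * C1)" for n using d_le[OF hK] \<Gamma>h order_trans by blast
  ultimately obtain L where L: "d \<longlonglongrightarrow> L" "\<And>n. d n \<le> L" using incseq_convergent by blast
  have "\<exists>z. z \<in> K n \<and> \<Gamma> z < d n + inverse (real (Suc n))" for n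
    using cInf_lessD[of "\<Gamma> ` K n" "d n + inverse (real (Suc n))"] hK[of n] by (auto simp: d_def)
  then obtain z where zK: "\<And>n. z n \<in> K n" and z\<Gamma>: "\<And>n. \<Gamma> (z n) < d n + inverse (real (Suc n))" by metis
  define D where "D n m t = norm (1::real, z n t) + norm (1::real, z m t) - norm ((1::real, z n t) + (1, z m t))" for n m t
  have Dc: "continuous_on I (D n m)" for n m unfolding D_def by (intro continuous_intros) auto
  have Dint: "(LINT t|M. D n m t) \<le> L - d n + 2 * inverse (real (Suc n))" if nm: "n \<le> m" for n m
  proof -
    define mid where "mid = (1/2) *\<^sub>R z n + (1/2) *\<^sub>R z m"
    have "convex (K n)" by (simp add: K_def)
    then have "mid \<in> K n" unfolding mid_def using zK[of n] zK[of m] Kmono[OF nm] by (intro convexD) auto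
    then have dmid: "d n \<le> \<Gamma> mid" by (rule d_le)
    have i3: "integrable M (\<lambda>t. norm ((1::real, z n t) + (1, z m t)))"
      by (intro integrable_cont continuous_intros) auto
    have "norm ((1::real, z n t) + (1, z m t)) = 2 * norm (1::real, mid t)" for t
    proof -
      have "(1::real, z n t) + (1, z m t) = 2 *\<^sub>R (1::real, mid t)" by (simp add: mid_def scaleR_add_right)
      then show ?thesis by (metis abs_numeral norm_scaleR)
    qed
    then have "(LINT t|M. norm ((1::real, z n t) + (1, z m t))) = 2 * \<Gamma> mid" by (simp add: \<Gamma>_def)
    then have "(LINT t|M. D n m t) = \<Gamma> (z n) + \<Gamma> (z m) - 2 * \<Gamma> mid"
      unfolding D_def using int1 i3 by (simp add: \<Gamma>_def)
    moreover have "inverse (real (Suc m)) \<le> inverse (real (Suc n))" using nm by (intro le_imp_inverse_le) auto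
    ultimately show ?thesis using z\<Gamma>[of n] z\<Gamma>[of m] dmid L(2)[of m] by linarith
  qed
  have cauchy': "\<exists>k. \<forall>n\<ge>k. \<forall>m\<ge>n. (LINT t|M. norm (z n t - z m t)) < e" if e: "e > 0" for e
  proof -
    define \<delta> where "\<delta> = e / (8 * T)"
    define \<delta>' where "\<delta>' = e / (16 * (C + 1))"
    have \<delta>: "\<delta> > 0" "\<delta>' > 0" using e T_pos C0 by (auto simp: \<delta>_def \<delta>'_def)
    obtain R where R: "R \<ge> 1" "\<And>v::'a. norm v > R \<Longrightarrow> norm v \<le> \<delta>' * G v" using superlinear_outside[OF \<delta>(2)] by blast
    define Q where "Q = 4 * (1 + R) ^ 3 / \<delta>"
    have Q: "Q > 0" using R \<delta> by (simp add: Q_def)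
    \<comment> \<open>uniform convexity where both slopes are at most \<open>R\<close>, superlinearity of \<open>G\<close> where one of
      them is larger\<close>
    have pw: "norm (z n t - z m t) \<le> \<delta> + Q * D n m t + 2 * \<delta>' * (G (z n t) + G (z m t))" for n m t
    proof (cases "norm (z n t) \<le> R \<and> norm (z m t) \<le> R")
      case True
      then have "(norm (z n t - z m t))\<^sup>2 \<le> 4 * (1 + R) ^ 3 * D n m t"
        using lifted_norm_uniformly_convex unfolding D_def by blast
      then have "(norm (z n t - z m t))\<^sup>2 / \<delta> \<le> Q * D n m t" using \<delta> by (simp add: Q_def divide_right_mono)
      moreover have "norm (z n t - z m t) \<le> \<delta> + (norm (z n t - z m t))\<^sup>2 / \<delta>"
      proof (cases "norm (z n t - z m t) \<le> \<delta>")
        case True then show ?thesis using \<delta> by (simp add: add_increasing2)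
      next
        case False
        then have "\<delta> * norm (z n t - z m t) \<le> norm (z n t - z m t) * norm (z n t - z m t)" by (intro mult_right_mono) auto
        then have "norm (z n t - z m t) \<le> (norm (z n t - z m t))\<^sup>2 / \<delta>" using \<delta> by (simp add: power2_eq_square field_simps)
        then show ?thesis using \<delta> by simp
      qed
      moreover have "0 \<le> 2 * \<delta>' * (G (z n t) + G (z m t))" using \<delta> G_nonneg by (simp add: add_nonneg_nonneg)
      ultimately show ?thesis by linarith
    next
      case False
      have le: "norm (z n t - z m t) \<le> norm (z n t) + norm (z m t)" by (rule norm_triangle_ineq4)
      have "0 \<le> D n m t" unfolding D_def diff_ge_0_iff_ge by (rule norm_triangle_ineq)
      then have D0: "0 \<le> Q * D n m t" using Q by simp
      have g: "0 \<le> \<delta>' * G (z n t)" "0 \<le> \<delta>' * G (z m t)" using \<delta> G_nonneg by auto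
      have "norm (z n t) + norm (z m t) \<le> 2 * (\<delta>' * G (z n t) + \<delta>' * G (z m t))"
      proof (cases "norm (z n t) \<le> norm (z m t)")
        case True
        then show ?thesis using R(2)[of "z m t"] False g by auto
      next
        case n: False
        then show ?thesis using R(2)[of "z n t"] False g by auto
      qed
      then show ?thesis using le D0 g \<delta> by (simp add: algebra_simps)
    qed
    have "(\<lambda>n. Q * (L - d n + 2 * inverse (real (Suc n)))) \<longlonglongrightarrow> Q * (L - L + 2 * 0)"
      by (intro tendsto_intros L LIMSEQ_inverse_real_of_nat)
    then have lim0: "(\<lambda>n. Q * (L - d n + 2 * inverse (real (Suc n)))) \<longlonglongrightarrow> 0" by simp
    have "\<forall>\<^sub>F n in sequentially. Q * (L - d n + 2 * inverse (real (Suc n))) < e / 4"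
      by (rule order_tendstoD(2)[OF lim0]) (use e in simp)
    then obtain k where k: "\<And>n. n \<ge> k \<Longrightarrow> Q * (L - d n + 2 * inverse (real (Suc n))) < e / 4" by (auto simp: eventually_sequentially)
    have "(LINT t|M. norm (z n t - z m t)) < e" if nm: "n \<ge> k" "m \<ge> n" for n m
    proof -
      have Di: "integrable M (D n m)" by (rule integrable_cont[OF Dc])
      have "(LINT t|M. norm (z n t - z m t)) \<le> (LINT t|M. \<delta> + Q * D n m t + 2 * \<delta>' * (G (z n t) + G (z m t)))"
        using integrable_bcontfun integrable_G_bcontfun Di by (intro integral_mono pw) auto
      also have "\<dots> = 2 * T * \<delta> + Q * (LINT t|M. D n m t) + 2 * \<delta>' * ((LINT t|M. G (z n t)) + (LINT t|M. G (z m t)))"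
        using integrable_G_bcontfun Di by simp
      also have "\<dots> \<le> 2 * T * \<delta> + Q * (L - d n + 2 * inverse (real (Suc n))) + 2 * \<delta>' * (C + C)"
        using Dint[OF nm(2)] KG[OF zK[of n]] KG[OF zK[of m]] Q \<delta> by (intro add_mono mult_left_mono order_refl) auto
      also have "\<dots> < e / 4 + e / 4 + e / 4"
      proof -
        have "2 * T * \<delta> = e / 4" using T_pos by (simp add: \<delta>_def)
        moreover have "2 * \<delta>' * (C + C) \<le> e / 4" using C0 e by (simp add: \<delta>'_def field_simps)
        ultimately show ?thesis using k[OF nm(1)] by linarith
      qed
      finally show ?thesis using e by simp
    qed
    then show ?thesis by blast
  qed
  have cauchy: "\<exists>k. \<forall>i\<ge>k. \<forall>j\<ge>k. (LINT t|M. norm (z i t - z j t)) < e" if e: "e > 0" for e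
  proof -
    obtain k where k: "\<And>n m. n \<ge> k \<Longrightarrow> m \<ge> n \<Longrightarrow> (LINT t|M. norm (z n t - z m t)) < e" using cauchy'[OF e] by blast
    have swap: "(LINT t|M. norm (z i t - z j t)) = (LINT t|M. norm (z j t - z i t))" for i j
      by (intro Bochner_Integration.integral_cong refl norm_minus_commute)
    have "(LINT t|M. norm (z i t - z j t)) < e" if "i \<ge> k" "j \<ge> k" for i j
    proof (cases "i \<le> j")
      case True then show ?thesis using k[OF that(1)] by blast
    next
      case False
      then have "(LINT t|M. norm (z j t - z i t)) < e" using k[OF that(2), of i] by simp
      then show ?thesis by (simp only: swap[of i j])
    qed
    then show ?thesis by blast
  qed
  obtain r Y where r: "strict_mono r" and Y: "integrable M Y" "AE t in M. (\<lambda>i. apply_bcontfun (z (r i)) t) \<longlonglongrightarrow> Y t"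
    "(\<lambda>i. LINT t|M. norm (apply_bcontfun (z (r i)) t - Y t)) \<longlonglongrightarrow> 0"
    using L1_cauchy_limit[of M "\<lambda>n. apply_bcontfun (z n)", OF integrable_bcontfun cauchy] by blast
  show thesis
  proof (rule that[of "\<lambda>n. z (r n)" Y])
    show "z (r n) \<in> convex hull (h ` {n..})" for n
      using zK[of "r n"] Kmono[OF seq_suble[OF r]] by (auto simp: K_def)
  qed (use Y in auto)
qed

text \<open>The curves are equicontinuous, so Arzela and Ascoli provide a uniform limit \<open>U\<close>. Convex
  combinations of the slopes converge in the mean to some \<open>Y\<close>; uniform closeness of primitives to
  \<open>U\<close> survives convex combinations, hence \<open>Y\<close> is the derivative of \<open>U\<close>. Fatou's lemma bounds its
  modular.\<close>

theorem weak_compactness: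
  fixes y :: "nat \<Rightarrow> (real \<Rightarrow>\<^sub>C 'a)" and c :: "nat \<Rightarrow> 'a"
  assumes yG: "\<And>k. (LINT t|M. G (y k t)) \<le> C" and c: "\<And>k. norm (c k) \<le> B"
  obtains \<sigma> Y c' where "strict_mono (\<sigma> :: nat \<Rightarrow> nat)" "integrable M Y" "integrable M (\<lambda>t. G (Y t))" "(LINT t|M. G (Y t)) \<le> C"
    "\<And>e. e > 0 \<Longrightarrow> \<exists>N. \<forall>n\<ge>N. \<forall>t\<in>I. norm ((c (\<sigma> n) + prim (y (\<sigma> n)) t) - (c' + prim Y t)) < e"
proof -
  define u where "u k t = c k + prim (y k) t" for k t
  have C0: "C \<ge> 0" using order_trans[OF integral_nonneg_AE yG[of 0]] G_nonneg by simp
  obtain C1 where C1: "C1 \<ge> 0" "\<And>v::'a. norm v \<le> 1 * G v + C1" using G_superlinear[of 1] by auto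
  have ub: "norm (u k t) \<le> B + (C + 2 * T * C1)" if "t \<in> I" for k t
  proof -
    have "norm (prim (y k) t - prim (y k) (-T)) \<le> (LINT t|M. norm (y k t))"
      by (rule prim_norm_le[OF integrable_bcontfun]) (use that T_pos in auto)
    then have "norm (prim (y k) t) \<le> C + 2 * T * C1"
      using LINT_norm_le_G[OF measurable_bcontfun integrable_G_bcontfun C1(2), of "y k"] yG[of k] by simp
    then show ?thesis using norm_triangle_ineq[of "c k" "prim (y k) t"] c[of k] by (simp add: u_def)
  qed
  have equi: "\<exists>d. 0 < d \<and> (\<forall>n s. s \<in> I \<and> norm (t - s) < d \<longrightarrow> norm (u n t - u n s) < e)" if t: "t \<in> I" and e: "0 < e" for t e
  proof -
    obtain d where d: "d > 0" "\<And>y s t. y \<in> borel_measurable M \<Longrightarrow> integrable M (\<lambda>t. G (y t)) \<Longrightarrow> (LINT t|M. G (y t)) \<le> C \<Longrightarrow>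
      s \<in> I \<Longrightarrow> t \<in> I \<Longrightarrow> \<bar>s - t\<bar> < d \<Longrightarrow> norm (prim y s - prim y t) < e"
      using small_oscillation[OF e C0] by blast
    have "norm (u n t - u n s) < e" if "s \<in> I" "norm (t - s) < d" for n s
      using d(2)[OF measurable_bcontfun integrable_G_bcontfun yG \<open>t \<in> I\<close> that(1)] that(2) by (simp add: u_def)
    then show ?thesis using d(1) by blast
  qed
  obtain U \<sigma> where "continuous_on I U" and \<sigma>: "strict_mono (\<sigma> :: nat \<Rightarrow> nat)"
    and U: "\<And>e. 0 < e \<Longrightarrow> \<exists>N. \<forall>n t. n \<ge> N \<and> t \<in> I \<longrightarrow> norm (u (\<sigma> n) t - U t) < e"
  proof (rule Arzela_Ascoli[of I u "B + (C + 2 * T * C1)", OF compact_Icc ub equi])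
    fix g and k :: "nat \<Rightarrow> nat"
    assume "continuous_on I g" "strict_mono k"
      "\<And>e. 0 < e \<Longrightarrow> \<exists>N. \<forall>n x. n \<ge> N \<and> x \<in> I \<longrightarrow> norm (u (k n) x - g x) < e"
    then show thesis by (rule that[of g k])
  qed
  obtain z Y where z: "\<And>n. z n \<in> convex hull ((\<lambda>n. y (\<sigma> n)) ` {n..})" and Y: "integrable M Y" "AE t in M. (\<lambda>n. apply_bcontfun (z n) t) \<longlonglongrightarrow> Y t"
    and zY: "(\<lambda>n. LINT t|M. norm (z n t - Y t)) \<longlonglongrightarrow> 0"
    using convex_combinations_L1_limit[of "\<lambda>n. y (\<sigma> n)" C] yG by blast
  have zG: "(LINT t|M. G (z n t)) \<le> C" for n
  proof -
    have "convex hull ((\<lambda>n. y (\<sigma> n)) ` {n..}) \<subseteq> {z :: real \<Rightarrow>\<^sub>C 'a. (LINT t|M. G (z t)) \<le> C}"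
      by (rule hull_minimal) (use yG convex_G_sublevel in auto)
    then show ?thesis using z[of n] by blast
  qed
  have GY: "AE t in M. (\<lambda>n. G (z n t)) \<longlonglongrightarrow> G (Y t)"
    using Y(2) by eventually_elim (rule continuous_on_tendsto_compose[OF G_cont[of UNIV]], auto)
  have Ym: "Y \<in> borel_measurable M" using Y by simp
  note fb = fatou_bound[of M "\<lambda>n t. G (z n t)" C, OF integrable_G_bcontfun G_nonneg zG GY measurable_G[OF Ym]]
  have UY: "U t = U (-T) + prim Y t" if t: "t \<in> I" for t
  proof -
    have "norm (prim Y t - (U t - U (-T))) \<le> 0"
    proof (rule field_le_epsilon)
      fix e :: real assume "e > 0"
      then obtain N where N: "\<And>n t. n \<ge> N \<Longrightarrow> t \<in> I \<Longrightarrow> norm (u (\<sigma> n) t - U t) < e / 4"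
        using U[of "e/4"] by auto
      \<comment> \<open>from some index on all primitives lie in a ball around the increment of \<open>U\<close>, and so do
        those of convex combinations\<close>
      have near: "norm (prim (y (\<sigma> n)) t - (U t - U (-T))) \<le> e / 2" if "n \<ge> N" for n
      proof -
        have "norm (prim (y (\<sigma> n)) t - (U t - U (-T))) = norm ((u (\<sigma> n) t - U t) - (u (\<sigma> n) (-T) - U (-T)))"
          by (intro arg_cong[where f = norm]) (simp add: u_def algebra_simps)
        also have "\<dots> \<le> norm (u (\<sigma> n) t - U t) + norm (u (\<sigma> n) (-T) - U (-T))" by (rule norm_triangle_ineq4)
        finally show ?thesis using N[OF that t] N[OF that, of "-T"] T_pos by simp
      qed
      have zn: "norm (prim (z n) t - (U t - U (-T))) \<le> e / 2" if "n \<ge> N" for n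
      proof -
        have "convex hull ((\<lambda>n. y (\<sigma> n)) ` {n..}) \<subseteq> {z :: real \<Rightarrow>\<^sub>C 'a. norm (prim z t - (U t - U (-T))) \<le> e / 2}"
        proof (rule hull_minimal)
          show "convex {z :: real \<Rightarrow>\<^sub>C 'a. norm (prim z t - (U t - U (-T))) \<le> e / 2}" by (rule convex_prim_near[OF t])
        qed (use near that in auto)
        then show ?thesis using z[of n] by blast
      qed
      have "\<forall>\<^sub>F n in sequentially. (LINT t|M. norm (z n t - Y t)) < e / 2"
        by (rule order_tendstoD(2)[OF zY]) (use \<open>e > 0\<close> in simp)
      then have "\<forall>\<^sub>F n in sequentially. n \<ge> N \<and> (LINT t|M. norm (z n t - Y t)) < e / 2"
        using eventually_ge_at_top[of N] by eventually_elim simp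
      then obtain n where n: "n \<ge> N" "(LINT t|M. norm (z n t - Y t)) < e / 2" by (auto simp: eventually_sequentially)
      have "norm (prim (\<lambda>t. z n t - Y t) t - prim (\<lambda>t. z n t - Y t) (-T)) \<le> (LINT t|M. norm (z n t - Y t))"
        by (rule prim_norm_le) (use integrable_bcontfun Y t T_pos in auto)
      then have "norm (prim (z n) t - prim Y t) \<le> e / 2"
        using prim_linear(2)[OF integrable_bcontfun Y(1) t, of "z n"] n by simp
      moreover have "norm (prim Y t - (U t - U (-T))) \<le> norm (prim (z n) t - (U t - U (-T))) + norm (prim (z n) t - prim Y t)"
        using norm_triangle_ineq4[of "prim (z n) t - (U t - U (-T))" "prim (z n) t - prim Y t"] by (simp add: algebra_simps)
      ultimately show "norm (prim Y t - (U t - U (-T))) \<le> 0 + e" using zn[OF n(1)] by simp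
    qed
    then have "prim Y t - (U t - U (-T)) = 0" by simp
    then show ?thesis by (simp only: diff_eq_eq add_0_left) (simp add: add.commute)
  qed
  show thesis
  proof (rule that[OF \<sigma> Y(1) fb(1,2)])
    fix e :: real assume "e > 0"
    then obtain N where N: "\<And>n t. n \<ge> N \<Longrightarrow> t \<in> I \<Longrightarrow> norm (u (\<sigma> n) t - U t) < e" using U by blast
    have "norm ((c (\<sigma> n) + prim (y (\<sigma> n)) t) - (U (-T) + prim Y t)) < e" if "n \<ge> N" "t \<in> I" for n t
      using N[OF that] unfolding UY[OF that(2), symmetric] u_def .
    then show "\<exists>N. \<forall>n\<ge>N. \<forall>t\<in>I. norm ((c (\<sigma> n) + prim (y (\<sigma> n)) t) - (U (-T) + prim Y t)) < e" by blast
  qed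
qed

end

section \<open>Continuous integrands and approximation by continuous slopes\<close>

text \<open>Difference quotients of a convex function along a segment lie below the increment over the
  whole segment.\<close>

lemma convex_subgradient:
  fixes f :: "'a::real_vector \<Rightarrow> real"
  assumes f: "convex_on UNIV f" and d: "((\<lambda>s. f (v + s *\<^sub>R (w - v))) has_real_derivative D) (at 0)"
  shows "f v + D \<le> f w"
proof -
  have "((\<lambda>s. (f (v + s *\<^sub>R (w - v)) - f v) / s) \<longlongrightarrow> D) (at_right 0)"
    using d by (simp add: DERIV_def filterlim_at_split)
  moreover have "\<forall>\<^sub>F s in at_right 0. (f (v + s *\<^sub>R (w - v)) - f v) / s \<le> f w - f v"
  proof -
    have "\<forall>\<^sub>F s in at_right (0::real). 0 < s \<and> s < 1" unfolding eventually_at_right_field by (intro exI[of _ 1]) auto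
    then show ?thesis
    proof eventually_elim
      case (elim s)
      have "v + s *\<^sub>R (w - v) = (1 - s) *\<^sub>R v + s *\<^sub>R w" by (simp add: algebra_simps)
      then have "f (v + s *\<^sub>R (w - v)) \<le> (1 - s) * f v + s * f w" using convex_onD[OF f, of s v w] elim by simp
      then have "f (v + s *\<^sub>R (w - v)) - f v \<le> s * (f w - f v)" by (simp add: algebra_simps)
      then show ?case using elim by (simp add: field_simps)
    qed
  qed
  ultimately have "D \<le> f w - f v" by (intro tendsto_upperbound) auto
  then show ?thesis by simp
qed

context time_interval
begin

text \<open>Time is restricted to the interval, since nothing is known about the data outside.\<close>

definition jcont :: "(real \<Rightarrow> 'a::euclidean_space \<Rightarrow> 'a \<Rightarrow> 'b::euclidean_space) \<Rightarrow> bool" where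
  "jcont H \<longleftrightarrow> continuous_on (I \<times> UNIV) (\<lambda>p. H (fst p) (fst (snd p)) (snd (snd p)))"

lemma jcont_continuous:
  assumes H: "jcont H" and "continuous_on I u" "continuous_on I y"
  shows "continuous_on I (\<lambda>t. H t (u t) (y t))"
proof -
  have "continuous_on I (\<lambda>t. (t, u t, y t))" by (intro continuous_intros assms)
  from continuous_on_compose2[OF H[unfolded jcont_def] this] show ?thesis by (simp add: image_subset_iff)
qed

lemma jcont_tendsto:
  assumes H: "jcont H" and t: "t \<in> I" and x: "(x \<longlongrightarrow> x0) Z" and v: "(v \<longlongrightarrow> v0) Z"
  shows "((\<lambda>k. H t (x k) (v k)) \<longlongrightarrow> H t x0 v0) Z"
proof -
  have "((\<lambda>k. (t, x k, v k)) \<longlongrightarrow> (t, x0, v0)) Z" by (intro tendsto_intros x v)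
  from continuous_on_tendsto_compose[OF H[unfolded jcont_def] this] t show ?thesis by simp
qed

text \<open>Clamping time to the interval makes \<open>H\<close> continuous on the whole space, where composition
  with measurable functions is measurable.\<close>

lemma jcont_measurable:
  assumes H: "jcont H" and u: "u \<in> borel_measurable M" and y: "y \<in> borel_measurable M"
  shows "(\<lambda>t. H t (u t) (y t)) \<in> borel_measurable M"
proof -
  define c where "c t = max (-T) (min T t)" for t
  have cI: "c t \<in> I" for t using T_pos by (auto simp: c_def)
  have cc: "continuous_on S (\<lambda>p. c (f p))" if "continuous_on S f" for S and f :: "'z::topological_space \<Rightarrow> real"
    unfolding c_def by (intro continuous_intros that)
  have "continuous_on UNIV (\<lambda>p::real \<times> 'a \<times> 'a. (c (fst p), snd p))" by (intro continuous_intros cc)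
  from continuous_on_compose2[OF H[unfolded jcont_def] this]
  have *: "continuous_on UNIV (\<lambda>p. H (c (fst p)) (fst (snd p)) (snd (snd p)))" using cI by (simp add: image_subset_iff)
  have "(\<lambda>t. t) \<in> borel_measurable M" by (rule measurable_cont) (rule continuous_on_id)
  then have "(\<lambda>t. (t, u t, y t)) \<in> borel_measurable M" by (intro borel_measurable_Pair u y)
  from borel_measurable_continuous_on[OF * this]
  have "(\<lambda>t. H (c t) (u t) (y t)) \<in> borel_measurable M" by simp
  then show ?thesis
    by (rule measurable_cong[THEN iffD1, rotated]) (auto simp: space_M c_def)
qed

lemma jcont_bounded:
  assumes H: "jcont H"
  obtains C where "C \<ge> 0" "\<And>t x v. t \<in> I \<Longrightarrow> norm x \<le> R \<Longrightarrow> norm v \<le> R' \<Longrightarrow> norm (H t x v) \<le> C"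
proof -
  define S where "S = I \<times> cball (0::'a) R \<times> cball (0::'a) R'"
  have "compact ((\<lambda>p. H (fst p) (fst (snd p)) (snd (snd p))) ` S)"
    by (intro compact_continuous_image continuous_on_subset[OF H[unfolded jcont_def]])
      (auto simp: S_def intro!: compact_Times)
  from compact_imp_bounded[OF this]
  obtain C where C: "C > 0" "\<forall>x\<in>(\<lambda>p. H (fst p) (fst (snd p)) (snd (snd p))) ` S. norm x \<le> C"
    unfolding bounded_pos by blast
  show thesis
  proof (rule that[of C])
    fix t and x v :: 'a assume "t \<in> I" "norm x \<le> R" "norm v \<le> R'"
    then have "(t, x, v) \<in> S" by (auto simp: S_def)
    from C(2)[rule_format, OF imageI[OF this]] show "norm (H t x v) \<le> C" by simp
  qed (use C in simp)
qed

lemma jcont_uniform: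
  assumes H: "jcont H" and "e > 0"
  obtains d where "d > 0" "\<And>t x x' v v'. t \<in> I \<Longrightarrow> norm x \<le> R \<Longrightarrow> norm x' \<le> R \<Longrightarrow> norm v \<le> R' \<Longrightarrow> norm v' \<le> R' \<Longrightarrow>
    norm (x - x') < d \<Longrightarrow> norm (v - v') < d \<Longrightarrow> norm (H t x v - H t x' v') < e"
proof -
  define S where "S = I \<times> cball (0::'a) R \<times> cball (0::'a) R'"
  have "uniformly_continuous_on S (\<lambda>p. H (fst p) (fst (snd p)) (snd (snd p)))"
    by (intro compact_uniformly_continuous continuous_on_subset[OF H[unfolded jcont_def]])
      (auto simp: S_def intro!: compact_Times)
  then obtain d where d: "d > 0" "\<And>p q. p \<in> S \<Longrightarrow> q \<in> S \<Longrightarrow> dist q p < d \<Longrightarrow>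
      dist (H (fst q) (fst (snd q)) (snd (snd q))) (H (fst p) (fst (snd p)) (snd (snd p))) < e"
    unfolding uniformly_continuous_on_def using \<open>e > 0\<close> by metis
  show thesis
  proof (rule that[of "d / 2"])
    fix t and x x' v v' :: 'a assume *: "t \<in> I" "norm x \<le> R" "norm x' \<le> R" "norm v \<le> R'" "norm v' \<le> R'"
      "norm (x - x') < d / 2" "norm (v - v') < d / 2"
    have "dist (t, x, v) (t, x', v') = norm (x - x', v - v')" by (simp add: dist_norm norm_Pair)
    also have "\<dots> \<le> norm (x - x') + norm (v - v')" by (rule norm_Pair_le)
    finally have "dist (t, x, v) (t, x', v') < d" using * by simp
    then show "norm (H t x v - H t x' v') < e" using d(2)[of "(t, x', v')" "(t, x, v)"] * by (simp add: S_def dist_norm)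
  qed (use d in simp)
qed

text \<open>Integration by parts turns uniform convergence of the primitives into convergence of the
  pairing with a polynomial. Polynomials are uniformly dense among the continuous functions, and
  the bound in the mean controls the error of replacing \<open>\<zeta>k\<close> and \<open>\<zeta>\<close> by the same polynomial.\<close>

lemma weak_strong_convergence:
  fixes \<zeta> :: "real \<Rightarrow> 'a::euclidean_space" and y :: "nat \<Rightarrow> real \<Rightarrow> 'a"
  assumes \<zeta>: "continuous_on I \<zeta>" and \<zeta>k: "\<And>k. continuous_on I (\<zeta>k k)"
    and unif: "\<And>e. e > 0 \<Longrightarrow> \<forall>\<^sub>F k in sequentially. \<forall>t\<in>I. norm (\<zeta>k k t - \<zeta> t) < e"
    and y: "\<And>k. integrable M (y k)" and Y: "integrable M Y" and L1: "\<And>k. (LINT t|M. norm (y k t)) \<le> C"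
    and prim: "\<And>e. e > 0 \<Longrightarrow> \<forall>\<^sub>F k in sequentially. \<forall>t\<in>I. norm (prim (y k) t - prim Y t) < e"
  shows "(\<lambda>k. LINT t|M. \<zeta>k k t \<bullet> y k t) \<longlonglongrightarrow> (LINT t|M. \<zeta> t \<bullet> Y t)"
proof (rule LIMSEQ_I)
  fix e :: real assume e: "e > 0"
  define C' where "C' = C + (LINT t|M. norm (Y t)) + 1"
  have "0 \<le> (LINT t|M. norm (y 0 t))" "0 \<le> (LINT t|M. norm (Y t))" by (auto intro!: integral_nonneg_AE)
  then have "0 \<le> C" "0 \<le> (LINT t|M. norm (Y t))" using L1[of 0] by linarith+
  then have C': "C' > 0" "C \<le> C'" "(LINT t|M. norm (Y t)) \<le> C'" unfolding C'_def by linarith+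
  define \<delta> where "\<delta> = e / (8 * C')"
  have \<delta>: "\<delta> > 0" using e C' by (simp add: \<delta>_def)
  have \<delta>C: "\<delta> * C' = e / 8" using C' by (simp add: \<delta>_def)
  obtain p where p: "polynomial_function p" "\<And>t. t \<in> I \<Longrightarrow> norm (\<zeta> t - p t) < \<delta>"
    using Stone_Weierstrass_polynomial_function[OF compact_Icc \<zeta> \<delta>] by blast
  obtain p' where p': "polynomial_function p'" "\<And>t. (p has_vector_derivative p' t) (at t)"
    using has_vector_derivative_polynomial_function[OF p(1)] by blast
  have pc: "continuous_on I p" and p'c: "continuous_on I p'"
    using continuous_on_polymonial_function p(1) p'(1) by blast+
  have parts: "(LINT t|M. r t \<bullet> p t) = prim r T \<bullet> p T - (LINT t|M. prim r t \<bullet> p' t)" if "integrable M r" for r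
    by (rule integration_by_parts_L1[OF that p'c]) (use p'(2) has_vector_derivative_at_within in blast)
  obtain P where P: "P \<ge> 0" "\<And>t. t \<in> I \<Longrightarrow> norm (p t) \<le> P" using bounded_cont[OF pc] by blast
  obtain P' where P': "P' \<ge> 0" "\<And>t. t \<in> I \<Longrightarrow> norm (p' t) \<le> P'" using bounded_cont[OF p'c] by blast
  define Q where "Q = P + 2 * T * P' + 1"
  have Q: "Q > 0" using P P' T_pos by (simp add: Q_def add_nonneg_pos)
  have poly: "\<bar>(LINT t|M. y k t \<bullet> p t) - (LINT t|M. Y t \<bullet> p t)\<bar> \<le> Q * s"
    if s: "s > 0" and near: "\<forall>t\<in>I. norm (prim (y k) t - prim Y t) < s" for k s
  proof -
    define d where "d = (\<lambda>t. y k t - Y t)"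
    have di: "integrable M d" unfolding d_def using y Y by simp
    have dp: "norm (prim d t) \<le> s" if "t \<in> I" for t
      using near that prim_linear(2)[OF y Y that, of k] by (auto simp: d_def less_imp_le)
    have i1: "integrable M (\<lambda>t. y k t \<bullet> p t)" "integrable M (\<lambda>t. Y t \<bullet> p t)"
      by (rule integrable_inner_bounded(1)[OF _ measurable_cont[OF pc] P(2)], use y Y in auto)+
    have pdi: "integrable M (prim d)" by (rule integrable_cont[OF prim_cont[OF di]])
    have "(LINT t|M. y k t \<bullet> p t) - (LINT t|M. Y t \<bullet> p t) = (LINT t|M. d t \<bullet> p t)"
      using i1 by (simp add: d_def inner_diff_left)
    also have "\<dots> = prim d T \<bullet> p T - (LINT t|M. prim d t \<bullet> p' t)" by (rule parts[OF di])
    finally have eq: "(LINT t|M. y k t \<bullet> p t) - (LINT t|M. Y t \<bullet> p t) = prim d T \<bullet> p T - (LINT t|M. prim d t \<bullet> p' t)" .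
    have "\<bar>prim d T \<bullet> p T\<bar> \<le> norm (prim d T) * norm (p T)" by (rule Cauchy_Schwarz_ineq2)
    also have "\<dots> \<le> s * P" using dp[of T] P T_pos s by (intro mult_mono) auto
    finally have b1: "\<bar>prim d T \<bullet> p T\<bar> \<le> s * P" .
    have "\<bar>LINT t|M. prim d t \<bullet> p' t\<bar> \<le> P' * (LINT t|M. norm (prim d t))"
      by (rule integrable_inner_bounded(2)[OF pdi measurable_cont[OF p'c] P'(2)])
    also have "\<dots> \<le> P' * (LINT t|M. s)"
      using pdi dp P' by (intro mult_left_mono integral_mono) (auto simp: space_M)
    finally have b2: "\<bar>LINT t|M. prim d t \<bullet> p' t\<bar> \<le> P' * (2 * T * s)" by simp
    have "Q * s = s * P + P' * (2 * T * s) + s" by (simp add: Q_def algebra_simps)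
    then show ?thesis using eq b1 b2 s by linarith
  qed
  have close: "\<bar>(LINT t|M. z t \<bullet> r t) - (LINT t|M. r t \<bullet> p t)\<bar> \<le> 2 * \<delta> * C'"
    if z: "continuous_on I z" "\<And>t. t \<in> I \<Longrightarrow> norm (z t - p t) \<le> 2 * \<delta>" and r: "integrable M r" "(LINT t|M. norm (r t)) \<le> C'" for z r
  proof -
    have zpc: "continuous_on I (\<lambda>t. z t - p t)" by (intro continuous_intros z pc)
    obtain Z where Z: "Z \<ge> 0" "\<And>t. t \<in> I \<Longrightarrow> norm (z t) \<le> Z" using bounded_cont[OF z(1)] by blast
    have i: "integrable M (\<lambda>t. r t \<bullet> z t)" "integrable M (\<lambda>t. r t \<bullet> p t)"
      using integrable_inner_bounded(1)[OF r(1) measurable_cont[OF z(1)] Z(2)] integrable_inner_bounded(1)[OF r(1) measurable_cont[OF pc] P(2)] by auto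
    have "(LINT t|M. z t \<bullet> r t) - (LINT t|M. r t \<bullet> p t) = (LINT t|M. r t \<bullet> (z t - p t))"
      using i by (simp add: inner_diff_right inner_commute)
    also have "\<bar>\<dots>\<bar> \<le> 2 * \<delta> * (LINT t|M. norm (r t))"
      by (rule integrable_inner_bounded(2)[OF r(1) measurable_cont[OF zpc] z(2)])
    also have "\<dots> \<le> 2 * \<delta> * C'" using r(2) \<delta> by (intro mult_left_mono) auto
    finally show ?thesis .
  qed
  have eQ: "e / (8 * Q) > 0" using e Q by simp
  have "\<forall>\<^sub>F k in sequentially. norm ((LINT t|M. \<zeta>k k t \<bullet> y k t) - (LINT t|M. \<zeta> t \<bullet> Y t)) < e"
    using unif[OF \<delta>] prim[OF eQ]
  proof eventually_elim
    case (elim k)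
    have "norm (\<zeta>k k t - p t) \<le> 2 * \<delta>" if "t \<in> I" for t
    proof -
      have "norm (\<zeta>k k t - p t) \<le> norm (\<zeta>k k t - \<zeta> t) + norm (\<zeta> t - p t)"
        using norm_triangle_ineq[of "\<zeta>k k t - \<zeta> t" "\<zeta> t - p t"] by simp
      then show ?thesis using elim(1)[rule_format, OF that] p(2)[OF that] by simp
    qed
    then have 1: "\<bar>(LINT t|M. \<zeta>k k t \<bullet> y k t) - (LINT t|M. y k t \<bullet> p t)\<bar> \<le> 2 * \<delta> * C'"
      using y L1[of k] C' by (intro close \<zeta>k) (auto intro: order_trans)
    have "norm (\<zeta> t - p t) \<le> 2 * \<delta>" if "t \<in> I" for t using p(2)[OF that] \<delta> by simp
    then have 2: "\<bar>(LINT t|M. \<zeta> t \<bullet> Y t) - (LINT t|M. Y t \<bullet> p t)\<bar> \<le> 2 * \<delta> * C'"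
      using Y C' by (intro close \<zeta>) auto
    have 3: "\<bar>(LINT t|M. y k t \<bullet> p t) - (LINT t|M. Y t \<bullet> p t)\<bar> \<le> Q * (e / (8 * Q))"
      by (rule poly) (use e Q elim in auto)
    have 4: "Q * (e / (8 * Q)) = e / 8" using Q by simp
    have 5: "2 * \<delta> * C' = e / 4" using \<delta>C by simp
    show ?case using 1 2 3 4 5 e unfolding real_norm_def by linarith
  qed
  then show "\<exists>N. \<forall>k\<ge>N. norm ((LINT t|M. \<zeta>k k t \<bullet> y k t) - (LINT t|M. \<zeta> t \<bullet> Y t)) < e"
    by (auto simp: eventually_sequentially)
qed

end

context orlicz_setting
begin

text \<open>First \<open>Y\<close> is truncated, then the truncation is approximated by bounded continuous functions,
  subtracting the mean each time. All these functions have modulars dominated by an integrable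
  function, by \<open>G_add\<close>. The functional \<open>Q\<close> is arbitrary, so that one \<open>\<eta>\<close> can serve several
  approximations at once.\<close>

lemma continuous_dense_modular:
  fixes Q :: "(real \<Rightarrow> 'a) \<Rightarrow> real"
  assumes Y: "Y \<in> borel_measurable M" "integrable M (\<lambda>t. G (Y t))" "(LINT t|M. Y t) = 0"
    and Q: "\<And>vn v h. (\<And>n::nat. vn n \<in> borel_measurable M) \<Longrightarrow> v \<in> borel_measurable M \<Longrightarrow> integrable M (\<lambda>t. G (v t)) \<Longrightarrow>
      AE t in M. (\<lambda>n. vn n t) \<longlonglongrightarrow> v t \<Longrightarrow> integrable M h \<Longrightarrow> (\<And>n. AE t in M. G (vn n t) \<le> h t) \<Longrightarrow> (\<lambda>n. Q (vn n)) \<longlonglongrightarrow> Q v"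
    and "e > 0"
  obtains \<eta> where "continuous_on UNIV \<eta>" "(LINT t|M. \<eta> t) = 0" "\<bar>Q \<eta> - Q Y\<bar> < e"
proof -
  define mean where "mean f = (1 / (2 * T)) *\<^sub>R (LINT t|M. f t)" for f :: "real \<Rightarrow> 'a"
  have mean_lim: "(\<lambda>n. mean (fn n)) \<longlonglongrightarrow> mean f"
    if "\<And>n. fn n \<in> borel_measurable M" "f \<in> borel_measurable M" "AE t in M. (\<lambda>n. fn n t) \<longlonglongrightarrow> f t"
      "integrable M h" "\<And>n. AE t in M. norm (fn n t) \<le> h t" for fn :: "nat \<Rightarrow> real \<Rightarrow> 'a" and f and h :: "real \<Rightarrow> real"
    unfolding mean_def by (intro tendsto_intros integral_dominated_convergence[where w = h] that)
  have Yi: "integrable M Y" by (rule integrable_of_G[OF Y(1,2)])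
  define z where "z n t = (if norm (Y t) \<le> real n then Y t else 0)" for n t
  have zm: "z n \<in> borel_measurable M" for n unfolding z_def using Y(1) by measurable
  have zb: "norm (z n t) \<le> real n" for n t by (simp add: z_def)
  have zY: "norm (z n t) \<le> norm (Y t)" "G (z n t) \<le> G (Y t)" for n t using G_0 G_nonneg by (auto simp: z_def)
  have zlim: "(\<lambda>n. z n t) \<longlonglongrightarrow> Y t" for t
  proof (rule tendsto_eventually)
    obtain N :: nat where "norm (Y t) < real N" using reals_Archimedean2 by blast
    then show "\<forall>\<^sub>F n in sequentially. z n t = Y t"
      by (intro eventually_sequentiallyI[of N]) (auto simp: z_def)
  qed
  have mz: "(\<lambda>n. mean (z n)) \<longlonglongrightarrow> mean Y"
    by (rule mean_lim[of z Y "\<lambda>t. norm (Y t)"]) (use zm Y Yi zlim zY in auto)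
  have meanY: "mean Y = 0" using Y by (simp add: mean_def)
  have bounded_mean: "\<exists>B\<ge>0. \<forall>n. G (- mean (fn n)) \<le> B" if "(\<lambda>n. mean (fn n)) \<longlonglongrightarrow> m" for fn :: "nat \<Rightarrow> real \<Rightarrow> 'a" and m
  proof -
    have "Bseq (\<lambda>n. mean (fn n))" using that convergentI convergent_imp_Bseq by blast
    then obtain K where K: "\<And>n. norm (mean (fn n)) \<le> K" unfolding Bseq_def by blast
    obtain B where "B \<ge> 0" "\<And>v::'a. norm v \<le> K \<Longrightarrow> G v \<le> B" using G_bounded by blast
    then show ?thesis using K by (intro exI[of _ B]) auto
  qed
  obtain B where B: "B \<ge> 0" "\<And>n. G (- mean (z n)) \<le> B" using bounded_mean[OF mz] by blast
  have "(\<lambda>n. Q (\<lambda>t. z n t - mean (z n))) \<longlonglongrightarrow> Q Y"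
  proof (rule Q[of "\<lambda>n t. z n t - mean (z n)" Y "\<lambda>t. CD * (1 + G (Y t) + B)"])
    show "(\<lambda>t. z n t - mean (z n)) \<in> borel_measurable M" for n using zm by measurable
    show "AE t in M. (\<lambda>n. z n t - mean (z n)) \<longlonglongrightarrow> Y t"
      using tendsto_diff[OF zlim mz] by (simp add: meanY)
    show "AE t in M. G (z n t - mean (z n)) \<le> CD * (1 + G (Y t) + B)" for n
    proof (rule AE_I2)
      fix t
      have "G (z n t - mean (z n)) \<le> CD * (1 + G (z n t) + G (- mean (z n)))" using G_add[of "z n t" "- mean (z n)"] by simp
      also have "\<dots> \<le> CD * (1 + G (Y t) + B)" using CD(1) zY B by (intro mult_left_mono add_mono) auto
      finally show "G (z n t - mean (z n)) \<le> CD * (1 + G (Y t) + B)" .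
    qed
  qed (use Y in auto)
  then have "\<forall>\<^sub>F n in sequentially. dist (Q (\<lambda>t. z n t - mean (z n))) (Q Y) < e / 2"
    using \<open>e > 0\<close> by (intro tendstoD) auto
  then have "\<forall>\<^sub>F n in sequentially. dist (Q (\<lambda>t. z n t - mean (z n))) (Q Y) < e / 2 \<and> n \<ge> 1"
    using eventually_ge_at_top[of 1] by eventually_elim simp
  then obtain n where n: "dist (Q (\<lambda>t. z n t - mean (z n))) (Q Y) < e / 2" "n \<ge> 1" by (auto simp: eventually_sequentially)
  obtain g where g: "\<And>j::nat. continuous_on UNIV (g j)" "\<And>j t. norm (g j t) \<le> real n" "AE t in M. (\<lambda>j. g j t) \<longlonglongrightarrow> z n t"
    using bounded_measurable_limit_continuous[OF zm[of n], of "real n"] zb n(2) by auto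
  have gm: "g j \<in> borel_measurable M" for j
    using g(1)[of j] continuous_on_subset by (intro measurable_cont) blast
  have mg: "(\<lambda>j. mean (g j)) \<longlonglongrightarrow> mean (z n)"
    by (rule mean_lim[of g "z n" "\<lambda>t. real n"]) (use gm zm g in auto)
  obtain B' where B': "B' \<ge> 0" "\<And>j. G (- mean (g j)) \<le> B'" using bounded_mean[OF mg] by blast
  obtain Bn where Bn: "Bn \<ge> 0" "\<And>v::'a. norm v \<le> real n \<Longrightarrow> G v \<le> Bn" using G_bounded by blast
  have "(\<lambda>j. Q (\<lambda>t. g j t - mean (g j))) \<longlonglongrightarrow> Q (\<lambda>t. z n t - mean (z n))"
  proof (rule Q[of "\<lambda>j t. g j t - mean (g j)" "\<lambda>t. z n t - mean (z n)" "\<lambda>t. CD * (1 + Bn + B')"])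
    show "(\<lambda>t. g j t - mean (g j)) \<in> borel_measurable M" for j using gm by measurable
    show zmm: "(\<lambda>t. z n t - mean (z n)) \<in> borel_measurable M" using zm by measurable
    show "integrable M (\<lambda>t. G (z n t - mean (z n)))"
    proof -
      obtain Bz where Bz: "Bz \<ge> 0" "\<And>v::'a. norm v \<le> real n + norm (mean (z n)) \<Longrightarrow> G v \<le> Bz" using G_bounded by blast
      have "norm (z n t - mean (z n)) \<le> real n + norm (mean (z n))" for t
        using norm_triangle_ineq4[of "z n t" "mean (z n)"] zb[of n t] by simp
      then show ?thesis using Bz G_nonneg by (intro integrable_bounded[of _ Bz] measurable_G[OF zmm]) auto
    qed
    show "AE t in M. (\<lambda>j. g j t - mean (g j)) \<longlonglongrightarrow> z n t - mean (z n)"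
      using g(3) by eventually_elim (intro tendsto_intros mg)
    show "AE t in M. G (g j t - mean (g j)) \<le> CD * (1 + Bn + B')" for j
    proof (rule AE_I2)
      fix t
      have "G (g j t - mean (g j)) \<le> CD * (1 + G (g j t) + G (- mean (g j)))" using G_add[of "g j t" "- mean (g j)"] by simp
      also have "\<dots> \<le> CD * (1 + Bn + B')" using CD(1) Bn B' g(2) by (intro mult_left_mono add_mono) auto
      finally show "G (g j t - mean (g j)) \<le> CD * (1 + Bn + B')" .
    qed
  qed auto
  then have "\<forall>\<^sub>F j in sequentially. dist (Q (\<lambda>t. g j t - mean (g j))) (Q (\<lambda>t. z n t - mean (z n))) < e / 2"
    using \<open>e > 0\<close> by (intro tendstoD) auto
  then obtain j where j: "dist (Q (\<lambda>t. g j t - mean (g j))) (Q (\<lambda>t. z n t - mean (z n))) < e / 2" by (auto simp: eventually_sequentially)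
  show thesis
  proof (rule that[of "\<lambda>t. g j t - mean (g j)"])
    show "continuous_on UNIV (\<lambda>t. g j t - mean (g j))" by (intro continuous_intros g)
    have "integrable M (g j)" by (rule integrable_bounded[OF gm g(2)])
    then show "(LINT t|M. g j t - mean (g j)) = 0" using T_pos by (simp add: mean_def)
    show "\<bar>Q (\<lambda>t. g j t - mean (g j)) - Q Y\<bar> < e" using n(1) j unfolding dist_real_def by linarith
  qed
qed

end

section \<open>Kinetic energies controlled by a G-function\<close>

text \<open>The data of the kinetic term. Derivatives are given as separate functions \<open>Fx\<close> and \<open>Fv\<close> in
  order to keep the arguments free of \<open>grad\<close>.\<close>

locale lagrangian = orlicz_setting T G for T :: real and G :: "'a::euclidean_space \<Rightarrow> real" +
  fixes F :: "real \<Rightarrow> 'a \<Rightarrow> 'a \<Rightarrow> real" and Fx Fv :: "real \<Rightarrow> 'a \<Rightarrow> 'a \<Rightarrow> 'a"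
    and a \<beta> :: "real \<Rightarrow> real" and \<Lambda> :: real
  assumes F_jcont: "jcont F" and Fx_jcont: "jcont Fx" and Fv_jcont: "jcont Fv"
    and F_deriv: "\<And>t x v. t \<in> I \<Longrightarrow>
      ((\<lambda>p. F t (fst p) (snd p)) has_derivative (\<lambda>h. Fx t x v \<bullet> fst h + Fv t x v \<bullet> snd h)) (at (x, v))"
    and F_convex: "\<And>t x. t \<in> I \<Longrightarrow> convex_on UNIV (F t x)"
    and a_cont: "continuous_on {0..} a" and a_nonneg: "\<And>s. s \<ge> 0 \<Longrightarrow> a s \<ge> 0"
    and \<beta>_int: "integrable M \<beta>" and \<beta>_nonneg: "\<And>t. t \<in> I \<Longrightarrow> \<beta> t \<ge> 0"
    and F_bound: "\<And>t x v. t \<in> I \<Longrightarrow> \<bar>F t x v\<bar> \<le> a (norm x) * (\<beta> t + G v)"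
    and Fx_bound: "\<And>t x v. t \<in> I \<Longrightarrow> norm (Fx t x v) \<le> a (norm x) * (\<beta> t + G v)"
    and \<Lambda>: "\<Lambda> > 0" and F_lower: "\<And>t x v. t \<in> I \<Longrightarrow> \<Lambda> * G v \<le> F t x v"
begin

lemma F_nonneg: "t \<in> I \<Longrightarrow> 0 \<le> F t x v"
  using F_lower[of t v x] mult_nonneg_nonneg[OF less_imp_le[OF \<Lambda>] G_nonneg[of v]] by linarith

lemma F_line:
  assumes t: "t \<in> I"
  shows "((\<lambda>s. F t (x + s *\<^sub>R h) (v + s *\<^sub>R k)) has_real_derivative
    Fx t (x + r *\<^sub>R h) (v + r *\<^sub>R k) \<bullet> h + Fv t (x + r *\<^sub>R h) (v + r *\<^sub>R k) \<bullet> k) (at r)"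
proof -
  have c: "((\<lambda>s. (x + s *\<^sub>R h, v + s *\<^sub>R k)) has_derivative (\<lambda>s. (s *\<^sub>R h, s *\<^sub>R k))) (at r)"
    by (auto intro!: derivative_eq_intros)
  from has_derivative_compose[OF c F_deriv[OF t]]
  have "((\<lambda>s. F t (x + s *\<^sub>R h) (v + s *\<^sub>R k)) has_derivative
    (\<lambda>s. Fx t (x + r *\<^sub>R h) (v + r *\<^sub>R k) \<bullet> (s *\<^sub>R h) + Fv t (x + r *\<^sub>R h) (v + r *\<^sub>R k) \<bullet> (s *\<^sub>R k))) (at r)" by simp
  then show ?thesis unfolding has_field_derivative_def
    by (rule has_derivative_eq_rhs) (auto simp: fun_eq_iff algebra_simps)
qed

lemma F_subgradient: "t \<in> I \<Longrightarrow> F t x v + Fv t x v \<bullet> (w - v) \<le> F t x w"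
  using convex_subgradient[OF F_convex[of t x], of v w "Fv t x v \<bullet> (w - v)"] F_line[of t x 0 v "w - v" 0] by simp

text \<open>The common majorant of \<open>F\<close> and its derivatives for bounded \<open>x\<close>; the summand 1 makes it at
  least 1, so that it also absorbs constants.\<close>

definition Bd :: "real \<Rightarrow> 'a \<Rightarrow> real" where "Bd t v = \<beta> t + 1 + G v"

lemma Bd_pos: "t \<in> I \<Longrightarrow> Bd t v \<ge> 1"
  using \<beta>_nonneg G_nonneg[of v] by (simp add: Bd_def)

lemma Bd_add: "t \<in> I \<Longrightarrow> Bd t (v + w) \<le> CD * (2 + G w) * Bd t v"
proof -
  assume t: "t \<in> I"
  have "\<beta> t + 1 \<le> CD * (\<beta> t + 1)" using CD(1) \<beta>_nonneg[OF t] by (simp add: mult_le_cancel_right1)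
  also have "\<dots> \<le> CD * Bd t v" using CD(1) G_nonneg[of v] by (intro mult_left_mono) (auto simp: Bd_def)
  finally have a: "\<beta> t + 1 \<le> CD * Bd t v" .
  have "G (v + w) \<le> CD * (1 + G v + G w)" by (rule G_add)
  also have "\<dots> \<le> CD * ((1 + G w) * Bd t v)"
  proof (rule mult_left_mono)
    have "(1 + G w) * (1 + G v) \<le> (1 + G w) * Bd t v"
      using G_nonneg[of w] \<beta>_nonneg[OF t] by (intro mult_left_mono) (auto simp: Bd_def)
    then show "1 + G v + G w \<le> (1 + G w) * Bd t v"
      using mult_nonneg_nonneg[OF G_nonneg[of w] G_nonneg[of v]] by (simp add: algebra_simps)
  qed (use CD(1) in simp)
  finally show ?thesis using a by (simp add: Bd_def[of t "v + w"] algebra_simps)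
qed

text \<open>By convexity the length of \<open>Fv t x v\<close> is at most the value of \<open>F t x\<close> one unit step away
  from \<open>v\<close> in the direction of \<open>Fv t x v\<close>, and \<open>\<Delta>\<^sub>2\<close> absorbs the unit step.\<close>

lemma growth:
  obtains C where "C \<ge> 0"
    "\<And>t x v. t \<in> I \<Longrightarrow> norm x \<le> R \<Longrightarrow> \<bar>F t x v\<bar> \<le> C * Bd t v"
    "\<And>t x v. t \<in> I \<Longrightarrow> norm x \<le> R \<Longrightarrow> norm (Fx t x v) \<le> C * Bd t v"
    "\<And>t x v. t \<in> I \<Longrightarrow> norm x \<le> R \<Longrightarrow> norm (Fv t x v) \<le> C * Bd t v"
proof -
  have "compact (a ` {0..max R 0})" by (intro compact_continuous_image continuous_on_subset[OF a_cont]) auto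
  from compact_imp_bounded[OF this]
  obtain A where A: "A > 0" "\<forall>s\<in>a ` {0..max R 0}. norm s \<le> A" unfolding bounded_pos by blast
  have aA: "a (norm x) \<le> A" if "norm x \<le> R" for x :: 'a
  proof -
    have "norm (a (norm x)) \<le> A" using that by (intro A(2)[rule_format] imageI) auto
    then show ?thesis by simp
  qed
  obtain B1 where B1: "B1 \<ge> 0" "\<And>v::'a. norm v \<le> 1 \<Longrightarrow> G v \<le> B1" using G_bounded by blast
  define C where "C = A * (CD * (2 + B1))"
  have k1: "1 * 1 \<le> CD * (2 + B1)" using CD(1) B1 by (intro mult_mono) auto
  then have AC: "A \<le> C" using A mult_left_mono[of 1 "CD * (2 + B1)" A] by (simp add: C_def)
  have base: "a (norm x) * (\<beta> t + G v) \<le> A * Bd t v" if "t \<in> I" "norm x \<le> R" for t and x v :: 'a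
    using aA[OF that(2)] A \<beta>_nonneg[OF that(1)] G_nonneg[of v] by (intro mult_mono) (auto simp: Bd_def)
  have base': "A * Bd t v \<le> C * Bd t v" if "t \<in> I" for t v
    using AC Bd_pos[OF that, of v] by (intro mult_right_mono) auto
  show thesis
  proof (rule that[of C])
    show "C \<ge> 0" using A AC by simp
    fix t and x v :: 'a assume t: "t \<in> I" and x: "norm x \<le> R"
    show "\<bar>F t x v\<bar> \<le> C * Bd t v" using F_bound[OF t, of x v] base[OF t x, of v] base'[OF t, of v] by linarith
    show "norm (Fx t x v) \<le> C * Bd t v" using Fx_bound[OF t, of x v] base[OF t x, of v] base'[OF t, of v] by linarith
    define e where "e = sgn (Fv t x v)"
    have "norm (Fv t x v) = Fv t x v \<bullet> e"
      by (cases "Fv t x v = 0") (simp_all add: e_def sgn_div_norm dot_square_norm power2_eq_square)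
    also have "\<dots> \<le> F t x (v + e)" using F_subgradient[OF t, of x v "v + e"] F_nonneg[OF t, of x v] by simp
    also have "\<dots> \<le> A * Bd t (v + e)" using F_bound[OF t, of x "v + e"] base[OF t x, of "v + e"] by linarith
    also have "\<dots> \<le> A * (CD * (2 + G e) * Bd t v)" using A by (intro mult_left_mono Bd_add[OF t]) auto
    also have "\<dots> \<le> A * (CD * (2 + B1) * Bd t v)"
      using A B1(2)[of e] CD(1) Bd_pos[OF t, of v]
      by (intro mult_left_mono mult_right_mono add_left_mono) (auto simp: e_def norm_sgn)
    finally show "norm (Fv t x v) \<le> C * Bd t v" by (simp add: C_def mult.assoc)
  qed
qed

text \<open>Curve and slope are independent of each other here, because the energy is also evaluated at
  pairs in which the second component is not the derivative of the first.\<close>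

definition adm :: "real \<Rightarrow> (real \<Rightarrow> 'a) \<Rightarrow> (real \<Rightarrow> 'a) \<Rightarrow> bool" where
  "adm R u y \<longleftrightarrow> u \<in> borel_measurable M \<and> y \<in> borel_measurable M \<and> (\<forall>t\<in>I. norm (u t) \<le> R) \<and> integrable M (\<lambda>t. G (y t))"

lemma integrable_Bd: "integrable M (\<lambda>t. G (y t)) \<Longrightarrow> integrable M (\<lambda>t. Bd t (y t))"
  unfolding Bd_def using \<beta>_int by simp

lemma integrable_Bd_bound:
  fixes h :: "real \<Rightarrow> 'b::euclidean_space"
  assumes "integrable M (\<lambda>t. G (y t))" "h \<in> borel_measurable M" "\<And>t. t \<in> I \<Longrightarrow> norm (h t) \<le> C * Bd t (y t)"
  shows "integrable M h" "(LINT t|M. norm (h t)) \<le> C * (LINT t|M. Bd t (y t))"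
proof -
  have i: "integrable M (\<lambda>t. C * Bd t (y t))" using integrable_Bd[OF assms(1)] by simp
  show h: "integrable M h"
    by (rule Bochner_Integration.integrable_bound[OF i])
      (use assms in \<open>auto intro!: AE_I2 simp: space_M intro: order_trans[OF _ abs_ge_self]\<close>)
  have "(LINT t|M. norm (h t)) \<le> (LINT t|M. C * Bd t (y t))"
    using i h assms(3) by (intro integral_mono) (auto simp: space_M)
  then show "(LINT t|M. norm (h t)) \<le> C * (LINT t|M. Bd t (y t))" by simp
qed

lemma adm_integrable:
  assumes "adm R u y"
  shows "integrable M (\<lambda>t. F t (u t) (y t))" "integrable M (\<lambda>t. Fx t (u t) (y t))" "integrable M (\<lambda>t. Fv t (u t) (y t))"
proof -
  obtain C where C: "C \<ge> 0"
    "\<And>t x v. t \<in> I \<Longrightarrow> norm x \<le> R \<Longrightarrow> \<bar>F t x v\<bar> \<le> C * Bd t v"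
    "\<And>t x v. t \<in> I \<Longrightarrow> norm x \<le> R \<Longrightarrow> norm (Fx t x v) \<le> C * Bd t v"
    "\<And>t x v. t \<in> I \<Longrightarrow> norm x \<le> R \<Longrightarrow> norm (Fv t x v) \<le> C * Bd t v" using growth by blast
  have u: "u \<in> borel_measurable M" "y \<in> borel_measurable M" "\<And>t. t \<in> I \<Longrightarrow> norm (u t) \<le> R" "integrable M (\<lambda>t. G (y t))"
    using assms by (auto simp: adm_def)
  show "integrable M (\<lambda>t. F t (u t) (y t))" using C(2) u
    by (intro integrable_Bd_bound(1)[OF u(4), of _ C] jcont_measurable[OF F_jcont]) auto
  show "integrable M (\<lambda>t. Fx t (u t) (y t))" using C(3) u
    by (intro integrable_Bd_bound(1)[OF u(4), of _ C] jcont_measurable[OF Fx_jcont]) auto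
  show "integrable M (\<lambda>t. Fv t (u t) (y t))" using C(4) u
    by (intro integrable_Bd_bound(1)[OF u(4), of _ C] jcont_measurable[OF Fv_jcont]) auto
qed

text \<open>The integrand of the first variation of the energy at \<open>(u, y)\<close> in the direction \<open>(\<phi>, \<eta>)\<close>.\<close>

definition dF :: "(real \<Rightarrow> 'a) \<Rightarrow> (real \<Rightarrow> 'a) \<Rightarrow> (real \<Rightarrow> 'a) \<Rightarrow> (real \<Rightarrow> 'a) \<Rightarrow> real \<Rightarrow> real" where
  "dF u y \<phi> \<eta> t = Fx t (u t) (y t) \<bullet> \<phi> t + Fv t (u t) (y t) \<bullet> \<eta> t"

lemma integrable_inner_cont:
  fixes r :: "real \<Rightarrow> 'a"
  assumes "integrable M r" "continuous_on I \<phi>"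
  shows "integrable M (\<lambda>t. r t \<bullet> \<phi> t)"
proof -
  obtain C where "C \<ge> 0" "\<And>t. t \<in> I \<Longrightarrow> norm (\<phi> t) \<le> C" using bounded_cont[OF assms(2)] by blast
  then show ?thesis by (intro integrable_inner_bounded(1)[OF assms(1) measurable_cont[OF assms(2)]])
qed

lemma integrable_dF: "adm R u y \<Longrightarrow> continuous_on I \<phi> \<Longrightarrow> continuous_on I \<eta> \<Longrightarrow> integrable M (dF u y \<phi> \<eta>)"
  unfolding dF_def[abs_def] by (intro Bochner_Integration.integrable_add integrable_inner_cont adm_integrable)

lemma adm_shift:
  assumes uy: "adm R u y" and \<phi>: "continuous_on I \<phi>" "\<And>t. t \<in> I \<Longrightarrow> norm (\<phi> t) \<le> H" and \<eta>: "continuous_on I \<eta>"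
  shows "adm (R + H) (\<lambda>t. u t + \<phi> t) (\<lambda>t. y t + \<eta> t)"
proof -
  obtain E where E: "\<And>t. t \<in> I \<Longrightarrow> norm (\<eta> t) \<le> E" using bounded_cont[OF \<eta>] by blast
  obtain B where B: "B \<ge> 0" "\<And>v::'a. norm v \<le> E \<Longrightarrow> G v \<le> B" using G_bounded by blast
  have u: "u \<in> borel_measurable M" "y \<in> borel_measurable M" "\<And>t. t \<in> I \<Longrightarrow> norm (u t) \<le> R" "integrable M (\<lambda>t. G (y t))"
    using uy by (auto simp: adm_def)
  have m: "(\<lambda>t. y t + \<eta> t) \<in> borel_measurable M" "(\<lambda>t. u t + \<phi> t) \<in> borel_measurable M"
    using u measurable_cont[OF \<phi>(1)] measurable_cont[OF \<eta>] by measurable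
  have "integrable M (\<lambda>t. CD * (1 + G (y t) + B))" using u by simp
  then have "integrable M (\<lambda>t. G (y t + \<eta> t))"
  proof (rule Bochner_Integration.integrable_bound)
    show "AE t in M. norm (G (y t + \<eta> t)) \<le> norm (CD * (1 + G (y t) + B))"
    proof (rule AE_I2)
      fix t assume "t \<in> space M"
      then have "G (\<eta> t) \<le> B" using E B by (simp add: space_M)
      have "G (y t + \<eta> t) \<le> CD * (1 + G (y t) + G (\<eta> t))" by (rule G_add)
      also have "\<dots> \<le> CD * (1 + G (y t) + B)" using \<open>G (\<eta> t) \<le> B\<close> CD(1) by (intro mult_left_mono) auto
      finally show "norm (G (y t + \<eta> t)) \<le> norm (CD * (1 + G (y t) + B))" using G_nonneg[of "y t + \<eta> t"] by simp
    qed
  qed (rule measurable_G[OF m(1)])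
  moreover have "norm (u t + \<phi> t) \<le> R + H" if "t \<in> I" for t
    using norm_triangle_ineq[of "u t" "\<phi> t"] u(3)[OF that] \<phi>(2)[OF that] by linarith
  ultimately show ?thesis using m by (simp add: adm_def)
qed

text \<open>Smallness of the integral of \<open>tail R y\<close>, uniformly in a family of slopes \<open>y\<close>, for large \<open>R\<close>
  expresses equi-integrability of their modulars.\<close>

definition tail :: "real \<Rightarrow> (real \<Rightarrow> 'a) \<Rightarrow> real \<Rightarrow> real" where
  "tail R y t = (if norm (y t) > R then Bd t (y t) else 0)"

lemma integrable_tail: "adm R u y \<Longrightarrow> integrable M (tail R' y)"
proof -
  assume uy: "adm R u y"
  have m: "y \<in> borel_measurable M" "\<beta> \<in> borel_measurable M" using uy \<beta>_int by (auto simp: adm_def)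
  have "integrable M (\<lambda>t. Bd t (y t))" using uy integrable_Bd by (simp add: adm_def)
  moreover have "tail R' y \<in> borel_measurable M"
    unfolding tail_def[abs_def] Bd_def using m measurable_G[OF m(1)] by measurable
  ultimately show ?thesis
    by (rule Bochner_Integration.integrable_bound) (auto simp: tail_def)
qed

text \<open>Where the slope is at most \<open>R'\<close>, the derivatives of \<open>F\<close> are uniformly continuous and the
  difference quotients converge uniformly. Where it is larger, everything is dominated by a
  multiple of \<open>Bd\<close>. The rate of differentiability thus depends on the pair \<open>(u, y)\<close> through the
  integral of its tail only.\<close>

lemma uniform_differentiability:
  assumes \<phi>: "continuous_on I \<phi>" and \<eta>: "continuous_on I \<eta>"
  obtains C where "C \<ge> 0"
    "\<And>\<epsilon> R'. \<epsilon> > 0 \<Longrightarrow> \<exists>s0>0. \<forall>s u y. \<bar>s\<bar> \<le> s0 \<longrightarrow> adm R u y \<longrightarrow>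
      \<bar>(LINT t|M. F t (u t + s *\<^sub>R \<phi> t) (y t + s *\<^sub>R \<eta> t)) - (LINT t|M. F t (u t) (y t)) - s * (LINT t|M. dF u y \<phi> \<eta> t)\<bar>
        \<le> \<bar>s\<bar> * (\<epsilon> + C * (LINT t|M. tail R' y t))"
proof -
  obtain H1 where H1: "H1 \<ge> 0" "\<And>t. t \<in> I \<Longrightarrow> norm (\<phi> t) \<le> H1" using bounded_cont[OF \<phi>] by blast
  obtain H2 where H2: "H2 \<ge> 0" "\<And>t. t \<in> I \<Longrightarrow> norm (\<eta> t) \<le> H2" using bounded_cont[OF \<eta>] by blast
  define H where "H = max H1 H2"
  have H: "H \<ge> 0" "\<And>t. t \<in> I \<Longrightarrow> norm (\<phi> t) \<le> H" "\<And>t. t \<in> I \<Longrightarrow> norm (\<eta> t) \<le> H"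
    using H1 H2 by (auto simp: H_def le_max_iff_disj)
  obtain C where C: "C \<ge> 0"
    "\<And>t x v. t \<in> I \<Longrightarrow> norm x \<le> R + H \<Longrightarrow> \<bar>F t x v\<bar> \<le> C * Bd t v"
    "\<And>t x v. t \<in> I \<Longrightarrow> norm x \<le> R + H \<Longrightarrow> norm (Fx t x v) \<le> C * Bd t v"
    "\<And>t x v. t \<in> I \<Longrightarrow> norm x \<le> R + H \<Longrightarrow> norm (Fv t x v) \<le> C * Bd t v" using growth by blast
  obtain BH where BH: "BH \<ge> 0" "\<And>v::'a. norm v \<le> H \<Longrightarrow> G v \<le> BH" using G_bounded by blast
  define K where "K = CD * (2 + BH)"
  have K: "K \<ge> 1" using mult_mono[of 1 CD 1 "2 + BH"] CD(1) BH by (simp add: K_def)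
  define C3 where "C3 = 4 * H * C * K"
  have C3: "C3 \<ge> 0" using H C K by (simp add: C3_def)
  define g where "g t x v r = Fx t (x + r *\<^sub>R \<phi> t) (v + r *\<^sub>R \<eta> t) \<bullet> \<phi> t + Fv t (x + r *\<^sub>R \<phi> t) (v + r *\<^sub>R \<eta> t) \<bullet> \<eta> t" for t x v r
  have gb: "\<bar>g t x v r\<bar> \<le> 2 * H * C * K * Bd t v" if t: "t \<in> I" and x: "norm x \<le> R" and r: "\<bar>r\<bar> \<le> 1" for t x v r
  proof -
    have rH: "norm (r *\<^sub>R \<phi> t) \<le> H" "norm (r *\<^sub>R \<eta> t) \<le> H"
      using mult_mono[OF r H(2)[OF t]] mult_mono[OF r H(3)[OF t]] by auto
    have xr: "norm (x + r *\<^sub>R \<phi> t) \<le> R + H" using norm_triangle_ineq[of x "r *\<^sub>R \<phi> t"] x rH by linarith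
    have "Bd t (v + r *\<^sub>R \<eta> t) \<le> CD * (2 + G (r *\<^sub>R \<eta> t)) * Bd t v" by (rule Bd_add[OF t])
    also have "\<dots> \<le> K * Bd t v" unfolding K_def
      using BH(2)[OF rH(2)] CD(1) Bd_pos[OF t, of v] by (intro mult_right_mono mult_left_mono) auto
    finally have bd: "C * Bd t (v + r *\<^sub>R \<eta> t) \<le> C * (K * Bd t v)" using C by (intro mult_left_mono)
    have "\<bar>Fx t (x + r *\<^sub>R \<phi> t) (v + r *\<^sub>R \<eta> t) \<bullet> \<phi> t\<bar> \<le> norm (Fx t (x + r *\<^sub>R \<phi> t) (v + r *\<^sub>R \<eta> t)) * norm (\<phi> t)"
      by (rule Cauchy_Schwarz_ineq2)
    also have "\<dots> \<le> (C * (K * Bd t v)) * H"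
      using order_trans[OF C(3)[OF t xr] bd] H t by (intro mult_mono) (auto intro: order_trans[OF norm_ge_zero])
    finally have 1: "\<bar>Fx t (x + r *\<^sub>R \<phi> t) (v + r *\<^sub>R \<eta> t) \<bullet> \<phi> t\<bar> \<le> (C * (K * Bd t v)) * H" .
    have "\<bar>Fv t (x + r *\<^sub>R \<phi> t) (v + r *\<^sub>R \<eta> t) \<bullet> \<eta> t\<bar> \<le> norm (Fv t (x + r *\<^sub>R \<phi> t) (v + r *\<^sub>R \<eta> t)) * norm (\<eta> t)"
      by (rule Cauchy_Schwarz_ineq2)
    also have "\<dots> \<le> (C * (K * Bd t v)) * H"
      using order_trans[OF C(4)[OF t xr] bd] H t by (intro mult_mono) (auto intro: order_trans[OF norm_ge_zero])
    finally have 2: "\<bar>Fv t (x + r *\<^sub>R \<phi> t) (v + r *\<^sub>R \<eta> t) \<bullet> \<eta> t\<bar> \<le> (C * (K * Bd t v)) * H" .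
    have "2 * H * C * K * Bd t v = (C * (K * Bd t v)) * H + (C * (K * Bd t v)) * H" by simp
    then show ?thesis using 1 2 abs_triangle_ineq unfolding g_def by (smt (verit))
  qed
  show thesis
  proof (rule that[OF C3])
    fix \<epsilon> R' :: real assume \<epsilon>: "\<epsilon> > 0"
    define e1 where "e1 = \<epsilon> / (4 * T * (H + 1))"
    have e1: "e1 > 0" using \<epsilon> T_pos H by (simp add: e1_def)
    obtain d1 where d1: "d1 > 0" "\<And>t x x' v v'. t \<in> I \<Longrightarrow> norm x \<le> R + H \<Longrightarrow> norm x' \<le> R + H \<Longrightarrow> norm v \<le> R' + H \<Longrightarrow> norm v' \<le> R' + H \<Longrightarrow>
      norm (x - x') < d1 \<Longrightarrow> norm (v - v') < d1 \<Longrightarrow> norm (Fx t x v - Fx t x' v') < e1" using jcont_uniform[OF Fx_jcont e1] by blast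
    obtain d2 where d2: "d2 > 0" "\<And>t x x' v v'. t \<in> I \<Longrightarrow> norm x \<le> R + H \<Longrightarrow> norm x' \<le> R + H \<Longrightarrow> norm v \<le> R' + H \<Longrightarrow> norm v' \<le> R' + H \<Longrightarrow>
      norm (x - x') < d2 \<Longrightarrow> norm (v - v') < d2 \<Longrightarrow> norm (Fv t x v - Fv t x' v') < e1" using jcont_uniform[OF Fv_jcont e1] by blast
    define s0 where "s0 = min 1 (min d1 d2 / (2 * (H + 1)))"
    have s0: "s0 > 0" "s0 \<le> 1" using d1 d2 H by (auto simp: s0_def)
    have s0H: "s0 * H < d1" "s0 * H < d2"
    proof -
      have "s0 * H \<le> min d1 d2 / (2 * (H + 1)) * H" using H by (intro mult_right_mono) (auto simp: s0_def)
      also have "\<dots> < min d1 d2"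
      proof -
        have "m / (2 * (H + 1)) * H < m" if "m > 0" for m :: real
        proof -
          have "m * H < m * (2 * (H + 1))" using H(1) that by (intro mult_strict_left_mono) auto
          then show ?thesis using H(1) by (simp add: pos_divide_less_eq)
        qed
        moreover have "min d1 d2 > 0" using d1(1) d2(1) by simp
        ultimately show ?thesis by blast
      qed
      finally show "s0 * H < d1" "s0 * H < d2" by auto
    qed
    have small: "\<bar>g t x v r - g t x v 0\<bar> \<le> \<epsilon> / (2 * T)"
      if t: "t \<in> I" and x: "norm x \<le> R" and v: "norm v \<le> R'" and r: "\<bar>r\<bar> \<le> s0" for t x v r
    proof -
      have rH: "norm (r *\<^sub>R \<phi> t) \<le> s0 * H" "norm (r *\<^sub>R \<eta> t) \<le> s0 * H"
        using mult_mono[OF r H(2)[OF t]] mult_mono[OF r H(3)[OF t]] s0 by auto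
      have rH': "s0 * H \<le> H" using s0 H by (simp add: mult_left_le_one_le)
      have b: "norm (x + r *\<^sub>R \<phi> t) \<le> R + H" "norm (v + r *\<^sub>R \<eta> t) \<le> R' + H" "norm x \<le> R + H" "norm v \<le> R' + H"
        using norm_triangle_ineq[of x "r *\<^sub>R \<phi> t"] norm_triangle_ineq[of v "r *\<^sub>R \<eta> t"] x v rH rH' H(1) by linarith+
      have 1: "norm (Fx t (x + r *\<^sub>R \<phi> t) (v + r *\<^sub>R \<eta> t) - Fx t x v) < e1"
        using rH s0H b by (intro d1(2) t) auto
      have 2: "norm (Fv t (x + r *\<^sub>R \<phi> t) (v + r *\<^sub>R \<eta> t) - Fv t x v) < e1"
        using rH s0H b by (intro d2(2) t) auto
      have eq: "g t x v r - g t x v 0 = (Fx t (x + r *\<^sub>R \<phi> t) (v + r *\<^sub>R \<eta> t) - Fx t x v) \<bullet> \<phi> t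
          + (Fv t (x + r *\<^sub>R \<phi> t) (v + r *\<^sub>R \<eta> t) - Fv t x v) \<bullet> \<eta> t" by (simp add: g_def inner_diff_left)
      have "\<bar>g t x v r - g t x v 0\<bar> \<le> norm (Fx t (x + r *\<^sub>R \<phi> t) (v + r *\<^sub>R \<eta> t) - Fx t x v) * norm (\<phi> t)
          + norm (Fv t (x + r *\<^sub>R \<phi> t) (v + r *\<^sub>R \<eta> t) - Fv t x v) * norm (\<eta> t)"
        unfolding eq by (intro order_trans[OF abs_triangle_ineq] add_mono Cauchy_Schwarz_ineq2)
      also have "\<dots> \<le> e1 * H + e1 * H" using 1 2 H(2,3)[OF t] e1 by (intro add_mono mult_mono) auto
      also have "\<dots> \<le> \<epsilon> / (2 * T)"
      proof -
        have "e1 * H \<le> e1 * (H + 1)" using e1 by simp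
        also have "\<dots> = \<epsilon> / (4 * T)" using H by (simp add: e1_def)
        finally have "e1 * H \<le> \<epsilon> / (4 * T)" .
        moreover have "\<epsilon> / (2 * T) = \<epsilon> / (4 * T) + \<epsilon> / (4 * T)" by simp
        ultimately show ?thesis by linarith
      qed
      finally show ?thesis .
    qed
    show "\<exists>s0>0. \<forall>s u y. \<bar>s\<bar> \<le> s0 \<longrightarrow> adm R u y \<longrightarrow>
      \<bar>(LINT t|M. F t (u t + s *\<^sub>R \<phi> t) (y t + s *\<^sub>R \<eta> t)) - (LINT t|M. F t (u t) (y t)) - s * (LINT t|M. dF u y \<phi> \<eta> t)\<bar>
        \<le> \<bar>s\<bar> * (\<epsilon> + C3 * (LINT t|M. tail R' y t))"
    proof (intro exI[of _ s0] conjI allI impI)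
      fix s u y assume s: "\<bar>s\<bar> \<le> s0" and uy: "adm R u y"
      have uR: "norm (u t) \<le> R" if "t \<in> I" for t using uy that by (simp add: adm_def)
      have pw: "\<bar>F t (u t + s *\<^sub>R \<phi> t) (y t + s *\<^sub>R \<eta> t) - F t (u t) (y t) - s * dF u y \<phi> \<eta> t\<bar>
          \<le> \<bar>s\<bar> * (\<epsilon> / (2 * T) + C3 * tail R' y t)" if t: "t \<in> I" for t
      proof -
        have "\<exists>\<theta>::real. \<theta> > 0 \<and> \<theta> < 1 \<and> F t (u t + 1 *\<^sub>R s *\<^sub>R \<phi> t) (y t + 1 *\<^sub>R s *\<^sub>R \<eta> t) - F t (u t + 0 *\<^sub>R s *\<^sub>R \<phi> t) (y t + 0 *\<^sub>R s *\<^sub>R \<eta> t)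
            = (1 - 0) * (Fx t (u t + \<theta> *\<^sub>R s *\<^sub>R \<phi> t) (y t + \<theta> *\<^sub>R s *\<^sub>R \<eta> t) \<bullet> (s *\<^sub>R \<phi> t) + Fv t (u t + \<theta> *\<^sub>R s *\<^sub>R \<phi> t) (y t + \<theta> *\<^sub>R s *\<^sub>R \<eta> t) \<bullet> (s *\<^sub>R \<eta> t))"
          by (rule MVT2) (rule zero_less_one, rule F_line[OF t])
        then obtain \<theta> where \<theta>: "0 < \<theta>" "\<theta> < 1" "F t (u t + s *\<^sub>R \<phi> t) (y t + s *\<^sub>R \<eta> t) - F t (u t) (y t) = s * g t (u t) (y t) (\<theta> * s)"
          by (auto simp: g_def algebra_simps)
        have \<theta>s: "\<bar>\<theta> * s\<bar> \<le> s0" using \<theta> s mult_mono[of \<theta> 1 "\<bar>s\<bar>" s0] by (simp add: abs_mult)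
        have "dF u y \<phi> \<eta> t = g t (u t) (y t) 0" by (simp add: g_def dF_def)
        then have "F t (u t + s *\<^sub>R \<phi> t) (y t + s *\<^sub>R \<eta> t) - F t (u t) (y t) - s * dF u y \<phi> \<eta> t = s * (g t (u t) (y t) (\<theta> * s) - g t (u t) (y t) 0)"
          using \<theta>(3) by (simp add: right_diff_distrib)
        then have eq: "\<bar>F t (u t + s *\<^sub>R \<phi> t) (y t + s *\<^sub>R \<eta> t) - F t (u t) (y t) - s * dF u y \<phi> \<eta> t\<bar> = \<bar>s\<bar> * \<bar>g t (u t) (y t) (\<theta> * s) - g t (u t) (y t) 0\<bar>"
          by (simp add: abs_mult)
        have "\<bar>g t (u t) (y t) (\<theta> * s) - g t (u t) (y t) 0\<bar> \<le> \<epsilon> / (2 * T) + C3 * tail R' y t"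
        proof (cases "norm (y t) \<le> R'")
          case True then show ?thesis using small[OF t uR[OF t] True \<theta>s] by (simp add: tail_def)
        next
          case False
          have "\<bar>g t (u t) (y t) (\<theta> * s) - g t (u t) (y t) 0\<bar> \<le> 2 * H * C * K * Bd t (y t) + 2 * H * C * K * Bd t (y t)"
            using gb[OF t uR[OF t], of "\<theta> * s" "y t"] gb[OF t uR[OF t], of 0 "y t"] \<theta>s s0 by linarith
          also have "\<dots> = C3 * tail R' y t" using False by (simp add: C3_def tail_def)
          finally show ?thesis using \<epsilon> T_pos by (simp add: add_increasing)
        qed
        then show ?thesis unfolding eq by (intro mult_left_mono) auto
      qed
      have sH: "norm (s *\<^sub>R \<phi> t) \<le> H" if "t \<in> I" for t
        using mult_mono[of "\<bar>s\<bar>" 1 "norm (\<phi> t)" H] s s0 H(2)[OF that] by auto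
      have adms: "adm (R + H) (\<lambda>t. u t + s *\<^sub>R \<phi> t) (\<lambda>t. y t + s *\<^sub>R \<eta> t)"
        by (intro adm_shift[OF uy] continuous_intros \<phi> \<eta> sH)
      note i1 = adm_integrable(1)[OF adms] and i2 = adm_integrable(1)[OF uy] and i3 = integrable_dF[OF uy \<phi> \<eta>]
      note i4 = integrable_tail[OF uy, of R']
      have split: "(LINT t|M. F t (u t + s *\<^sub>R \<phi> t) (y t + s *\<^sub>R \<eta> t)) - (LINT t|M. F t (u t) (y t)) - s * (LINT t|M. dF u y \<phi> \<eta> t)
          = (LINT t|M. F t (u t + s *\<^sub>R \<phi> t) (y t + s *\<^sub>R \<eta> t) - F t (u t) (y t) - s * dF u y \<phi> \<eta> t)"
        using i1 i2 i3 by simp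
      have "\<bar>LINT t|M. F t (u t + s *\<^sub>R \<phi> t) (y t + s *\<^sub>R \<eta> t) - F t (u t) (y t) - s * dF u y \<phi> \<eta> t\<bar> \<le> (LINT t|M. \<bar>F t (u t + s *\<^sub>R \<phi> t) (y t + s *\<^sub>R \<eta> t) - F t (u t) (y t) - s * dF u y \<phi> \<eta> t\<bar>)"
        by (rule integral_abs_bound)
      also have "\<dots> \<le> (LINT t|M. \<bar>s\<bar> * (\<epsilon> / (2 * T) + C3 * tail R' y t))"
        using i1 i2 i3 i4 pw by (intro integral_mono) (auto simp: space_M)
      also have "\<dots> = \<bar>s\<bar> * (\<epsilon> + C3 * (LINT t|M. tail R' y t))" using i4 T_pos by simp
      finally show "\<bar>(LINT t|M. F t (u t + s *\<^sub>R \<phi> t) (y t + s *\<^sub>R \<eta> t)) - (LINT t|M. F t (u t) (y t)) - s * (LINT t|M. dF u y \<phi> \<eta> t)\<bar>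
        \<le> \<bar>s\<bar> * (\<epsilon> + C3 * (LINT t|M. tail R' y t))" unfolding split .
    qed (rule s0)
  qed
qed

lemma growth_energy:
  obtains C where "C \<ge> 0" "\<And>t x v. t \<in> I \<Longrightarrow> norm x \<le> R \<Longrightarrow> \<bar>F t x v\<bar> \<le> C * Bd t v"
proof (rule growth[of R])
  fix C :: real
  assume "C \<ge> 0" "\<And>t x v. t \<in> I \<Longrightarrow> norm x \<le> R \<Longrightarrow> \<bar>F t x v\<bar> \<le> C * Bd t v"
  then show thesis by (rule that)
qed

lemma growth_force:
  obtains C where "C \<ge> 0" "\<And>t x v. t \<in> I \<Longrightarrow> norm x \<le> R \<Longrightarrow> norm (Fx t x v) \<le> C * Bd t v"
proof (rule growth[of R])
  fix C :: real
  assume "C \<ge> 0" "\<And>t x v. t \<in> I \<Longrightarrow> norm x \<le> R \<Longrightarrow> norm (Fx t x v) \<le> C * Bd t v"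
  then show thesis by (rule that)
qed

lemma dominated_continuity_energy:
  assumes U: "U \<in> borel_measurable M" "\<And>t. t \<in> I \<Longrightarrow> norm (U t) \<le> R"
    and vn: "\<And>n::nat. vn n \<in> borel_measurable M" and v: "v \<in> borel_measurable M"
    and lim: "AE t in M. (\<lambda>n. vn n t) \<longlonglongrightarrow> v t" and h: "integrable M h" "\<And>n. AE t in M. G (vn n t) \<le> h t"
  shows "(\<lambda>n. LINT t|M. F t (U t) (vn n t)) \<longlonglongrightarrow> (LINT t|M. F t (U t) (v t))"
proof -
  obtain C where C: "C \<ge> 0" "\<And>t x v. t \<in> I \<Longrightarrow> norm x \<le> R \<Longrightarrow> \<bar>F t x v\<bar> \<le> C * Bd t v" using growth_energy by blast
  show ?thesis
  proof (rule integral_dominated_convergence[where w = "\<lambda>t. C * (\<beta> t + 1 + h t)"])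
    show "AE t in M. (\<lambda>n. F t (U t) (vn n t)) \<longlonglongrightarrow> F t (U t) (v t)"
      using lim AE_space
    proof eventually_elim
      case (elim t) then show ?case by (intro jcont_tendsto[OF F_jcont]) (auto simp: space_M)
    qed
    show "AE t in M. norm (F t (U t) (vn n t)) \<le> C * (\<beta> t + 1 + h t)" for n
      using h(2)[of n] AE_space
    proof eventually_elim
      case (elim t)
      then have t: "t \<in> I" by (simp add: space_M)
      have "C * Bd t (vn n t) \<le> C * (\<beta> t + 1 + h t)" using elim C(1) by (intro mult_left_mono) (auto simp: Bd_def)
      then show ?case using C(2)[OF t U(2)[OF t], of "vn n t"] by simp
    qed
    show "integrable M (\<lambda>t. C * (\<beta> t + 1 + h t))" using \<beta>_int h by simp
  qed (intro jcont_measurable[OF F_jcont] U vn v)+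
qed

text \<open>The product of \<open>Fv\<close> with \<open>Y - v\<close> has no evident integrable majorant. But the affine minorant
  of \<open>F t x\<close> at \<open>v + \<eta>\<close> lies below \<open>F t x\<close> both at \<open>Y + \<eta>\<close> and at the reflection \<open>2 *\<^sub>R v - Y +
  \<eta>\<close>, and these two inequalities enclose the integrand between functions dominated by modulars.\<close>

lemma dominated_continuity_affine:
  assumes U: "U \<in> borel_measurable M" "\<And>t. t \<in> I \<Longrightarrow> norm (U t) \<le> R" and Y: "Y \<in> borel_measurable M" "integrable M (\<lambda>t. G (Y t))"
    and \<eta>: "continuous_on I \<eta>"
    and vn: "\<And>n::nat. vn n \<in> borel_measurable M" and v: "v \<in> borel_measurable M"
    and lim: "AE t in M. (\<lambda>n. vn n t) \<longlonglongrightarrow> v t" and h: "integrable M h" "\<And>n. AE t in M. G (vn n t) \<le> h t"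
  shows "(\<lambda>n. LINT t|M. F t (U t) (vn n t + \<eta> t) + Fv t (U t) (vn n t + \<eta> t) \<bullet> (Y t - vn n t))
     \<longlonglongrightarrow> (LINT t|M. F t (U t) (v t + \<eta> t) + Fv t (U t) (v t + \<eta> t) \<bullet> (Y t - v t))"
proof -
  obtain C where C: "C \<ge> 0" "\<And>t x v. t \<in> I \<Longrightarrow> norm x \<le> R \<Longrightarrow> \<bar>F t x v\<bar> \<le> C * Bd t v" using growth_energy by blast
  obtain E where E: "\<And>t. t \<in> I \<Longrightarrow> norm (\<eta> t) \<le> E" using bounded_cont[OF \<eta>] by blast
  obtain B where B: "B \<ge> 0" "\<And>v::'a. norm v \<le> E \<Longrightarrow> G v \<le> B" using G_bounded by blast
  have \<eta>m: "\<eta> \<in> borel_measurable M" by (rule measurable_cont[OF \<eta>])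
  define w1 where "w1 t = C * (\<beta> t + 1 + CD * (1 + h t + B))" for t
  define w2 where "w2 t = C * (\<beta> t + 1 + CD * (1 + G (Y t) + B))" for t
  define w3 where "w3 t = C * (\<beta> t + 1 + CD * (1 + CD * (1 + h t) + CD * (1 + G (Y t) + B)))" for t
  have bnd: "\<bar>F t (U t) (z + \<eta> t) + Fv t (U t) (z + \<eta> t) \<bullet> (Y t - z)\<bar> \<le> w1 t + w2 t + w3 t"
    if t: "t \<in> I" and z: "G z \<le> h t" for t z
  proof -
    have G\<eta>: "G (\<eta> t) \<le> B" using E[OF t] B by blast
    have CDp: "CD \<ge> 0" using CD(1) by simp
    have g1: "G (z + \<eta> t) \<le> CD * (1 + h t + B)"
      using G_add[of z "\<eta> t"] mult_left_mono[of "1 + G z + G (\<eta> t)" "1 + h t + B" CD] z G\<eta> CDp by linarith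
    have g2: "G (Y t + \<eta> t) \<le> CD * (1 + G (Y t) + B)"
      using G_add[of "Y t" "\<eta> t"] mult_left_mono[of "1 + G (Y t) + G (\<eta> t)" "1 + G (Y t) + B" CD] G\<eta> CDp by linarith
    have g3: "G (2 *\<^sub>R z - Y t + \<eta> t) \<le> CD * (1 + CD * (1 + h t) + CD * (1 + G (Y t) + B))"
    proof -
      have "G (2 *\<^sub>R z) \<le> CD * (1 + h t)" using CD(2)[of z] mult_left_mono[of "1 + G z" "1 + h t" CD] z CDp by linarith
      moreover have "G (\<eta> t - Y t) \<le> CD * (1 + G (Y t) + B)"
        using G_add[of "\<eta> t" "- Y t"] mult_left_mono[of "1 + G (\<eta> t) + G (Y t)" "1 + G (Y t) + B" CD] G\<eta> CDp by (simp add: G_even)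
      ultimately have "CD * (1 + G (2 *\<^sub>R z) + G (\<eta> t - Y t)) \<le> CD * (1 + CD * (1 + h t) + CD * (1 + G (Y t) + B))"
        using CDp by (intro mult_left_mono) auto
      then show ?thesis using G_add[of "2 *\<^sub>R z" "\<eta> t - Y t"] by (simp add: algebra_simps)
    qed
    note FC = C(2)[OF t U(2)[OF t]]
    have F1: "F t (U t) (z + \<eta> t) \<le> w1 t"
      using FC[of "z + \<eta> t"] mult_left_mono[OF g1 C(1)] by (simp add: w1_def Bd_def algebra_simps)
    have F2: "F t (U t) (Y t + \<eta> t) \<le> w2 t"
      using FC[of "Y t + \<eta> t"] mult_left_mono[OF g2 C(1)] by (simp add: w2_def Bd_def algebra_simps)
    have F3: "F t (U t) (2 *\<^sub>R z - Y t + \<eta> t) \<le> w3 t"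
      using FC[of "2 *\<^sub>R z - Y t + \<eta> t"] mult_left_mono[OF g3 C(1)] by (simp add: w3_def Bd_def algebra_simps)
    have s1: "F t (U t) (z + \<eta> t) + Fv t (U t) (z + \<eta> t) \<bullet> (Y t - z) \<le> F t (U t) (Y t + \<eta> t)"
      using F_subgradient[OF t, of "U t" "z + \<eta> t" "Y t + \<eta> t"] by simp
    \<comment> \<open>reflecting \<open>Y\<close> in \<open>z\<close> turns the subgradient inequality into a lower bound\<close>
    have d: "(2 *\<^sub>R z - Y t + \<eta> t) - (z + \<eta> t) = z - Y t" by (simp add: scaleR_2)
    have s2: "F t (U t) (z + \<eta> t) - Fv t (U t) (z + \<eta> t) \<bullet> (Y t - z) \<le> F t (U t) (2 *\<^sub>R z - Y t + \<eta> t)"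
      using F_subgradient[OF t, of "U t" "z + \<eta> t" "2 *\<^sub>R z - Y t + \<eta> t"]
      unfolding d by (simp add: inner_diff_right)
    show ?thesis using s1 s2 F1 F2 F3 F_nonneg[OF t, of "U t" "z + \<eta> t"] F_nonneg[OF t, of "U t" "Y t + \<eta> t"]
      F_nonneg[OF t, of "U t" "2 *\<^sub>R z - Y t + \<eta> t"] by linarith
  qed
  have meas: "(\<lambda>t. F t (U t) (z t + \<eta> t) + Fv t (U t) (z t + \<eta> t) \<bullet> (Y t - z t)) \<in> borel_measurable M"
    if "z \<in> borel_measurable M" for z
    using that \<eta>m Y
    by (intro borel_measurable_add borel_measurable_inner jcont_measurable[OF F_jcont] jcont_measurable[OF Fv_jcont] U borel_measurable_diff)
  show ?thesis
  proof (rule integral_dominated_convergence[where w = "\<lambda>t. w1 t + w2 t + w3 t"])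
    show "AE t in M. (\<lambda>n. F t (U t) (vn n t + \<eta> t) + Fv t (U t) (vn n t + \<eta> t) \<bullet> (Y t - vn n t))
        \<longlonglongrightarrow> F t (U t) (v t + \<eta> t) + Fv t (U t) (v t + \<eta> t) \<bullet> (Y t - v t)"
      using lim AE_space
    proof eventually_elim
      case (elim t) then show ?case
        by (intro tendsto_intros jcont_tendsto[OF F_jcont] jcont_tendsto[OF Fv_jcont]) (auto simp: space_M)
    qed
    show "AE t in M. norm (F t (U t) (vn n t + \<eta> t) + Fv t (U t) (vn n t + \<eta> t) \<bullet> (Y t - vn n t)) \<le> w1 t + w2 t + w3 t" for n
      using h(2)[of n] AE_space
    proof eventually_elim
      case (elim t) then show ?case using bnd[of t "vn n t"] by (simp add: space_M)
    qed
    show "integrable M (\<lambda>t. w1 t + w2 t + w3 t)" unfolding w1_def w2_def w3_def using \<beta>_int h Y by simp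
  qed (intro meas vn v)+
qed

end

section \<open>Limits of almost critical sequences\<close>

text \<open>An almost critical sequence with its limit: curves \<open>u k\<close> with continuous slopes \<open>y k\<close>
  converge uniformly to \<open>U\<close> with slope \<open>Y\<close>, while \<open>r k\<close> collects the forces that do not stem from
  \<open>F\<close>. Asymptotic criticality is required in fixed directions (\<open>test\<close>) and in the direction of the
  curve itself (\<open>self\<close>).\<close>

locale ps_limit = lagrangian T G F Fx Fv a \<beta> \<Lambda>
  for T :: real and G :: "'a::euclidean_space \<Rightarrow> real" and F Fx Fv a \<beta> \<Lambda> +
  fixes u y r :: "nat \<Rightarrow> real \<Rightarrow> 'a" and c :: "nat \<Rightarrow> 'a" and U Y rl :: "real \<Rightarrow> 'a" and c' :: 'a and R C :: real
  assumes y_cont: "\<And>k. continuous_on I (y k)" and y_mean: "\<And>k. (LINT t|M. y k t) = 0"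
    and y_G: "\<And>k. (LINT t|M. G (y k t)) \<le> C"
    and u_prim: "\<And>k t. t \<in> I \<Longrightarrow> u k t = c k + prim (y k) t" and u_bound: "\<And>k t. t \<in> I \<Longrightarrow> norm (u k t) \<le> R"
    and Y_int: "integrable M Y" and Y_G: "integrable M (\<lambda>t. G (Y t))"
    and U_prim: "\<And>t. t \<in> I \<Longrightarrow> U t = c' + prim Y t"
    and unif: "\<And>e. e > 0 \<Longrightarrow> \<forall>\<^sub>F k in sequentially. \<forall>t\<in>I. norm (u k t - U t) < e"
    and r_int: "\<And>k. integrable M (r k)" and rl_int: "integrable M rl"
    and r_lim: "(\<lambda>k. LINT t|M. norm (r k t - rl t)) \<longlonglongrightarrow> 0"
    and test: "\<And>\<eta> d. continuous_on UNIV \<eta> \<Longrightarrow> (LINT t|M. \<eta> t) = 0 \<Longrightarrow>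
      (\<lambda>k. (LINT t|M. dF (u k) (y k) (\<lambda>t. d + prim \<eta> t) \<eta> t) + (LINT t|M. r k t \<bullet> (d + prim \<eta> t))) \<longlonglongrightarrow> 0"
    and self: "(\<lambda>k. (LINT t|M. dF (u k) (y k) (u k) (y k) t) + (LINT t|M. r k t \<bullet> u k t)) \<longlonglongrightarrow> 0"
begin

lemma Y_meas: "Y \<in> borel_measurable M" using Y_int by simp

lemma y_int: "integrable M (y k)" by (rule integrable_cont[OF y_cont])

lemma u_cont: "continuous_on I (u k)"
proof -
  have "continuous_on I (\<lambda>t. c k + prim (y k) t)" by (intro continuous_intros prim_cont y_int)
  then show ?thesis by (rule continuous_on_eq) (simp add: u_prim)
qed

lemma U_cont: "continuous_on I U"
proof -
  have "continuous_on I (\<lambda>t. c' + prim Y t)" by (intro continuous_intros prim_cont Y_int)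
  then show ?thesis by (rule continuous_on_eq) (simp add: U_prim)
qed

lemma pointwise: "t \<in> I \<Longrightarrow> (\<lambda>k. u k t) \<longlonglongrightarrow> U t"
proof (rule tendstoI)
  fix e :: real assume t: "t \<in> I" and "0 < e"
  from unif[OF \<open>0 < e\<close>] show "\<forall>\<^sub>F k in sequentially. dist (u k t) (U t) < e"
    by eventually_elim (use t in \<open>auto simp: dist_norm\<close>)
qed

lemma U_bound: "t \<in> I \<Longrightarrow> norm (U t) \<le> R"
  by (rule LIMSEQ_le_const2[OF tendsto_norm[OF pointwise]]) (use u_bound in auto)

lemma adm_k: "adm R (u k) (y k)"
  using measurable_cont[OF u_cont] measurable_cont[OF y_cont] u_bound integrable_G_cont[OF y_cont] by (simp add: adm_def)

lemma adm_U: "adm R U Y"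
  using measurable_cont[OF U_cont] Y_meas U_bound Y_G by (simp add: adm_def)

lemma Y_mean: "(LINT t|M. Y t) = 0"
proof -
  have ends: "-T \<in> I" "T \<in> I" using T_pos by auto
  have "u k T = u k (-T)" for k using u_prim ends prim_end[OF y_int] y_mean by simp
  then have "(\<lambda>k. u k (-T)) \<longlonglongrightarrow> U T" using pointwise[OF ends(2)] by simp
  then have "U T = U (-T)" using pointwise[OF ends(1)] LIMSEQ_unique by blast
  then show ?thesis using U_prim ends prim_end[OF Y_int] by simp
qed

lemma prim_unif: "e > 0 \<Longrightarrow> \<forall>\<^sub>F k in sequentially. \<forall>t\<in>I. norm (prim (y k) t - prim Y t) < e"
proof -
  assume "e > 0"
  then have "e / 2 > 0" by simp
  from unif[OF this] show ?thesis
  proof eventually_elim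
    case (elim k)
    have ends: "-T \<in> I" using T_pos by auto
    show ?case
    proof
      fix t assume t: "t \<in> I"
      have "prim (y k) t - prim Y t = (u k t - U t) - (u k (-T) - U (-T))" using u_prim U_prim t ends by simp
      also have "norm \<dots> \<le> norm (u k t - U t) + norm (u k (-T) - U (-T))" by (rule norm_triangle_ineq4)
      also have "\<dots> < e" using elim[rule_format, OF t] elim[rule_format, OF ends] by simp
      finally show "norm (prim (y k) t - prim Y t) < e" .
    qed
  qed
qed

lemma y_L1: obtains C' where "\<And>k. (LINT t|M. norm (y k t)) \<le> C'"
proof -
  obtain C1 where C1: "C1 \<ge> 0" "\<And>v::'a. norm v \<le> 1 * G v + C1" using G_superlinear[of 1] by auto
  have "(LINT t|M. norm (y k t)) \<le> C + 2 * T * C1" for k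
    using LINT_norm_le_G[OF measurable_cont[OF y_cont] integrable_G_cont[OF y_cont] C1(2), of k] y_G[of k] by simp
  then show thesis by (rule that)
qed

lemma jcont_unif:
  assumes H: "jcont (H :: real \<Rightarrow> 'a \<Rightarrow> 'a \<Rightarrow> 'b::euclidean_space)" and z: "continuous_on I z" and \<phi>: "continuous_on I \<phi>" and "e > 0"
  shows "\<forall>\<^sub>F k in sequentially. \<forall>t\<in>I. norm (H t (u k t + \<phi> t) (z t) - H t (U t + \<phi> t) (z t)) < e"
proof -
  obtain B where B: "\<And>t. t \<in> I \<Longrightarrow> norm (\<phi> t) \<le> B" using bounded_cont[OF \<phi>] by blast
  obtain E where E: "\<And>t. t \<in> I \<Longrightarrow> norm (z t) \<le> E" using bounded_cont[OF z] by blast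
  obtain d where d: "d > 0" "\<And>t x x' v v'. t \<in> I \<Longrightarrow> norm x \<le> R + B \<Longrightarrow> norm x' \<le> R + B \<Longrightarrow> norm v \<le> E \<Longrightarrow> norm v' \<le> E \<Longrightarrow>
    norm (x - x') < d \<Longrightarrow> norm (v - v') < d \<Longrightarrow> norm (H t x v - H t x' v') < e" using jcont_uniform[OF H \<open>e > 0\<close>] by blast
  from unif[OF d(1)] show ?thesis
  proof eventually_elim
    case (elim k)
    show ?case
    proof
      fix t assume t: "t \<in> I"
      have "norm (u k t + \<phi> t) \<le> R + B" using norm_triangle_ineq[of "u k t" "\<phi> t"] u_bound[OF t, of k] B[OF t] by linarith
      moreover have "norm (U t + \<phi> t) \<le> R + B" using norm_triangle_ineq[of "U t" "\<phi> t"] U_bound[OF t] B[OF t] by linarith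
      ultimately show "norm (H t (u k t + \<phi> t) (z t) - H t (U t + \<phi> t) (z t)) < e"
        using elim t E[OF t] d(1) by (intro d(2)) auto
    qed
  qed
qed

lemma LINT_F_cont_tendsto:
  assumes z: "continuous_on I z" and \<phi>: "continuous_on I \<phi>"
  shows "(\<lambda>k. LINT t|M. F t (u k t + \<phi> t) (z t)) \<longlonglongrightarrow> (LINT t|M. F t (U t + \<phi> t) (z t))"
proof (rule LIMSEQ_I)
  fix e :: real assume "e > 0"
  then have e': "e / (4 * T) > 0" using T_pos by simp
  have ci: "integrable M (\<lambda>t. F t (w t + \<phi> t) (z t))" if "continuous_on I w" for w
    by (intro integrable_cont jcont_continuous[OF F_jcont] continuous_intros that z \<phi>)
  from jcont_unif[OF F_jcont z \<phi> e']
  have "\<forall>\<^sub>F k in sequentially. norm ((LINT t|M. F t (u k t + \<phi> t) (z t)) - (LINT t|M. F t (U t + \<phi> t) (z t))) < e"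
  proof eventually_elim
    case (elim k)
    have "(LINT t|M. F t (u k t + \<phi> t) (z t)) - (LINT t|M. F t (U t + \<phi> t) (z t)) = (LINT t|M. F t (u k t + \<phi> t) (z t) - F t (U t + \<phi> t) (z t))"
      using ci[OF u_cont] ci[OF U_cont] by simp
    also have "norm \<dots> \<le> (LINT t|M. norm (F t (u k t + \<phi> t) (z t) - F t (U t + \<phi> t) (z t)))" by (rule integral_norm_bound)
    also have "\<dots> \<le> (LINT t|M. e / (4 * T))"
      using ci[OF u_cont] ci[OF U_cont] elim by (intro integral_mono) (auto simp: space_M less_imp_le)
    also have "\<dots> < e" using T_pos \<open>e > 0\<close> by simp
    finally show ?case .
  qed
  then show "\<exists>N. \<forall>k\<ge>N. norm ((LINT t|M. F t (u k t + \<phi> t) (z t)) - (LINT t|M. F t (U t + \<phi> t) (z t))) < e"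
    by (auto simp: eventually_sequentially)
qed

lemma LINT_affine_tendsto:
  assumes z: "continuous_on I z" and \<phi>: "continuous_on I \<phi>" and \<eta>: "continuous_on I \<eta>"
  shows "(\<lambda>k. LINT t|M. F t (u k t + \<phi> t) (z t + \<eta> t) + Fv t (u k t + \<phi> t) (z t + \<eta> t) \<bullet> (y k t - z t))
     \<longlonglongrightarrow> (LINT t|M. F t (U t + \<phi> t) (z t + \<eta> t) + Fv t (U t + \<phi> t) (z t + \<eta> t) \<bullet> (Y t - z t))"
proof -
  have z\<eta>: "continuous_on I (\<lambda>t. z t + \<eta> t)" by (intro continuous_intros z \<eta>)
  obtain C' where C': "\<And>k. (LINT t|M. norm (y k t)) \<le> C'" using y_L1 by blast
  have Fvc: "continuous_on I (\<lambda>t. Fv t (w t + \<phi> t) (z t + \<eta> t))" if "continuous_on I w" for w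
    by (intro jcont_continuous[OF Fv_jcont] continuous_intros that \<phi> z \<eta>)
  have Fi: "integrable M (\<lambda>t. F t (w t + \<phi> t) (z t + \<eta> t))" if "continuous_on I w" for w
    by (intro integrable_cont jcont_continuous[OF F_jcont] continuous_intros that \<phi> z \<eta>)
  have zi: "integrable M z" by (rule integrable_cont[OF z])
  have wc: "(\<lambda>k. LINT t|M. Fv t (u k t + \<phi> t) (z t + \<eta> t) \<bullet> (y k t - z t)) \<longlonglongrightarrow> (LINT t|M. Fv t (U t + \<phi> t) (z t + \<eta> t) \<bullet> (Y t - z t))"
  proof (rule weak_strong_convergence[where C = "C' + (LINT t|M. norm (z t))"])
    show "\<forall>\<^sub>F k in sequentially. \<forall>t\<in>I. norm (Fv t (u k t + \<phi> t) (z t + \<eta> t) - Fv t (U t + \<phi> t) (z t + \<eta> t)) < e" if "e > 0" for e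
      by (rule jcont_unif[OF Fv_jcont z\<eta> \<phi> that])
    show "integrable M (\<lambda>t. y k t - z t)" for k using y_int zi by simp
    show "integrable M (\<lambda>t. Y t - z t)" using Y_int zi by simp
    show "(LINT t|M. norm (y k t - z t)) \<le> C' + (LINT t|M. norm (z t))" for k
    proof -
      have "(LINT t|M. norm (y k t - z t)) \<le> (LINT t|M. norm (y k t) + norm (z t))"
        using y_int zi by (intro integral_mono norm_triangle_ineq4) auto
      then show ?thesis using C'[of k] y_int zi by simp
    qed
    show "\<forall>\<^sub>F k in sequentially. \<forall>t\<in>I. norm (prim (\<lambda>t. y k t - z t) t - prim (\<lambda>t. Y t - z t) t) < e" if "e > 0" for e
      using prim_unif[OF that] by eventually_elim (simp add: prim_linear(2) y_int Y_int zi)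
  qed (intro Fvc U_cont u_cont)+
  have ip: "integrable M (\<lambda>t. Fv t (w t + \<phi> t) (z t + \<eta> t) \<bullet> (x t - z t))" if "continuous_on I w" "integrable M x" for w x
    using integrable_inner_cont[OF _ Fvc[OF that(1)], of "\<lambda>t. x t - z t"] that zi by (simp add: inner_commute)
  have "(\<lambda>k. (LINT t|M. F t (u k t + \<phi> t) (z t + \<eta> t)) + (LINT t|M. Fv t (u k t + \<phi> t) (z t + \<eta> t) \<bullet> (y k t - z t)))
      \<longlonglongrightarrow> (LINT t|M. F t (U t + \<phi> t) (z t + \<eta> t)) + (LINT t|M. Fv t (U t + \<phi> t) (z t + \<eta> t) \<bullet> (Y t - z t))"
    by (intro tendsto_add LINT_F_cont_tendsto[OF z\<eta> \<phi>] wc)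
  then show ?thesis using Fi[OF u_cont] Fi[OF U_cont] ip[OF u_cont y_int] ip[OF U_cont Y_int] by simp
qed

text \<open>This bound makes the force terms negligible when they are paired with uniformly small
  curves.\<close>

lemma dual_bound:
  obtains K where "K \<ge> 0" "\<forall>\<^sub>F k in sequentially. (LINT t|M. norm (Fx t (u k t) (y k t) + r k t)) \<le> K"
proof -
  obtain Cg where Cg: "Cg \<ge> 0" "\<And>t x v. t \<in> I \<Longrightarrow> norm x \<le> R \<Longrightarrow> norm (Fx t x v) \<le> Cg * Bd t v" using growth_force by blast
  define K where "K = Cg * ((LINT t|M. \<beta> t) + 2 * T + C) + (LINT t|M. norm (rl t)) + 1"
  have "\<forall>\<^sub>F k in sequentially. (LINT t|M. norm (r k t - rl t)) < 1"
    by (rule order_tendstoD(2)[OF r_lim]) simp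
  then have ev: "\<forall>\<^sub>F k in sequentially. (LINT t|M. norm (Fx t (u k t) (y k t) + r k t)) \<le> K"
  proof eventually_elim
    case (elim k)
    have i: "integrable M (\<lambda>t. Fx t (u k t) (y k t))" by (rule adm_integrable(2)[OF adm_k])
    have "(LINT t|M. norm (Fx t (u k t) (y k t))) \<le> Cg * (LINT t|M. Bd t (y k t))"
      using Cg(2) u_bound by (intro integrable_Bd_bound(2)[OF integrable_G_cont[OF y_cont]] jcont_measurable[OF Fx_jcont] measurable_cont u_cont y_cont) auto
    also have "(LINT t|M. Bd t (y k t)) = (LINT t|M. \<beta> t) + 2 * T + (LINT t|M. G (y k t))"
      unfolding Bd_def using \<beta>_int integrable_G_cont[OF y_cont, of k] by simp
    also have "Cg * \<dots> \<le> Cg * ((LINT t|M. \<beta> t) + 2 * T + C)" using y_G[of k] Cg(1) by (intro mult_left_mono) auto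
    finally have 1: "(LINT t|M. norm (Fx t (u k t) (y k t))) \<le> Cg * ((LINT t|M. \<beta> t) + 2 * T + C)" .
    have "(LINT t|M. norm (Fx t (u k t) (y k t) + r k t)) \<le> (LINT t|M. norm (Fx t (u k t) (y k t)) + (norm (rl t) + norm (r k t - rl t)))"
    proof (rule integral_mono)
      fix t show "norm (Fx t (u k t) (y k t) + r k t) \<le> norm (Fx t (u k t) (y k t)) + (norm (rl t) + norm (r k t - rl t))"
        using norm_triangle_ineq[of "Fx t (u k t) (y k t)" "r k t"] norm_triangle_ineq[of "rl t" "r k t - rl t"] by simp
    qed (use i r_int rl_int in auto)
    also have "\<dots> = (LINT t|M. norm (Fx t (u k t) (y k t))) + ((LINT t|M. norm (rl t)) + (LINT t|M. norm (r k t - rl t)))"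
      using i r_int rl_int by simp
    finally show ?case using 1 elim by (simp add: K_def)
  qed
  show thesis
  proof (rule that[OF _ ev])
    obtain k where "(LINT t|M. norm (Fx t (u k t) (y k t) + r k t)) \<le> K" using ev by (auto simp: eventually_sequentially)
    moreover have "0 \<le> (LINT t|M. norm (Fx t (u k t) (y k t) + r k t))" by (rule integral_nonneg_AE) simp
    ultimately show "K \<ge> 0" by linarith
  qed
qed

text \<open>Subtract \<open>test\<close> from \<open>self\<close>. What remains is \<open>Fv\<close> at \<open>(u k, y k)\<close> paired with \<open>y k - \<eta>\<close>,
  which by convexity dominates the difference of the energies with slopes \<open>y k\<close> and \<open>\<eta>\<close>, and a
  force term paired with \<open>u k - (d + prim \<eta>)\<close>, which \<open>dual_bound\<close> controls by \<open>\<delta>\<close>.\<close>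

lemma energy_upper:
  obtains K where "K \<ge> 0"
    "\<And>\<eta> d \<delta> e. continuous_on UNIV \<eta> \<Longrightarrow> (LINT t|M. \<eta> t) = 0 \<Longrightarrow> (\<And>t. t \<in> I \<Longrightarrow> norm (U t - (d + prim \<eta> t)) \<le> \<delta>) \<Longrightarrow> e > 0 \<Longrightarrow>
      \<forall>\<^sub>F k in sequentially. (LINT t|M. F t (u k t) (y k t)) \<le> (LINT t|M. F t (U t) (\<eta> t)) + K * \<delta> + e"
proof -
  obtain K where K: "K \<ge> 0" "\<forall>\<^sub>F k in sequentially. (LINT t|M. norm (Fx t (u k t) (y k t) + r k t)) \<le> K" using dual_bound by blast
  show thesis
  proof (rule that[OF K(1)])
    fix \<eta> :: "real \<Rightarrow> 'a" and d \<delta> and e :: real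
    assume \<eta>: "continuous_on UNIV \<eta>" and \<eta>0: "(LINT t|M. \<eta> t) = 0" and \<delta>: "\<And>t. t \<in> I \<Longrightarrow> norm (U t - (d + prim \<eta> t)) \<le> \<delta>" and e: "e > 0"
    define \<phi> where "\<phi> = (\<lambda>t. d + prim \<eta> t)"
    have \<eta>I: "continuous_on I \<eta>" using \<eta> continuous_on_subset by blast
    have \<phi>c: "continuous_on I \<phi>" unfolding \<phi>_def by (intro continuous_intros prim_cont integrable_cont \<eta>I)
    define E where "E k \<phi> \<eta> = (LINT t|M. dF (u k) (y k) \<phi> \<eta> t) + (LINT t|M. r k t \<bullet> \<phi> t)" for k \<phi> \<eta>
    have E1: "(\<lambda>k. E k \<phi> \<eta>) \<longlonglongrightarrow> 0" using test[OF \<eta> \<eta>0, of d] by (simp add: E_def \<phi>_def)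
    have E2: "(\<lambda>k. E k (u k) (y k)) \<longlonglongrightarrow> 0" using self by (simp add: E_def)
    have c0: "continuous_on I (\<lambda>t::real. 0::'a)" by simp
    have F1: "(\<lambda>k. LINT t|M. F t (u k t) (\<eta> t)) \<longlonglongrightarrow> (LINT t|M. F t (U t) (\<eta> t))"
      using LINT_F_cont_tendsto[OF \<eta>I c0] by simp
    define e1 where "e1 = e / (2 * (K + 1))"
    have e1: "e1 > 0" using e K by (simp add: e1_def)
    have Ke1: "K * e1 \<le> e / 2"
    proof -
      have "K * e1 \<le> (K + 1) * e1" using e1 by simp
      also have "\<dots> = e / 2" using K(1) by (simp add: e1_def field_simps)
      finally show ?thesis .
    qed
    have "(\<lambda>k. (LINT t|M. F t (u k t) (\<eta> t)) + E k (u k) (y k) - E k \<phi> \<eta>) \<longlonglongrightarrow> (LINT t|M. F t (U t) (\<eta> t)) + 0 - 0"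
      by (intro tendsto_intros F1 E1 E2)
    then have "\<forall>\<^sub>F k in sequentially. (LINT t|M. F t (u k t) (\<eta> t)) + E k (u k) (y k) - E k \<phi> \<eta> < (LINT t|M. F t (U t) (\<eta> t)) + e / 2"
      using e by (intro order_tendstoD(2)) auto
    then show "\<forall>\<^sub>F k in sequentially. (LINT t|M. F t (u k t) (y k t)) \<le> (LINT t|M. F t (U t) (\<eta> t)) + K * \<delta> + e"
      using K(2) unif[OF e1]
    proof eventually_elim
      case (elim k)
      have adm\<eta>: "adm R (u k) \<eta>"
        using measurable_cont[OF u_cont] measurable_cont[OF \<eta>I] u_bound integrable_G_cont[OF \<eta>I] by (simp add: adm_def)
      note iF = adm_integrable(1)[OF adm_k, of k] and iF\<eta> = adm_integrable(1)[OF adm\<eta>]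
      have iFv: "integrable M (\<lambda>t. Fv t (u k t) (y k t) \<bullet> (y k t - \<eta> t))"
        by (intro integrable_inner_cont adm_integrable[OF adm_k] continuous_intros y_cont \<eta>I)
      have iw: "integrable M (\<lambda>t. Fx t (u k t) (y k t) + r k t)" using adm_integrable(2)[OF adm_k] r_int by simp
      have uc: "continuous_on I (\<lambda>t. u k t - \<phi> t)" by (intro continuous_intros u_cont \<phi>c)
      have iwu: "integrable M (\<lambda>t. (Fx t (u k t) (y k t) + r k t) \<bullet> (u k t - \<phi> t))" by (rule integrable_inner_cont[OF iw uc])
      have i: "integrable M (dF (u k) (y k) (u k) (y k))" "integrable M (dF (u k) (y k) \<phi> \<eta>)"
        "integrable M (\<lambda>t. r k t \<bullet> u k t)" "integrable M (\<lambda>t. r k t \<bullet> \<phi> t)"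
        by (intro integrable_dF[OF adm_k] integrable_inner_cont r_int u_cont y_cont \<phi>c \<eta>I)+
      have "E k (u k) (y k) - E k \<phi> \<eta> = (LINT t|M. (dF (u k) (y k) (u k) (y k) t + r k t \<bullet> u k t) - (dF (u k) (y k) \<phi> \<eta> t + r k t \<bullet> \<phi> t))"
        using i by (simp add: E_def)
      also have "\<dots> = (LINT t|M. (Fx t (u k t) (y k t) + r k t) \<bullet> (u k t - \<phi> t) + Fv t (u k t) (y k t) \<bullet> (y k t - \<eta> t))"
        by (intro Bochner_Integration.integral_cong refl) (simp add: dF_def inner_diff_right inner_add_left)
      also have "\<dots> = (LINT t|M. (Fx t (u k t) (y k t) + r k t) \<bullet> (u k t - \<phi> t)) + (LINT t|M. Fv t (u k t) (y k t) \<bullet> (y k t - \<eta> t))"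
        using iwu iFv by simp
      finally have eq: "E k (u k) (y k) - E k \<phi> \<eta> = (LINT t|M. (Fx t (u k t) (y k t) + r k t) \<bullet> (u k t - \<phi> t)) + (LINT t|M. Fv t (u k t) (y k t) \<bullet> (y k t - \<eta> t))" .
      have dist: "norm (u k t - \<phi> t) \<le> e1 + \<delta>" if t: "t \<in> I" for t
      proof -
        have "norm (u k t - \<phi> t) \<le> norm (u k t - U t) + norm (U t - \<phi> t)" using norm_triangle_ineq[of "u k t - U t" "U t - \<phi> t"] by simp
        then show ?thesis using elim(3)[rule_format, OF t] \<delta>[OF t] by (simp add: \<phi>_def)
      qed
      have \<delta>0: "e1 + \<delta> \<ge> 0" using order_trans[OF norm_ge_zero dist[of T]] T_pos by simp
      have "\<bar>LINT t|M. (Fx t (u k t) (y k t) + r k t) \<bullet> (u k t - \<phi> t)\<bar> \<le> (e1 + \<delta>) * (LINT t|M. norm (Fx t (u k t) (y k t) + r k t))"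
        by (rule integrable_inner_bounded(2)[OF iw measurable_cont[OF uc] dist])
      also have "\<dots> \<le> (e1 + \<delta>) * K" using elim(2) \<delta>0 by (intro mult_left_mono)
      finally have rem: "\<bar>LINT t|M. (Fx t (u k t) (y k t) + r k t) \<bullet> (u k t - \<phi> t)\<bar> \<le> K * e1 + K * \<delta>" by (simp add: algebra_simps)
      have "(LINT t|M. F t (u k t) (y k t) - Fv t (u k t) (y k t) \<bullet> (y k t - \<eta> t)) \<le> (LINT t|M. F t (u k t) (\<eta> t))"
      proof (rule integral_mono)
        fix t assume "t \<in> space M"
        then have "F t (u k t) (y k t) + Fv t (u k t) (y k t) \<bullet> (\<eta> t - y k t) \<le> F t (u k t) (\<eta> t)"
          by (intro F_subgradient) (simp add: space_M)
        then show "F t (u k t) (y k t) - Fv t (u k t) (y k t) \<bullet> (y k t - \<eta> t) \<le> F t (u k t) (\<eta> t)" by (simp add: inner_diff_right)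
      qed (use iF iFv iF\<eta> in auto)
      then have "(LINT t|M. F t (u k t) (y k t)) - (LINT t|M. Fv t (u k t) (y k t) \<bullet> (y k t - \<eta> t)) \<le> (LINT t|M. F t (u k t) (\<eta> t))"
        using iF iFv by simp
      then show ?case using elim(1) eq rem Ke1 by linarith
    qed
  qed
qed

text \<open>The sum of the three deviations, taken as a functional of \<open>w\<close>, is continuous in the sense of
  \<open>continuous_dense_modular\<close>, so a single \<open>w\<close> makes all of them small.\<close>

lemma approximants:
  assumes \<phi>: "continuous_on I \<phi>" and \<eta>: "continuous_on I \<eta>" and "e > 0"
  obtains w where "continuous_on UNIV w" "(LINT t|M. w t) = 0" "\<And>t. t \<in> I \<Longrightarrow> norm (U t - (c' + prim w t)) \<le> e"
    "\<bar>(LINT t|M. F t (U t) (w t)) - (LINT t|M. F t (U t) (Y t))\<bar> < e"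
    "\<bar>(LINT t|M. F t (U t + \<phi> t) (w t + \<eta> t) + Fv t (U t + \<phi> t) (w t + \<eta> t) \<bullet> (Y t - w t)) - (LINT t|M. F t (U t + \<phi> t) (Y t + \<eta> t))\<bar> < e"
proof -
  obtain B where B: "\<And>t. t \<in> I \<Longrightarrow> norm (\<phi> t) \<le> B" using bounded_cont[OF \<phi>] by blast
  have U\<phi>: "(\<lambda>t. U t + \<phi> t) \<in> borel_measurable M" "\<And>t. t \<in> I \<Longrightarrow> norm (U t + \<phi> t) \<le> R + B"
  proof -
    show "(\<lambda>t. U t + \<phi> t) \<in> borel_measurable M" by (intro measurable_cont continuous_intros U_cont \<phi>)
    show "norm (U t + \<phi> t) \<le> R + B" if t: "t \<in> I" for t
      using norm_triangle_ineq[of "U t" "\<phi> t"] U_bound[OF t] B[OF t] by linarith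
  qed
  define Q1 where "Q1 v = (LINT t|M. F t (U t) (v t))" for v
  define Q2 where "Q2 v = (LINT t|M. F t (U t + \<phi> t) (v t + \<eta> t) + Fv t (U t + \<phi> t) (v t + \<eta> t) \<bullet> (Y t - v t))" for v
  \<comment> \<open>closeness in the mean makes the primitives uniformly close, hence the first summand\<close>
  define Q where "Q v = (LINT t|M. norm (v t - Y t)) + (\<bar>Q1 v - Q1 Y\<bar> + \<bar>Q2 v - Q2 Y\<bar>)" for v
  obtain C1 where C1: "C1 \<ge> 0" "\<And>v::'a. norm v \<le> 1 * G v + C1" using G_superlinear[of 1] by auto
  obtain w where w: "continuous_on UNIV w" "(LINT t|M. w t) = 0" "\<bar>Q w - Q Y\<bar> < e"
  proof (rule continuous_dense_modular[OF Y_meas Y_G Y_mean _ \<open>e > 0\<close>, of Q])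
    fix vn :: "nat \<Rightarrow> real \<Rightarrow> 'a" and v and h :: "real \<Rightarrow> real"
    assume vn: "\<And>n. vn n \<in> borel_measurable M" and v: "v \<in> borel_measurable M" and lim: "AE t in M. (\<lambda>n. vn n t) \<longlonglongrightarrow> v t"
      and h: "integrable M h" "\<And>n. AE t in M. G (vn n t) \<le> h t"
    have "(\<lambda>n. LINT t|M. norm (vn n t - Y t)) \<longlonglongrightarrow> (LINT t|M. norm (v t - Y t))"
    proof (rule integral_dominated_convergence[where w = "\<lambda>t. h t + C1 + norm (Y t)"])
      show "AE t in M. (\<lambda>n. norm (vn n t - Y t)) \<longlonglongrightarrow> norm (v t - Y t)"
        using lim by eventually_elim (intro tendsto_intros)
      show "AE t in M. norm (norm (vn n t - Y t)) \<le> h t + C1 + norm (Y t)" for n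
        using h(2)[of n]
      proof eventually_elim
        case (elim t) then show ?case using norm_triangle_ineq4[of "vn n t" "Y t"] C1(2)[of "vn n t"] by simp
      qed
      show "(\<lambda>t. norm (vn n t - Y t)) \<in> borel_measurable M" for n using vn Y_meas by measurable
      show "(\<lambda>t. norm (v t - Y t)) \<in> borel_measurable M" using v Y_meas by measurable
    qed (use h Y_int in auto)
    moreover have "(\<lambda>n. Q1 (vn n)) \<longlonglongrightarrow> Q1 v" unfolding Q1_def
      by (rule dominated_continuity_energy[OF measurable_cont[OF U_cont] U_bound vn v lim h])
    moreover have "(\<lambda>n. Q2 (vn n)) \<longlonglongrightarrow> Q2 v" unfolding Q2_def
      by (rule dominated_continuity_affine[OF U\<phi> Y_meas Y_G \<eta> vn v lim h])
    ultimately show "(\<lambda>n. Q (vn n)) \<longlonglongrightarrow> Q v" unfolding Q_def by (intro tendsto_intros)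
  qed blast
  have "Q Y = 0" by (simp add: Q_def)
  then have Qw: "Q w < e" using w(3) by simp
  have nn: "0 \<le> (LINT t|M. norm (w t - Y t))" by (rule integral_nonneg_AE) simp
  have wi: "integrable M w" using w(1) continuous_on_subset by (intro integrable_cont) blast
  show thesis
  proof (rule that[OF w(1,2)])
    show "norm (U t - (c' + prim w t)) \<le> e" if t: "t \<in> I" for t
    proof -
      have "norm (prim (\<lambda>t. w t - Y t) t - prim (\<lambda>t. w t - Y t) (-T)) \<le> (LINT t|M. norm (w t - Y t))"
        by (rule prim_norm_le) (use wi Y_int t T_pos in auto)
      moreover have "norm (U t - (c' + prim w t)) = norm (prim w t - prim Y t)" using U_prim[OF t] by (simp add: norm_minus_commute)
      ultimately show ?thesis using prim_linear(2)[OF wi Y_int t] Qw nn unfolding Q_def by simp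
    qed
    show "\<bar>(LINT t|M. F t (U t) (w t)) - (LINT t|M. F t (U t) (Y t))\<bar> < e" using Qw nn unfolding Q_def Q1_def by linarith
    show "\<bar>(LINT t|M. F t (U t + \<phi> t) (w t + \<eta> t) + Fv t (U t + \<phi> t) (w t + \<eta> t) \<bullet> (Y t - w t)) - (LINT t|M. F t (U t + \<phi> t) (Y t + \<eta> t))\<bar> < e"
    proof -
      have "Q2 Y = (LINT t|M. F t (U t + \<phi> t) (Y t + \<eta> t))" by (simp add: Q2_def)
      then show ?thesis using Qw nn unfolding Q_def Q2_def[of w] by linarith
    qed
  qed
qed

text \<open>Let the competitor in \<open>energy_upper\<close> approach the limit curve.\<close>

lemma energy_limsup:
  assumes "e > 0"
  shows "\<forall>\<^sub>F k in sequentially. (LINT t|M. F t (u k t) (y k t)) \<le> (LINT t|M. F t (U t) (Y t)) + e"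
proof -
  obtain K where K: "K \<ge> 0"
    "\<And>\<eta> d \<delta> e. continuous_on UNIV \<eta> \<Longrightarrow> (LINT t|M. \<eta> t) = 0 \<Longrightarrow> (\<And>t. t \<in> I \<Longrightarrow> norm (U t - (d + prim \<eta> t)) \<le> \<delta>) \<Longrightarrow> e > 0 \<Longrightarrow>
      \<forall>\<^sub>F k in sequentially. (LINT t|M. F t (u k t) (y k t)) \<le> (LINT t|M. F t (U t) (\<eta> t)) + K * \<delta> + e" using energy_upper by blast
  define e1 where "e1 = e / (K + 2)"
  have e1: "e1 > 0" using assms K(1) by (simp add: e1_def)
  have e1e: "e1 + K * e1 + e1 = e"
  proof -
    have "e1 + K * e1 + e1 = e1 * (K + 2)" by (simp add: algebra_simps)
    then show ?thesis using K(1) by (simp add: e1_def)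
  qed
  have c0: "continuous_on I (\<lambda>t::real. 0::'a)" by simp
  obtain w where w: "continuous_on UNIV w" "(LINT t|M. w t) = 0" "\<And>t. t \<in> I \<Longrightarrow> norm (U t - (c' + prim w t)) \<le> e1"
    "\<bar>(LINT t|M. F t (U t) (w t)) - (LINT t|M. F t (U t) (Y t))\<bar> < e1"
    by (rule approximants[OF c0 c0 e1]) (rule that; assumption)
  have "\<forall>\<^sub>F k in sequentially. (LINT t|M. F t (u k t) (y k t)) \<le> (LINT t|M. F t (U t) (w t)) + K * e1 + e1"
    by (rule K(2)[OF w(1,2) w(3) e1])
  then show ?thesis
  proof eventually_elim
    case (elim k) then show ?case using w(4) e1e by linarith
  qed
qed

text \<open>Lower semicontinuity by convexity: the affine minorant of \<open>F\<close> at a continuous approximant of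
  \<open>Y\<close> has continuous coefficients, so its integral along the sequence converges by
  \<open>weak_strong_convergence\<close>.\<close>

lemma shifted_energy_liminf:
  assumes \<phi>: "continuous_on I \<phi>" and \<eta>: "continuous_on I \<eta>" and "e > 0"
  shows "\<forall>\<^sub>F k in sequentially. (LINT t|M. F t (u k t + \<phi> t) (y k t + \<eta> t)) \<ge> (LINT t|M. F t (U t + \<phi> t) (Y t + \<eta> t)) - e"
proof -
  have e2: "e / 2 > 0" using assms by simp
  obtain w where w: "continuous_on UNIV w"
    "\<bar>(LINT t|M. F t (U t + \<phi> t) (w t + \<eta> t) + Fv t (U t + \<phi> t) (w t + \<eta> t) \<bullet> (Y t - w t)) - (LINT t|M. F t (U t + \<phi> t) (Y t + \<eta> t))\<bar> < e / 2"
    by (rule approximants[OF \<phi> \<eta> e2]) (rule that; assumption)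
  have wI: "continuous_on I w" using w(1) continuous_on_subset by blast
  obtain B where B: "\<And>t. t \<in> I \<Longrightarrow> norm (\<phi> t) \<le> B" using bounded_cont[OF \<phi>] by blast
  have "\<forall>\<^sub>F k in sequentially. (LINT t|M. F t (U t + \<phi> t) (w t + \<eta> t) + Fv t (U t + \<phi> t) (w t + \<eta> t) \<bullet> (Y t - w t)) - e / 2
      < (LINT t|M. F t (u k t + \<phi> t) (w t + \<eta> t) + Fv t (u k t + \<phi> t) (w t + \<eta> t) \<bullet> (y k t - w t))"
    by (rule order_tendstoD(1)[OF LINT_affine_tendsto[OF wI \<phi> \<eta>]]) (use assms in simp)
  then show ?thesis
  proof eventually_elim
    case (elim k)
    have "(LINT t|M. F t (u k t + \<phi> t) (w t + \<eta> t) + Fv t (u k t + \<phi> t) (w t + \<eta> t) \<bullet> (y k t - w t)) \<le> (LINT t|M. F t (u k t + \<phi> t) (y k t + \<eta> t))"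
    proof (rule integral_mono)
      fix t assume "t \<in> space M"
      then have "F t (u k t + \<phi> t) (w t + \<eta> t) + Fv t (u k t + \<phi> t) (w t + \<eta> t) \<bullet> ((y k t + \<eta> t) - (w t + \<eta> t)) \<le> F t (u k t + \<phi> t) (y k t + \<eta> t)"
        by (intro F_subgradient) (simp add: space_M)
      then show "F t (u k t + \<phi> t) (w t + \<eta> t) + Fv t (u k t + \<phi> t) (w t + \<eta> t) \<bullet> (y k t - w t) \<le> F t (u k t + \<phi> t) (y k t + \<eta> t)" by simp
    next
      show "integrable M (\<lambda>t. F t (u k t + \<phi> t) (y k t + \<eta> t))"
        by (rule adm_integrable(1)[OF adm_shift[OF adm_k \<phi> B \<eta>]])
      show "integrable M (\<lambda>t. F t (u k t + \<phi> t) (w t + \<eta> t) + Fv t (u k t + \<phi> t) (w t + \<eta> t) \<bullet> (y k t - w t))"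
        by (intro integrable_cont continuous_intros jcont_continuous[OF F_jcont] jcont_continuous[OF Fv_jcont] u_cont \<phi> \<eta> wI y_cont)
    qed
    then show ?case using elim w(2) by linarith
  qed
qed

text \<open>The defect between \<open>F\<close> and its affine minorant at a continuous approximant of \<open>Y\<close> is
  nonnegative and has small integral, because by \<open>energy_limsup\<close> the energies do not
  asymptotically exceed that of the limit. Where the slope is large the minorant has only linear
  growth while \<open>F\<close> is at least \<open>\<Lambda> * G\<close>, so there the defect controls \<open>G\<close> up to a small multiple of
  \<open>G\<close> itself.\<close>

lemma equi_integrable:
  assumes "e > 0"
  obtains R\<^sub>0 where "\<And>R'. R' \<ge> R\<^sub>0 \<Longrightarrow> \<forall>\<^sub>F k in sequentially. (LINT t|M. tail R' (y k) t) \<le> e"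
proof -
  define e1 where "e1 = e / (2 * (1 + 3 / \<Lambda>))"
  have e1: "e1 > 0" using assms \<Lambda> by (simp add: e1_def add_pos_pos)
  have e1e: "e1 + 3 * e1 / \<Lambda> = e / 2"
  proof -
    have "1 + 3 / \<Lambda> > 0" using \<Lambda> by (simp add: add_pos_pos)
    moreover have "e1 + 3 * e1 / \<Lambda> = e1 * (1 + 3 / \<Lambda>)" by (simp add: algebra_simps)
    moreover have "e / (2 * k) * k = e / 2" if "k > 0" for k :: real using that by simp
    ultimately show ?thesis unfolding e1_def by metis
  qed
  have c0: "continuous_on I (\<lambda>t::real. 0::'a)" by simp
  obtain w where w: "continuous_on UNIV w"
    "\<bar>(LINT t|M. F t (U t + 0) (w t + 0) + Fv t (U t + 0) (w t + 0) \<bullet> (Y t - w t)) - (LINT t|M. F t (U t + 0) (Y t + 0))\<bar> < e1"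
    by (rule approximants[OF c0 c0 e1]) (rule that; assumption)
  have wI: "continuous_on I w" using w(1) continuous_on_subset by blast
  obtain W where W: "W \<ge> 0" "\<And>t. t \<in> I \<Longrightarrow> norm (w t) \<le> W" using bounded_cont[OF wI] by blast
  obtain Cv where Cv: "Cv \<ge> 0" "\<And>t x v. t \<in> I \<Longrightarrow> norm x \<le> R \<Longrightarrow> norm v \<le> W \<Longrightarrow> norm (Fv t x v) \<le> Cv"
    using jcont_bounded[OF Fv_jcont] by blast
  obtain Cf where Cf: "Cf \<ge> 0" "\<And>t x v. t \<in> I \<Longrightarrow> norm x \<le> R \<Longrightarrow> norm v \<le> W \<Longrightarrow> norm (F t x v) \<le> Cf"
    using jcont_bounded[OF F_jcont] by blast
  define C2 where "C2 = Cf + Cv * (1 + W)"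
  have C2: "C2 \<ge> 0" using Cv Cf W by (simp add: C2_def)
  \<comment> \<open>the defect of convexity of \<open>F\<close> between the slopes \<open>w\<close> and \<open>y k\<close>\<close>
  define D where "D k t = F t (u k t) (y k t) - (F t (u k t) (w t) + Fv t (u k t) (w t) \<bullet> (y k t - w t))" for k t
  have D0: "0 \<le> D k t" if "t \<in> I" for k t using F_subgradient[OF that, of "u k t" "w t" "y k t"] by (simp add: D_def)
  have iD: "integrable M (D k)" for k
    unfolding D_def[abs_def]
    by (intro integrable_cont continuous_intros jcont_continuous[OF F_jcont] jcont_continuous[OF Fv_jcont] u_cont wI y_cont)
  have iA: "integrable M (\<lambda>t. F t (u k t) (w t) + Fv t (u k t) (w t) \<bullet> (y k t - w t))" for k
    by (intro integrable_cont continuous_intros jcont_continuous[OF F_jcont] jcont_continuous[OF Fv_jcont] u_cont wI y_cont)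
  have limA: "(\<lambda>k. LINT t|M. F t (u k t) (w t) + Fv t (u k t) (w t) \<bullet> (y k t - w t)) \<longlonglongrightarrow> (LINT t|M. F t (U t) (w t) + Fv t (U t) (w t) \<bullet> (Y t - w t))"
    using LINT_affine_tendsto[OF wI c0 c0] by simp
  have "\<forall>\<^sub>F k in sequentially. (LINT t|M. F t (U t) (w t) + Fv t (U t) (w t) \<bullet> (Y t - w t)) - e1 < (LINT t|M. F t (u k t) (w t) + Fv t (u k t) (w t) \<bullet> (y k t - w t))"
    by (rule order_tendstoD(1)[OF limA]) (use e1 in simp)
  then have defect: "\<forall>\<^sub>F k in sequentially. (LINT t|M. D k t) \<le> 3 * e1"
    using energy_limsup[OF e1]
  proof eventually_elim
    case (elim k)
    have "(LINT t|M. D k t) = (LINT t|M. F t (u k t) (y k t)) - (LINT t|M. F t (u k t) (w t) + Fv t (u k t) (w t) \<bullet> (y k t - w t))"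
      unfolding D_def using adm_integrable(1)[OF adm_k] iA by (intro Bochner_Integration.integral_diff)
    then show ?case using elim w(2) by simp
  qed
  obtain R1 where R1: "R1 > 0" "(LINT t|M. max 0 (norm (\<beta> t) - R1)) < e1" using truncation_small[OF \<beta>_int e1] by blast
  define Q where "Q = (R1 + 1) + 2 * C2 / \<Lambda>"
  have Q: "Q \<ge> 0" using R1 C2 \<Lambda> by (simp add: Q_def)
  have C0: "C \<ge> 0" using order_trans[OF integral_nonneg_AE y_G[of 0]] G_nonneg by simp
  define \<delta> where "\<delta> = e / (2 * (Q + 1) * (C + 1))"
  have \<delta>: "\<delta> > 0" using assms Q C0 by (simp add: \<delta>_def)
  have Q\<delta>C: "Q * \<delta> * C \<le> e / 2"
  proof -
    have "Q * \<delta> * C \<le> (Q + 1) * \<delta> * (C + 1)" using Q C0 \<delta> by (intro mult_mono) auto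
    also have "\<dots> = e / 2"
    proof -
      have "p * (e / (2 * p * q)) * q = e / 2" if "p > 0" "q > 0" for p q :: real using that by simp
      from this[of "Q + 1" "C + 1"] show ?thesis unfolding \<delta>_def using Q C0 by linarith
    qed
    finally show ?thesis .
  qed
  obtain R2 where R2: "R2 \<ge> 1" "\<And>v::'a. norm v > R2 \<Longrightarrow> norm v \<le> \<delta> * G v" using superlinear_outside[OF \<delta>] by blast
  show thesis
  proof (rule that[of R2])
    fix R' assume R': "R' \<ge> R2"
    \<comment> \<open>large values of \<open>\<beta>\<close> are cut off at \<open>R1\<close>; a constant is absorbed into \<open>G\<close> because \<open>1 \<le> \<delta> *
      G\<close> for large slopes\<close>
    have pw: "tail R' (y k) t \<le> max 0 (norm (\<beta> t) - R1) + D k t / \<Lambda> + Q * \<delta> * G (y k t)" if t: "t \<in> I" for k t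
    proof (cases "norm (y k t) > R'")
      case False
      then show ?thesis using D0[OF t, of k] \<Lambda> Q \<delta> G_nonneg[of "y k t"] by (simp add: tail_def)
    next
      case True
      then have big: "1 \<le> norm (y k t)" "norm (y k t) \<le> \<delta> * G (y k t)" using R' R2 by auto
      have "\<bar>Fv t (u k t) (w t) \<bullet> (y k t - w t)\<bar> \<le> norm (Fv t (u k t) (w t)) * norm (y k t - w t)" by (rule Cauchy_Schwarz_ineq2)
      also have "\<dots> \<le> Cv * (norm (y k t) + W)"
        using Cv u_bound[OF t] W(2)[OF t] t norm_triangle_ineq4[of "y k t" "w t"] by (intro mult_mono) auto
      also have "\<dots> \<le> Cv * (1 + W) * norm (y k t)"
      proof -
        have "norm (y k t) + W \<le> (1 + W) * norm (y k t)" using big(1) W(1) mult_left_mono[of 1 "norm (y k t)" W] by (simp add: algebra_simps)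
        then show ?thesis using Cv(1) mult_left_mono[of _ _ Cv] by (simp add: mult.assoc)
      qed
      finally have v: "\<bar>Fv t (u k t) (w t) \<bullet> (y k t - w t)\<bar> \<le> Cv * (1 + W) * norm (y k t)" .
      have f: "F t (u k t) (w t) \<le> Cf * norm (y k t)"
        using Cf(2)[OF t u_bound[OF t] W(2)[OF t], of k] mult_left_mono[OF big(1) Cf(1)] by simp
      have "\<Lambda> * G (y k t) \<le> D k t + C2 * norm (y k t)"
        using F_lower[OF t, of "y k t" "u k t"] v f by (simp add: D_def C2_def distrib_right)
      also have "\<dots> \<le> D k t + C2 * (\<delta> * G (y k t))" using big(2) C2 by (intro add_left_mono mult_left_mono) auto
      finally have g: "G (y k t) \<le> D k t / \<Lambda> + C2 / \<Lambda> * (\<delta> * G (y k t))"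
        using \<Lambda> by (simp add: field_simps)
      define P X where "P = (R1 + 1) * (\<delta> * G (y k t))" and "X = C2 / \<Lambda> * (\<delta> * G (y k t))"
      have "\<beta> t \<le> R1 + max 0 (norm (\<beta> t) - R1)" by auto
      moreover have "R1 + 1 \<le> P"
        using R1 big mult_left_mono[of 1 "\<delta> * G (y k t)" "R1 + 1"] by (simp add: P_def)
      moreover have "0 \<le> X" unfolding X_def using C2 \<Lambda> \<delta> G_nonneg[of "y k t"] by simp
      moreover have "Q * \<delta> * G (y k t) = P + X + X" by (simp add: P_def X_def Q_def algebra_simps)
      moreover have "tail R' (y k) t = \<beta> t + 1 + G (y k t)" using True by (simp add: tail_def Bd_def)
      ultimately show ?thesis using g[folded X_def] by linarith
    qed
    have i\<beta>: "integrable M (\<lambda>t. max 0 (norm (\<beta> t) - R1))"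
      by (rule Bochner_Integration.integrable_bound[OF \<beta>_int]) (use R1 \<beta>_int in auto)
    have iG: "integrable M (\<lambda>t. G (y k t))" for k by (rule integrable_G_cont[OF y_cont])
    from defect show "\<forall>\<^sub>F k in sequentially. (LINT t|M. tail R' (y k) t) \<le> e"
    proof eventually_elim
      case (elim k)
      have "(LINT t|M. tail R' (y k) t) \<le> (LINT t|M. max 0 (norm (\<beta> t) - R1) + D k t / \<Lambda> + Q * \<delta> * G (y k t))"
        using i\<beta> iD iG integrable_tail[OF adm_k] pw by (intro integral_mono) (auto simp: space_M)
      also have "\<dots> = (LINT t|M. max 0 (norm (\<beta> t) - R1)) + (LINT t|M. D k t) / \<Lambda> + Q * \<delta> * (LINT t|M. G (y k t))"
        using i\<beta> iD iG by simp
      also have "\<dots> \<le> e1 + 3 * e1 / \<Lambda> + Q * \<delta> * C"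
        using R1(2) elim \<Lambda> Q \<delta> y_G[of k] by (intro add_mono divide_right_mono mult_left_mono) auto
      finally show ?case using e1e Q\<delta>C by linarith
    qed
  qed
qed

lemma limit_tail:
  assumes "e > 0"
  obtains R\<^sub>0 where "\<And>R'. R' \<ge> R\<^sub>0 \<Longrightarrow> (LINT t|M. tail R' Y t) \<le> e"
proof -
  have iB: "integrable M (\<lambda>t. Bd t (Y t))" by (rule integrable_Bd[OF Y_G])
  have tm: "tail R' Y \<in> borel_measurable M" for R' using integrable_tail[OF adm_U] by simp
  have "(\<lambda>n. LINT t|M. tail (real n) Y t) \<longlonglongrightarrow> (LINT t|M. 0)"
  proof (rule integral_dominated_convergence[where w = "\<lambda>t. norm (Bd t (Y t))"])
    show "AE t in M. (\<lambda>n. tail (real n) Y t) \<longlonglongrightarrow> 0"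
    proof (rule AE_I2, rule tendsto_eventually)
      fix t
      obtain N :: nat where N: "norm (Y t) < real N" using reals_Archimedean2 by blast
      show "\<forall>\<^sub>F n in sequentially. tail (real n) Y t = 0"
        by (rule eventually_sequentiallyI[of N]) (use N in \<open>auto simp: tail_def\<close>)
    qed
    show "tail (real n) Y \<in> borel_measurable M" for n by (rule tm)
  qed (use iB in \<open>auto simp: tail_def\<close>)
  then have lim0: "(\<lambda>n. LINT t|M. tail (real n) Y t) \<longlonglongrightarrow> 0" by simp
  have "\<forall>\<^sub>F n in sequentially. (LINT t|M. tail (real n) Y t) < e"
    by (rule order_tendstoD(2)[OF lim0 assms])
  then obtain n :: nat where n: "(LINT t|M. tail (real n) Y t) < e" by (auto simp: eventually_sequentially)
  show thesis
  proof (rule that[of "real n"])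
    fix R' :: real assume "R' \<ge> real n"
    then have "(LINT t|M. tail R' Y t) \<le> (LINT t|M. tail (real n) Y t)"
    proof (intro integral_mono integrable_tail[OF adm_U])
      fix t assume "t \<in> space M" "real n \<le> R'"
      then show "tail R' Y t \<le> tail (real n) Y t"
        using Bd_pos[of t "Y t"] by (auto simp: tail_def space_M)
    qed
    then show "(LINT t|M. tail R' Y t) \<le> e" using n by linarith
  qed
qed

text \<open>Since \<open>F\<close> is merely convex in the velocity, the slopes need not converge in the mean and
  \<open>Fv\<close> cannot be passed to the limit directly. Energies can: put \<open>\<psi> k s = (LINT t|M. F t (u k t +
  s \<phi> t) (y k t + s \<eta> t))\<close> and let \<open>\<psi>\<close> be the same function for the limit. Then the lower limit of
  \<open>\<psi> k s\<close> is at least \<open>\<psi> s\<close>, and the upper limit of \<open>\<psi> k 0\<close> is at most \<open>\<psi> 0\<close>. The functions \<open>\<psi> k\<close>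
  are differentiable at 0 at a common rate, by equi-integrability, with derivatives converging to
  some \<open>l\<close>. Hence \<open>\<psi> s - \<psi> 0 \<le> s l + o(s)\<close>, and both signs of \<open>s\<close> give \<open>\<psi>' 0 = l\<close>.\<close>

theorem euler_equation:
  assumes \<eta>: "continuous_on UNIV \<eta>" "(LINT t|M. \<eta> t) = 0"
  shows "(LINT t|M. dF U Y (\<lambda>t. d + prim \<eta> t) \<eta> t) + (LINT t|M. rl t \<bullet> (d + prim \<eta> t)) = 0"
proof -
  define \<phi> where "\<phi> = (\<lambda>t. d + prim \<eta> t)"
  have \<eta>I: "continuous_on I \<eta>" using \<eta> continuous_on_subset by blast
  have \<phi>c: "continuous_on I \<phi>" unfolding \<phi>_def by (intro continuous_intros prim_cont integrable_cont \<eta>I)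
  obtain P where P: "P \<ge> 0" "\<And>t. t \<in> I \<Longrightarrow> norm (\<phi> t) \<le> P" using bounded_cont[OF \<phi>c] by blast
  define S where "S = (LINT t|M. dF U Y \<phi> \<eta> t)"
  define B where "B k = (LINT t|M. dF (u k) (y k) \<phi> \<eta> t)" for k
  define l where "l = - (LINT t|M. rl t \<bullet> \<phi> t)"
  have rlim: "(\<lambda>k. LINT t|M. r k t \<bullet> \<phi> t) \<longlonglongrightarrow> (LINT t|M. rl t \<bullet> \<phi> t)"
  proof (rule Lim_transform2[OF tendsto_const])
    show "(\<lambda>k. (LINT t|M. rl t \<bullet> \<phi> t) - (LINT t|M. r k t \<bullet> \<phi> t)) \<longlonglongrightarrow> 0"
    proof (rule Lim_null_comparison)
      show "(\<lambda>k. P * (LINT t|M. norm (r k t - rl t))) \<longlonglongrightarrow> 0" using tendsto_mult_right_zero[OF r_lim] by blast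
      show "\<forall>\<^sub>F k in sequentially. norm ((LINT t|M. rl t \<bullet> \<phi> t) - (LINT t|M. r k t \<bullet> \<phi> t)) \<le> P * (LINT t|M. norm (r k t - rl t))"
      proof (rule always_eventually, rule allI)
        fix k
        have i: "integrable M (\<lambda>t. r k t - rl t)" using r_int rl_int by simp
        have "\<bar>LINT t|M. (r k t - rl t) \<bullet> \<phi> t\<bar> \<le> P * (LINT t|M. norm (r k t - rl t))"
          by (rule integrable_inner_bounded(2)[OF i measurable_cont[OF \<phi>c] P(2)])
        moreover have "(LINT t|M. (r k t - rl t) \<bullet> \<phi> t) = (LINT t|M. r k t \<bullet> \<phi> t) - (LINT t|M. rl t \<bullet> \<phi> t)"
          using integrable_inner_cont[OF r_int \<phi>c] integrable_inner_cont[OF rl_int \<phi>c] by (simp add: inner_diff_left)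
        ultimately show "norm ((LINT t|M. rl t \<bullet> \<phi> t) - (LINT t|M. r k t \<bullet> \<phi> t)) \<le> P * (LINT t|M. norm (r k t - rl t))" by simp
      qed
    qed
  qed
  have "(\<lambda>k. B k + (LINT t|M. r k t \<bullet> \<phi> t)) \<longlonglongrightarrow> 0" using test[OF \<eta>, of d] by (simp add: B_def \<phi>_def)
  from tendsto_diff[OF this rlim] have Bl: "B \<longlonglongrightarrow> l" by (simp add: l_def)
  obtain C3 where C3: "C3 \<ge> 0"
    "\<And>\<epsilon> R'. \<epsilon> > 0 \<Longrightarrow> \<exists>s0>0. \<forall>s u y. \<bar>s\<bar> \<le> s0 \<longrightarrow> adm R u y \<longrightarrow>
      \<bar>(LINT t|M. F t (u t + s *\<^sub>R \<phi> t) (y t + s *\<^sub>R \<eta> t)) - (LINT t|M. F t (u t) (y t)) - s * (LINT t|M. dF u y \<phi> \<eta> t)\<bar>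
        \<le> \<bar>s\<bar> * (\<epsilon> + C3 * (LINT t|M. tail R' y t))" using uniform_differentiability[OF \<phi>c \<eta>I] by blast
  have key: "\<bar>S - l\<bar> \<le> (5 + 2 * C3) * \<epsilon>" if \<epsilon>: "\<epsilon> > 0" for \<epsilon>
  proof -
    obtain R1 where R1: "\<And>R'. R' \<ge> R1 \<Longrightarrow> \<forall>\<^sub>F k in sequentially. (LINT t|M. tail R' (y k) t) \<le> \<epsilon>" using equi_integrable[OF \<epsilon>] by blast
    obtain R2 where R2: "\<And>R'. R' \<ge> R2 \<Longrightarrow> (LINT t|M. tail R' Y t) \<le> \<epsilon>" using limit_tail[OF \<epsilon>] by blast
    define R' where "R' = max R1 R2"
    obtain s0 where s0: "s0 > 0" "\<And>s u y. \<bar>s\<bar> \<le> s0 \<Longrightarrow> adm R u y \<Longrightarrow>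
      \<bar>(LINT t|M. F t (u t + s *\<^sub>R \<phi> t) (y t + s *\<^sub>R \<eta> t)) - (LINT t|M. F t (u t) (y t)) - s * (LINT t|M. dF u y \<phi> \<eta> t)\<bar>
        \<le> \<bar>s\<bar> * (\<epsilon> + C3 * (LINT t|M. tail R' y t))" using C3(2)[OF \<epsilon>, of R'] by blast
    \<comment> \<open>the sign of the step is that of \<open>S - l\<close>, so one inequality bounds the absolute value\<close>
    define s where "s = (if S - l \<ge> 0 then s0 else - s0)"
    have s: "\<bar>s\<bar> = s0" "s * (S - l) = s0 * \<bar>S - l\<bar>" using s0(1) by (auto simp: s_def abs_if algebra_simps)
    have se: "s0 * \<epsilon> > 0" using s0 \<epsilon> by simp
    have sc: "continuous_on I (\<lambda>t. s *\<^sub>R \<phi> t)" "continuous_on I (\<lambda>t. s *\<^sub>R \<eta> t)" by (intro continuous_intros \<phi>c \<eta>I)+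
    have tY: "(LINT t|M. tail R' Y t) \<le> \<epsilon>" using R2 by (simp add: R'_def)
    have tk: "\<forall>\<^sub>F k in sequentially. (LINT t|M. tail R' (y k) t) \<le> \<epsilon>" using R1 by (simp add: R'_def)
    have Bs: "(\<lambda>k. s * B k) \<longlonglongrightarrow> s * l" by (intro tendsto_intros Bl)
    have "\<forall>\<^sub>F k in sequentially. s * B k < s * l + s0 * \<epsilon>" by (rule order_tendstoD(2)[OF Bs]) (use se in simp)
    with tk energy_limsup[OF se] shifted_energy_liminf[OF sc se]
    have "\<forall>\<^sub>F k in sequentially. s * S \<le> s * l + s0 * ((5 + 2 * C3) * \<epsilon>)"
    proof eventually_elim
      case (elim k)
      have bnd: "s0 * (\<epsilon> + C3 * x) \<le> s0 * (\<epsilon> + C3 * \<epsilon>)" if "x \<le> \<epsilon>" for x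
        using that s0 C3 by (intro mult_left_mono add_left_mono) auto
      have 1: "\<bar>(LINT t|M. F t (U t + s *\<^sub>R \<phi> t) (Y t + s *\<^sub>R \<eta> t)) - (LINT t|M. F t (U t) (Y t)) - s * S\<bar> \<le> s0 * (\<epsilon> + C3 * \<epsilon>)"
        using s0(2)[OF eq_refl[OF s(1)] adm_U] bnd[OF tY] by (simp only: S_def s(1))
      have 2: "\<bar>(LINT t|M. F t (u k t + s *\<^sub>R \<phi> t) (y k t + s *\<^sub>R \<eta> t)) - (LINT t|M. F t (u k t) (y k t)) - s * B k\<bar> \<le> s0 * (\<epsilon> + C3 * \<epsilon>)"
        using s0(2)[OF eq_refl[OF s(1)] adm_k, of k] bnd[OF elim(1)] by (simp only: B_def s(1))
      have 3: "s0 * ((5 + 2 * C3) * \<epsilon>) = 2 * (s0 * (\<epsilon> + C3 * \<epsilon>)) + 3 * (s0 * \<epsilon>)" by (simp add: algebra_simps)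
      show ?case using 1 2 elim(2-4) unfolding 3 by linarith
    qed
    then have "s * S \<le> s * l + s0 * ((5 + 2 * C3) * \<epsilon>)" by simp
    then have "s0 * \<bar>S - l\<bar> \<le> s0 * ((5 + 2 * C3) * \<epsilon>)" using s(2) by (simp add: right_diff_distrib)
    then show ?thesis using s0(1) by (metis mult_le_cancel_left_pos)
  qed
  have "S = l"
  proof (rule ccontr)
    assume "S \<noteq> l"
    define Q where "Q = 5 + 2 * C3"
    have Q: "Q > 0" using C3 by (simp add: Q_def)
    have "\<bar>S - l\<bar> \<le> Q * (\<bar>S - l\<bar> / (2 * Q))" using key[of "\<bar>S - l\<bar> / (2 * Q)"] \<open>S \<noteq> l\<close> Q by (simp add: Q_def)
    also have "\<dots> = \<bar>S - l\<bar> / 2" using Q by simp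
    finally show False using \<open>S \<noteq> l\<close> by simp
  qed
  then show ?thesis by (simp add: S_def l_def \<phi>_def)
qed

end

section \<open>The action as a functional of starting value and slope\<close>

text \<open>Superlinear growth makes the supremum that defines the conjugate finite.\<close>

lemma (in orlicz_setting) fenchel_young: "x \<bullet> y \<le> fenchel_conjugate G y + G x"
proof -
  have "norm y + 1 > 0" by (simp add: add_nonneg_pos)
  then have d: "1 / (norm y + 1) > 0" by simp
  obtain C where C: "C \<ge> 0" "\<And>v::'a. norm v \<le> 1 / (norm y + 1) * G v + C" using G_superlinear[OF d] by blast
  have "bdd_above (range (\<lambda>x. x \<bullet> y - G x))"
  proof (rule bdd_aboveI2)
    fix x :: 'a
    have "x \<bullet> y \<le> norm x * norm y" by (rule norm_cauchy_schwarz)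
    also have "\<dots> \<le> (1 / (norm y + 1) * G x + C) * norm y" using C(2)[of x] by (intro mult_right_mono) auto
    also have "\<dots> = norm y / (norm y + 1) * G x + C * norm y" by (simp add: distrib_right)
    also have "\<dots> \<le> 1 * G x + C * norm y"
      using G_nonneg[of x] by (intro add_right_mono mult_right_mono) (auto simp: divide_le_eq_1 add_nonneg_pos)
    finally show "x \<bullet> y - G x \<le> C * norm y" by simp
  qed
  then have "x \<bullet> y - G x \<le> fenchel_conjugate G y" unfolding fenchel_conjugate_def by (rule cSUP_upper[OF UNIV_I])
  then show ?thesis by simp
qed

locale action = lagrangian T G F Fx Fv a \<beta> \<Lambda>
  for T :: real and G :: "'a::euclidean_space \<Rightarrow> real" and F Fx Fv a \<beta> \<Lambda> +
  fixes V :: "real \<Rightarrow> 'a \<Rightarrow> real" and Vx :: "real \<Rightarrow> 'a \<Rightarrow> 'a" and f :: "real \<Rightarrow> 'a"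
  assumes V_jcont: "jcont (\<lambda>t x (v::'a). V t x)" and Vx_jcont: "jcont (\<lambda>t x (v::'a). Vx t x)"
    and V_deriv: "\<And>t x. t \<in> I \<Longrightarrow> (V t has_derivative (\<lambda>h. Vx t x \<bullet> h)) (at x)"
    and f_meas: "f \<in> borel_measurable M" and f_conj: "integrable M (\<lambda>t. fenchel_conjugate G (f t))"
begin

text \<open>The Fenchel-Young inequality at the unit vector in the direction of \<open>f t\<close>.\<close>

lemma f_int: "integrable M f"
proof -
  obtain B where B: "B \<ge> 0" "\<And>v::'a. norm v \<le> 1 \<Longrightarrow> G v \<le> B" using G_bounded by blast
  have le: "norm (f t) \<le> fenchel_conjugate G (f t) + B" for t
  proof -
    have "norm (f t) = sgn (f t) \<bullet> f t"
      by (cases "f t = 0") (simp_all add: sgn_div_norm dot_square_norm power2_eq_square)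
    also have "\<dots> \<le> fenchel_conjugate G (f t) + G (sgn (f t))" by (rule fenchel_young)
    also have "\<dots> \<le> fenchel_conjugate G (f t) + B" using B(2)[of "sgn (f t)"] by (simp add: norm_sgn)
    finally show ?thesis .
  qed
  have "integrable M (\<lambda>t. fenchel_conjugate G (f t) + B)" using f_conj by simp
  then show ?thesis
    by (rule Bochner_Integration.integrable_bound) (use f_meas le in \<open>auto intro!: AE_I2 intro: order_trans[OF _ abs_ge_self]\<close>)
qed

lemma V_line: "t \<in> I \<Longrightarrow> ((\<lambda>s. V t (x + s *\<^sub>R h)) has_real_derivative Vx t (x + r *\<^sub>R h) \<bullet> h) (at r)"
proof -
  assume t: "t \<in> I"
  have c: "((\<lambda>s. x + s *\<^sub>R h) has_derivative (\<lambda>s. s *\<^sub>R h)) (at r)" by (auto intro!: derivative_eq_intros)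
  from has_derivative_compose[OF c V_deriv[OF t]]
  show ?thesis unfolding has_field_derivative_def
    by (rule has_derivative_eq_rhs) (auto simp: fun_eq_iff)
qed

definition mean :: "(real \<Rightarrow> 'a) \<Rightarrow> 'a" where "mean y = (1 / (2 * T)) *\<^sub>R (LINT t|M. y t)"

text \<open>Subtracting the mean makes every curve periodic. The linear space \<open>'a \<times> (real \<Rightarrow>\<^sub>C 'a)\<close> of
  starting values and slopes thus parametrises periodic curves, and no constraint has to be
  carried along.\<close>

definition slope :: "'a \<times> (real \<Rightarrow>\<^sub>C 'a) \<Rightarrow> (real \<Rightarrow>\<^sub>C 'a)" where
  "slope x = snd x - const_bcontfun (mean (snd x))"

definition curve :: "'a \<times> (real \<Rightarrow>\<^sub>C 'a) \<Rightarrow> real \<Rightarrow> 'a" where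
  "curve x t = fst x + prim (slope x) t"

lemma slope_apply: "slope x t = snd x t - mean (snd x)" by (simp add: slope_def const_bcontfun.rep_eq)

lemma mean_slope: "(LINT t|M. slope x t) = 0"
  using integrable_bcontfun[of "snd x"] T_pos by (simp add: slope_apply mean_def)

lemma curve_cont: "continuous_on I (curve x)"
  unfolding curve_def[abs_def] by (intro continuous_intros prim_cont integrable_bcontfun)

lemma slope_lin: "slope (x + s *\<^sub>R h) = slope x + s *\<^sub>R slope h"
proof (rule bcontfun_eqI)
  fix t
  have "(LINT t|M. snd x t + s *\<^sub>R snd h t) = (LINT t|M. snd x t) + s *\<^sub>R (LINT t|M. snd h t)"
    using integrable_bcontfun[of "snd x"] integrable_bcontfun[of "snd h"] by simp
  then show "slope (x + s *\<^sub>R h) t = (slope x + s *\<^sub>R slope h) t"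
    by (simp add: slope_apply mean_def algebra_simps)
qed

lemma curve_lin: "t \<in> I \<Longrightarrow> curve (x + s *\<^sub>R h) t = curve x t + s *\<^sub>R curve h t"
  using prim_lincomb[of t 1 "slope x" s "slope h"] by (simp add: curve_def slope_lin algebra_simps)

lemma norm_slope: "norm (slope x t) \<le> 2 * norm x"
proof -
  have s: "norm (snd x t) \<le> norm x" for t
    using order_trans[OF norm_bounded[of "snd x" t] norm_snd_le[of "snd x" "fst x"]] by simp
  have "norm (mean (snd x)) \<le> (1 / (2 * T)) * (LINT t|M. norm (snd x t))"
    unfolding mean_def using T_pos integral_norm_bound[of M "apply_bcontfun (snd x)"] by (simp add: divide_right_mono)
  also have "\<dots> \<le> (1 / (2 * T)) * (LINT t|M. norm x)"
    using T_pos s integrable_bcontfun[of "snd x"] by (intro mult_left_mono integral_mono) auto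
  also have "\<dots> = norm x" using T_pos by simp
  finally have "norm (mean (snd x)) \<le> norm x" .
  then show ?thesis using s[of t] norm_triangle_ineq4[of "snd x t" "mean (snd x)"] by (simp add: slope_apply)
qed

lemma norm_curve: "t \<in> I \<Longrightarrow> norm (curve x t) \<le> (1 + 4 * T) * norm x"
proof -
  assume t: "t \<in> I"
  have "norm (prim (slope x) t - prim (slope x) (-T)) \<le> (LINT t|M. norm (slope x t))"
    by (rule prim_norm_le[OF integrable_bcontfun]) (use t T_pos in auto)
  also have "\<dots> \<le> (LINT t|M. 2 * norm x)"
    using integrable_bcontfun norm_slope by (intro integral_mono) auto
  finally have "norm (prim (slope x) t) \<le> 4 * T * norm x" by simp
  then show ?thesis using norm_triangle_ineq[of "fst x" "prim (slope x) t"] norm_fst_le[of "fst x" "snd x"]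
    by (simp add: curve_def algebra_simps)
qed

definition J :: "'a \<times> (real \<Rightarrow>\<^sub>C 'a) \<Rightarrow> real" where
  "J x = (LINT t|M. F t (curve x t) (slope x t) + V t (curve x t) + f t \<bullet> curve x t)"

definition DJ :: "'a \<times> (real \<Rightarrow>\<^sub>C 'a) \<Rightarrow> 'a \<times> (real \<Rightarrow>\<^sub>C 'a) \<Rightarrow> real" where
  "DJ x h = (LINT t|M. dF (curve x) (slope x) (curve h) (slope h) t + (Vx t (curve x t) + f t) \<bullet> curve h t)"

lemma slope_contI: "continuous_on I (slope x)" by simp

lemma integrable_J_terms:
  "integrable M (\<lambda>t. F t (curve x t) (slope x t))" "integrable M (\<lambda>t. V t (curve x t))" "integrable M (\<lambda>t. f t \<bullet> curve x t)"
  by (intro integrable_cont jcont_continuous[OF F_jcont] jcont_continuous[OF V_jcont, where y = "\<lambda>_. 0"]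
      curve_cont slope_contI integrable_inner_cont f_int continuous_on_const)+

lemma integrable_DJ_terms:
  "integrable M (dF (curve x) (slope x) (curve h) (slope h))" "integrable M (\<lambda>t. Vx t (curve x t))"
  "integrable M (\<lambda>t. (Vx t (curve x t) + f t) \<bullet> curve h t)"
proof -
  show "integrable M (dF (curve x) (slope x) (curve h) (slope h))" unfolding dF_def[abs_def]
    by (intro integrable_cont continuous_intros jcont_continuous[OF Fx_jcont] jcont_continuous[OF Fv_jcont] curve_cont slope_contI)
  show V: "integrable M (\<lambda>t. Vx t (curve x t))"
    by (intro integrable_cont jcont_continuous[OF Vx_jcont, where y = "\<lambda>_. 0"] curve_cont continuous_on_const)
  show "integrable M (\<lambda>t. (Vx t (curve x t) + f t) \<bullet> curve h t)"
    by (intro integrable_inner_cont Bochner_Integration.integrable_add V f_int curve_cont)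
qed

lemma DJ_eq: "DJ x h = (LINT t|M. dF (curve x) (slope x) (curve h) (slope h) t) + (LINT t|M. (Vx t (curve x t) + f t) \<bullet> curve h t)"
  unfolding DJ_def using integrable_DJ_terms by simp

lemma J_eq: "J x = (LINT t|M. F t (curve x t) (slope x t)) + (LINT t|M. V t (curve x t)) + (LINT t|M. f t \<bullet> curve x t)"
  unfolding J_def using integrable_J_terms by simp

lemma curve_tendsto: "t \<in> I \<Longrightarrow> xn \<longlonglongrightarrow> x \<Longrightarrow> (\<lambda>n. curve (xn n) t) \<longlonglongrightarrow> curve x t"
  and slope_tendsto: "xn \<longlonglongrightarrow> x \<Longrightarrow> (\<lambda>n. slope (xn n) t) \<longlonglongrightarrow> slope x t"
proof -
  assume xn: "xn \<longlonglongrightarrow> x"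
  have n0: "(\<lambda>n. norm (xn n - x)) \<longlonglongrightarrow> 0" using xn by (simp add: tendsto_norm_zero LIM_zero)
  show "(\<lambda>n. slope (xn n) t) \<longlonglongrightarrow> slope x t"
  proof (rule LIM_zero_cancel, rule Lim_null_comparison)
    show "(\<lambda>n. 2 * norm (xn n - x)) \<longlonglongrightarrow> 0" using tendsto_mult_right_zero[OF n0] by blast
    have "slope (xn n) t - slope x t = slope (xn n - x) t" for n
      using slope_lin[of x 1 "xn n - x"] by simp
    then show "\<forall>\<^sub>F n in sequentially. norm (slope (xn n) t - slope x t) \<le> 2 * norm (xn n - x)" using norm_slope by simp
  qed
  assume t: "t \<in> I"
  show "(\<lambda>n. curve (xn n) t) \<longlonglongrightarrow> curve x t"
  proof (rule LIM_zero_cancel, rule Lim_null_comparison)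
    show "(\<lambda>n. (1 + 4 * T) * norm (xn n - x)) \<longlonglongrightarrow> 0" using tendsto_mult_right_zero[OF n0] by blast
    have "curve (xn n) t - curve x t = curve (xn n - x) t" for n
      using curve_lin[OF t, of x 1 "xn n - x"] by simp
    then show "\<forall>\<^sub>F n in sequentially. norm (curve (xn n) t - curve x t) \<le> (1 + 4 * T) * norm (xn n - x)" using norm_curve[OF t] by simp
  qed
qed

lemma bounded_sequence:
  assumes "xn \<longlonglongrightarrow> x"
  obtains R where "R \<ge> 0" "\<And>n t. t \<in> I \<Longrightarrow> norm (curve (xn n) t) \<le> R" "\<And>n t. norm (slope (xn n) t) \<le> R"
proof -
  obtain K where K: "K > 0" "\<And>n. norm (xn n) \<le> K"
    using convergent_imp_Bseq[OF convergentI[OF assms]] unfolding Bseq_def by blast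
  show thesis
  proof (rule that[of "(2 + 4 * T) * K"])
    show "(2 + 4 * T) * K \<ge> 0" using K T_pos by simp
    fix n t
    have "2 * norm (xn n) \<le> (2 + 4 * T) * K" using K(2)[of n] T_pos by (intro mult_mono) auto
    then show "norm (slope (xn n) t) \<le> (2 + 4 * T) * K" using norm_slope order_trans by blast
    assume t: "t \<in> I"
    have "(1 + 4 * T) * norm (xn n) \<le> (2 + 4 * T) * K" using K(2)[of n] T_pos by (intro mult_mono) auto
    then show "norm (curve (xn n) t) \<le> (2 + 4 * T) * K" using norm_curve[OF t] order_trans by blast
  qed
qed

text \<open>Dominated convergence: a convergent sequence of parameters has uniformly bounded curves and
  slopes.\<close>

lemma DJ_sequential:
  assumes x: "xn \<longlonglongrightarrow> x" and h: "hn \<longlonglongrightarrow> h"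
  shows "(\<lambda>n. DJ (xn n) (hn n)) \<longlonglongrightarrow> DJ x h"
proof -
  obtain R where R: "R \<ge> 0" "\<And>n t. t \<in> I \<Longrightarrow> norm (curve (xn n) t) \<le> R" "\<And>n t. norm (slope (xn n) t) \<le> R" using bounded_sequence[OF x] by blast
  obtain H where H: "H \<ge> 0" "\<And>n t. t \<in> I \<Longrightarrow> norm (curve (hn n) t) \<le> H" "\<And>n t. norm (slope (hn n) t) \<le> H" using bounded_sequence[OF h] by blast
  obtain C1 where C1: "C1 \<ge> 0" "\<And>t x v. t \<in> I \<Longrightarrow> norm x \<le> R \<Longrightarrow> norm v \<le> R \<Longrightarrow> norm (Fx t x v) \<le> C1" using jcont_bounded[OF Fx_jcont] by blast
  obtain C2 where C2: "C2 \<ge> 0" "\<And>t x v. t \<in> I \<Longrightarrow> norm x \<le> R \<Longrightarrow> norm v \<le> R \<Longrightarrow> norm (Fv t x v) \<le> C2" using jcont_bounded[OF Fv_jcont] by blast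
  obtain C3 where C3: "C3 \<ge> 0" "\<And>t x v. t \<in> I \<Longrightarrow> norm x \<le> R \<Longrightarrow> norm (v::'a) \<le> R \<Longrightarrow> norm (Vx t x) \<le> C3" using jcont_bounded[OF Vx_jcont] by blast
  show ?thesis unfolding DJ_def
  proof (rule integral_dominated_convergence[where w = "\<lambda>t. C1 * H + C2 * H + (C3 + norm (f t)) * H"])
    show "AE t in M. (\<lambda>n. dF (curve (xn n)) (slope (xn n)) (curve (hn n)) (slope (hn n)) t + (Vx t (curve (xn n) t) + f t) \<bullet> curve (hn n) t)
        \<longlonglongrightarrow> dF (curve x) (slope x) (curve h) (slope h) t + (Vx t (curve x t) + f t) \<bullet> curve h t"
    proof (rule AE_I2)
      fix t assume "t \<in> space M"
      then have t: "t \<in> I" by (simp add: space_M)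
      show "(\<lambda>n. dF (curve (xn n)) (slope (xn n)) (curve (hn n)) (slope (hn n)) t + (Vx t (curve (xn n) t) + f t) \<bullet> curve (hn n) t)
        \<longlonglongrightarrow> dF (curve x) (slope x) (curve h) (slope h) t + (Vx t (curve x t) + f t) \<bullet> curve h t"
        unfolding dF_def
        by (intro tendsto_intros jcont_tendsto[OF Fx_jcont t] jcont_tendsto[OF Fv_jcont t] curve_tendsto[OF t] slope_tendsto x h
            jcont_tendsto[OF Vx_jcont t, where v = "\<lambda>_. 0" and ?v0.0 = 0])
    qed
    show "AE t in M. norm (dF (curve (xn n)) (slope (xn n)) (curve (hn n)) (slope (hn n)) t + (Vx t (curve (xn n) t) + f t) \<bullet> curve (hn n) t)
        \<le> C1 * H + C2 * H + (C3 + norm (f t)) * H" for n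
    proof (rule AE_I2)
      fix t assume "t \<in> space M"
      then have t: "t \<in> I" by (simp add: space_M)
      have cs: "\<bar>v \<bullet> w\<bar> \<le> A * H" if "norm v \<le> A" "norm w \<le> H" for v w :: 'a and A
        using Cauchy_Schwarz_ineq2[of v w] mult_mono[OF that] norm_ge_zero[of v] that(1) by (smt (verit) norm_ge_zero)
      have 1: "\<bar>Fx t (curve (xn n) t) (slope (xn n) t) \<bullet> curve (hn n) t\<bar> \<le> C1 * H" by (intro cs C1 R H t)
      have 2: "\<bar>Fv t (curve (xn n) t) (slope (xn n) t) \<bullet> slope (hn n) t\<bar> \<le> C2 * H" by (intro cs C2 R H t)
      have "norm (Vx t (curve (xn n) t)) \<le> C3" by (rule C3(2)[OF t R(2)[OF t], of 0]) (use R(1) in simp)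
      then have "norm (Vx t (curve (xn n) t) + f t) \<le> C3 + norm (f t)"
        using norm_triangle_ineq[of "Vx t (curve (xn n) t)" "f t"] by linarith
      then have 3: "\<bar>(Vx t (curve (xn n) t) + f t) \<bullet> curve (hn n) t\<bar> \<le> (C3 + norm (f t)) * H" by (intro cs H t)
      show "norm (dF (curve (xn n)) (slope (xn n)) (curve (hn n)) (slope (hn n)) t + (Vx t (curve (xn n) t) + f t) \<bullet> curve (hn n) t)
        \<le> C1 * H + C2 * H + (C3 + norm (f t)) * H" using 1 2 3 unfolding dF_def real_norm_def by linarith
    qed
    show "integrable M (\<lambda>t. C1 * H + C2 * H + (C3 + norm (f t)) * H)" using f_int by simp
  qed (use integrable_DJ_terms in \<open>auto intro!: borel_measurable_add borel_measurable_integrable\<close>)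
qed

text \<open>Differentiation under the integral sign. The term with \<open>f\<close>, which need not be continuous, is
  linear along the line and is treated separately.\<close>

lemma J_line: "((\<lambda>s. J (x + s *\<^sub>R h)) has_real_derivative DJ x h) (at 0)"
proof -
  define \<psi> where "\<psi> s t = F t (curve x t + s *\<^sub>R curve h t) (slope x t + s *\<^sub>R slope h t) + V t (curve x t + s *\<^sub>R curve h t)" for s t
  define \<psi>' where "\<psi>' s t = Fx t (curve x t + s *\<^sub>R curve h t) (slope x t + s *\<^sub>R slope h t) \<bullet> curve h t
      + Fv t (curve x t + s *\<^sub>R curve h t) (slope x t + s *\<^sub>R slope h t) \<bullet> slope h t + Vx t (curve x t + s *\<^sub>R curve h t) \<bullet> curve h t" for s t
  have cts: "continuous_on I (\<lambda>t. curve x t + s *\<^sub>R curve h t)" "continuous_on I (\<lambda>t. slope x t + s *\<^sub>R slope h t)" for s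
    by (intro continuous_intros curve_cont slope_contI)+
  have \<psi>c: "continuous_on I (\<psi> s)" for s unfolding \<psi>_def
    by (intro continuous_intros jcont_continuous[OF F_jcont] jcont_continuous[OF V_jcont, where y = "\<lambda>_. 0"] cts)
  have \<psi>'c: "continuous_on I (\<psi>' s)" for s unfolding \<psi>'_def
    by (intro continuous_intros jcont_continuous[OF Fx_jcont] jcont_continuous[OF Fv_jcont] jcont_continuous[OF Vx_jcont, where y = "\<lambda>_. 0"] cts curve_cont slope_contI)
  have two: "continuous_on (UNIV \<times> I) (\<lambda>p. w (snd p))" if "continuous_on I w" for w :: "real \<Rightarrow> 'a"
    by (rule continuous_on_compose2[OF that]) (auto intro: continuous_intros)
  have jc: "continuous_on (UNIV \<times> I) (\<lambda>p. H (snd p) (curve x (snd p) + fst p *\<^sub>R curve h (snd p)) (slope x (snd p) + fst p *\<^sub>R slope h (snd p)))"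
    if H: "jcont H" for H :: "real \<Rightarrow> 'a \<Rightarrow> 'a \<Rightarrow> 'a"
  proof -
    have "continuous_on (UNIV \<times> I) (\<lambda>p. (snd p, curve x (snd p) + fst p *\<^sub>R curve h (snd p), slope x (snd p) + fst p *\<^sub>R slope h (snd p)))"
      by (intro continuous_intros two[OF curve_cont] two[OF slope_contI])
    from continuous_on_compose2[OF H[unfolded jcont_def] this] show ?thesis by (simp add: image_subset_iff)
  qed
  have joint: "continuous_on (UNIV \<times> cbox (-T) T) (\<lambda>(s, t). \<psi>' s t)"
    unfolding \<psi>'_def case_prod_beta cbox_interval
    using jc[OF Vx_jcont] by (intro continuous_intros jc[OF Fx_jcont] jc[OF Fv_jcont] two[OF curve_cont] two[OF slope_contI])
  have "((\<lambda>s. integral (cbox (-T) T) (\<psi> s)) has_field_derivative integral (cbox (-T) T) (\<psi>' 0)) (at 0 within UNIV)"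
  proof (rule leibniz_rule_field_derivative[OF _ _ joint])
    fix s t assume "t \<in> cbox (-T) T"
    then have t: "t \<in> I" by simp
    show "((\<lambda>s. \<psi> s t) has_field_derivative \<psi>' s t) (at s within UNIV)"
      unfolding \<psi>_def \<psi>'_def using DERIV_add[OF F_line[OF t] V_line[OF t]] by simp
  next
    fix s show "\<psi> s integrable_on cbox (-T) T" using \<psi>c[of s] by (simp add: integrable_continuous_real)
  qed auto
  moreover have "integral (cbox (-T) T) (\<psi> s) = (LINT t|M. \<psi> s t)" for s
    using lebesgue_integral_eq_integral[OF integrable_cont[OF \<psi>c[of s]]] by simp
  moreover have "integral (cbox (-T) T) (\<psi>' 0) = (LINT t|M. \<psi>' 0 t)"
    using lebesgue_integral_eq_integral[OF integrable_cont[OF \<psi>'c[of 0]]] by simp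
  ultimately have d1: "((\<lambda>s. LINT t|M. \<psi> s t) has_real_derivative (LINT t|M. \<psi>' 0 t)) (at 0)" by simp
  have fi: "integrable M (\<lambda>t. f t \<bullet> curve x t)" "integrable M (\<lambda>t. f t \<bullet> curve h t)" by (rule integrable_J_terms(3))+
  have "((\<lambda>s. (LINT t|M. f t \<bullet> curve x t) + s * (LINT t|M. f t \<bullet> curve h t)) has_real_derivative (LINT t|M. f t \<bullet> curve h t)) (at 0)"
    by (auto intro!: derivative_eq_intros)
  from DERIV_add[OF d1 this]
  have "((\<lambda>s. (LINT t|M. \<psi> s t) + ((LINT t|M. f t \<bullet> curve x t) + s * (LINT t|M. f t \<bullet> curve h t)))
      has_real_derivative (LINT t|M. \<psi>' 0 t) + (LINT t|M. f t \<bullet> curve h t)) (at 0)" .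
  moreover have "(LINT t|M. \<psi> s t) + ((LINT t|M. f t \<bullet> curve x t) + s * (LINT t|M. f t \<bullet> curve h t)) = J (x + s *\<^sub>R h)" for s
  proof -
    have "J (x + s *\<^sub>R h) = (LINT t|M. \<psi> s t + (f t \<bullet> curve x t + s * (f t \<bullet> curve h t)))"
      unfolding J_def \<psi>_def
      by (intro Bochner_Integration.integral_cong refl) (simp add: space_M curve_lin slope_lin inner_add_right)
    also have "\<dots> = (LINT t|M. \<psi> s t) + ((LINT t|M. f t \<bullet> curve x t) + s * (LINT t|M. f t \<bullet> curve h t))"
      using integrable_cont[OF \<psi>c[of s]] fi by simp
    finally show ?thesis by simp
  qed
  moreover have "(LINT t|M. \<psi>' 0 t) + (LINT t|M. f t \<bullet> curve h t) = DJ x h"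
  proof -
    have "DJ x h = (LINT t|M. \<psi>' 0 t + f t \<bullet> curve h t)"
      unfolding DJ_def \<psi>'_def dF_def by (intro Bochner_Integration.integral_cong refl) (simp add: inner_add_left)
    also have "\<dots> = (LINT t|M. \<psi>' 0 t) + (LINT t|M. f t \<bullet> curve h t)"
      using integrable_cont[OF \<psi>'c[of 0]] fi(2) by (intro Bochner_Integration.integral_add)
    finally show ?thesis by simp
  qed
  ultimately show ?thesis by simp
qed

lemma DJ_linear: "linear (DJ x)"
proof (rule linearI)
  have scaled: "DJ x (h + s *\<^sub>R k) = DJ x h + s * DJ x k" for h k s
  proof -
    have "DJ x (h + s *\<^sub>R k) = (LINT t|M. (dF (curve x) (slope x) (curve h) (slope h) t + (Vx t (curve x t) + f t) \<bullet> curve h t)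
        + s * (dF (curve x) (slope x) (curve k) (slope k) t + (Vx t (curve x t) + f t) \<bullet> curve k t))"
      unfolding DJ_def dF_def
      by (intro Bochner_Integration.integral_cong refl) (simp add: space_M curve_lin slope_lin inner_add_right algebra_simps)
    then show ?thesis unfolding DJ_def using integrable_DJ_terms by simp
  qed
  show "DJ x (h + k) = DJ x h + DJ x k" for h k using scaled[of h 1 k] by simp
  have "DJ x 0 = 0" using scaled[of 0 1 0] by simp
  then show "DJ x (s *\<^sub>R k) = s *\<^sub>R DJ x k" for s k using scaled[of 0 s k] by simp
qed

lemma J_C1: "C1_functional J DJ"
proof (rule C1_functional.intro)
  show "continuous_on UNIV (\<lambda>p. DJ (fst p) (snd p))"
    unfolding continuous_on_sequentially
  proof (intro allI ballI impI)
    fix p :: "nat \<Rightarrow> ('a \<times> (real \<Rightarrow>\<^sub>C 'a)) \<times> ('a \<times> (real \<Rightarrow>\<^sub>C 'a))" and q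
    assume "(\<forall>n. p n \<in> UNIV) \<and> p \<longlonglongrightarrow> q"
    then have "(\<lambda>n. fst (p n)) \<longlonglongrightarrow> fst q" "(\<lambda>n. snd (p n)) \<longlonglongrightarrow> snd q" by (auto intro: tendsto_intros)
    from DJ_sequential[OF this] show "((\<lambda>p. DJ (fst p) (snd p)) \<circ> p) \<longlonglongrightarrow> DJ (fst q) (snd q)" by (simp add: o_def)
  qed
qed (rule DJ_linear J_line)+

end

section \<open>Mountain pass geometry and a priori bounds\<close>

text \<open>The mountain pass theorem is applied on the product of the space of starting values with
  this one.\<close>

instance bcontfun :: (metric_space, banach) banach ..

lemma powr_dominates:
  fixes p \<delta> :: real
  assumes "p > 1" "\<delta> > 0"
  obtains C where "C \<ge> 0" "\<And>s. s \<ge> 0 \<Longrightarrow> s \<le> \<delta> * s powr p + C"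
proof -
  define S where "S = (1 / \<delta>) powr (1 / (p - 1))"
  have S: "S > 0" using assms by (simp add: S_def)
  show thesis
  proof (rule that[of S])
    fix s :: real assume s: "s \<ge> 0"
    show "s \<le> \<delta> * s powr p + S"
    proof (cases "s \<le> S")
      case True then show ?thesis using assms by (simp add: add_increasing)
    next
      case False
      then have sp: "s > 0" using S by linarith
      have "1 / \<delta> = S powr (p - 1)" using assms by (simp add: S_def powr_powr)
      also have "\<dots> \<le> s powr (p - 1)" using False S assms by (intro powr_mono2) auto
      finally have "1 \<le> \<delta> * s powr (p - 1)" using assms by (simp add: field_simps)
      then have "s * 1 \<le> s * (\<delta> * s powr (p - 1))" using sp by (intro mult_left_mono) auto
      also have "\<dots> = \<delta> * s powr p" using sp by (simp add: powr_diff)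
      finally show ?thesis using S by simp
    qed
  qed (use S in simp)
qed

text \<open>The assumptions \<open>V_AR\<close> and \<open>V_neg\<close> summarise what the splitting of the potential into \<open>K -
  W\<close> says about \<open>V\<close> outside a ball.\<close>

locale mountain_pass_setting = action T G F Fx Fv a \<beta> \<Lambda> V Vx f
  for T :: real and G :: "'a::euclidean_space \<Rightarrow> real" and F Fx Fv a \<beta> \<Lambda> V Vx f +
  fixes g :: "real \<Rightarrow> real" and \<theta>F \<theta>V \<epsilon>V pK M0 \<rho> b :: real
  assumes T_half: "2 * T \<ge> 1" and G_diff: "\<And>x. \<exists>D. (G has_derivative D) (at x)"
    and F_zero: "\<And>t x. t \<in> I \<Longrightarrow> F t x 0 = 0"
    and F_AR: "\<And>t x v. t \<in> I \<Longrightarrow> Fx t x v \<bullet> x + Fv t x v \<bullet> v \<le> \<theta>F * F t x v"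
    and exponents: "\<theta>F < \<theta>V" "\<epsilon>V > 0" "1 < pK" "pK \<le> \<theta>V - \<epsilon>V" and M0: "M0 > 0"
    and V_AR: "\<And>t x. t \<in> I \<Longrightarrow> norm x > M0 \<Longrightarrow> Vx t x \<bullet> x \<le> \<theta>V * V t x - \<epsilon>V * norm x powr pK"
    and V_neg: "\<And>t x. t \<in> I \<Longrightarrow> norm x > M0 \<Longrightarrow> V t x < 0"
    and \<rho>: "\<rho> > 0" and b: "b > 1" and g_int: "integrable M g"
    and V_lower: "\<And>t x. t \<in> I \<Longrightarrow> G ((1 / (2 * (2 * T))) *\<^sub>R x) \<le> \<rho> / 2 \<Longrightarrow> V t x \<ge> b * G x - g t"
    and V_zero: "(LINT t|M. V t 0) = 0"
    and f_small: "(LINT t|M. fenchel_conjugate G (f t) + g t) < min \<Lambda> (b - 1) * \<rho>"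
begin

lemma \<theta>V_gt_1: "\<theta>V > 1" using exponents by linarith

text \<open>Integrate the inequality of the tangent plane at the mean.\<close>

lemma jensen:
  assumes z: "z \<in> borel_measurable M" "integrable M (\<lambda>t. G (z t))"
  shows "G (mean z) \<le> (1 / (2 * T)) * (LINT t|M. G (z t))"
proof -
  have zi: "integrable M z" by (rule integrable_of_G[OF z])
  obtain D where D: "(G has_derivative D) (at (mean z))" using G_diff by blast
  have bl: "bounded_linear D" by (rule has_derivative_bounded_linear[OF D])
  have sub: "G (mean z) + D (w - mean z) \<le> G w" for w
  proof (rule convex_subgradient[OF G_convex])
    have "((\<lambda>s::real. mean z + s *\<^sub>R (w - mean z)) has_derivative (\<lambda>s. s *\<^sub>R (w - mean z))) (at 0)"
      by (auto intro!: derivative_eq_intros)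
    moreover have "(G has_derivative D) (at (mean z + 0 *\<^sub>R (w - mean z)))" using D by simp
    ultimately have "((\<lambda>s. G (mean z + s *\<^sub>R (w - mean z))) has_derivative (\<lambda>s. D (s *\<^sub>R (w - mean z)))) (at 0)"
      by (rule has_derivative_compose)
    then show "((\<lambda>s. G (mean z + s *\<^sub>R (w - mean z))) has_real_derivative D (w - mean z)) (at 0)"
      unfolding has_field_derivative_def
      by (rule has_derivative_eq_rhs) (simp add: fun_eq_iff linear_scale[OF bounded_linear.linear[OF bl]])
  qed
  have iz: "integrable M (\<lambda>t. z t - mean z)" using zi by simp
  have "(LINT t|M. D (z t - mean z)) = D (LINT t|M. z t - mean z)"
    by (rule integral_bounded_linear[OF bl iz])
  also have "(LINT t|M. z t - mean z) = 0" using zi T_pos by (simp add: mean_def)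
  finally have D0: "(LINT t|M. D (z t - mean z)) = 0" by (simp add: linear_0[OF bounded_linear.linear[OF bl]])
  have iD: "integrable M (\<lambda>t. D (z t - mean z))" by (rule integrable_bounded_linear[OF bl iz])
  have "(LINT t|M. G (mean z) + D (z t - mean z)) \<le> (LINT t|M. G (z t))"
    using z iD by (intro integral_mono sub) auto
  then have "2 * T * G (mean z) \<le> (LINT t|M. G (z t))" using iD D0 by simp
  then show ?thesis using T_pos by (simp add: field_simps)
qed

lemma integrable_G_curve: "integrable M (\<lambda>t. G (curve x t))" by (rule integrable_G_cont[OF curve_cont])

lemma LINT_G_nonneg: "0 \<le> (LINT t|M. G (z t))" by (rule integral_nonneg_AE) (simp add: G_nonneg)

text \<open>With \<open>c\<close> the reciprocal of the length of the interval, \<open>c\<close> times an increment of the curve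
  is the mean of the slope cut off outside the interval of the increment, so Jensen's inequality
  bounds \<open>G\<close> of it. Half of the scaled curve at \<open>t\<close> is the midpoint of the scaled curve at \<open>s\<close> and
  the scaled increment from \<open>s\<close> to \<open>t\<close>; averaging over \<open>s\<close> gives the claim.\<close>

lemma pointwise_G_bound:
  assumes t: "t \<in> I"
  shows "G ((1 / (2 * (2 * T))) *\<^sub>R curve x t) \<le> ((LINT t|M. G (slope x t)) + (LINT t|M. G (curve x t))) / 2"
proof -
  define c where "c = 1 / (2 * T)"
  have c: "0 < c" "c \<le> 1" "c * (2 * T) = 1" using T_half T_pos by (auto simp: c_def)
  define N1 where "N1 = (LINT t|M. G (slope x t))"
  define N2 where "N2 = (LINT t|M. G (curve x t))"
  have increment: "G (c *\<^sub>R (prim (slope x) t - prim (slope x) s)) \<le> c * N1" if st: "-T \<le> s" "s \<le> t" "t \<le> T" for s t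
  proof -
    \<comment> \<open>the slope cut off outside the interval; its mean is the scaled increment\<close>
    define z where "z = (\<lambda>\<tau>. indicator {s..t} \<tau> *\<^sub>R slope x \<tau>)"
    have zi: "integrable M z" unfolding z_def by (rule integral_eq_LINT(3)[OF integrable_bcontfun st(1,3)])
    have zm: "z \<in> borel_measurable M" using zi by simp
    have Gz: "G (z \<tau>) \<le> G (slope x \<tau>)" for \<tau> using G_0 G_nonneg by (simp add: z_def indicator_def)
    have iGz: "integrable M (\<lambda>\<tau>. G (z \<tau>))"
      by (rule Bochner_Integration.integrable_bound[OF integrable_G_bcontfun[of "slope x"]])
        (use measurable_G[OF zm] Gz G_nonneg in auto)
    have "c *\<^sub>R (prim (slope x) t - prim (slope x) s) = mean z"
      unfolding prim_diff[OF integrable_bcontfun st] integral_eq_LINT(2)[OF integrable_bcontfun st(1,3)] by (simp add: mean_def z_def c_def)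
    then have "G (c *\<^sub>R (prim (slope x) t - prim (slope x) s)) \<le> c * (LINT \<tau>|M. G (z \<tau>))"
      using jensen[OF zm iGz] by (simp add: c_def)
    also have "\<dots> \<le> c * N1" unfolding N1_def
      using c iGz integrable_G_bcontfun[of "slope x"] Gz by (intro mult_left_mono integral_mono) auto
    finally show ?thesis .
  qed
  have diff: "G (c *\<^sub>R (curve x t - curve x s)) \<le> c * N1" if s: "s \<in> I" for s
  proof (cases "s \<le> t")
    case True then show ?thesis using increment[of s t] s t by (simp add: curve_def)
  next
    case False
    have "G (c *\<^sub>R (curve x t - curve x s)) = G (c *\<^sub>R (curve x s - curve x t))"
      by (subst G_even[symmetric]) (simp flip: scaleR_minus_right)
    then show ?thesis using increment[of t s] False s t by (simp add: curve_def)
  qed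
  have each: "G ((c / 2) *\<^sub>R curve x t) \<le> (c * G (curve x s) + c * N1) / 2" if s: "s \<in> I" for s
  proof -
    have "(c / 2) *\<^sub>R curve x t = (1/2) *\<^sub>R (c *\<^sub>R curve x s + c *\<^sub>R (curve x t - curve x s))" by (simp add: algebra_simps)
    then have "G ((c / 2) *\<^sub>R curve x t) \<le> (G (c *\<^sub>R curve x s) + G (c *\<^sub>R (curve x t - curve x s))) / 2"
      using G_half[of "c *\<^sub>R curve x s" "c *\<^sub>R (curve x t - curve x s)"] by simp
    also have "\<dots> \<le> (c * G (curve x s) + c * N1) / 2"
      using G_scale_le[of c "curve x s"] c diff[OF s] by (intro divide_right_mono add_mono) auto
    finally show ?thesis .
  qed
  have "(LINT s|M. G ((c / 2) *\<^sub>R curve x t)) \<le> (LINT s|M. (c * G (curve x s) + c * N1) / 2)"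
    using integrable_G_curve[of x] each by (intro integral_mono) (auto simp: space_M)
  also have "\<dots> = (c * N2 + 2 * T * (c * N1)) / 2" using integrable_G_curve[of x] by (simp add: N2_def)
  finally have "2 * T * G ((c / 2) *\<^sub>R curve x t) \<le> (c * N2 + 2 * T * (c * N1)) / 2" by simp
  then have "c * (2 * T * G ((c / 2) *\<^sub>R curve x t)) \<le> c * ((c * N2 + 2 * T * (c * N1)) / 2)" using c by (intro mult_left_mono) auto
  moreover have "c * (2 * T * G ((c / 2) *\<^sub>R curve x t)) = G ((c / 2) *\<^sub>R curve x t)"
    using c(3) by (metis mult.assoc mult_1)
  moreover have "c * ((c * N2 + 2 * T * (c * N1)) / 2) = (c * (c * N2) + c * N1) / 2"
  proof -
    have "c * ((c * N2 + 2 * T * (c * N1)) / 2) = (c * (c * N2) + (c * (2 * T)) * (c * N1)) / 2" by (simp add: algebra_simps)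
    then show ?thesis using c(3) by simp
  qed
  moreover have "c * (c * N2) \<le> N2" "c * N1 \<le> N1"
  proof -
    have nn: "0 \<le> N1" "0 \<le> N2" unfolding N1_def N2_def by (rule LINT_G_nonneg)+
    then show "c * N1 \<le> N1" using c by (intro mult_left_le_one_le) auto
    have "c * N2 \<le> N2" using nn c by (intro mult_left_le_one_le) auto
    then show "c * (c * N2) \<le> N2" using c nn by (meson less_imp_le mult_left_le_one_le mult_nonneg_nonneg order_trans)
  qed
  ultimately have le: "G ((c / 2) *\<^sub>R curve x t) \<le> (c * (c * N2) + c * N1) / 2" "c * (c * N2) \<le> N2" "c * N1 \<le> N1"
    by (simp_all only:)
  then have "(c * (c * N2) + c * N1) / 2 \<le> (N2 + N1) / 2" by (intro divide_right_mono add_mono) auto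
  with le(1) have "G ((c / 2) *\<^sub>R curve x t) \<le> (N1 + N2) / 2" by (simp only: add.commute)
  moreover have "c / 2 = 1 / (2 * (2 * T))" by (simp add: c_def)
  ultimately show ?thesis by (simp only: N1_def N2_def)
qed

definition \<alpha> :: real where "\<alpha> = min \<Lambda> (b - 1) * \<rho> - (LINT t|M. fenchel_conjugate G (f t) + g t)"

lemma \<alpha>_pos: "\<alpha> > 0" using f_small by (simp add: \<alpha>_def)

text \<open>On this level set the curve stays where the lower bound of the potential is valid. The
  Fenchel-Young inequality pays for the force with one copy of \<open>G (curve x t)\<close>, which leaves the
  factor \<open>b - 1\<close>.\<close>

lemma J_on_sphere:
  assumes sphere: "(LINT t|M. G (slope x t)) + (LINT t|M. G (curve x t)) = \<rho>"
  shows "J x \<ge> \<alpha>"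
proof -
  have pw: "\<Lambda> * G (slope x t) + (b - 1) * G (curve x t) - (fenchel_conjugate G (f t) + g t)
      \<le> F t (curve x t) (slope x t) + V t (curve x t) + f t \<bullet> curve x t" if t: "t \<in> I" for t
  proof -
    have "V t (curve x t) \<ge> b * G (curve x t) - g t"
      by (rule V_lower[OF t]) (use pointwise_G_bound[OF t, of x] sphere in simp)
    moreover have "- (f t \<bullet> curve x t) \<le> fenchel_conjugate G (f t) + G (curve x t)"
      using fenchel_young[of "- curve x t" "f t"] by (simp add: G_even inner_commute)
    ultimately show ?thesis using F_lower[OF t, of "slope x t" "curve x t"] by (simp add: algebra_simps)
  qed
  have i: "integrable M (\<lambda>t. fenchel_conjugate G (f t) + g t)" using f_conj g_int by simp
  have "(LINT t|M. \<Lambda> * G (slope x t) + (b - 1) * G (curve x t) - (fenchel_conjugate G (f t) + g t)) \<le> J x"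
    unfolding J_def using integrable_J_terms[of x] integrable_G_curve[of x] integrable_G_bcontfun[of "slope x"] i pw
    by (intro integral_mono) (auto simp: space_M)
  moreover have "(LINT t|M. \<Lambda> * G (slope x t) + (b - 1) * G (curve x t) - (fenchel_conjugate G (f t) + g t))
      = \<Lambda> * (LINT t|M. G (slope x t)) + (b - 1) * (LINT t|M. G (curve x t)) - (LINT t|M. fenchel_conjugate G (f t) + g t)"
    using integrable_G_curve[of x] integrable_G_bcontfun[of "slope x"] i by (simp add: Bochner_Integration.integral_diff)
  moreover have "min \<Lambda> (b - 1) * (LINT t|M. G (slope x t)) \<le> \<Lambda> * (LINT t|M. G (slope x t))"
    "min \<Lambda> (b - 1) * (LINT t|M. G (curve x t)) \<le> (b - 1) * (LINT t|M. G (curve x t))"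
    by (intro mult_right_mono LINT_G_nonneg min.cobounded1 min.cobounded2)+
  moreover have "min \<Lambda> (b - 1) * \<rho> = min \<Lambda> (b - 1) * (LINT t|M. G (slope x t)) + min \<Lambda> (b - 1) * (LINT t|M. G (curve x t))"
    unfolding sphere[symmetric] by (rule distrib_left)
  ultimately show ?thesis unfolding \<alpha>_def by linarith
qed

definition modular where "modular x = (LINT t|M. G (slope x t) + G (curve x t))"

lemma modular_eq: "modular x = (LINT t|M. G (slope x t)) + (LINT t|M. G (curve x t))"
  unfolding modular_def using integrable_G_curve[of x] integrable_G_bcontfun[of "slope x"] by simp

lemma modular_cont: "continuous_on S modular"
  unfolding continuous_on_sequentially
proof (intro allI ballI impI)
  fix xn :: "nat \<Rightarrow> 'a \<times> (real \<Rightarrow>\<^sub>C 'a)" and x assume "(\<forall>n. xn n \<in> S) \<and> xn \<longlonglongrightarrow> x"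
  then have x: "xn \<longlonglongrightarrow> x" by blast
  obtain R where R: "R \<ge> 0" "\<And>n t. t \<in> I \<Longrightarrow> norm (curve (xn n) t) \<le> R" "\<And>n t. norm (slope (xn n) t) \<le> R" using bounded_sequence[OF x] by blast
  obtain B where B: "B \<ge> 0" "\<And>v::'a. norm v \<le> R \<Longrightarrow> G v \<le> B" using G_bounded by blast
  have Glim: "(\<lambda>n. G (w n)) \<longlonglongrightarrow> G w0" if "w \<longlonglongrightarrow> w0" for w :: "nat \<Rightarrow> 'a" and w0
    by (rule continuous_on_tendsto_compose[OF G_cont[of UNIV] that]) auto
  have "(\<lambda>n. modular (xn n)) \<longlonglongrightarrow> modular x" unfolding modular_def
  proof (rule integral_dominated_convergence[where w = "\<lambda>t. B + B"])
    show "AE t in M. (\<lambda>n. G (slope (xn n) t) + G (curve (xn n) t)) \<longlonglongrightarrow> G (slope x t) + G (curve x t)"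
      by (rule AE_I2) (auto intro!: tendsto_add Glim curve_tendsto slope_tendsto x simp: space_M)
    show "AE t in M. norm (G (slope (xn n) t) + G (curve (xn n) t)) \<le> B + B" for n
    proof (rule AE_I2)
      fix t assume "t \<in> space M"
      then have "G (slope (xn n) t) \<le> B" "G (curve (xn n) t) \<le> B" using R B by (auto simp: space_M)
      then show "norm (G (slope (xn n) t) + G (curve (xn n) t)) \<le> B + B"
        using G_nonneg[of "slope (xn n) t"] G_nonneg[of "curve (xn n) t"] by simp
    qed
  qed (use integrable_G_curve integrable_G_bcontfun in \<open>auto intro!: borel_measurable_add borel_measurable_integrable\<close>)
  then show "(modular \<circ> xn) \<longlonglongrightarrow> modular x" by (simp add: o_def)
qed

lemma const_curve: "t \<in> I \<Longrightarrow> curve (v, 0) t = v" "slope (v, 0) = 0"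
proof -
  show s0: "slope (v, 0) = 0" by (rule bcontfun_eqI) (simp add: slope_apply mean_def)
  show "t \<in> I \<Longrightarrow> curve (v, 0) t = v" unfolding curve_def s0 by (simp add: prim_def)
qed

text \<open>By the inequality \<open>V_AR\<close> the function \<open>s powr (- \<theta>V) * V t (s *\<^sub>R x)\<close> has nonpositive
  derivative.\<close>

lemma V_radial_decay:
  assumes t: "t \<in> I" and x: "norm x > M0" and s: "s \<ge> 1"
  shows "V t (s *\<^sub>R x) \<le> s powr \<theta>V * V t x"
proof -
  define h where "h s = s powr (- \<theta>V) * V t (s *\<^sub>R x)" for s
  have "h s \<le> h 1"
  proof (rule DERIV_nonpos_imp_nonincreasing[OF s])
    fix r :: real assume r: "1 \<le> r"
    have d: "(h has_real_derivative (- \<theta>V) * r powr (- \<theta>V - 1) * V t (r *\<^sub>R x) + r powr (- \<theta>V) * (Vx t (r *\<^sub>R x) \<bullet> x)) (at r)"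
    proof -
      have "((\<lambda>s. V t (0 + s *\<^sub>R x)) has_real_derivative Vx t (0 + r *\<^sub>R x) \<bullet> x) (at r)" by (rule V_line[OF t])
      then have v: "((\<lambda>s. V t (s *\<^sub>R x)) has_real_derivative Vx t (r *\<^sub>R x) \<bullet> x) (at r)" by simp
      have p: "((\<lambda>s. s powr (- \<theta>V)) has_real_derivative (- \<theta>V) * r powr (- \<theta>V - 1)) (at r)"
        using r by (intro has_real_derivative_powr) simp
      from DERIV_mult[OF p v] show ?thesis unfolding h_def by (simp add: mult.commute add.commute)
    qed
    have rx: "norm (r *\<^sub>R x) > M0"
    proof -
      have "1 * norm x \<le> r * norm x" using r by (intro mult_right_mono) auto
      then show ?thesis using x r by simp
    qed
    have "r * (Vx t (r *\<^sub>R x) \<bullet> x) = Vx t (r *\<^sub>R x) \<bullet> (r *\<^sub>R x)" by simp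
    also have "\<dots> \<le> \<theta>V * V t (r *\<^sub>R x)"
      using V_AR[OF t rx] mult_nonneg_nonneg[OF less_imp_le[OF exponents(2)] powr_ge_zero[of "norm (r *\<^sub>R x)" pK]] by linarith
    finally have le: "r * (Vx t (r *\<^sub>R x) \<bullet> x) \<le> \<theta>V * V t (r *\<^sub>R x)" .
    have pr: "r powr (- \<theta>V) = r powr (- \<theta>V - 1) * r" using r by (simp add: powr_diff)
    have "(- \<theta>V) * r powr (- \<theta>V - 1) * V t (r *\<^sub>R x) + r powr (- \<theta>V) * (Vx t (r *\<^sub>R x) \<bullet> x)
        = r powr (- \<theta>V - 1) * (r * (Vx t (r *\<^sub>R x) \<bullet> x) - \<theta>V * V t (r *\<^sub>R x))" unfolding pr by (simp add: algebra_simps)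
    also have "\<dots> \<le> 0" using le by (intro mult_nonneg_nonpos) auto
    finally show "\<exists>y. (h has_real_derivative y) (at r) \<and> y \<le> 0" using d by blast
  qed
  then have "s powr (- \<theta>V) * V t (s *\<^sub>R x) \<le> V t x" by (simp add: h_def)
  then have "s powr \<theta>V * (s powr (- \<theta>V) * V t (s *\<^sub>R x)) \<le> s powr \<theta>V * V t x" by (intro mult_left_mono) auto
  moreover have "s powr \<theta>V * s powr (- \<theta>V) = 1" using s by (simp flip: powr_add)
  ultimately show ?thesis by (metis mult.assoc mult_1)
qed

text \<open>Constant curves have no kinetic energy, and along a ray the potential tends to minus
  infinity like the power \<open>\<theta>V > 1\<close>, which beats the linear force term.\<close>

lemma far_point: obtains e where "J e \<le> 0" "modular e > \<rho>"
proof -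
  obtain e1 :: 'a where e1: "norm e1 = 1" using nonempty_Basis norm_Basis by blast
  define v where "v = (M0 + 1) *\<^sub>R e1"
  have v: "norm v > M0" "norm v = M0 + 1" using M0 e1 by (auto simp: v_def)
  have Vc: "continuous_on I (\<lambda>t. V t v)"
    using jcont_continuous[OF V_jcont, of "\<lambda>_. v" "\<lambda>_. 0"] by (simp add: continuous_on_const)
  obtain t0 where t0: "t0 \<in> I" "\<And>t. t \<in> I \<Longrightarrow> V t v \<le> V t0 v"
    using continuous_attains_sup[OF compact_Icc _ Vc] T_pos by auto
  define \<kappa> where "\<kappa> = - V t0 v"
  have \<kappa>: "\<kappa> > 0" using V_neg[OF t0(1) v(1)] by (simp add: \<kappa>_def)
  define c where "c = \<bar>LINT t|M. f t \<bullet> v\<bar>"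
  obtain C1 where C1: "C1 \<ge> 0" "\<And>s. s \<ge> 0 \<Longrightarrow> s \<le> (T * \<kappa> / (c + 1)) * s powr \<theta>V + C1"
    by (rule powr_dominates[of \<theta>V "T * \<kappa> / (c + 1)"]) (use \<theta>V_gt_1 T_pos \<kappa> in \<open>auto simp: c_def add_nonneg_pos\<close>)
  obtain CG where CG: "CG \<ge> 0" "\<And>v::'a. norm v \<le> 1 * G v + CG" using G_superlinear[of 1] by auto
  define s where "s = max 1 (max (2 * C1) (CG + \<rho> + 1))"
  have s: "s \<ge> 1" "s \<ge> 2 * C1" "s \<ge> CG + \<rho> + 1" by (auto simp: s_def)
  show thesis
  proof (rule that[of "(s *\<^sub>R v, 0)"])
    have "J (s *\<^sub>R v, 0) = (LINT t|M. V t (s *\<^sub>R v) + s * (f t \<bullet> v))"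
      unfolding J_def by (intro Bochner_Integration.integral_cong refl) (simp add: space_M const_curve F_zero)
    also have "\<dots> \<le> (LINT t|M. - (s powr \<theta>V * \<kappa>) + s * (f t \<bullet> v))"
    proof (rule integral_mono)
      have fv: "integrable M (\<lambda>t. f t \<bullet> v)" using f_int by simp
      have "integrable M (\<lambda>t. V t (s *\<^sub>R v))"
        using jcont_continuous[OF V_jcont, of "\<lambda>_. s *\<^sub>R v" "\<lambda>_. 0"] by (intro integrable_cont) (simp add: continuous_on_const)
      then show "integrable M (\<lambda>t. V t (s *\<^sub>R v) + s * (f t \<bullet> v))" using fv by simp
      show "integrable M (\<lambda>t. - (s powr \<theta>V * \<kappa>) + s * (f t \<bullet> v))" using fv by simp
      fix t assume "t \<in> space M"
      then have t: "t \<in> I" by (simp add: space_M)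
      have "V t (s *\<^sub>R v) \<le> s powr \<theta>V * V t v" by (rule V_radial_decay[OF t v(1) s(1)])
      also have "\<dots> \<le> s powr \<theta>V * (- \<kappa>)" using t0(2)[OF t] by (intro mult_left_mono) (auto simp: \<kappa>_def)
      finally show "V t (s *\<^sub>R v) + s * (f t \<bullet> v) \<le> - (s powr \<theta>V * \<kappa>) + s * (f t \<bullet> v)" by simp
    qed
    also have "\<dots> = - (2 * T * \<kappa> * s powr \<theta>V) + s * (LINT t|M. f t \<bullet> v)" using f_int by simp
    also have "\<dots> \<le> 0"
    proof -
      have "s \<le> (T * \<kappa> / (c + 1)) * s powr \<theta>V + s / 2" using C1(2)[of s] s by simp
      then have "s \<le> 2 * ((T * \<kappa> / (c + 1)) * s powr \<theta>V)" by simp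
      then have "s * (c + 1) \<le> 2 * T * \<kappa> * s powr \<theta>V" by (simp add: c_def field_simps)
      moreover have "s * (LINT t|M. f t \<bullet> v) \<le> s * (c + 1)" using s by (intro mult_left_mono) (auto simp: c_def)
      ultimately show ?thesis by linarith
    qed
    finally show "J (s *\<^sub>R v, 0) \<le> 0" .
    have "s * 1 \<le> s * norm v" using s v M0 by (intro mult_left_mono) auto
    moreover have "norm (s *\<^sub>R v) = s * norm v" using s(1) by simp
    ultimately have Gv: "G (s *\<^sub>R v) \<ge> \<rho> + 1" using CG(2)[of "s *\<^sub>R v"] s(3) by linarith
    have "modular (s *\<^sub>R v, 0) = (LINT t|M. G (s *\<^sub>R v))"
      unfolding modular_def by (intro Bochner_Integration.integral_cong refl) (simp add: space_M const_curve G_0)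
    also have "\<dots> = 2 * T * G (s *\<^sub>R v)" by simp
    finally show "modular (s *\<^sub>R v, 0) > \<rho>"
      using mult_mono[of 1 "2 * T" "\<rho> + 1" "G (s *\<^sub>R v)"] T_half Gv \<rho> by simp
  qed
qed

text \<open>By the intermediate value theorem, every path from 0 to the far point meets the set on which
  the modular equals \<open>\<rho>\<close>.\<close>

lemma cerami_sequence:
  obtains C where "\<And>\<epsilon>. \<epsilon> > 0 \<Longrightarrow> \<exists>x. \<alpha> \<le> J x \<and> J x \<le> C \<and> \<bar>DJ x x\<bar> \<le> \<epsilon> \<and> (\<forall>h. \<bar>DJ x h\<bar> \<le> \<epsilon> * norm h)"
proof -
  obtain e where e: "J e \<le> 0" "modular e > \<rho>" using far_point by blast
  have zero: "(0 :: 'a \<times> (real \<Rightarrow>\<^sub>C 'a)) = (0, 0)" by (simp add: zero_prod_def)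
  have "J 0 = (LINT t|M. V t 0)"
    unfolding J_def zero by (intro Bochner_Integration.integral_cong refl) (simp add: space_M const_curve F_zero)
  then have J0: "J 0 \<le> 0" using V_zero by simp
  have "modular 0 = (LINT t|M. 0)"
    unfolding modular_def zero by (intro Bochner_Integration.integral_cong refl) (simp add: space_M const_curve G_0)
  then have s0: "modular 0 = 0" by simp
  have "\<exists>C. \<forall>\<epsilon>>0. \<exists>x. \<alpha> \<le> J x \<and> J x \<le> C \<and> \<bar>DJ x x\<bar> \<le> \<epsilon> \<and> (\<forall>h. \<bar>DJ x h\<bar> \<le> \<epsilon> * norm h)"
  proof (rule mountain_pass_cerami[OF J_C1 J0 e(1) \<alpha>_pos])
    fix \<gamma> :: "real \<Rightarrow> 'a \<times> (real \<Rightarrow>\<^sub>C 'a)"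
    assume \<gamma>: "continuous_on {0..1} \<gamma>" "\<gamma> 0 = 0" "\<gamma> 1 = e"
    have "continuous_on {0..1} (\<lambda>t. modular (\<gamma> t))"
      by (rule continuous_on_compose2[OF modular_cont[of UNIV] \<gamma>(1)]) simp
    then have "\<exists>t. 0 \<le> t \<and> t \<le> 1 \<and> modular (\<gamma> t) = \<rho>"
      by (intro IVT') (use \<gamma> s0 e(2) \<rho> in auto)
    then obtain t where "0 \<le> t" "t \<le> 1" "modular (\<gamma> t) = \<rho>" by blast
    then show "\<exists>t\<in>{0..1}. J (\<gamma> t) \<ge> \<alpha>"
      using J_on_sphere[of "\<gamma> t"] by (intro bexI[of _ t]) (auto simp: modular_eq)
  qed
  then show thesis using that by blast
qed

text \<open>In \<open>\<theta>V * J x - DJ x x\<close> the superquadraticity assumptions leave the coercive terms \<open>(\<theta>V - \<theta>F)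
  * \<Lambda> * G (slope x t)\<close> and \<open>\<epsilon>V * norm (curve x t) powr pK\<close>. The force contributes at most a
  multiple of the maximum of the curve, which is bounded by a constant plus arbitrarily small
  multiples of the integrals of the coercive terms.\<close>

lemma ambrosetti_rabinowitz_bound:
  obtains C' R where "\<And>x. J x \<le> C \<Longrightarrow> \<bar>DJ x x\<bar> \<le> 1 \<Longrightarrow> (LINT t|M. G (slope x t)) \<le> C'"
    "\<And>x t. J x \<le> C \<Longrightarrow> \<bar>DJ x x\<bar> \<le> 1 \<Longrightarrow> t \<in> I \<Longrightarrow> norm (curve x t) \<le> R"
proof -
  obtain CV where CV: "CV \<ge> 0" "\<And>t x v. t \<in> I \<Longrightarrow> norm x \<le> M0 \<Longrightarrow> norm (v::'a) \<le> 0 \<Longrightarrow> norm (V t x) \<le> CV" using jcont_bounded[OF V_jcont] by blast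
  obtain CVx where CVx: "CVx \<ge> 0" "\<And>t x v. t \<in> I \<Longrightarrow> norm x \<le> M0 \<Longrightarrow> norm (v::'a) \<le> 0 \<Longrightarrow> norm (Vx t x) \<le> CVx" using jcont_bounded[OF Vx_jcont] by blast
  define C1 where "C1 = \<theta>V * CV + CVx * M0 + \<epsilon>V * M0 powr pK"
  have pot: "\<epsilon>V * norm x powr pK - C1 \<le> \<theta>V * V t x - Vx t x \<bullet> x" if t: "t \<in> I" for t x
  proof (cases "norm x > M0")
    case True
    have "C1 \<ge> 0" using CV CVx M0 \<theta>V_gt_1 exponents by (simp add: C1_def)
    then show ?thesis using V_AR[OF t True] by linarith
  next
    case False
    then have x: "norm x \<le> M0" by simp
    have "norm x powr pK \<le> M0 powr pK" using x exponents by (intro powr_mono2) auto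
    then have 1: "\<epsilon>V * norm x powr pK \<le> \<epsilon>V * M0 powr pK" using exponents by (intro mult_left_mono) auto
    have "\<bar>V t x\<bar> \<le> CV" using CV(2)[OF t x, of 0] by simp
    then have 2: "\<theta>V * V t x \<ge> - (\<theta>V * CV)" using \<theta>V_gt_1 mult_left_mono[of "- CV" "V t x" \<theta>V] by (simp add: abs_le_iff)
    have "\<bar>Vx t x \<bullet> x\<bar> \<le> norm (Vx t x) * norm x" by (rule Cauchy_Schwarz_ineq2)
    also have "\<dots> \<le> CVx * M0" using CVx(2)[OF t x, of 0] x CVx(1) by (intro mult_mono) auto
    finally show ?thesis using 1 2 by (simp add: C1_def abs_le_iff)
  qed
  define k1 where "k1 = (\<theta>V - \<theta>F) * \<Lambda>"
  have k1: "k1 > 0" using exponents \<Lambda> by (simp add: k1_def)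
  define nf where "nf = (\<theta>V - 1) * (LINT t|M. norm (f t))"
  have nf: "nf \<ge> 0" unfolding nf_def using \<theta>V_gt_1 by (intro mult_nonneg_nonneg integral_nonneg_AE) auto
  \<comment> \<open>so small that the force absorbs at most half of each coercive term\<close>
  define \<delta> where "\<delta> = min (k1 / (2 * (nf + 1))) (2 * T * \<epsilon>V / (2 * (nf + 1)))"
  have \<delta>: "\<delta> > 0" using k1 nf T_pos exponents by (simp add: \<delta>_def add_nonneg_pos)
  have nf\<delta>: "nf * \<delta> \<le> k1 / 2" "nf * (\<delta> / (2 * T)) \<le> \<epsilon>V / 2"
  proof -
    have q: "nf * (k / (2 * (nf + 1))) \<le> k / 2" if "k > 0" for k
      using that nf by (simp add: field_simps)
    have "nf * \<delta> \<le> nf * (k1 / (2 * (nf + 1)))" using nf by (intro mult_left_mono) (auto simp: \<delta>_def)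
    then show "nf * \<delta> \<le> k1 / 2" using q[OF k1] by linarith
    have "\<delta> / (2 * T) \<le> \<epsilon>V / (2 * (nf + 1))"
    proof -
      have "\<delta> \<le> 2 * T * (\<epsilon>V / (2 * (nf + 1)))" by (simp add: \<delta>_def)
      then show ?thesis using T_pos by (simp add: pos_divide_le_eq mult.commute)
    qed
    then have "nf * (\<delta> / (2 * T)) \<le> nf * (\<epsilon>V / (2 * (nf + 1)))" using nf by (intro mult_left_mono)
    then show "nf * (\<delta> / (2 * T)) \<le> \<epsilon>V / 2" using q[OF exponents(2)] by linarith
  qed
  obtain Cg where Cg: "Cg \<ge> 0" "\<And>v::'a. norm v \<le> \<delta> * G v + Cg" using G_superlinear[OF \<delta>] by blast
  obtain Cp where Cp: "Cp \<ge> 0" "\<And>s. s \<ge> 0 \<Longrightarrow> s \<le> \<delta> * s powr pK + Cp" using powr_dominates[OF exponents(3) \<delta>] by blast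
  define A where "A = \<theta>V * \<bar>C\<bar> + 1 + 2 * T * C1 + nf * (Cp + 2 * T * Cg)"
  define B where "B = \<bar>A\<bar> / (k1 / 2)"
  define P' where "P' = \<bar>A\<bar> / (\<epsilon>V / 2)"
  have main: "(LINT t|M. G (slope x t)) \<le> B \<and> (\<forall>t\<in>I. norm (curve x t) \<le> (\<delta> * P' / (2 * T) + Cp) + (\<delta> * B + 2 * T * Cg))"
    if x: "J x \<le> C" "\<bar>DJ x x\<bar> \<le> 1" for x
  proof -
    define u where "u = curve x"
    define y where "y = apply_bcontfun (slope x)"
    define Gy where "Gy = (LINT t|M. G (y t))"
    define P where "P = (LINT t|M. norm (u t) powr pK)"
    have uc: "continuous_on I u" unfolding u_def by (rule curve_cont)
    have ui: "integrable M u" by (rule integrable_cont[OF uc])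
    have yi: "integrable M y" "integrable M (\<lambda>t. G (y t))" "y \<in> borel_measurable M"
      unfolding y_def by (rule integrable_bcontfun integrable_G_bcontfun measurable_bcontfun)+
    have pint: "integrable M (\<lambda>t. norm (u t) powr pK)"
      by (intro integrable_cont continuous_on_powr' continuous_intros uc) (use exponents in auto)
    have Gy0: "Gy \<ge> 0" unfolding Gy_def by (rule LINT_G_nonneg)
    have P0: "P \<ge> 0" unfolding P_def by (intro integral_nonneg_AE) simp
    have L1y: "(LINT t|M. norm (y t)) \<le> \<delta> * Gy + 2 * T * Cg"
      unfolding Gy_def by (rule LINT_norm_le_G[OF yi(3,2) Cg(2)])
    have L1u: "(LINT t|M. norm (u t)) \<le> \<delta> * P + 2 * T * Cp"
    proof -
      have "(LINT t|M. norm (u t)) \<le> (LINT t|M. \<delta> * norm (u t) powr pK + Cp)"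
        using ui pint by (intro integral_mono Cp) auto
      then show ?thesis using pint by (simp add: P_def)
    qed
    \<comment> \<open>the maximum of the curve is at most its mean plus the integral of the length of its slope\<close>
    define S where "S = (\<delta> * P / (2 * T) + Cp) + (\<delta> * Gy + 2 * T * Cg)"
    have sup: "norm (u t) \<le> S" if t: "t \<in> I" for t
    proof -
      have "norm (u t) \<le> norm (u s) + (LINT t|M. norm (y t))" if s: "s \<in> I" for s
      proof -
        have "norm (prim (slope x) t - prim (slope x) s) \<le> (LINT t|M. norm (slope x t))"
          by (rule prim_norm_le[OF integrable_bcontfun s t])
        then have "norm (u t - u s) \<le> (LINT t|M. norm (y t))" by (simp add: u_def y_def curve_def)
        then show ?thesis using norm_triangle_ineq[of "u s" "u t - u s"] by simp
      qed
      then have "(LINT s|M. norm (u t)) \<le> (LINT s|M. norm (u s) + (LINT t|M. norm (y t)))"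
        using ui by (intro integral_mono) (auto simp: space_M)
      then have "2 * T * norm (u t) \<le> (LINT s|M. norm (u s)) + 2 * T * (LINT t|M. norm (y t))" using ui by simp
      also have "\<dots> \<le> (\<delta> * P + 2 * T * Cp) + 2 * T * (\<delta> * Gy + 2 * T * Cg)"
        using L1u L1y T_pos by (intro add_mono mult_left_mono) auto
      also have "\<dots> = 2 * T * S" using T_pos by (simp add: S_def algebra_simps)
      finally show ?thesis using T_pos by simp
    qed
    have S0: "S \<ge> 0" using order_trans[OF norm_ge_zero sup[of T]] T_pos by simp
    have pw: "(k1 * G (y t) + \<epsilon>V * norm (u t) powr pK - C1) - (\<theta>V - 1) * (S * norm (f t))
        \<le> \<theta>V * (F t (u t) (y t) + V t (u t) + f t \<bullet> u t) - (dF u y u y t + (Vx t (u t) + f t) \<bullet> u t)" if t: "t \<in> I" for t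
    proof -
      have "k1 * G (y t) \<le> (\<theta>V - \<theta>F) * F t (u t) (y t)"
        using mult_left_mono[OF F_lower[OF t, of "y t" "u t"], of "\<theta>V - \<theta>F"] exponents by (simp add: k1_def mult.assoc)
      then have 1: "k1 * G (y t) \<le> \<theta>V * F t (u t) (y t) - dF u y u y t"
        using F_AR[OF t, of "u t" "y t"] by (simp add: dF_def left_diff_distrib)
      have "\<bar>f t \<bullet> u t\<bar> \<le> norm (f t) * norm (u t)" by (rule Cauchy_Schwarz_ineq2)
      also have "\<dots> \<le> norm (f t) * S" using sup[OF t] by (intro mult_left_mono) auto
      finally have "(\<theta>V - 1) * (- (S * norm (f t))) \<le> (\<theta>V - 1) * (f t \<bullet> u t)"
        using \<theta>V_gt_1 by (intro mult_left_mono) (auto simp: abs_le_iff mult.commute)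
      then show ?thesis using 1 pot[OF t, of "u t"] by (simp add: algebra_simps inner_add_left)
    qed
    have "(LINT t|M. (k1 * G (y t) + \<epsilon>V * norm (u t) powr pK - C1) - (\<theta>V - 1) * (S * norm (f t)))
        \<le> (LINT t|M. \<theta>V * (F t (u t) (y t) + V t (u t) + f t \<bullet> u t) - (dF u y u y t + (Vx t (u t) + f t) \<bullet> u t))"
    proof (rule integral_mono)
      show "integrable M (\<lambda>t. (k1 * G (y t) + \<epsilon>V * norm (u t) powr pK - C1) - (\<theta>V - 1) * (S * norm (f t)))"
        using yi pint f_int by simp
      show "integrable M (\<lambda>t. \<theta>V * (F t (u t) (y t) + V t (u t) + f t \<bullet> u t) - (dF u y u y t + (Vx t (u t) + f t) \<bullet> u t))"
        using integrable_J_terms[of x] integrable_DJ_terms(1,3)[of x x] unfolding u_def y_def by simp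
    qed (use pw in \<open>auto simp: space_M\<close>)
    also have "\<dots> = \<theta>V * J x - DJ x x"
      unfolding J_def DJ_def u_def y_def using integrable_J_terms[of x] integrable_DJ_terms(1,3)[of x x] by simp
    also have "\<dots> \<le> \<theta>V * \<bar>C\<bar> + 1"
    proof -
      have "\<theta>V * J x \<le> \<theta>V * \<bar>C\<bar>" using x \<theta>V_gt_1 by (intro mult_left_mono) auto
      then show ?thesis using x(2) by (simp add: abs_le_iff)
    qed
    also have "(LINT t|M. (k1 * G (y t) + \<epsilon>V * norm (u t) powr pK - C1) - (\<theta>V - 1) * (S * norm (f t)))
        = k1 * Gy + \<epsilon>V * P - 2 * T * C1 - nf * S"
      using yi pint f_int by (simp add: Gy_def P_def nf_def)
    finally have "k1 * Gy + \<epsilon>V * P \<le> \<theta>V * \<bar>C\<bar> + 1 + 2 * T * C1 + nf * S" by linarith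
    moreover have "nf * S = (nf * (\<delta> / (2 * T))) * P + (nf * \<delta>) * Gy + nf * (Cp + 2 * T * Cg)" by (simp add: S_def algebra_simps)
    moreover have "(nf * (\<delta> / (2 * T))) * P \<le> \<epsilon>V / 2 * P" "(nf * \<delta>) * Gy \<le> k1 / 2 * Gy"
      by (rule mult_right_mono[OF nf\<delta>(2) P0], rule mult_right_mono[OF nf\<delta>(1) Gy0])
    ultimately have "k1 / 2 * Gy + \<epsilon>V / 2 * P \<le> A" unfolding A_def by linarith
    moreover have "k1 / 2 * Gy \<ge> 0" "\<epsilon>V / 2 * P \<ge> 0" using k1 exponents Gy0 P0 by auto
    ultimately have le: "k1 / 2 * Gy \<le> \<bar>A\<bar>" "\<epsilon>V / 2 * P \<le> \<bar>A\<bar>" by linarith+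
    have GB: "Gy \<le> B" unfolding B_def using le(1) k1 by (subst pos_le_divide_eq) (auto simp: mult.commute)
    have PB: "P \<le> P'" unfolding P'_def using le(2) exponents by (subst pos_le_divide_eq) (auto simp: mult.commute)
    have "S \<le> (\<delta> * P' / (2 * T) + Cp) + (\<delta> * B + 2 * T * Cg)"
      unfolding S_def using GB PB \<delta> T_pos by (intro add_mono divide_right_mono mult_left_mono) auto
    then show ?thesis using GB sup unfolding Gy_def y_def u_def by fastforce
  qed
  show thesis by (rule that[of B]) (use main in blast)+
qed

section \<open>Weak solutions\<close>

text \<open>Criticality has to be tested only with curves whose slopes are continuous and have mean
  zero; each of them comes from a parameter, whose slope is extended to the line by constants.\<close>

lemma test_direction:
  assumes "continuous_on UNIV \<eta>" "(LINT t|M. \<eta> t) = 0"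
  obtains h where "\<And>t. t \<in> I \<Longrightarrow> slope h t = \<eta> t" "\<And>t. t \<in> I \<Longrightarrow> curve h t = d + prim \<eta> t"
proof -
  have "continuous_on I \<eta>" using assms(1) continuous_on_subset by blast
  then obtain w where weq: "\<And>t. t \<in> I \<Longrightarrow> apply_bcontfun w t = \<eta> t" by (rule bcontfun_of_path) blast
  have "(LINT t|M. w t) = (LINT t|M. \<eta> t)" by (intro Bochner_Integration.integral_cong refl) (simp add: space_M weq)
  then have "mean w = 0" using assms(2) by (simp add: mean_def)
  then have s: "slope (d, w) t = \<eta> t" if "t \<in> I" for t using weq[OF that] by (simp add: slope_apply)
  have "curve (d, w) t = d + prim \<eta> t" if "t \<in> I" for t
    unfolding curve_def prim_def using that s by (auto intro!: Henstock_Kurzweil_Integration.integral_cong)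
  then show thesis using that[of "(d, w)"] s by blast
qed

text \<open>The almost critical sequence of \<open>cerami_sequence\<close> is bounded and, along a subsequence,
  satisfies the assumptions of \<open>ps_limit\<close>; \<open>euler_equation\<close> then gives the weak equation. If the
  limit were zero, comparison with the zero curve in \<open>energy_upper\<close> would push the values of \<open>J\<close>
  below \<open>\<alpha>\<close>.\<close>

theorem weak_solution:
  obtains U Y c R where "integrable M Y" "integrable M (\<lambda>t. G (Y t))" "\<And>t. t \<in> I \<Longrightarrow> U t = c + prim Y t" "(LINT t|M. Y t) = 0"
    "adm R U Y" "continuous_on I U"
    "\<And>\<eta>. continuous_on UNIV \<eta> \<Longrightarrow> (LINT t|M. \<eta> t) = 0 \<Longrightarrow>
      (LINT t|M. dF U Y (prim \<eta>) \<eta> t) + (LINT t|M. (Vx t (U t) + f t) \<bullet> prim \<eta> t) = 0"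
    "\<exists>t\<in>I. U t \<noteq> 0"
proof -
  obtain C where C: "\<And>\<epsilon>. \<epsilon> > 0 \<Longrightarrow> \<exists>x. \<alpha> \<le> J x \<and> J x \<le> C \<and> \<bar>DJ x x\<bar> \<le> \<epsilon> \<and> (\<forall>h. \<bar>DJ x h\<bar> \<le> \<epsilon> * norm h)" using cerami_sequence by blast
  have "\<forall>n::nat. \<exists>x. \<alpha> \<le> J x \<and> J x \<le> C \<and> \<bar>DJ x x\<bar> \<le> inverse (real (Suc n)) \<and> (\<forall>h. \<bar>DJ x h\<bar> \<le> inverse (real (Suc n)) * norm h)"
    using C by simp
  then obtain x where x: "\<And>n. \<alpha> \<le> J (x n)" "\<And>n. J (x n) \<le> C" "\<And>n. \<bar>DJ (x n) (x n)\<bar> \<le> inverse (real (Suc n))"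
    "\<And>n h. \<bar>DJ (x n) h\<bar> \<le> inverse (real (Suc n)) * norm h" by metis
  obtain C' R where bound: "\<And>x. J x \<le> C \<Longrightarrow> \<bar>DJ x x\<bar> \<le> 1 \<Longrightarrow> (LINT t|M. G (slope x t)) \<le> C'"
    "\<And>x t. J x \<le> C \<Longrightarrow> \<bar>DJ x x\<bar> \<le> 1 \<Longrightarrow> t \<in> I \<Longrightarrow> norm (curve x t) \<le> R" using ambrosetti_rabinowitz_bound by blast
  have DJ1: "\<bar>DJ (x n) (x n)\<bar> \<le> 1" for n
  proof -
    have "inverse (real (Suc n)) \<le> 1" by (simp add: field_simps)
    then show ?thesis using x(3)[of n] by linarith
  qed
  have xG: "(LINT t|M. G (slope (x n) t)) \<le> C'" and xR: "t \<in> I \<Longrightarrow> norm (curve (x n) t) \<le> R" for n t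
    using bound x(2) DJ1 by blast+
  have fstR: "norm (fst (x n)) \<le> R" for n using xR[of "-T" n] T_pos by (simp add: curve_def)
  obtain \<sigma> :: "nat \<Rightarrow> nat" and Y c' where \<sigma>: "strict_mono \<sigma>" and Y: "integrable M Y" "integrable M (\<lambda>t. G (Y t))"
    and unif: "\<And>e. e > 0 \<Longrightarrow> \<exists>N. \<forall>n\<ge>N. \<forall>t\<in>I. norm ((fst (x (\<sigma> n)) + prim (slope (x (\<sigma> n))) t) - (c' + prim Y t)) < e"
  proof (rule weak_compactness[of "\<lambda>n. slope (x n)" C' "\<lambda>n. fst (x n)" R, OF xG fstR])
    fix \<sigma> :: "nat \<Rightarrow> nat" and Y c'
    assume *: "strict_mono \<sigma>" "integrable M Y" "integrable M (\<lambda>t. G (Y t))"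
      "\<And>e. e > 0 \<Longrightarrow> \<exists>N. \<forall>n\<ge>N. \<forall>t\<in>I. norm ((fst (x (\<sigma> n)) + prim (slope (x (\<sigma> n))) t) - (c' + prim Y t)) < e"
    show thesis by (rule that[OF *])
  qed
  define z where "z k = x (\<sigma> k)" for k
  define u where "u k = curve (z k)" for k
  define U where "U t = c' + prim Y t" for t
  have \<epsilon>0: "(\<lambda>k. inverse (real (Suc (\<sigma> k)))) \<longlonglongrightarrow> 0"
    using LIMSEQ_subseq_LIMSEQ[OF LIMSEQ_inverse_real_of_nat \<sigma>] by (simp add: o_def)
  have uU: "\<forall>\<^sub>F k in sequentially. \<forall>t\<in>I. norm (u k t - U t) < e" if "e > 0" for e
    using unif[OF that] by (simp add: eventually_sequentially u_def U_def z_def curve_def)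
  have pt: "(\<lambda>k. u k t) \<longlonglongrightarrow> U t" if t: "t \<in> I" for t
  proof (rule tendstoI)
    fix e :: real assume "0 < e"
    from uU[OF this] show "\<forall>\<^sub>F k in sequentially. dist (u k t) (U t) < e"
      by eventually_elim (use t in \<open>auto simp: dist_norm\<close>)
  qed
  have uR: "norm (u k t) \<le> R" if "t \<in> I" for k t using xR[OF that] by (simp add: u_def z_def)
  have UR: "norm (U t) \<le> R" if "t \<in> I" for t
    by (rule LIMSEQ_le_const2[OF tendsto_norm[OF pt[OF that]]]) (use uR[OF that] in auto)
  have Uc: "continuous_on I U" unfolding U_def[abs_def] by (intro continuous_intros prim_cont Y)
  obtain Cv where Cv: "Cv \<ge> 0" "\<And>t x v. t \<in> I \<Longrightarrow> norm x \<le> R \<Longrightarrow> norm (v::'a) \<le> 0 \<Longrightarrow> norm (Vx t x) \<le> Cv" using jcont_bounded[OF Vx_jcont] by blast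
  have Vxc: "continuous_on I (\<lambda>t. Vx t (w t))" if "continuous_on I w" for w
    by (rule jcont_continuous[OF Vx_jcont that, of "\<lambda>_. 0"]) (rule continuous_on_const)
  have Vc: "continuous_on I (\<lambda>t. V t (w t))" if "continuous_on I w" for w
    by (rule jcont_continuous[OF V_jcont that, of "\<lambda>_. 0"]) (rule continuous_on_const)
  have uc: "continuous_on I (u k)" for k unfolding u_def by (rule curve_cont)
  interpret ps_limit T G F Fx Fv a \<beta> \<Lambda> u "\<lambda>k. apply_bcontfun (slope (z k))" "\<lambda>k t. Vx t (u k t) + f t" "\<lambda>k. fst (z k)" U Y
    "\<lambda>t. Vx t (U t) + f t" c' R C'
  proof unfold_locales
    show "continuous_on I (apply_bcontfun (slope (z k)))" for k by simp
    show "(LINT t|M. slope (z k) t) = 0" for k by (rule mean_slope)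
    show "(LINT t|M. G (slope (z k) t)) \<le> C'" for k unfolding z_def by (rule xG)
    show "u k t = fst (z k) + prim (slope (z k)) t" for k t by (simp add: u_def curve_def)
    show "t \<in> I \<Longrightarrow> norm (u k t) \<le> R" for k t by (rule uR)
    show "integrable M Y" "integrable M (\<lambda>t. G (Y t))" by (rule Y)+
    show "U t = c' + prim Y t" for t by (simp add: U_def)
    show "\<forall>\<^sub>F k in sequentially. \<forall>t\<in>I. norm (u k t - U t) < e" if "e > 0" for e by (rule uU[OF that])
    show "integrable M (\<lambda>t. Vx t (u k t) + f t)" for k by (intro Bochner_Integration.integrable_add integrable_cont Vxc uc f_int)
    show "integrable M (\<lambda>t. Vx t (U t) + f t)" by (intro Bochner_Integration.integrable_add integrable_cont Vxc Uc f_int)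
    have "(\<lambda>k. LINT t|M. norm (Vx t (u k t) + f t - (Vx t (U t) + f t))) \<longlonglongrightarrow> (LINT t|M. 0)"
    proof (rule integral_dominated_convergence[where w = "\<lambda>t. 2 * Cv"])
      show "AE t in M. (\<lambda>k. norm (Vx t (u k t) + f t - (Vx t (U t) + f t))) \<longlonglongrightarrow> 0"
      proof (rule AE_I2)
        fix t assume "t \<in> space M"
        then have t: "t \<in> I" by (simp add: space_M)
        have "(\<lambda>k. Vx t (u k t)) \<longlonglongrightarrow> Vx t (U t)"
          using jcont_tendsto[OF Vx_jcont t pt[OF t] tendsto_const[of 0]] .
        from tendsto_norm_zero[OF LIM_zero[OF this]]
        show "(\<lambda>k. norm (Vx t (u k t) + f t - (Vx t (U t) + f t))) \<longlonglongrightarrow> 0" by simp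
      qed
      show "AE t in M. norm (norm (Vx t (u k t) + f t - (Vx t (U t) + f t))) \<le> 2 * Cv" for k
      proof (rule AE_I2)
        fix t assume "t \<in> space M"
        then have t: "t \<in> I" by (simp add: space_M)
        have "norm (Vx t (u k t)) \<le> Cv" "norm (Vx t (U t)) \<le> Cv" by (rule Cv(2)[OF t uR[OF t], of 0], simp, rule Cv(2)[OF t UR[OF t], of 0], simp)
        then show "norm (norm (Vx t (u k t) + f t - (Vx t (U t) + f t))) \<le> 2 * Cv"
          using norm_triangle_ineq4[of "Vx t (u k t)" "Vx t (U t)"] by simp
      qed
      show "(\<lambda>t. norm (Vx t (u k t) + f t - (Vx t (U t) + f t))) \<in> borel_measurable M" for k
        using measurable_cont[OF Vxc[OF uc]] measurable_cont[OF Vxc[OF Uc]] f_meas by measurable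
    qed auto
    then show "(\<lambda>k. LINT t|M. norm (Vx t (u k t) + f t - (Vx t (U t) + f t))) \<longlonglongrightarrow> 0" by simp
    show "(\<lambda>k. (LINT t|M. dF (u k) (slope (z k)) (\<lambda>t. d + prim \<eta> t) \<eta> t) + (LINT t|M. (Vx t (u k t) + f t) \<bullet> (d + prim \<eta> t))) \<longlonglongrightarrow> 0"
      if \<eta>: "continuous_on UNIV \<eta>" "(LINT t|M. \<eta> t) = 0" for \<eta> d
    proof -
      obtain h where h: "\<And>t. t \<in> I \<Longrightarrow> slope h t = \<eta> t" "\<And>t. t \<in> I \<Longrightarrow> curve h t = d + prim \<eta> t" using test_direction[OF \<eta>] by blast
      have eq: "(LINT t|M. dF (u k) (slope (z k)) (\<lambda>t. d + prim \<eta> t) \<eta> t) + (LINT t|M. (Vx t (u k t) + f t) \<bullet> (d + prim \<eta> t)) = DJ (z k) h" for k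
        unfolding DJ_eq u_def dF_def
        by (intro arg_cong2[where f = "(+)"] Bochner_Integration.integral_cong refl) (simp_all add: space_M h)
      show ?thesis unfolding eq
      proof (rule Lim_null_comparison)
        show "(\<lambda>k. inverse (real (Suc (\<sigma> k))) * norm h) \<longlonglongrightarrow> 0" using tendsto_mult_left_zero[OF \<epsilon>0] by blast
        show "\<forall>\<^sub>F k in sequentially. norm (DJ (z k) h) \<le> inverse (real (Suc (\<sigma> k))) * norm h"
          using x(4) by (simp add: z_def)
      qed
    qed
    have eq: "(LINT t|M. dF (u k) (slope (z k)) (u k) (slope (z k)) t) + (LINT t|M. (Vx t (u k t) + f t) \<bullet> u k t) = DJ (z k) (z k)" for k
      unfolding DJ_eq u_def ..
    show "(\<lambda>k. (LINT t|M. dF (u k) (slope (z k)) (u k) (slope (z k)) t) + (LINT t|M. (Vx t (u k t) + f t) \<bullet> u k t)) \<longlonglongrightarrow> 0"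
      unfolding eq
    proof (rule Lim_null_comparison[OF _ \<epsilon>0])
      show "\<forall>\<^sub>F k in sequentially. norm (DJ (z k) (z k)) \<le> inverse (real (Suc (\<sigma> k)))" using x(3) by (simp add: z_def)
    qed
  qed
  have nontrivial: "\<exists>t\<in>I. U t \<noteq> 0"
  proof (rule ccontr)
    assume "\<not> ?thesis"
    then have U0: "U t = 0" if "t \<in> I" for t using that by blast
    obtain K where K: "K \<ge> 0"
      "\<And>\<eta> d \<delta> e. continuous_on UNIV \<eta> \<Longrightarrow> (LINT t|M. \<eta> t) = 0 \<Longrightarrow> (\<And>t. t \<in> I \<Longrightarrow> norm (U t - (d + prim \<eta> t)) \<le> \<delta>) \<Longrightarrow> e > 0 \<Longrightarrow>
        \<forall>\<^sub>F k in sequentially. (LINT t|M. F t (u k t) (slope (z k) t)) \<le> (LINT t|M. F t (U t) (\<eta> t)) + K * \<delta> + e" using energy_upper by blast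
    have \<alpha>4: "\<alpha> / 4 > 0" using \<alpha>_pos by simp
    have F0: "(LINT t|M. F t (U t) 0) = 0"
      using F_zero by (intro integral_eq_zero_AE AE_I2) (simp add: space_M)
    \<comment> \<open>the zero curve is a competitor without kinetic energy at distance 0 from the limit\<close>
    have "\<forall>\<^sub>F k in sequentially. (LINT t|M. F t (u k t) (slope (z k) t)) \<le> (LINT t|M. F t (U t) 0) + K * 0 + \<alpha> / 4"
      by (rule K(2)[of "\<lambda>_. 0" 0 0]) (use U0 \<alpha>4 in \<open>auto simp: prim_def\<close>)
    then have ev1: "\<forall>\<^sub>F k in sequentially. (LINT t|M. F t (u k t) (slope (z k) t)) \<le> \<alpha> / 4" by (simp add: F0)
    obtain CV where CV: "CV \<ge> 0" "\<And>t x v. t \<in> I \<Longrightarrow> norm x \<le> R \<Longrightarrow> norm (v::'a) \<le> 0 \<Longrightarrow> norm (V t x) \<le> CV" using jcont_bounded[OF V_jcont] by blast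
    have "(\<lambda>k. LINT t|M. V t (u k t)) \<longlonglongrightarrow> (LINT t|M. V t 0)"
    proof (rule integral_dominated_convergence[where w = "\<lambda>t. CV"])
      show "AE t in M. (\<lambda>k. V t (u k t)) \<longlonglongrightarrow> V t 0"
      proof (rule AE_I2)
        fix t assume "t \<in> space M"
        then have t: "t \<in> I" by (simp add: space_M)
        show "(\<lambda>k. V t (u k t)) \<longlonglongrightarrow> V t 0" using jcont_tendsto[OF V_jcont t pt[OF t] tendsto_const[of 0]] U0[OF t] by simp
      qed
      show "AE t in M. norm (V t (u k t)) \<le> CV" for k
      proof (rule AE_I2)
        fix t assume "t \<in> space M"
        then have t: "t \<in> I" by (simp add: space_M)
        show "norm (V t (u k t)) \<le> CV" by (rule CV(2)[OF t uR[OF t], of 0]) simp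
      qed
    qed (auto intro!: measurable_cont Vc uc continuous_on_const)
    then have Vlim: "(\<lambda>k. LINT t|M. V t (u k t)) \<longlonglongrightarrow> 0" using V_zero by simp
    have ev2: "\<forall>\<^sub>F k in sequentially. (LINT t|M. V t (u k t)) < \<alpha> / 4" by (rule order_tendstoD(2)[OF Vlim \<alpha>4])
    define nf where "nf = (LINT t|M. norm (f t)) + 1"
    have nf: "nf > 0" unfolding nf_def by (intro add_nonneg_pos integral_nonneg_AE) auto
    have e4: "\<alpha> / (4 * nf) > 0" using \<alpha>_pos nf by simp
    from ev1 ev2 uU[OF e4] have "\<forall>\<^sub>F k in sequentially. J (z k) < \<alpha>"
    proof eventually_elim
      case (elim k)
      have "\<bar>LINT t|M. f t \<bullet> u k t\<bar> \<le> (\<alpha> / (4 * nf)) * (LINT t|M. norm (f t))"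
        by (rule integrable_inner_bounded(2)[OF f_int measurable_cont[OF uc]]) (use elim(3) U0 in \<open>auto intro: less_imp_le\<close>)
      also have "\<dots> \<le> (\<alpha> / (4 * nf)) * nf" using e4 by (intro mult_left_mono) (auto simp: nf_def)
      also have "\<dots> = \<alpha> / 4" using nf by simp
      finally show ?case using elim(1,2) \<alpha>_pos unfolding J_eq[of "z k"] u_def by linarith
    qed
    then have "\<forall>\<^sub>F k in sequentially. False" by eventually_elim (use x(1) in \<open>auto simp: z_def not_less[symmetric]\<close>)
    then show False by simp
  qed
  show thesis
  proof (rule that[of Y U c' R, OF Y _ Y_mean adm_U Uc _ nontrivial])
    show "U t = c' + prim Y t" for t by (simp add: U_def)
    show "(LINT t|M. dF U Y (prim \<eta>) \<eta> t) + (LINT t|M. (Vx t (U t) + f t) \<bullet> prim \<eta> t) = 0"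
      if "continuous_on UNIV \<eta>" "(LINT t|M. \<eta> t) = 0" for \<eta>
      using euler_equation[OF that, of 0] by simp
  qed
qed

end

section \<open>Periodic solutions\<close>

lemma grad_eq: "GDERIV h x :> D \<Longrightarrow> grad h x = D"
  unfolding grad_def
proof (rule the_equality)
  fix E assume "GDERIV h x :> D" "GDERIV h x :> E"
  then have "(\<lambda>k. k \<bullet> D) = (\<lambda>k. k \<bullet> E)" unfolding gderiv_def by (rule has_derivative_unique)
  then have "(D - E) \<bullet> D = (D - E) \<bullet> E" by (rule fun_cong)
  then have "(D - E) \<bullet> (D - E) = 0" by (simp add: inner_diff_right)
  then show "E = D" by simp
qed

context action
begin

lemma grad_L_x:
  assumes t: "t \<in> I"
  shows "grad (\<lambda>x. F t x v + V t x + f t \<bullet> x) x = Fx t x v + Vx t x + f t"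
proof (rule grad_eq)
  have "((\<lambda>x. (x, v)) has_derivative (\<lambda>h. (h, 0))) (at x)" by (auto intro!: derivative_eq_intros)
  from has_derivative_compose[OF this F_deriv[OF t]]
  have "((\<lambda>x. F t x v) has_derivative (\<lambda>h. Fx t x v \<bullet> h)) (at x)" by simp
  then have "((\<lambda>x. F t x v + V t x + f t \<bullet> x) has_derivative (\<lambda>h. Fx t x v \<bullet> h + Vx t x \<bullet> h + f t \<bullet> h)) (at x)"
    by (intro has_derivative_add V_deriv[OF t] bounded_linear_imp_has_derivative bounded_linear_inner_right)
  then show "GDERIV (\<lambda>x. F t x v + V t x + f t \<bullet> x) x :> Fx t x v + Vx t x + f t"
    unfolding gderiv_def by (rule has_derivative_eq_rhs) (simp add: fun_eq_iff inner_add_right inner_commute)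
qed

lemma grad_L_v:
  assumes t: "t \<in> I"
  shows "grad (\<lambda>v. F t x v + V t x + f t \<bullet> x) v = Fv t x v"
proof (rule grad_eq)
  have "((\<lambda>v. (x, v)) has_derivative (\<lambda>h. (0, h))) (at v)" by (auto intro!: derivative_eq_intros)
  from has_derivative_compose[OF this F_deriv[OF t]]
  have "((\<lambda>v. F t x v) has_derivative (\<lambda>h. Fv t x v \<bullet> h)) (at v)" by simp
  then have "((\<lambda>v. F t x v + V t x + f t \<bullet> x) has_derivative (\<lambda>h. Fv t x v \<bullet> h)) (at v)"
    by (auto intro!: derivative_eq_intros)
  then show "GDERIV (\<lambda>v. F t x v + V t x + f t \<bullet> x) v :> Fv t x v"
    unfolding gderiv_def by (rule has_derivative_eq_rhs) (simp add: fun_eq_iff inner_commute)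
qed

text \<open>Completeness of Lebesgue measure.\<close>

lemma measurable_AE_eq:
  fixes u v :: "real \<Rightarrow> 'a"
  assumes u: "u \<in> borel_measurable M" and eq: "AE t in M. u t = v t"
  shows "v \<in> borel_measurable M"
proof -
  have "(\<lambda>t. if t \<in> I then u t else 0) \<in> borel_measurable lebesgue"
    using u by (subst borel_measurable_if) auto
  moreover have "AE t in lebesgue. (if t \<in> I then u t else 0) = (if t \<in> I then v t else 0)"
    using eq by (subst (asm) AE_restrict_space_iff) (auto elim: AE_mp)
  ultimately have "(\<lambda>t. if t \<in> I then v t else 0) \<in> borel_measurable lebesgue" by (rule borel_measurable_AE)
  then show ?thesis by (subst (asm) borel_measurable_if) auto
qed

text \<open>Integration by parts moves all derivatives in the weak equation onto the test slope, and du
  Bois-Reymond's lemma shows that \<open>Fv\<close> along the solution differs from a primitive \<open>prim r\<close> by a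
  constant \<open>d\<close>. So \<open>p = d + prim r\<close> is the absolutely continuous representative of the momentum.\<close>

lemma weak_solution_is_periodic_solution:
  assumes Y: "integrable M Y" "integrable M (\<lambda>t. G (Y t))" and U: "\<And>t. t \<in> I \<Longrightarrow> U t = c + prim Y t" "(LINT t|M. Y t) = 0"
    "adm R U Y" "continuous_on I U"
    and euler: "\<And>\<eta>. continuous_on UNIV \<eta> \<Longrightarrow> (LINT t|M. \<eta> t) = 0 \<Longrightarrow>
      (LINT t|M. dF U Y (prim \<eta>) \<eta> t) + (LINT t|M. (Vx t (U t) + f t) \<bullet> prim \<eta> t) = 0"
  shows "periodic_solution G T (\<lambda>t x v. F t x v + V t x + f t \<bullet> x) U"
proof -
  define q where "q t = Fv t (U t) (Y t)" for t
  define r where "r t = Fx t (U t) (Y t) + (Vx t (U t) + f t)" for t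
  have iV: "integrable M (\<lambda>t. Vx t (U t) + f t)"
    by (intro Bochner_Integration.integrable_add integrable_cont jcont_continuous[OF Vx_jcont U(4), of "\<lambda>_. 0"] continuous_on_const f_int)
  have qi: "integrable M q" unfolding q_def[abs_def] by (rule adm_integrable(3)[OF U(3)])
  have ri: "integrable M r" unfolding r_def[abs_def] using adm_integrable(2)[OF U(3)] iV by simp
  have pri: "integrable M (prim r)" by (rule integrable_cont[OF prim_cont[OF ri]])
  obtain d where d: "AE t in M. q t - prim r t = d"
  proof (rule du_bois_reymond[of "\<lambda>t. q t - prim r t"])
    show "integrable M (\<lambda>t. q t - prim r t)" using qi pri by simp
    fix \<eta> :: "real \<Rightarrow> 'a" assume \<eta>: "continuous_on UNIV \<eta>" "(LINT t|M. \<eta> t) = 0"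
    have \<eta>I: "continuous_on I \<eta>" using \<eta>(1) continuous_on_subset by blast
    have \<eta>i: "integrable M \<eta>" by (rule integrable_cont[OF \<eta>I])
    have pc: "continuous_on I (prim \<eta>)" by (rule prim_cont[OF \<eta>i])
    have deriv: "(prim \<eta> has_vector_derivative \<eta> t) (at t within I)" if "t \<in> I" for t
      unfolding prim_def using integral_has_vector_derivative[OF \<eta>I that] by simp
    have "prim \<eta> T = 0" using prim_end[OF \<eta>i] \<eta>(2) by simp
    then have parts: "(LINT t|M. r t \<bullet> prim \<eta> t) = - (LINT t|M. prim r t \<bullet> \<eta> t)"
      using integration_by_parts_L1[OF ri \<eta>I deriv] by simp
    have i: "integrable M (\<lambda>t. r t \<bullet> prim \<eta> t)" "integrable M (\<lambda>t. q t \<bullet> \<eta> t)" "integrable M (\<lambda>t. prim r t \<bullet> \<eta> t)"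
      "integrable M (dF U Y (prim \<eta>) \<eta>)" "integrable M (\<lambda>t. (Vx t (U t) + f t) \<bullet> prim \<eta> t)"
      by (intro integrable_inner_cont integrable_dF[OF U(3)] ri qi pri pc \<eta>I iV)+
    have "(LINT t|M. dF U Y (prim \<eta>) \<eta> t) + (LINT t|M. (Vx t (U t) + f t) \<bullet> prim \<eta> t)
        = (LINT t|M. dF U Y (prim \<eta>) \<eta> t + (Vx t (U t) + f t) \<bullet> prim \<eta> t)" using i by simp
    also have "\<dots> = (LINT t|M. r t \<bullet> prim \<eta> t + q t \<bullet> \<eta> t)"
      by (intro Bochner_Integration.integral_cong refl) (simp add: dF_def r_def q_def inner_add_left)
    also have "\<dots> = (LINT t|M. r t \<bullet> prim \<eta> t) + (LINT t|M. q t \<bullet> \<eta> t)" using i by simp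
    finally have "(LINT t|M. r t \<bullet> prim \<eta> t) + (LINT t|M. q t \<bullet> \<eta> t) = 0" using euler[OF \<eta>] by simp
    then show "(LINT t|M. (q t - prim r t) \<bullet> \<eta> t) = 0" using parts i by (simp add: inner_diff_left)
  qed blast
  define p where "p t = d + prim r t" for t
  have dU: "AE t in M. (U has_vector_derivative Y t) (at t)" by (rule prim_derivative[OF Y(1) U(1)])
  then have vU: "AE t in M. Y t = vector_derivative U (at t)" by eventually_elim (simp add: vector_derivative_at)
  have Ym: "Y \<in> borel_measurable M" using Y by simp
  have vm: "(\<lambda>t. vector_derivative U (at t)) \<in> borel_measurable M" by (rule measurable_AE_eq[OF Ym vU])
  have "AE t in M. G (Y t) = G (vector_derivative U (at t))" using vU by eventually_elim simp
  then have vG: "integrable M (\<lambda>t. G (vector_derivative U (at t)))"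
    using Y(2) measurable_G[OF vm] measurable_G[OF Ym] by (subst integrable_cong_AE[symmetric]) auto
  have UG: "integrable M (\<lambda>t. G (U t))" by (rule integrable_G_cont[OF U(4)])
  have per: "U (-T) = U T" using U(1)[of T] U(1)[of "-T"] prim_end[OF Y(1)] U(2) T_pos by simp
  have space: "U \<in> orlicz_sobolev_periodic G T"
    unfolding orlicz_sobolev_periodic_def orlicz_sobolev_def orlicz_def
    using prim_abs_continuous[OF Y(1) U(1)] measurable_cont[OF U(4)] UG vm vG per by simp
  have dp: "AE t in M. (p has_vector_derivative r t) (at t)" by (rule prim_derivative[OF ri, of p d]) (simp add: p_def)
  have pac: "abs_continuous_on I p" by (rule prim_abs_continuous[OF ri, of p d]) (simp add: p_def)
  have "AE t in M. p t = grad (\<lambda>v. F t (U t) v + V t (U t) + f t \<bullet> U t) (vector_derivative U (at t))"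
    using d vU AE_space
  proof eventually_elim
    case (elim t)
    then have "p t = Fv t (U t) (vector_derivative U (at t))" by (simp add: p_def q_def algebra_simps)
    then show ?case using grad_L_v[of t "U t" "vector_derivative U (at t)"] elim by (simp add: space_M)
  qed
  moreover have "AE t in M. (p has_vector_derivative grad (\<lambda>x. F t x (vector_derivative U (at t)) + V t x + f t \<bullet> x) (U t)) (at t)"
    using dp vU AE_space
  proof eventually_elim
    case (elim t)
    then show ?case using grad_L_x[of t "vector_derivative U (at t)" "U t"] by (simp add: space_M r_def add.assoc)
  qed
  ultimately show ?thesis unfolding periodic_solution_def using space pac by blast
qed

end

theorem (in mountain_pass_setting) nontrivial_periodic_solution:
  "\<exists>u. periodic_solution G T (\<lambda>t x v. F t x v + V t x + f t \<bullet> x) u \<and> (\<exists>t\<in>I. u t \<noteq> 0)"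
proof (rule weak_solution)
  fix U Y c R
  assume *: "integrable M Y" "integrable M (\<lambda>t. G (Y t))" "\<And>t. t \<in> I \<Longrightarrow> U t = c + prim Y t" "(LINT t|M. Y t) = 0"
    "adm R U Y" "continuous_on I U"
    "\<And>\<eta>. continuous_on UNIV \<eta> \<Longrightarrow> (LINT t|M. \<eta> t) = 0 \<Longrightarrow>
      (LINT t|M. dF U Y (prim \<eta>) \<eta> t) + (LINT t|M. (Vx t (U t) + f t) \<bullet> prim \<eta> t) = 0"
    and "\<exists>t\<in>I. U t \<noteq> 0"
  then show ?thesis using weak_solution_is_periodic_solution[OF *] by blast
qed

lemma riesz_representation_euclidean:
  fixes L :: "'a::euclidean_space \<Rightarrow> real"
  assumes "linear L"
  shows "L h = (\<Sum>b\<in>Basis. L b *\<^sub>R b) \<bullet> h"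
proof -
  have "L h = L (\<Sum>b\<in>Basis. (h \<bullet> b) *\<^sub>R b)" by (simp add: euclidean_representation)
  also have "\<dots> = (\<Sum>b\<in>Basis. (h \<bullet> b) * L b)" by (simp add: linear_sum[OF assms] linear_scale[OF assms])
  finally show ?thesis by (simp add: inner_sum_left inner_commute[of h] mult.commute)
qed

text \<open>At a fixed time the pair \<open>(x, v)\<close> ranges over a full space, so the derivative within \<open>I \<times>
  UNIV\<close> restricts to an ordinary one there. The gradients are the coordinates of the total
  derivative with respect to a basis, hence jointly continuous.\<close>

lemma (in time_interval) C1_on_partial_gradients:
  fixes F :: "real \<Rightarrow> 'a::euclidean_space \<Rightarrow> 'a \<Rightarrow> real"
  assumes "C1_on (\<lambda>(t, x, v). F t x v) (I \<times> UNIV \<times> UNIV)"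
  shows "jcont F" "jcont (\<lambda>t x v. grad (\<lambda>y. F t y v) x)" "jcont (\<lambda>t x v. grad (\<lambda>w. F t x w) v)"
    "t \<in> I \<Longrightarrow> ((\<lambda>p. F t (fst p) (snd p)) has_derivative
      (\<lambda>h. grad (\<lambda>y. F t y v) x \<bullet> fst h + grad (\<lambda>w. F t x w) v \<bullet> snd h)) (at (x, v))"
proof -
  define \<Phi> where "\<Phi> = (\<lambda>p::real \<times> 'a \<times> 'a. F (fst p) (fst (snd p)) (snd (snd p)))"
  have \<Phi>eq: "(\<lambda>(t, x, v). F t x v) = \<Phi>" by (auto simp: \<Phi>_def)
  obtain h' where hc: "continuous_on (I \<times> UNIV) h'"
    and hd: "\<And>z. z \<in> I \<times> UNIV \<Longrightarrow> (\<Phi> has_derivative blinfun_apply (h' z)) (at z within I \<times> UNIV)"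
    using assms unfolding C1_on_def \<Phi>eq by auto
  define gx where "gx t x v = (\<Sum>b\<in>Basis. h' (t, x, v) (0, b, 0) *\<^sub>R b)" for t x v
  define gv where "gv t x v = (\<Sum>b\<in>Basis. h' (t, x, v) (0, 0, b) *\<^sub>R b)" for t x v
  have pd: "((\<lambda>p. F t (fst p) (snd p)) has_derivative (\<lambda>h. gx t x v \<bullet> fst h + gv t x v \<bullet> snd h)) (at (x, v))" if t: "t \<in> I" for t x v
  proof -
    let ?e = "\<lambda>p::'a \<times> 'a. (t, p)"
    have e: "(?e has_derivative (\<lambda>h. (0, h))) (at (x, v) within UNIV)" by (auto intro!: derivative_eq_intros)
    have "(\<Phi> has_derivative blinfun_apply (h' (t, x, v))) (at (?e (x, v)) within range ?e)"
      by (rule has_derivative_subset[OF hd]) (use t in auto)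
    from has_derivative_in_compose[OF e this]
    have D: "((\<lambda>p. F t (fst p) (snd p)) has_derivative (\<lambda>h. h' (t, x, v) (0, h))) (at (x, v))" by (simp add: \<Phi>_def)
    show ?thesis
    proof (rule has_derivative_eq_rhs[OF D], rule ext)
      fix h :: "'a \<times> 'a"
      have lin: "linear (blinfun_apply (h' (t, x, v)))" by (rule bounded_linear.linear[OF blinfun.bounded_linear_right])
      have lx: "linear (\<lambda>k. h' (t, x, v) (0, k, 0))" and lv: "linear (\<lambda>k. h' (t, x, v) (0, 0, k))"
        using linear_compose[of "\<lambda>k::'a. (0::real, k, 0::'a)", OF _ lin] linear_compose[of "\<lambda>k::'a. (0::real, 0::'a, k)", OF _ lin]
        by (auto simp: o_def linear_iff)
      have "h' (t, x, v) (0, h) = h' (t, x, v) ((0, fst h, 0) + (0, 0, snd h))" by simp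
      also have "\<dots> = h' (t, x, v) (0, fst h, 0) + h' (t, x, v) (0, 0, snd h)" by (rule blinfun.add_right)
      finally show "h' (t, x, v) (0, h) = gx t x v \<bullet> fst h + gv t x v \<bullet> snd h"
        unfolding gx_def gv_def riesz_representation_euclidean[OF lx, of "fst h", symmetric]
          riesz_representation_euclidean[OF lv, of "snd h", symmetric] .
    qed
  qed
  have gradx: "grad (\<lambda>y. F t y v) x = gx t x v" if t: "t \<in> I" for t x v
  proof (rule grad_eq)
    have "((\<lambda>x. (x, v)) has_derivative (\<lambda>h. (h, 0))) (at x)" by (auto intro!: derivative_eq_intros)
    from has_derivative_compose[OF this pd[OF t]] show "GDERIV (\<lambda>y. F t y v) x :> gx t x v"
      by (simp add: gderiv_def inner_commute)
  qed
  have gradv: "grad (\<lambda>w. F t x w) v = gv t x v" if t: "t \<in> I" for t x v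
  proof (rule grad_eq)
    have "((\<lambda>v. (x, v)) has_derivative (\<lambda>h. (0, h))) (at v)" by (auto intro!: derivative_eq_intros)
    from has_derivative_compose[OF this pd[OF t]] show "GDERIV (\<lambda>w. F t x w) v :> gv t x v"
      by (simp add: gderiv_def inner_commute)
  qed
  show "jcont F"
  proof -
    have "continuous_on (I \<times> UNIV) \<Phi>" unfolding continuous_on_eq_continuous_within
      by (intro ballI has_derivative_continuous[OF hd])
    then show ?thesis by (simp add: jcont_def \<Phi>_def)
  qed
  show "jcont (\<lambda>t x v. grad (\<lambda>y. F t y v) x)"
    unfolding jcont_def
  proof (rule continuous_on_eq)
    show "continuous_on (I \<times> UNIV) (\<lambda>p. gx (fst p) (fst (snd p)) (snd (snd p)))"
      unfolding gx_def prod.collapse by (intro continuous_intros hc)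
  qed (use gradx in auto)
  show "jcont (\<lambda>t x v. grad (\<lambda>w. F t x w) v)"
    unfolding jcont_def
  proof (rule continuous_on_eq)
    show "continuous_on (I \<times> UNIV) (\<lambda>p. gv (fst p) (fst (snd p)) (snd (snd p)))"
      unfolding gv_def prod.collapse by (intro continuous_intros hc)
  qed (use gradv in auto)
  show "t \<in> I \<Longrightarrow> ((\<lambda>p. F t (fst p) (snd p)) has_derivative
      (\<lambda>h. grad (\<lambda>y. F t y v) x \<bullet> fst h + grad (\<lambda>w. F t x w) v \<bullet> snd h)) (at (x, v))"
    using pd gradx gradv by simp
qed

text \<open>Viewed as independent of the velocity, the potential falls under \<open>C1_on_partial_gradients\<close>
  as well.\<close>

lemma C1_on_add_variable:
  fixes V :: "real \<Rightarrow> 'a::euclidean_space \<Rightarrow> real"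
  assumes "C1_on (\<lambda>(t, x). V t x) (S \<times> UNIV)"
  shows "C1_on (\<lambda>(t, x, v :: 'a). V t x) (S \<times> UNIV \<times> UNIV)"
proof -
  obtain h' where hc: "continuous_on (S \<times> UNIV) h'"
    and hd: "\<And>z. z \<in> S \<times> UNIV \<Longrightarrow> ((\<lambda>(t, x). V t x) has_derivative blinfun_apply (h' z)) (at z within S \<times> UNIV)"
    using assms unfolding C1_on_def by blast
  define \<pi> where "\<pi> = (\<lambda>p::real \<times> 'a \<times> 'a. (fst p, fst (snd p)))"
  have bl: "bounded_linear \<pi>" unfolding \<pi>_def
    by (intro bounded_linear_Pair bounded_linear_fst bounded_linear_fst_comp bounded_linear_snd)
  have \<pi>S: "\<pi> ` (S \<times> UNIV \<times> UNIV) \<subseteq> S \<times> UNIV" by (auto simp: \<pi>_def)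
  show ?thesis unfolding C1_on_def
  proof (intro exI[of _ "\<lambda>z. h' (\<pi> z) o\<^sub>L Blinfun \<pi>"] conjI ballI)
    show "continuous_on (S \<times> UNIV \<times> UNIV) (\<lambda>z. h' (\<pi> z) o\<^sub>L Blinfun \<pi>)"
      by (intro continuous_intros continuous_on_compose2[OF hc _ \<pi>S] linear_continuous_on[OF bl])
    fix z :: "real \<times> 'a \<times> 'a" assume z: "z \<in> S \<times> UNIV \<times> UNIV"
    have d\<pi>: "(\<pi> has_derivative \<pi>) (at z within S \<times> UNIV \<times> UNIV)" by (rule bounded_linear_imp_has_derivative[OF bl])
    have "((\<lambda>(t, x). V t x) has_derivative blinfun_apply (h' (\<pi> z))) (at (\<pi> z) within \<pi> ` (S \<times> UNIV \<times> UNIV))"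
      by (rule has_derivative_subset[OF hd \<pi>S]) (use z in \<open>auto simp: \<pi>_def\<close>)
    note comp = has_derivative_in_compose[OF d\<pi> this]
    have V\<pi>: "(\<lambda>(t, x, v). V t x) = (\<lambda>p. case \<pi> p of (t, x) \<Rightarrow> V t x)" by (auto simp: \<pi>_def)
    have h\<pi>: "blinfun_apply (h' (\<pi> z) o\<^sub>L Blinfun \<pi>) = (\<lambda>x. blinfun_apply (h' (\<pi> z)) (\<pi> x))"
      by (simp add: fun_eq_iff bounded_linear_Blinfun_apply[OF bl])
    show "((\<lambda>(t, x, v). V t x) has_derivative blinfun_apply (h' (\<pi> z) o\<^sub>L Blinfun \<pi>)) (at z within S \<times> UNIV \<times> UNIV)"
      unfolding V\<pi> h\<pi> by (rule comp)
  qed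
qed

theorem theorem3p1:
  fixes T :: real
    and G :: "real ^ 'n \<Rightarrow> real"
    and F :: "real \<Rightarrow> real ^ 'n \<Rightarrow> real ^ 'n \<Rightarrow> real"
    and V K W :: "real \<Rightarrow> real ^ 'n \<Rightarrow> real"
    and f :: "real \<Rightarrow> real ^ 'n"
    and a \<beta> g :: "real \<Rightarrow> real"
    and \<theta>\<^sub>F \<Lambda> M \<epsilon>\<^sub>V \<theta>\<^sub>V p\<^sub>K \<rho> b :: real
  defines "I \<equiv> {-T..T}"
  assumes T: "T > 0" "2 * T \<ge> 1"
    and G: "G_function G" "C1_on G UNIV" "Delta2_at_infinity G" "Nabla2_at_infinity G"
    and F: "C1_on (\<lambda>(t, x, v). F t x v) (I \<times> UNIV \<times> UNIV)"
    and V: "C1_on (\<lambda>(t, x). V t x) (I \<times> UNIV)"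
    and f: "f \<in> orlicz (fenchel_conjugate G) I"
    and F1: "\<And>t x. t \<in> I \<Longrightarrow> convex_on UNIV (\<lambda>v. F t x v)"
    and F2_a: "continuous_on {0..} a" "\<And>s. s \<ge> 0 \<Longrightarrow> a s \<ge> 0"
    and F2_\<beta>: "integrable (lebesgue_on I) \<beta>" "\<And>t. t \<in> I \<Longrightarrow> \<beta> t \<ge> 0"
    and F2_F: "\<And>t x v. t \<in> I \<Longrightarrow> \<bar>F t x v\<bar> \<le> a (norm x) * (\<beta> t + G v)"
    and F2_Fx: "\<And>t x v. t \<in> I \<Longrightarrow>
        norm (grad (\<lambda>y. F t y v) x) \<le> a (norm x) * (\<beta> t + G v)"
    and F2_Fv: "\<And>t x v. t \<in> I \<Longrightarrow>
        fenchel_conjugate G (grad (\<lambda>w. F t x w) v)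
          \<le> a (norm x) * (\<beta> t + fenchel_conjugate G (grad G v))"
    and F3: "\<theta>\<^sub>F > 0"
        "\<And>t x v. t \<in> I \<Longrightarrow>
          grad (\<lambda>y. F t y v) x \<bullet> x + grad (\<lambda>w. F t x w) v \<bullet> v \<le> \<theta>\<^sub>F * F t x v"
    and F4: "\<Lambda> > 0" "\<And>t x v. t \<in> I \<Longrightarrow> F t x v \<ge> \<Lambda> * G v"
    and F5: "\<And>t x. t \<in> I \<Longrightarrow> F t x 0 = 0"
        "\<And>t x. t \<in> I \<Longrightarrow> grad (\<lambda>w. F t x w) 0 = 0"
    and V1: "\<And>t x. t \<in> I \<Longrightarrow> V t x = K t x - W t x"
    and V2: "M > 0" "\<epsilon>\<^sub>V > 0" "\<theta>\<^sub>V > \<theta>\<^sub>F" "1 < p\<^sub>K" "p\<^sub>K \<le> \<theta>\<^sub>V - \<epsilon>\<^sub>V"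
        "\<And>t x. t \<in> I \<Longrightarrow> norm x > M \<Longrightarrow>
          grad (\<lambda>y. V t y) x \<bullet> x \<le> (\<theta>\<^sub>V - \<epsilon>\<^sub>V) * K t x - \<theta>\<^sub>V * W t x"
        "\<And>t x. t \<in> I \<Longrightarrow> norm x > M \<Longrightarrow> W t x > K t x \<and> K t x > norm x powr p\<^sub>K"
    and V3: "\<rho> > 0" "b > 1" "integrable (lebesgue_on I) g"
        "\<And>t x. t \<in> I \<Longrightarrow> G ((1 / (2 * (2 * T))) *\<^sub>R x) \<le> \<rho> / 2 \<Longrightarrow> V t x \<ge> b * G x - g t"
    and V4: "(LINT t|lebesgue_on I. V t 0) = 0"
    and f_small: "(LINT t|lebesgue_on I. fenchel_conjugate G (f t) + g t) < min \<Lambda> (b - 1) * \<rho>"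
  shows "\<exists>u. periodic_solution G T (\<lambda>t x v. F t x v + V t x + f t \<bullet> x) u \<and> (\<exists>t\<in>I. u t \<noteq> 0)"
proof -
  interpret time_interval T by unfold_locales (rule T(1))
  have MI: "I = {-T..T}" by (simp add: I_def)
  note F' = C1_on_partial_gradients[OF F[unfolded MI]]
  note V' = C1_on_partial_gradients[OF C1_on_add_variable[OF V[unfolded MI]]]
  interpret mountain_pass_setting T G F "\<lambda>t x v. grad (\<lambda>y. F t y v) x" "\<lambda>t x v. grad (\<lambda>w. F t x w) v" a \<beta> \<Lambda>
    V "\<lambda>t x. grad (\<lambda>y. V t y) x" f g \<theta>\<^sub>F \<theta>\<^sub>V \<epsilon>\<^sub>V p\<^sub>K M \<rho> b
  proof unfold_locales
    show "G_function G" "Delta2_at_infinity G" by (rule G)+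
    show "jcont F" "jcont (\<lambda>t x v. grad (\<lambda>y. F t y v) x)" "jcont (\<lambda>t x v. grad (\<lambda>w. F t x w) v)" by (rule F')+
    show "((\<lambda>p. F t (fst p) (snd p)) has_derivative (\<lambda>h. grad (\<lambda>y. F t y v) x \<bullet> fst h + grad (\<lambda>w. F t x w) v \<bullet> snd h)) (at (x, v))"
      if "t \<in> {-T..T}" for t x v by (rule F'(4)[OF that])
    show "convex_on UNIV (F t x)" if "t \<in> {-T..T}" for t x using F1 that by (simp add: MI)
    show "continuous_on {0..} a" "\<And>s. s \<ge> 0 \<Longrightarrow> a s \<ge> 0" by (rule F2_a)+
    show "integrable (lebesgue_on {-T..T}) \<beta>" using F2_\<beta>(1) by (simp add: MI)
    show "0 \<le> \<beta> t" if "t \<in> {-T..T}" for t using F2_\<beta>(2) that by (simp add: MI)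
    show "\<bar>F t x v\<bar> \<le> a (norm x) * (\<beta> t + G v)" if "t \<in> {-T..T}" for t x v using F2_F that by (simp add: MI)
    show "norm (grad (\<lambda>y. F t y v) x) \<le> a (norm x) * (\<beta> t + G v)" if "t \<in> {-T..T}" for t x v using F2_Fx that by (simp add: MI)
    show "\<Lambda> > 0" by (rule F4)
    show "\<Lambda> * G v \<le> F t x v" if "t \<in> {-T..T}" for t x v using F4(2) that by (simp add: MI)
    show "jcont (\<lambda>t x (v::real^'n). V t x)" "jcont (\<lambda>t x (v::real^'n). grad (V t) x)" by (rule V'(1), rule V'(2))
    show "(V t has_derivative (\<lambda>h. grad (V t) x \<bullet> h)) (at x)" if t: "t \<in> {-T..T}" for t x
    proof -
      have "((\<lambda>x. (x, 0::real^'n)) has_derivative (\<lambda>h. (h, 0))) (at x)" by (auto intro!: derivative_eq_intros)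
      from has_derivative_compose[OF this V'(4)[OF t]] show ?thesis by simp
    qed
    show "f \<in> borel_measurable (lebesgue_on {-T..T})" "integrable (lebesgue_on {-T..T}) (\<lambda>t. fenchel_conjugate G (f t))"
      using f by (auto simp: orlicz_def MI)
    show "1 \<le> 2 * T" by (rule T(2))
    show "\<exists>D. (G has_derivative D) (at x)" for x using G(2) unfolding C1_on_def by blast
    show "F t x 0 = 0" if "t \<in> {-T..T}" for t x using F5(1) that by (simp add: MI)
    show "grad (\<lambda>y. F t y v) x \<bullet> x + grad (F t x) v \<bullet> v \<le> \<theta>\<^sub>F * F t x v" if "t \<in> {-T..T}" for t x v using F3(2) that by (simp add: MI)
    show "\<theta>\<^sub>F < \<theta>\<^sub>V" "\<epsilon>\<^sub>V > 0" "1 < p\<^sub>K" "p\<^sub>K \<le> \<theta>\<^sub>V - \<epsilon>\<^sub>V" "M > 0" by (rule V2)+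
    show "grad (V t) x \<bullet> x \<le> \<theta>\<^sub>V * V t x - \<epsilon>\<^sub>V * norm x powr p\<^sub>K" if "t \<in> {-T..T}" "norm x > M" for t x
    proof -
      have tI: "t \<in> I" using that(1) by (simp add: MI)
      \<comment> \<open>of the term \<open>\<theta>\<^sub>V * (K - W)\<close> the part \<open>\<epsilon>\<^sub>V * K\<close> is left over and dominates the power\<close>
      have "\<epsilon>\<^sub>V * norm x powr p\<^sub>K \<le> \<epsilon>\<^sub>V * K t x" using V2(7)[OF tI that(2)] V2(2) by (intro mult_left_mono) auto
      moreover have "(\<theta>\<^sub>V - \<epsilon>\<^sub>V) * K t x - \<theta>\<^sub>V * W t x = \<theta>\<^sub>V * V t x - \<epsilon>\<^sub>V * K t x"
        unfolding V1[OF tI] by (simp add: algebra_simps)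
      ultimately show ?thesis using V2(6)[OF tI that(2)] by linarith
    qed
    show "V t x < 0" if "t \<in> {-T..T}" "norm x > M" for t x
    proof -
      have tI: "t \<in> I" using that(1) by (simp add: MI)
      show ?thesis using V2(7)[OF tI that(2)] V1[OF tI, of x] by simp
    qed
    show "\<rho> > 0" "b > 1" by (rule V3)+
    show "integrable (lebesgue_on {-T..T}) g" using V3(3) by (simp add: MI)
    show "b * G x - g t \<le> V t x" if "t \<in> {-T..T}" "G ((1 / (2 * (2 * T))) *\<^sub>R x) \<le> \<rho> / 2" for t x
      using V3(4)[of t x] that by (simp add: MI)
    show "(LINT t|lebesgue_on {-T..T}. V t 0) = 0" using V4 by (simp add: MI)
    show "(LINT t|lebesgue_on {-T..T}. fenchel_conjugate G (f t) + g t) < min \<Lambda> (b - 1) * \<rho>" using f_small by (simp add: MI)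
  qed
  show ?thesis using nontrivial_periodic_solution unfolding MI .
qed

end
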